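(* Let $(\psi_j)_{j\ge1}$ be a family of functions in $L^\infty(D)$ with finitely overlapping supports, i.e. there exists an integer $M$ such that $\#\{j\ge1: \psi_j(x)\ne0\}\le M$ for every $x\in D$. Let $0<p<2$. If $(\|\psi_j\|_{L^\infty(D)})_{j\ge1}$ belongs to $\ell^q(\mathbb{N})$ for $q=q(p):=\frac{2p}{2-p}$, then $(\|u_\nu\|_V)_{\nu\in\mathcal{F}}$ belongs to $\ell^p(\mathcal{F})$. In particular, best $n$-term Hermite approximations converge in $L^2(U,V,\gamma)$ with rate $n^{-s}$, where $s=\frac1p-\frac12=\frac1q$: there is a constant $C$ such that $\|u-u_{\Lambda_n}\|_{L^2(U,V,\gamma)}\le Cn^{-s}$ for all $n\ge1$, where $u_{\Lambda_n}:=\sum_{\nu\in\Lambda_n}u_\nu H_\nu$ and $\Lambda_n$ is a set of indices corresponding to the $n$ largest values of $\|u_\nu\|_V$.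
   Context: $D\subset\mathbb{R}^d$ is a bounded Lipschitz domain, $V:=H^1_0(D)$ with norm $\|v\|_V:=\|\nabla v\|_{L^2(D)}$, and $f\in H^{-1}(D)$ is fixed. $U:=\mathbb{R}^{\mathbb{N}}$, $\mathbb{N}=\{1,2,\dots\}$, is equipped with the $\sigma$-algebra generated by the Borel cylinders and with $\gamma$, the countable product of standard Gaussian measures $\mathcal{N}(0,1)$ on $\mathbb{R}$. For $y=(y_j)_{j\ge1}\in U$ set $b(y):=\sum_{j\ge1}y_j\psi_j$ whenever this series converges in $L^\infty(D)$, set $a(y):=\exp(b(y))$, and let $u(y)\in V$ be the unique weak solution of $-\mathrm{div}(a(y)\nabla u(y))=f$ in $D$ with homogeneous Dirichlet boundary conditions, i.e. $\int_D a(y)\nabla u(y)\cdot\nabla v\,dx=\langle f,v\rangle$ for all $v\in V$. The map $y\mapsto u(y)$ need only be defined for $\gamma$-almost every $y$. $\mathcal{F}$ is the countable set of finitely supported sequences $\nu=(\nu_j)_{j\ge1}$ of nonnegative integers. $H_k$ are the univariate Hermite polynomials normalized in $L^2(\mathbb{R},g\,dt)$, where $g(t)=(2\pi)^{-1/2}e^{-t^2/2}$, i.e. $H_k=\frac{(-1)^k}{\sqrt{k!}}\frac{g^{(k)}}{g}$; $H_\nu(y):=\prod_{j\ge1}H_{\nu_j}(y_j)$; and $u_\nu:=\int_U u(y)H_\nu(y)\,d\gamma(y)\in V$. *)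

theory Defs
  imports "HOL-Probability.Probability"
begin

section \<open>The Hilbert space of square integrable functions\<close>

definition square_integrable :: "('a::euclidean_space \<Rightarrow> 'b::euclidean_space) \<Rightarrow> bool" where
  "square_integrable f \<longleftrightarrow>
     f \<in> borel_measurable lborel \<and> integrable lborel (\<lambda>x. (norm (f x))\<^sup>2)"

definition L2_eq :: "('a::euclidean_space \<Rightarrow> 'b::euclidean_space) \<Rightarrow> ('a \<Rightarrow> 'b) \<Rightarrow> bool" where
  "L2_eq f g \<longleftrightarrow> square_integrable f \<and> square_integrable g \<and> (AE x in lborel. f x = g x)"

lemma square_integrable_measurable [measurable_dest]:
  "square_integrable f \<Longrightarrow> f \<in> borel_measurable lborel"
  by (simp add: square_integrable_def)

lemma square_integrable_zero [simp]: "square_integrable (\<lambda>x. 0)"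
  by (simp add: square_integrable_def)

lemma norm_add_sq_le: "(norm (x + y))\<^sup>2 \<le> 2 * (norm x)\<^sup>2 + 2 * (norm (y::'b::real_normed_vector))\<^sup>2"
proof -
  have "(norm (x + y))\<^sup>2 \<le> (norm x + norm y)\<^sup>2"
    by (intro power_mono norm_triangle_ineq) simp
  also have "\<dots> \<le> 2 * (norm x)\<^sup>2 + 2 * (norm y)\<^sup>2"
    using sum_squares_bound[of "norm x" "norm y"] by (simp add: power2_sum)
  finally show ?thesis .
qed

lemma square_integrable_bound:
  assumes [measurable]: "f \<in> borel_measurable lborel"
    and "integrable lborel h" and "AE x in lborel. (norm (f x))\<^sup>2 \<le> h x"
  shows "square_integrable f"
  unfolding square_integrable_def
proof
  have "AE x in lborel. norm ((norm (f x))\<^sup>2) \<le> norm (h x)"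
    using assms(3) by eventually_elim simp
  then show "integrable lborel (\<lambda>x. (norm (f x))\<^sup>2)"
    by (intro Bochner_Integration.integrable_bound[OF assms(2)]) measurable
qed (fact assms(1))

lemma square_integrable_add:
  assumes "square_integrable f" "square_integrable g"
  shows "square_integrable (\<lambda>x. f x + g x)"
proof (rule square_integrable_bound)
  note [measurable] = assms[THEN square_integrable_measurable]
  show "(\<lambda>x. f x + g x) \<in> borel_measurable lborel" by measurable
  show "integrable lborel (\<lambda>x. 2 * (norm (f x))\<^sup>2 + 2 * (norm (g x))\<^sup>2)"
    using assms by (auto simp: square_integrable_def)
qed (simp add: norm_add_sq_le)

lemma square_integrable_scaleR:
  "square_integrable f \<Longrightarrow> square_integrable (\<lambda>x. c *\<^sub>R f x)"
  by (auto simp: square_integrable_def power_mult_distrib)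

lemma square_integrable_uminus:
  "square_integrable f \<Longrightarrow> square_integrable (\<lambda>x. - f x)"
  by (auto simp: square_integrable_def)

lemma square_integrable_diff:
  "square_integrable f \<Longrightarrow> square_integrable g \<Longrightarrow> square_integrable (\<lambda>x. f x - g x)"
  using square_integrable_add[OF _ square_integrable_uminus, of f g] by simp

lemma square_integrable_inner:
  assumes "square_integrable f" "square_integrable g"
  shows "integrable lborel (\<lambda>x. f x \<bullet> g x)"
proof (rule Bochner_Integration.integrable_bound)
  note [measurable] = assms[THEN square_integrable_measurable]
  show "integrable lborel (\<lambda>x. (norm (f x))\<^sup>2 + (norm (g x))\<^sup>2)"
    using assms by (auto simp: square_integrable_def)
  show "(\<lambda>x. f x \<bullet> g x) \<in> borel_measurable lborel" by measurable
  have "\<bar>f x \<bullet> g x\<bar> \<le> (norm (f x))\<^sup>2 + (norm (g x))\<^sup>2" for x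
    using Cauchy_Schwarz_ineq2[of "f x" "g x"] sum_squares_bound[of "norm (f x)" "norm (g x)"]
      mult_nonneg_nonneg[of "norm (f x)" "norm (g x)"] by simp
  then show "AE x in lborel. norm (f x \<bullet> g x) \<le> norm ((norm (f x))\<^sup>2 + (norm (g x))\<^sup>2)"
    by simp
qed

quotient_type (overloaded) ('a, 'b) L2 = "'a::euclidean_space \<Rightarrow> 'b::euclidean_space" / partial: L2_eq
  morphisms rep_L2 mk_L2
proof (rule part_equivpI)
  show "\<exists>f. L2_eq f (f :: 'a \<Rightarrow> 'b)"
    by (rule exI[of _ "\<lambda>x. 0"]) (simp add: L2_eq_def)
  show "symp (L2_eq :: ('a \<Rightarrow> 'b) \<Rightarrow> _)"
    by (auto simp: symp_def L2_eq_def)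
  show "transp (L2_eq :: ('a \<Rightarrow> 'b) \<Rightarrow> _)"
    unfolding transp_def L2_eq_def by force
qed

text \<open>
  \<^const>\<open>mk_L2\<close> maps a square integrable function to its class, \<^const>\<open>rep_L2\<close> picks a
  representative.
\<close>

lemma L2_eq_refl: "L2_eq f f \<longleftrightarrow> square_integrable f"
  by (simp add: L2_eq_def)

lemma L2_eq_rep: "L2_eq (rep_L2 u) (rep_L2 u)"
  using Quotient_L2 by (rule Quotient_rep_reflp)

lemma square_integrable_rep [simp, intro]: "square_integrable (rep_L2 u)"
  using L2_eq_rep L2_eq_refl by blast

lemma measurable_rep_L2 [measurable]: "rep_L2 u \<in> borel_measurable lborel"
  by (rule square_integrable_measurable) simp

lemma mk_rep_L2 [simp]: "mk_L2 (rep_L2 u) = u"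
  using Quotient_L2 by (rule Quotient_abs_rep)

lemma mk_L2_eq_iff:
  "square_integrable f \<Longrightarrow> square_integrable g \<Longrightarrow>
    mk_L2 f = mk_L2 g \<longleftrightarrow> (AE x in lborel. f x = g x)"
  using Quotient_rel[OF Quotient_L2, of f g] by (auto simp: L2_eq_def)

lemma rep_mk_L2: "square_integrable f \<Longrightarrow> AE x in lborel. rep_L2 (mk_L2 f) x = f x"
  using mk_L2_eq_iff[of "rep_L2 (mk_L2 f)" f] by simp

lemma L2_cases: obtains f where "square_integrable f" "u = mk_L2 f"
  using mk_rep_L2 square_integrable_rep by metis

instantiation L2 :: (euclidean_space, euclidean_space) real_vector
begin

lift_definition zero_L2 :: "('a, 'b) L2" is "\<lambda>x. 0"
  by (simp add: L2_eq_def)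

lift_definition plus_L2 :: "('a, 'b) L2 \<Rightarrow> ('a, 'b) L2 \<Rightarrow> ('a, 'b) L2" is "\<lambda>f g x. f x + g x"
  by (auto simp: L2_eq_def square_integrable_add)

lift_definition minus_L2 :: "('a, 'b) L2 \<Rightarrow> ('a, 'b) L2 \<Rightarrow> ('a, 'b) L2" is "\<lambda>f g x. f x - g x"
  by (auto simp: L2_eq_def square_integrable_diff)

lift_definition uminus_L2 :: "('a, 'b) L2 \<Rightarrow> ('a, 'b) L2" is "\<lambda>f x. - f x"
  by (auto simp: L2_eq_def square_integrable_uminus)

lift_definition scaleR_L2 :: "real \<Rightarrow> ('a, 'b) L2 \<Rightarrow> ('a, 'b) L2" is "\<lambda>c f x. c *\<^sub>R f x"
  by (auto simp: L2_eq_def square_integrable_scaleR)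

instance
proof
  fix u v w :: "('a, 'b) L2" and r s :: real
  show "u + v + w = u + (v + w)" by transfer (auto simp: L2_eq_def square_integrable_add add.assoc)
  show "u + v = v + u" by transfer (auto simp: L2_eq_def square_integrable_add add.commute)
  show "0 + u = u" by transfer (simp add: L2_eq_def)
  show "- u + u = 0" by transfer (simp add: L2_eq_def)
  show "u - v = u + - v"
    by transfer (auto simp: L2_eq_def square_integrable_diff)
  show "r *\<^sub>R (u + v) = r *\<^sub>R u + r *\<^sub>R v"
    by transfer (auto simp: L2_eq_def square_integrable_add square_integrable_scaleR scaleR_add_right)
  show "(r + s) *\<^sub>R u = r *\<^sub>R u + s *\<^sub>R u"
    by transfer (auto simp: L2_eq_def square_integrable_add square_integrable_scaleR scaleR_add_left)
  show "r *\<^sub>R s *\<^sub>R u = (r * s) *\<^sub>R u"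
    by transfer (auto simp: L2_eq_def square_integrable_scaleR)
  show "1 *\<^sub>R u = u" by transfer (simp add: L2_eq_def)
qed

end

instantiation L2 :: (euclidean_space, euclidean_space) real_inner
begin

lift_definition inner_L2 :: "('a, 'b) L2 \<Rightarrow> ('a, 'b) L2 \<Rightarrow> real" is
  "\<lambda>f g. \<integral>x. f x \<bullet> g x \<partial>lborel"
proof -
  fix f1 f2 g1 g2 :: "'a \<Rightarrow> 'b"
  assume *: "L2_eq f1 f2" "L2_eq g1 g2"
  then have [measurable]: "f1 \<in> borel_measurable lborel" "f2 \<in> borel_measurable lborel"
    "g1 \<in> borel_measurable lborel" "g2 \<in> borel_measurable lborel"
    by (auto simp: L2_eq_def square_integrable_def)
  show "(\<integral>x. f1 x \<bullet> g1 x \<partial>lborel) = (\<integral>x. f2 x \<bullet> g2 x \<partial>lborel)"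
    using * by (intro integral_cong_AE) (auto simp: L2_eq_def)
qed

definition norm_L2 :: "('a, 'b) L2 \<Rightarrow> real" where "norm_L2 u = sqrt (u \<bullet> u)"
definition sgn_L2 :: "('a, 'b) L2 \<Rightarrow> ('a, 'b) L2" where "sgn_L2 u = u /\<^sub>R norm u"
definition dist_L2 :: "('a, 'b) L2 \<Rightarrow> ('a, 'b) L2 \<Rightarrow> real" where "dist_L2 u v = norm (u - v)"
definition uniformity_L2 :: "(('a, 'b) L2 \<times> ('a, 'b) L2) filter" where
  "uniformity_L2 = (INF e\<in>{0 <..}. principal {(u, v). dist u v < e})"
definition open_L2 :: "('a, 'b) L2 set \<Rightarrow> bool" where
  "open_L2 S = (\<forall>u\<in>S. \<forall>\<^sub>F (u', v) in uniformity. u' = u \<longrightarrow> v \<in> S)"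

instance
proof
  fix u v w :: "('a, 'b) L2" and r s :: real
  show "dist u v = norm (u - v)" "sgn u = u /\<^sub>R norm u" "norm u = sqrt (u \<bullet> u)"
    by (simp_all add: dist_L2_def sgn_L2_def norm_L2_def)
  show "uniformity = (INF e\<in>{0 <..}. principal {(u, v :: ('a, 'b) L2). dist u v < e})"
    by (rule uniformity_L2_def)
  show "open S = (\<forall>u\<in>S. \<forall>\<^sub>F (u', v) in uniformity. u' = u \<longrightarrow> v \<in> S)" for S :: "('a, 'b) L2 set"
    by (rule open_L2_def)
  show "u \<bullet> v = v \<bullet> u" by transfer (simp add: inner_commute)
  show "(u + v) \<bullet> w = u \<bullet> w + v \<bullet> w"
    by transfer (simp add: L2_eq_def inner_add_left square_integrable_inner)
  show "(r *\<^sub>R u) \<bullet> v = r * (u \<bullet> v)" by transfer simp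
  show "0 \<le> u \<bullet> u" by transfer simp
  show "u \<bullet> u = 0 \<longleftrightarrow> u = 0"
  proof transfer
    fix f :: "'a \<Rightarrow> 'b" assume "L2_eq f f"
    then have "square_integrable f" by (simp add: L2_eq_def)
    then have "(\<integral>x. f x \<bullet> f x \<partial>lborel) = 0 \<longleftrightarrow> (AE x in lborel. f x \<bullet> f x = 0)"
      by (intro integral_nonneg_eq_0_iff_AE square_integrable_inner) auto
    then show "(\<integral>x. f x \<bullet> f x \<partial>lborel) = 0 \<longleftrightarrow> L2_eq f (\<lambda>x. 0)"
      using \<open>square_integrable f\<close> by (simp add: L2_eq_def)
  qed
qed

end

lemma norm_mk_L2_sq:
  assumes "square_integrable f"
  shows "(norm (mk_L2 f))\<^sup>2 = (\<integral>x. (norm (f x))\<^sup>2 \<partial>lborel)"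
proof -
  have "mk_L2 f \<bullet> mk_L2 f = (\<integral>x. f x \<bullet> f x \<partial>lborel)"
    using assms by (simp add: inner_L2.abs_eq L2_eq_refl)
  then show ?thesis by (simp flip: power2_norm_eq_inner)
qed

lemma mk_L2_add: "square_integrable f \<Longrightarrow> square_integrable g \<Longrightarrow> mk_L2 f + mk_L2 g = mk_L2 (\<lambda>x. f x + g x)"
  by (simp add: plus_L2.abs_eq L2_eq_refl)

lemma mk_L2_diff: "square_integrable f \<Longrightarrow> square_integrable g \<Longrightarrow> mk_L2 f - mk_L2 g = mk_L2 (\<lambda>x. f x - g x)"
  by (simp add: minus_L2.abs_eq L2_eq_refl)

lemma mk_L2_scaleR: "square_integrable f \<Longrightarrow> c *\<^sub>R mk_L2 f = mk_L2 (\<lambda>x. c *\<^sub>R f x)"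
  by (simp add: scaleR_L2.abs_eq L2_eq_refl)

lemma nn_integral_mk_L2_diff:
  assumes "square_integrable f" "square_integrable g"
  shows "(\<integral>\<^sup>+x. ennreal ((norm (f x - g x))\<^sup>2) \<partial>lborel) = ennreal ((dist (mk_L2 f) (mk_L2 g))\<^sup>2)"
proof -
  have "square_integrable (\<lambda>x. f x - g x)" using assms by (rule square_integrable_diff)
  then show ?thesis
    using assms unfolding dist_norm
    by (subst nn_integral_eq_integral) (simp_all add: mk_L2_diff norm_mk_L2_sq square_integrable_def)
qed

lemma mk_L2_zero: "mk_L2 (\<lambda>x. 0) = 0"
  by (simp add: zero_L2_def)

lemma tendsto_mk_L2_iff:
  fixes F :: "nat \<Rightarrow> 'a::euclidean_space \<Rightarrow> 'b::euclidean_space"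
  assumes "\<And>n. square_integrable (F n)" "square_integrable f"
  shows "(\<lambda>n. mk_L2 (F n)) \<longlonglongrightarrow> mk_L2 f \<longleftrightarrow> (\<lambda>n. \<integral>x. (norm (F n x - f x))\<^sup>2 \<partial>lborel) \<longlonglongrightarrow> 0"
proof -
  have 1: "(\<lambda>n. \<integral>x. (norm (F n x - f x))\<^sup>2 \<partial>lborel) = (\<lambda>n. (norm (mk_L2 (F n) - mk_L2 f))\<^sup>2)"
    using assms by (simp add: mk_L2_diff norm_mk_L2_sq square_integrable_diff)
  have 2: "(\<lambda>n. norm (a n)) \<longlonglongrightarrow> 0 \<longleftrightarrow> (\<lambda>n. (norm (a n))\<^sup>2) \<longlonglongrightarrow> 0" for a :: "nat \<Rightarrow> ('a, 'b) L2"
  proof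
    assume "(\<lambda>n. norm (a n)) \<longlonglongrightarrow> 0"
    from tendsto_power[OF this, of 2] show "(\<lambda>n. (norm (a n))\<^sup>2) \<longlonglongrightarrow> 0" by simp
  next
    assume "(\<lambda>n. (norm (a n))\<^sup>2) \<longlonglongrightarrow> 0"
    from tendsto_real_sqrt[OF this] show "(\<lambda>n. norm (a n)) \<longlonglongrightarrow> 0" by simp
  qed
  show ?thesis
    unfolding 1 2[symmetric] tendsto_norm_zero_iff by (rule LIM_zero_iff[symmetric])
qed

lemma L2_dominated_convergence:
  fixes F :: "nat \<Rightarrow> 'a::euclidean_space \<Rightarrow> 'b::euclidean_space"
  assumes [measurable]: "\<And>n. F n \<in> borel_measurable lborel" "f \<in> borel_measurable lborel"
    and h: "integrable lborel h"
    and lim: "AE x in lborel. (\<lambda>n. F n x) \<longlonglongrightarrow> f x"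
    and dom: "\<And>n. AE x in lborel. (norm (F n x))\<^sup>2 \<le> h x"
  shows "square_integrable f" "\<And>n. square_integrable (F n)"
    "(\<lambda>n. mk_L2 (F n)) \<longlonglongrightarrow> mk_L2 f"
proof -
  have dom': "AE x in lborel. \<forall>n. (norm (F n x))\<^sup>2 \<le> h x"
    using dom by (simp add: AE_all_countable)
  have fh: "AE x in lborel. (norm (f x))\<^sup>2 \<le> h x"
    using lim dom'
  proof eventually_elim
    case (elim x)
    have "(\<lambda>n. (norm (F n x))\<^sup>2) \<longlonglongrightarrow> (norm (f x))\<^sup>2"
      by (intro tendsto_intros elim)
    then show ?case by (rule LIMSEQ_le_const2) (use elim in auto)
  qed
  show f: "square_integrable f" by (rule square_integrable_bound[OF _ h fh]) simp
  show F: "square_integrable (F n)" for n by (rule square_integrable_bound[OF _ h dom]) simp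
  have "(\<lambda>n. \<integral>x. (norm (F n x - f x))\<^sup>2 \<partial>lborel) \<longlonglongrightarrow> integral\<^sup>L lborel (\<lambda>x::'a. 0::real)"
  proof (rule integral_dominated_convergence)
    show "integrable lborel (\<lambda>x. 4 * h x)" using h by simp
    show "AE x in lborel. (\<lambda>n. (norm (F n x - f x))\<^sup>2) \<longlonglongrightarrow> 0"
      using lim
    proof eventually_elim
      case (elim x)
      then have "(\<lambda>n. F n x - f x) \<longlonglongrightarrow> 0" by (rule LIM_zero)
      then show ?case using tendsto_power[OF tendsto_norm_zero, of "\<lambda>n. F n x - f x" sequentially 2] by simp
    qed
    show "AE x in lborel. norm ((norm (F n x - f x))\<^sup>2) \<le> 4 * h x" for n
      using dom[of n] fh
    proof eventually_elim
      case (elim x)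
      then show ?case using norm_add_sq_le[of "F n x" "- f x"] by simp
    qed
  qed measurable
  then have "(\<lambda>n. \<integral>x. (norm (F n x - f x))\<^sup>2 \<partial>lborel) \<longlonglongrightarrow> 0"
    by simp
  then show "(\<lambda>n. mk_L2 (F n)) \<longlonglongrightarrow> mk_L2 f"
    using tendsto_mk_L2_iff[of F f, OF F f] by blast
qed

subsection \<open>Completeness\<close>

instance L2 :: (euclidean_space, euclidean_space) complete_space
proof
  fix X :: "nat \<Rightarrow> ('a, 'b) L2"
  assume X: "Cauchy X"
  have "\<exists>N. \<forall>m\<ge>N. \<forall>n\<ge>N. dist (X m) (X n) < (1/2)^k" for k
    using X unfolding Cauchy_def by simp
  then obtain N where N: "\<And>k m n. m \<ge> N k \<Longrightarrow> n \<ge> N k \<Longrightarrow> dist (X m) (X n) < (1/2)^k"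
    by metis
  define r where "r k = (\<Sum>i\<le>k. N i) + k" for k
  have r_N: "r k \<ge> N i" if "i \<le> k" for i k
    using member_le_sum[of i "{..k}" N] that by (auto simp: r_def)
  have r: "strict_mono r" by (auto simp: strict_mono_Suc_iff r_def)
  define F where "F k = rep_L2 (X (r k))" for k
  have F_sq: "square_integrable (F k)" for k by (simp add: F_def)
  note [measurable] = F_sq[THEN square_integrable_measurable]
  have FX: "mk_L2 (F k) = X (r k)" for k by (simp add: F_def)
  have nn: "(\<integral>\<^sup>+x. ennreal ((norm (F k x - F m x))\<^sup>2) \<partial>lborel) = ennreal ((dist (X (r k)) (X (r m)))\<^sup>2)"
    for k m
    using F_sq[of k] F_sq[of m] by (simp add: nn_integral_mk_L2_diff FX)
  define h where "h k x = norm (F (Suc k) x - F k x)" for k x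
  have [measurable]: "h k \<in> borel_measurable lborel" for k unfolding h_def by measurable
  have "(\<integral>\<^sup>+x. (\<Sum>k. ennreal (2^k * (h k x)\<^sup>2)) \<partial>lborel) = (\<Sum>k. \<integral>\<^sup>+x. ennreal (2^k * (h k x)\<^sup>2) \<partial>lborel)"
    by (intro nn_integral_suminf) measurable
  also have "\<dots> \<le> (\<Sum>k. ennreal ((1/2)^k))"
  proof (intro suminf_le summableI)
    fix k
    have "(\<integral>\<^sup>+x. ennreal (2^k * (h k x)\<^sup>2) \<partial>lborel) = ennreal (2^k) * ennreal ((dist (X (r (Suc k))) (X (r k)))\<^sup>2)"
      by (simp add: h_def ennreal_mult nn_integral_cmult nn)
    also have "\<dots> \<le> ennreal (2^k) * ennreal (((1/2)^k)\<^sup>2)"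
    proof (intro mult_left_mono ennreal_leI power_mono)
      show "dist (X (r (Suc k))) (X (r k)) \<le> (1/2)^k"
        by (intro less_imp_le[OF N[OF r_N r_N]]) auto
    qed auto
    also have "\<dots> = ennreal ((1/2)^k)"
    proof -
      have "(2::real)^k * ((1/2)^k)\<^sup>2 = (1/2)^k"
        by (simp add: power2_eq_square power_one_over)
      then show ?thesis by (subst ennreal_mult[symmetric]) auto
    qed
    finally show "(\<integral>\<^sup>+x. ennreal (2^k * (h k x)\<^sup>2) \<partial>lborel) \<le> ennreal ((1/2)^k)" .
  qed
  also have "\<dots> < \<infinity>"
    by (subst suminf_ennreal2[OF _ summable_geometric]) auto
  finally have "AE x in lborel. (\<Sum>k. ennreal (2^k * (h k x)\<^sup>2)) \<noteq> \<infinity>"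
    by (intro nn_integral_PInf_AE) auto
  then have conv: "AE x in lborel. convergent (\<lambda>k. F k x)"
  proof eventually_elim
    case (elim x)
    have s: "summable (\<lambda>k. 2^k * (h k x)\<^sup>2)"
      using elim by (intro summable_suminf_not_top) auto
    have "summable (\<lambda>k. h k x)"
    proof (rule summable_comparison_test')
      show "summable (\<lambda>k. (1/2)^k + 2^k * (h k x)\<^sup>2)"
        by (intro summable_add s summable_geometric) simp
      fix k
      have "2 * (sqrt ((1/2)^k) * (sqrt (2^k) * h k x)) \<le> (sqrt ((1/2)^k))\<^sup>2 + (sqrt (2^k) * h k x)\<^sup>2"
        using sum_squares_bound[of "sqrt ((1/2)^k)" "sqrt (2^k) * h k x"] by (simp add: mult.assoc)
      moreover have "sqrt ((1/2)^k) * (sqrt (2^k) * h k x) = h k x"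
      proof -
        have "sqrt ((1/2)^k) * sqrt (2^k) = 1"
          unfolding real_sqrt_mult[symmetric] by (simp add: power_one_over)
        then show ?thesis by (simp flip: mult.assoc)
      qed
      moreover have "(sqrt ((1/2)^k))\<^sup>2 = (1/2)^k" "(sqrt (2^k) * h k x)\<^sup>2 = 2^k * (h k x)\<^sup>2"
        by (simp_all add: power_mult_distrib)
      moreover have "0 \<le> h k x" by (simp add: h_def)
      ultimately show "norm (h k x) \<le> (1/2)^k + 2^k * (h k x)\<^sup>2"
        by (simp only: real_norm_def)
    qed
    then have "summable (\<lambda>k. F (Suc k) x - F k x)"
      unfolding h_def by (rule summable_norm_cancel)
    then have "convergent (\<lambda>n. \<Sum>k<n. F (Suc k) x - F k x)"
      by (simp add: summable_iff_convergent)
    then have "convergent (\<lambda>n. F n x - F 0 x)"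
      by (simp add: sum_lessThan_telescope[of "\<lambda>k. F k x"])
    then show ?case
      using convergent_add[of "\<lambda>n. F n x - F 0 x" "\<lambda>n. F 0 x"] by (simp add: convergent_const)
  qed
  define f where "f x = lim (\<lambda>k. F k x)" for x
  have [measurable]: "f \<in> borel_measurable lborel"
    unfolding f_def by (rule borel_measurable_lim_metric) measurable
  have lim: "AE x in lborel. (\<lambda>k. F k x) \<longlonglongrightarrow> f x"
    using conv by eventually_elim (simp add: f_def convergent_LIMSEQ_iff)
  have le: "(\<integral>\<^sup>+x. ennreal ((norm (F k x - f x))\<^sup>2) \<partial>lborel) \<le> ennreal (((1/2)^k)\<^sup>2)" for k
  proof -
    have "(\<integral>\<^sup>+x. ennreal ((norm (F k x - f x))\<^sup>2) \<partial>lborel) =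
        (\<integral>\<^sup>+x. liminf (\<lambda>m. ennreal ((norm (F k x - F m x))\<^sup>2)) \<partial>lborel)"
    proof (rule nn_integral_cong_AE, use lim in eventually_elim)
      case (elim x)
      have "(\<lambda>m. ennreal ((norm (F k x - F m x))\<^sup>2)) \<longlonglongrightarrow> ennreal ((norm (F k x - f x))\<^sup>2)"
        by (intro tendsto_intros tendsto_ennrealI elim)
      then show ?case by (intro lim_imp_Liminf[symmetric]) auto
    qed
    also have "\<dots> \<le> liminf (\<lambda>m. \<integral>\<^sup>+x. ennreal ((norm (F k x - F m x))\<^sup>2) \<partial>lborel)"
      by (intro nn_integral_liminf) measurable
    also have "\<dots> = liminf (\<lambda>m. ennreal ((dist (X (r k)) (X (r m)))\<^sup>2))"
      by (simp add: nn)
    also have "\<dots> \<le> liminf (\<lambda>m. ennreal (((1/2)^k)\<^sup>2))"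
    proof (intro Liminf_mono eventually_sequentiallyI[of k] ennreal_leI power_mono)
      fix m assume "k \<le> m"
      then show "dist (X (r k)) (X (r m)) \<le> (1/2)^k"
        by (intro less_imp_le[OF N[OF r_N r_N]]) auto
    qed auto
    finally show ?thesis by (simp add: Liminf_const)
  qed
  have dsq: "square_integrable (\<lambda>x. F k x - f x)" for k
  proof -
    have "integrable lborel (\<lambda>x. (norm (F k x - f x))\<^sup>2)"
      using le[of k] by (intro integrableI_nonneg) (auto intro: le_less_trans)
    then show ?thesis by (simp add: square_integrable_def)
  qed
  have f_sq: "square_integrable f"
    using square_integrable_diff[OF F_sq[of 0] dsq[of 0]] by simp
  have "dist (X (r k)) (mk_L2 f) \<le> (1/2)^k" for k
  proof -
    have "ennreal ((dist (X (r k)) (mk_L2 f))\<^sup>2) = (\<integral>\<^sup>+x. ennreal ((norm (F k x - f x))\<^sup>2) \<partial>lborel)"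
      using F_sq[of k] f_sq by (simp add: nn_integral_mk_L2_diff FX)
    also note le[of k]
    finally have "(dist (X (r k)) (mk_L2 f))\<^sup>2 \<le> ((1/2)^k)\<^sup>2"
      by (subst (asm) ennreal_le_iff) simp_all
    then show ?thesis by (rule power2_le_imp_le) simp
  qed
  then have "\<forall>k. norm (dist (X (r k)) (mk_L2 f)) \<le> (1/2)^k" by simp
  moreover have "(\<lambda>k. (1/2::real)^k) \<longlonglongrightarrow> 0" by (intro LIMSEQ_power_zero) simp
  ultimately have "(\<lambda>k. dist (X (r k)) (mk_L2 f)) \<longlonglongrightarrow> 0"
    by (rule Lim_null_comparison[OF always_eventually])
  then have "(X \<circ> r) \<longlonglongrightarrow> mk_L2 f"
    unfolding o_def by (rule iffD2[OF tendsto_dist_iff])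
  then show "convergent X"
    using Cauchy_converges_subseq[OF X r] by (rule_tac convergentI)
qed

instance L2 :: (euclidean_space, euclidean_space) banach ..

subsection \<open>Separability\<close>

lemma second_countable_of_countable_dense:
  assumes "countable C" "closure C = (UNIV :: 'a::metric_space set)"
  shows "\<exists>B::'a set set. countable B \<and> open = generate_topology B"
proof (intro exI conjI topological_basis_imp_subbasis topological_basisI)
  let ?B = "(\<lambda>(c, n::nat). ball c (1 / Suc n)) ` (C \<times> UNIV)"
  show "countable ?B" using assms(1) by auto
  show "open U" if "U \<in> ?B" for U using that by auto
  fix U :: "'a set" and x assume "open U" "x \<in> U"
  then obtain e where e: "e > 0" "ball x e \<subseteq> U" using openE by blast
  obtain n :: nat where n: "1 / Suc n < e / 2"
    using e(1) nat_approx_posE[of "e/2"] by auto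
  have "x \<in> closure C" using assms(2) by simp
  then obtain c where c: "c \<in> C" "dist c x < 1 / Suc n"
    unfolding closure_approachable by (metis of_nat_0_less_iff zero_less_Suc zero_less_divide_1_iff)
  have "ball c (1 / Suc n) \<subseteq> ball x e"
  proof
    fix z assume "z \<in> ball c (1 / Suc n)"
    then have "dist c z < 1 / Suc n" by simp
    then have "dist x z < e"
      using dist_triangle[of x z c] c(2) n by (simp only: dist_commute[of x c])
    then show "z \<in> ball x e" by simp
  qed
  then show "\<exists>V\<in>?B. x \<in> V \<and> V \<subseteq> U"
    using c e(2) by (intro bexI[of _ "ball c (1 / Suc n)"]) auto
qed

lemma countable_closed_span:
  fixes G :: "'a::real_normed_vector set"
  assumes "countable G"
  obtains Q where "countable Q" "G \<subseteq> closure Q" "0 \<in> closure Q"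
    "\<And>a b. a \<in> closure Q \<Longrightarrow> b \<in> closure Q \<Longrightarrow> a + b \<in> closure Q"
    "\<And>c a. a \<in> closure Q \<Longrightarrow> c *\<^sub>R a \<in> closure Q"
proof
  define L where "L xs = sum_list (map (\<lambda>(q, g). real_of_rat q *\<^sub>R g) xs)" for xs :: "(rat \<times> 'a) list"
  define Q where "Q = L ` lists (UNIV \<times> G)"
  show "countable Q" using assms by (auto simp: Q_def)
  have 0: "0 \<in> Q" unfolding Q_def by (rule image_eqI[of _ _ "[]"]) (auto simp: L_def)
  then show "0 \<in> closure Q" using closure_subset by blast
  have "g \<in> Q" if "g \<in> G" for g
    unfolding Q_def by (rule image_eqI[of _ _ "[(1, g)]"]) (use that in \<open>auto simp: L_def\<close>)
  then show "G \<subseteq> closure Q" using closure_subset by blast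
  have add: "a + b \<in> Q" if ab: "a \<in> Q" "b \<in> Q" for a b
  proof -
    obtain xs ys where "a = L xs" "b = L ys" "xs \<in> lists (UNIV \<times> G)" "ys \<in> lists (UNIV \<times> G)"
      using ab unfolding Q_def by blast
    then show ?thesis unfolding Q_def by (intro image_eqI[of _ _ "xs @ ys"]) (auto simp: L_def)
  qed
  have scale: "real_of_rat q *\<^sub>R a \<in> Q" if a: "a \<in> Q" for q a
  proof -
    obtain xs where xs: "a = L xs" "xs \<in> lists (UNIV \<times> G)"
      using a unfolding Q_def by blast
    have "L (map (\<lambda>(r, g). (q * r, g)) xs) = real_of_rat q *\<^sub>R L xs"
      by (induction xs) (auto simp: L_def scaleR_add_right of_rat_mult)
    then show ?thesis
      using xs unfolding Q_def
      by (intro image_eqI[of _ _ "map (\<lambda>(r, g). (q * r, g)) xs"]) auto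
  qed
  show "a + b \<in> closure Q" if "a \<in> closure Q" "b \<in> closure Q" for a b
  proof -
    obtain f where "\<forall>n::nat. f n \<in> Q" "f \<longlonglongrightarrow> a"
      using \<open>a \<in> closure Q\<close> unfolding closure_sequential by blast
    moreover obtain g where "\<forall>n::nat. g n \<in> Q" "g \<longlonglongrightarrow> b"
      using \<open>b \<in> closure Q\<close> unfolding closure_sequential by blast
    ultimately have "\<forall>n. f n + g n \<in> Q" "(\<lambda>n. f n + g n) \<longlonglongrightarrow> a + b"
      by (simp_all add: add tendsto_add)
    then show ?thesis
      unfolding closure_sequential by (intro exI[of _ "\<lambda>n. f n + g n"] conjI)
  qed
  have real_scale: "c *\<^sub>R a \<in> closure Q" if "a \<in> Q" for c a
  proof -
    have "c \<in> closure \<rat>" by (simp add: Rats_closure_real)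
    then obtain q where q: "\<forall>n::nat. q n \<in> \<rat>" "q \<longlonglongrightarrow> c"
      unfolding closure_sequential by blast
    have "q n *\<^sub>R a \<in> Q" for n
    proof -
      have "q n \<in> \<rat>" using q(1) by blast
      then obtain p where "q n = real_of_rat p" by (rule Rats_cases)
      then show ?thesis using scale[OF that] by simp
    qed
    moreover have "(\<lambda>n. q n *\<^sub>R a) \<longlonglongrightarrow> c *\<^sub>R a" by (intro tendsto_intros q)
    ultimately show ?thesis
      unfolding closure_sequential by (intro exI[of _ "\<lambda>n. q n *\<^sub>R a"] conjI allI)
  qed
  show "c *\<^sub>R a \<in> closure Q" if "a \<in> closure Q" for c a
  proof -
    obtain f where f: "\<forall>n::nat. f n \<in> Q" "f \<longlonglongrightarrow> a"
      using \<open>a \<in> closure Q\<close> unfolding closure_sequential by blast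
    have "(\<lambda>n. c *\<^sub>R f n) \<longlonglongrightarrow> c *\<^sub>R a" using f by (intro tendsto_intros)
    then show ?thesis
      by (rule closed_sequentially[OF closed_closure, rotated]) (use real_scale f(1) in blast)
  qed
qed

lemma square_integrable_indicator_cball:
  assumes [measurable]: "S \<in> sets borel"
  shows "square_integrable (\<lambda>x::'a::euclidean_space. indicator (S \<inter> cball 0 r) x *\<^sub>R (c::'b::euclidean_space))"
proof (rule square_integrable_bound)
  have [measurable]: "cball (0::'a) r \<in> sets borel" by simp
  show "(\<lambda>x::'a. indicator (S \<inter> cball 0 r) x *\<^sub>R c) \<in> borel_measurable lborel" by measurable
  show "integrable lborel (\<lambda>x::'a. indicator (cball 0 r) x *\<^sub>R (norm c)\<^sup>2)"
  proof (rule integrable_scaleR_left)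
    show "integrable lborel (\<lambda>x::'a. indicator (cball 0 r) x :: real)"
      using emeasure_lborel_cball_finite[of "0::'a" r] by (intro integrable_real_indicator) auto
  qed
  show "AE x in lborel. (norm (indicator (S \<inter> cball 0 r) x *\<^sub>R c))\<^sup>2 \<le> indicator (cball (0::'a) r) x *\<^sub>R (norm c)\<^sup>2"
    by (intro AE_I2) (simp add: indicator_def)
qed

lemma mk_L2_sum:
  assumes "finite I" "\<And>i. i \<in> I \<Longrightarrow> square_integrable (f i)"
  shows "square_integrable (\<lambda>x. \<Sum>i\<in>I. f i x) \<and> mk_L2 (\<lambda>x. \<Sum>i\<in>I. f i x) = (\<Sum>i\<in>I. mk_L2 (f i))"
  using assms
  by (induction I rule: finite_induct) (auto simp: mk_L2_zero square_integrable_add simp flip: mk_L2_add)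

lemma L2_countable_dense:
  "\<exists>C :: ('a::euclidean_space, 'b::euclidean_space) L2 set. countable C \<and> closure C = UNIV"
proof -
  obtain A :: "'a set set" where A: "countable A" "topological_basis A"
    using ex_countable_basis by blast
  define P where "P = Inter ` {F. finite F \<and> F \<subseteq> A}"
  have "countable P"
    unfolding P_def by (intro countable_image countable_Collect_finite_subset A)
  have "A \<subseteq> P"
  proof
    fix S assume "S \<in> A"
    then show "S \<in> P" unfolding P_def by (intro image_eqI[of _ _ "{S}"]) auto
  qed
  have openP: "open S" if "S \<in> P" for S
    using that topological_basis_open[OF A(2)] by (auto simp: P_def)
  have "topological_basis P"
  proof (rule topological_basisI)
    fix U :: "'a set" and x assume "open U" "x \<in> U"
    then obtain S where "S \<in> A" "x \<in> S" "S \<subseteq> U"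
      using topological_basisE[OF A(2)] by metis
    then show "\<exists>S\<in>P. x \<in> S \<and> S \<subseteq> U" using \<open>A \<subseteq> P\<close> by blast
  qed (rule openP)
  then have "(borel :: 'a measure) = sigma UNIV P"
    using \<open>countable P\<close> by (intro borel_eq_countable_basis)
  then have "sets (borel :: 'a measure) = sets (sigma UNIV P)"
    by (rule arg_cong)
  then have sets_P: "sigma_sets UNIV P = sets borel"
    by (simp add: sets_measure_of)
  have stable: "Int_stable P"
  proof (rule Int_stableI)
    fix S T assume "S \<in> P" "T \<in> P"
    then obtain F F' where "S = \<Inter>F" "T = \<Inter>F'" "finite F" "finite F'" "F \<subseteq> A" "F' \<subseteq> A"
      unfolding P_def by blast
    then show "S \<inter> T \<in> P" unfolding P_def by (intro image_eqI[of _ _ "F \<union> F'"]) auto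
  qed
  have P_Pow: "P \<subseteq> Pow UNIV" by simp
  have UNIV_P: "UNIV \<in> P" unfolding P_def by (rule image_eqI[of _ _ "{}"]) auto

  define f where "f S n c = (\<lambda>x. indicator (S \<inter> cball 0 (real n)) x *\<^sub>R c)"
    for S :: "'a set" and n :: nat and c :: 'b
  define g where "g S n c = mk_L2 (f S n c)" for S n c
  have f_sq: "square_integrable (f S n c)" if "S \<in> sets borel" for S n c
    unfolding f_def using that by (rule square_integrable_indicator_cball)
  define G where "G = (\<lambda>(S, n, e). g S n e) ` (P \<times> UNIV \<times> Basis)"
  have "countable G"
    unfolding G_def using \<open>countable P\<close>
    by (intro countable_image countable_SIGMA) (auto intro: countable_finite)
  then obtain Q where Q: "countable Q" "G \<subseteq> closure Q" "0 \<in> closure Q"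
    and add: "\<And>a b. a \<in> closure Q \<Longrightarrow> b \<in> closure Q \<Longrightarrow> a + b \<in> closure Q"
    and scale: "\<And>c a. a \<in> closure Q \<Longrightarrow> c *\<^sub>R a \<in> closure Q"
    by (rule countable_closed_span) blast
  have diff: "a - b \<in> closure Q" if "a \<in> closure Q" "b \<in> closure Q" for a b
    using add[OF that(1) scale[OF that(2), of "-1"]] by simp
  have sum: "sum h I \<in> closure Q" if "finite I" "\<And>i. i \<in> I \<Longrightarrow> h i \<in> closure Q"
    for h :: "'b \<Rightarrow> ('a, 'b) L2" and I
    using that by (induction I rule: finite_induct) (auto intro: Q add)

  have step1: "g S n e \<in> closure Q" if S: "S \<in> sets borel" and e: "e \<in> Basis" for S n e
  proof -
    have "S \<in> sigma_sets UNIV P" using S by (simp add: sets_P)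
    with stable P_Pow show ?thesis
    proof (induct S rule: sigma_sets_induct_disjoint)
      case (basic S)
      then have "g S n e \<in> G" unfolding G_def using e by (intro image_eqI[of _ _ "(S, n, e)"]) auto
      then show ?case using Q by blast
    next
      case empty
      have "f {} n e = (\<lambda>x. 0)" by (auto simp: f_def)
      then show ?case using Q by (simp add: g_def mk_L2_zero)
    next
      case (compl S)
      have "g (UNIV - S) n e = g UNIV n e - g S n e"
      proof -
        have "f (UNIV - S) n e = (\<lambda>x. f UNIV n e x - f S n e x)"
          by (auto simp: f_def indicator_def)
        then show ?thesis
          using f_sq[of UNIV n e] f_sq[of S n e] compl by (simp add: g_def mk_L2_diff sets_P)
      qed
      moreover have "g UNIV n e \<in> G"
        unfolding G_def using e UNIV_P by (intro image_eqI[of _ _ "(UNIV, n, e)"]) auto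
      ultimately show ?case using Q compl diff by auto
    next
      case (union B)
      then have B [measurable]: "B i \<in> sets borel" for i using sets_P by auto
      have part: "g (\<Union>i<m. B i) n e \<in> closure Q" for m
      proof (induction m)
        case 0
        have "f {} n e = (\<lambda>x. 0)" by (auto simp: f_def)
        then show ?case using Q by (simp add: g_def mk_L2_zero)
      next
        case (Suc m)
        have disj: "B i \<inter> B m = {}" if "i < m" for i
          using union(1) that by (auto simp: disjoint_family_on_def)
        have plus: "f (S \<union> T) n e = (\<lambda>x. f S n e x + f T n e x)" if "S \<inter> T = {}" for S T
          using that by (auto simp: f_def indicator_def fun_eq_iff)
        have "(\<Union>i<Suc m. B i) = (\<Union>i<m. B i) \<union> B m"
          by (auto simp: lessThan_Suc)
        moreover have "(\<Union>i<m. B i) \<inter> B m = {}" using disj by blast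
        ultimately have "f (\<Union>i<Suc m. B i) n e = (\<lambda>x. f (\<Union>i<m. B i) n e x + f (B m) n e x)"
          using plus by simp
        then have "g (\<Union>i<Suc m. B i) n e = g (\<Union>i<m. B i) n e + g (B m) n e"
          using f_sq[of "\<Union>i<m. B i" n e] f_sq[of "B m" n e] by (simp add: g_def mk_L2_add)
        then show ?case using Suc union(3) add by simp
      qed
      have "(\<lambda>m. mk_L2 (f (\<Union>i<m. B i) n e)) \<longlonglongrightarrow> mk_L2 (f (\<Union>i. B i) n e)"
      proof (rule L2_dominated_convergence)
        show "f (\<Union>i<m. B i) n e \<in> borel_measurable lborel" for m
          by (intro square_integrable_measurable f_sq) measurable
        show "f (\<Union>i. B i) n e \<in> borel_measurable lborel"
          by (intro square_integrable_measurable f_sq) measurable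
        show "integrable lborel (\<lambda>x. (norm (f UNIV n e x))\<^sup>2)"
          using f_sq[of UNIV n e] by (simp add: square_integrable_def)
        show "AE x in lborel. (norm (f (\<Union>i<m. B i) n e x))\<^sup>2 \<le> (norm (f UNIV n e x))\<^sup>2" for m
          by (auto simp: f_def indicator_def)
        show "AE x in lborel. (\<lambda>m. f (\<Union>i<m. B i) n e x) \<longlonglongrightarrow> f (\<Union>i. B i) n e x"
        proof (rule AE_I2, rule tendsto_eventually)
          fix x
          show "\<forall>\<^sub>F m in sequentially. f (\<Union>i<m. B i) n e x = f (\<Union>i. B i) n e x"
          proof (cases "x \<in> (\<Union>i. B i)")
            case True
            then obtain i where "x \<in> B i" by blast
            then show ?thesis
              by (intro eventually_sequentiallyI[of "Suc i"]) (auto simp: f_def indicator_def)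
          qed (auto simp: f_def)
        qed
      qed
      then show ?case
        unfolding g_def
        by (rule closed_sequentially[OF closed_closure, rotated]) (use part in \<open>simp add: g_def\<close>)
    qed
  qed
  have step2: "g S n c \<in> closure Q" if S: "S \<in> sets borel" for S n c
  proof -
    have "f S n c = (\<lambda>x. \<Sum>e\<in>Basis. (c \<bullet> e) *\<^sub>R f S n e x)"
    proof
      fix x
      have "f S n c x = indicator (S \<inter> cball 0 (real n)) x *\<^sub>R (\<Sum>e\<in>Basis. (c \<bullet> e) *\<^sub>R e)"
        by (simp add: f_def euclidean_representation)
      then show "f S n c x = (\<Sum>e\<in>Basis. (c \<bullet> e) *\<^sub>R f S n e x)"
        by (simp add: f_def scaleR_sum_right mult.commute)
    qed
    then have "g S n c = (\<Sum>e\<in>Basis. mk_L2 (\<lambda>x. (c \<bullet> e) *\<^sub>R f S n e x))"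
      unfolding g_def
      by (simp add: mk_L2_sum[OF finite_Basis square_integrable_scaleR[OF f_sq[OF S]]])
    then have "g S n c = (\<Sum>e\<in>Basis. (c \<bullet> e) *\<^sub>R g S n e)"
      by (simp add: g_def mk_L2_scaleR f_sq[OF S])
    moreover have "(\<Sum>e\<in>Basis. (c \<bullet> e) *\<^sub>R g S n e) \<in> closure Q"
      by (intro sum scale step1 S finite_Basis)
    ultimately show ?thesis by (simp only:)
  qed
  have step3: "square_integrable (\<lambda>x. indicator (cball 0 (real n)) x *\<^sub>R s x) \<and>
      mk_L2 (\<lambda>x. indicator (cball 0 (real n)) x *\<^sub>R s x) \<in> closure Q"
    if s: "simple_function lborel s" for s :: "'a \<Rightarrow> 'b" and n
  proof -
    have fin: "finite (range s)" and S: "s -` {c} \<in> sets borel" for c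
      using simple_functionD[OF s] by auto
    have "(\<lambda>x. indicator (cball 0 (real n)) x *\<^sub>R s x) = (\<lambda>x. \<Sum>c\<in>range s. f (s -` {c}) n c x)"
    proof
      fix x
      have "(\<Sum>c\<in>range s. f (s -` {c}) n c x) = (\<Sum>c\<in>range s. if c = s x then f (s -` {c}) n c x else 0)"
        by (rule sum.cong) (auto simp: f_def)
      then show "indicator (cball 0 (real n)) x *\<^sub>R s x = (\<Sum>c\<in>range s. f (s -` {c}) n c x)"
        using fin by (simp add: sum.delta' f_def indicator_def)
    qed
    moreover have "square_integrable (\<lambda>x. \<Sum>c\<in>range s. f (s -` {c}) n c x) \<and>
        mk_L2 (\<lambda>x. \<Sum>c\<in>range s. f (s -` {c}) n c x) = (\<Sum>c\<in>range s. g (s -` {c}) n c)"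
      unfolding g_def by (intro mk_L2_sum fin f_sq S)
    moreover have "(\<Sum>c\<in>range s. g (s -` {c}) n c) \<in> closure Q"
      by (intro sum fin step2 S)
    ultimately show ?thesis by (simp only:)
  qed
  have "u \<in> closure Q" for u
  proof -
    define h where "h = rep_L2 u"
    have [measurable]: "h \<in> borel_measurable lborel" and h: "integrable lborel (\<lambda>x. (norm (h x))\<^sup>2)"
      using square_integrable_rep[of u] by (auto simp: h_def square_integrable_def)
    obtain s where s: "\<And>i. simple_function lborel (s i)"
      and lim: "\<And>x. (\<lambda>i. s i x) \<longlonglongrightarrow> h x" and bound: "\<And>i x. norm (s i x) \<le> 2 * norm (h x)"
      using borel_measurable_implies_sequence_metric[of h lborel 0] by auto
    have [measurable]: "s i \<in> borel_measurable lborel" for i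
      using s by (rule borel_measurable_simple_function)
    have "(\<lambda>i. mk_L2 (\<lambda>x. indicator (cball 0 (real i)) x *\<^sub>R s i x)) \<longlonglongrightarrow> mk_L2 h"
    proof (rule L2_dominated_convergence)
      show "(\<lambda>x. indicator (cball 0 (real i)) x *\<^sub>R s i x) \<in> borel_measurable lborel" for i
        using step3[OF s] by (intro square_integrable_measurable) blast
      show "integrable lborel (\<lambda>x. 4 * (norm (h x))\<^sup>2)" using h by simp
      have "(norm (s i x))\<^sup>2 \<le> 4 * (norm (h x))\<^sup>2" for i x
        using power_mono[OF bound[of i x], of 2] by (simp add: power_mult_distrib)
      then show "AE x in lborel. (norm (indicator (cball 0 (real i)) x *\<^sub>R s i x))\<^sup>2 \<le> 4 * (norm (h x))\<^sup>2" for i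
        by (auto simp: indicator_def)
      show "AE x in lborel. (\<lambda>i. indicator (cball 0 (real i)) x *\<^sub>R s i x) \<longlonglongrightarrow> h x"
      proof (rule AE_I2, rule Lim_transform_eventually[OF lim])
        fix x :: 'a
        show "\<forall>\<^sub>F i in sequentially. s i x = indicator (cball 0 (real i)) x *\<^sub>R s i x"
          using eventually_ge_at_top[of "nat \<lceil>norm x\<rceil>"]
          by eventually_elim (auto simp: indicator_def nat_ceiling_le_eq)
      qed
    qed measurable
    then have "mk_L2 h \<in> closure Q"
      by (rule closed_sequentially[OF closed_closure, rotated]) (use step3[OF s] in blast)
    then show ?thesis by (simp add: h_def)
  qed
  then show ?thesis using Q(1) by blast
qed

instance L2 :: (euclidean_space, euclidean_space) second_countable_topology
proof
  show "\<exists>B::('a, 'b) L2 set set. countable B \<and> open = generate_topology B"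
    using L2_countable_dense second_countable_of_countable_dense by metis
qed


section \<open>Lipschitz domains and the space \<open>H\<^sup>1\<^sub>0\<close>\<close>

text \<open>
  Near every boundary point \<open>D\<close> is, in a coordinate system with last axis \<open>e\<close>, the set of
  points strictly above the graph of a Lipschitz function on the hyperplane orthogonal to \<open>e\<close>.
  Only the values of \<open>g\<close> on that hyperplane matter.
\<close>

definition lipschitz_boundary :: "'a::euclidean_space set \<Rightarrow> bool" where
  "lipschitz_boundary D \<longleftrightarrow>
     (\<forall>p\<in>frontier D. \<exists>e g L N. norm e = 1 \<and> L-lipschitz_on {z. z \<bullet> e = 0} g \<and> open N \<and> p \<in> N \<and>
        D \<inter> N = {x\<in>N. (g (x - (x \<bullet> e) *\<^sub>R e) :: real) < x \<bullet> e})"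

definition bounded_lipschitz_domain :: "'a::euclidean_space set \<Rightarrow> bool" where
  "bounded_lipschitz_domain D \<longleftrightarrow>
     open D \<and> connected D \<and> D \<noteq> {} \<and> bounded D \<and> lipschitz_boundary D"

text \<open>
  Existence of all directional derivatives as \<open>C\<^sup>k\<close> functions; together with differentiability
  at every point this is the usual notion of a \<open>C\<^sup>k\<^sup>+\<^sup>1\<close> function.
\<close>

primrec Ck_fun :: "nat \<Rightarrow> ('a::euclidean_space \<Rightarrow> real) \<Rightarrow> bool" where
  "Ck_fun 0 \<phi> \<longleftrightarrow> continuous_on UNIV \<phi>"
| "Ck_fun (Suc k) \<phi> \<longleftrightarrow> (\<forall>x. \<phi> differentiable (at x)) \<and>
     (\<forall>h. Ck_fun k (\<lambda>x. frechet_derivative \<phi> (at x) h))"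

definition test_functions :: "'a::euclidean_space set \<Rightarrow> ('a \<Rightarrow> real) set" where
  "test_functions D =
     {\<phi>. (\<forall>k. Ck_fun k \<phi>) \<and> compact (closure {x. \<phi> x \<noteq> 0}) \<and> closure {x. \<phi> x \<noteq> 0} \<subseteq> D}"

definition gradient :: "('a::euclidean_space \<Rightarrow> real) \<Rightarrow> 'a \<Rightarrow> 'a" where
  "gradient \<phi> x = (\<Sum>b\<in>Basis. frechet_derivative \<phi> (at x) b *\<^sub>R b)"

lemma square_integrable_compact_support:
  assumes cont: "continuous_on UNIV f" and K: "compact K" and zero: "\<And>x. x \<notin> K \<Longrightarrow> f x = 0"
  shows "square_integrable f"
proof -
  have "integrable lborel (\<lambda>x. indicator K x *\<^sub>R (norm (f x))\<^sup>2)"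
    by (intro borel_integrable_compact K continuous_intros continuous_on_subset[OF cont]) simp
  also have "(\<lambda>x. indicator K x *\<^sub>R (norm (f x))\<^sup>2) = (\<lambda>x. (norm (f x))\<^sup>2)"
    using zero by (auto simp: indicator_def fun_eq_iff)
  finally have "integrable lborel (\<lambda>x. (norm (f x))\<^sup>2)" .
  moreover have "f \<in> borel_measurable lborel"
    using borel_measurable_continuous_onI[OF cont] by simp
  ultimately show ?thesis by (simp add: square_integrable_def)
qed

text \<open>The classes formed in the definition of \<open>H1_0\<close> below are those of square integrable functions.\<close>

lemma square_integrable_test_function:
  assumes "\<phi> \<in> test_functions D"
  shows "square_integrable \<phi>" "square_integrable (gradient \<phi>)"
proof -
  let ?K = "closure {x. \<phi> x \<noteq> 0}"
  have K: "compact ?K" and C: "Ck_fun k \<phi>" for k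
    using assms by (auto simp: test_functions_def)
  have zero: "\<phi> x = 0" if "x \<notin> ?K" for x
    using that subsetD[OF closure_subset[of "{x. \<phi> x \<noteq> 0}"], of x] by auto
  show "square_integrable \<phi>"
    using C[of 0] by (intro square_integrable_compact_support[OF _ K zero]) simp_all
  have "gradient \<phi> x = 0" if x: "x \<notin> ?K" for x
  proof -
    have "(\<phi> has_derivative (\<lambda>h. 0)) (at x)"
    proof (rule has_derivative_transform_within_open)
      show "((\<lambda>_. 0 :: real) has_derivative (\<lambda>h. 0)) (at x)" by simp
      show "open (- ?K)" by (simp add: open_Compl)
      show "x \<in> - ?K" using x by simp
      show "0 = \<phi> z" if "z \<in> - ?K" for z using zero[of z] that by simp
    qed
    then have "frechet_derivative \<phi> (at x) = (\<lambda>h. 0)"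
      by (rule frechet_derivative_at[symmetric])
    then show ?thesis by (simp add: gradient_def)
  qed
  moreover have "continuous_on UNIV (gradient \<phi>)"
    unfolding gradient_def using C[of "Suc 0"] by (intro continuous_intros) simp
  ultimately show "square_integrable (gradient \<phi>)"
    by (intro square_integrable_compact_support[OF _ K])
qed

text \<open>
  An element \<open>v\<close> of \<open>H\<^sup>1\<^sub>0(D)\<close> is represented by the pair \<open>(v, \<nabla>v)\<close> of the function and its weak
  gradient, both extended by zero outside \<open>D\<close>. The norm of the product type \<open>L\<^sup>2 \<times> L\<^sup>2\<close> is the
  full \<open>H\<^sup>1\<close> norm, so that \<open>H1_0 D\<close> is the \<open>H\<^sup>1\<close>-closure of the test functions. On this closed
  subspace \<open>V_norm\<close> is an equivalent norm by the Poincare inequality; in particular Bochner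
  integrals of \<open>V\<close>-valued maps can be formed in the product type.
\<close>

type_synonym 'a H1 = "('a, real) L2 \<times> ('a, 'a) L2"

definition H1_0 :: "'a::euclidean_space set \<Rightarrow> 'a H1 set" where
  "H1_0 D = closure ((\<lambda>\<phi>. (mk_L2 \<phi>, mk_L2 (gradient \<phi>))) ` test_functions D)"

definition weak_grad :: "'a::euclidean_space H1 \<Rightarrow> 'a \<Rightarrow> 'a" where
  "weak_grad v = rep_L2 (snd v)"

definition V_norm :: "'a::euclidean_space H1 \<Rightarrow> real" where
  "V_norm v = norm (snd v)"

definition H_minus1 :: "'a::euclidean_space set \<Rightarrow> ('a H1 \<Rightarrow> real) set" where
  "H_minus1 D = {f.
     (\<forall>v\<in>H1_0 D. \<forall>w\<in>H1_0 D. f (v + w) = f v + f w) \<and>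
     (\<forall>c. \<forall>v\<in>H1_0 D. f (c *\<^sub>R v) = c * f v) \<and>
     (\<exists>K. \<forall>v\<in>H1_0 D. \<bar>f v\<bar> \<le> K * V_norm v)}"

section \<open>The elliptic problem with lognormal coefficient\<close>

definition Linf_norm :: "'a::euclidean_space set \<Rightarrow> ('a \<Rightarrow> real) \<Rightarrow> ereal" where
  "Linf_norm D w = esssup (lebesgue_on D) (\<lambda>x. ereal \<bar>w x\<bar>)"

definition Linf :: "'a::euclidean_space set \<Rightarrow> ('a \<Rightarrow> real) set" where
  "Linf D = {w. w \<in> borel_measurable (lebesgue_on D) \<and> Linf_norm D w < \<infinity>}"

definition Linf_sums :: "'a::euclidean_space set \<Rightarrow> (nat \<Rightarrow> 'a \<Rightarrow> real) \<Rightarrow> ('a \<Rightarrow> real) \<Rightarrow> bool" where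
  "Linf_sums D w b \<longleftrightarrow>
     b \<in> Linf D \<and> (\<lambda>n. Linf_norm D (\<lambda>x. b x - (\<Sum>j<n. w j x))) \<longlonglongrightarrow> 0"

definition weak_solution ::
  "'a::euclidean_space set \<Rightarrow> ('a \<Rightarrow> real) \<Rightarrow> ('a H1 \<Rightarrow> real) \<Rightarrow> 'a H1 \<Rightarrow> bool" where
  "weak_solution D a f u \<longleftrightarrow>
     u \<in> H1_0 D \<and>
     (\<forall>v\<in>H1_0 D. (\<integral>x. a x * (weak_grad u x \<bullet> weak_grad v x) \<partial>lebesgue_on D) = f v)"

text \<open>The sequences are indexed from 0 instead of 1.\<close>

definition log_coeff_converges ::
  "'a::euclidean_space set \<Rightarrow> (nat \<Rightarrow> 'a \<Rightarrow> real) \<Rightarrow> (nat \<Rightarrow> real) \<Rightarrow> bool" where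
  "log_coeff_converges D \<psi> y \<longleftrightarrow> (\<exists>b. Linf_sums D (\<lambda>j x. y j * \<psi> j x) b)"

text \<open>The limit is determined up to a null set, hence the choice of a representative.\<close>

definition log_coeff ::
  "'a::euclidean_space set \<Rightarrow> (nat \<Rightarrow> 'a \<Rightarrow> real) \<Rightarrow> (nat \<Rightarrow> real) \<Rightarrow> 'a \<Rightarrow> real" where
  "log_coeff D \<psi> y = (SOME b. Linf_sums D (\<lambda>j x. y j * \<psi> j x) b)"

definition diffusion_coeff ::
  "'a::euclidean_space set \<Rightarrow> (nat \<Rightarrow> 'a \<Rightarrow> real) \<Rightarrow> (nat \<Rightarrow> real) \<Rightarrow> 'a \<Rightarrow> real" where
  "diffusion_coeff D \<psi> y x = exp (log_coeff D \<psi> y x)"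

text \<open>The value 0 where the series diverges is arbitrary.\<close>

definition solution_map ::
  "'a::euclidean_space set \<Rightarrow> (nat \<Rightarrow> 'a \<Rightarrow> real) \<Rightarrow> ('a H1 \<Rightarrow> real) \<Rightarrow> (nat \<Rightarrow> real) \<Rightarrow> 'a H1" where
  "solution_map D \<psi> f y =
     (if log_coeff_converges D \<psi> y then THE u. weak_solution D (diffusion_coeff D \<psi> y) f u else 0)"

section \<open>Hermite expansions\<close>

definition gaussian_product :: "(nat \<Rightarrow> real) measure" where
  "gaussian_product = Pi\<^sub>M UNIV (\<lambda>_. density lborel std_normal_density)"

definition multi_indices :: "(nat \<Rightarrow> nat) set" where
  "multi_indices = {\<nu>. finite {j. \<nu> j \<noteq> 0}}"

definition hermite :: "nat \<Rightarrow> real \<Rightarrow> real" where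
  "hermite k t =
     (-1) ^ k / sqrt (fact k) * (deriv ^^ k) std_normal_density t / std_normal_density t"

text \<open>Since \<open>hermite 0\<close> is constant 1, only the indices in the support of \<open>\<nu>\<close> contribute.\<close>

definition hermite_multi :: "(nat \<Rightarrow> nat) \<Rightarrow> (nat \<Rightarrow> real) \<Rightarrow> real" where
  "hermite_multi \<nu> y = (\<Prod>j | \<nu> j \<noteq> 0. hermite (\<nu> j) (y j))"

definition hermite_coeff ::
  "((nat \<Rightarrow> real) \<Rightarrow> 'a::euclidean_space H1) \<Rightarrow> (nat \<Rightarrow> nat) \<Rightarrow> 'a H1" where
  "hermite_coeff u \<nu> = (\<integral>y. hermite_multi \<nu> y *\<^sub>R u y \<partial>gaussian_product)"

definition hermite_partial_sum ::
  "((nat \<Rightarrow> real) \<Rightarrow> 'a::euclidean_space H1) \<Rightarrow> (nat \<Rightarrow> nat) set \<Rightarrow> (nat \<Rightarrow> real) \<Rightarrow> 'a H1" where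
  "hermite_partial_sum u \<Lambda> y = (\<Sum>\<nu>\<in>\<Lambda>. hermite_multi \<nu> y *\<^sub>R hermite_coeff u \<nu>)"

definition L2_gaussian :: "'a::euclidean_space set \<Rightarrow> ((nat \<Rightarrow> real) \<Rightarrow> 'a H1) set" where
  "L2_gaussian D = {w \<in> borel_measurable gaussian_product.
     (AE y in gaussian_product. w y \<in> H1_0 D) \<and> integrable gaussian_product (\<lambda>y. (V_norm (w y))\<^sup>2)}"

definition L2_gaussian_norm :: "((nat \<Rightarrow> real) \<Rightarrow> 'a::euclidean_space H1) \<Rightarrow> real" where
  "L2_gaussian_norm w = sqrt (\<integral>y. (V_norm (w y))\<^sup>2 \<partial>gaussian_product)"

definition n_largest :: "'i set \<Rightarrow> ('i \<Rightarrow> real) \<Rightarrow> nat \<Rightarrow> 'i set \<Rightarrow> bool" where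
  "n_largest I c n \<Lambda> \<longleftrightarrow>
     \<Lambda> \<subseteq> I \<and> finite \<Lambda> \<and> card \<Lambda> = n \<and> (\<forall>i\<in>\<Lambda>. \<forall>j\<in>I - \<Lambda>. c j \<le> c i)"

end

theory Submission
  imports Defs
begin

text \<open>The Taylor coefficients \<open>t \<mu>\<close> of the solution at \<open>y\<close> satisfy a triangular system in which the
  coefficients of lower order enter through the Taylor coefficients of the exponential. In the energy
  norm this is a convolution inequality over multi-indices, and for weights with
  \<open>\<Sum>\<^sub>j \<rho> j \<bar>\<psi> j x\<bar> \<le> 1/2\<close> -- which the finite overlap permits with \<open>\<rho> j\<close> comparable to
  \<open>1 / \<parallel>\<psi> j\<parallel>\<close> -- Young's inequality bounds \<open>\<Sum> \<rho>\<^sup>2\<^sup>\<mu> \<parallel>t \<mu>\<parallel>\<^sup>2\<close>. Gaussian integration by parts turns the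
  Hermite coefficients of \<open>t \<mu>\<close> into explicit multiples of the coefficients \<open>u (\<kappa> + \<mu>)\<close>, so that
  Bessel's inequality gives a weighted \<open>\<ell>\<^sup>2\<close> bound on the Hermite coefficients of the solution; the
  inverse weights are summable to the power \<open>q/2\<close>, and Hoelder's inequality gives \<open>\<ell>\<^sup>p\<close>.
  Completeness of the Hermite polynomials and Stechkin's estimate give the rate.\<close>

section \<open>Hermite polynomials and the standard Gaussian measure\<close>

text \<open>At a fixed \<open>y\<close> the bounds carry a factor
  \<open>exp (2 * (M * W y))\<close>, where \<open>W y\<close> is the supremum over j of the
  absolute value of \<open>y j\<close> times the norm of the j-th function: at most \<open>M\<close>
  terms are nonzero at a point. Exponential moments of \<open>W\<close> are finite because the norms
  are q-summable. The weights use derivatives of bounded order only: \<nu> is paired with the index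
  \<open>min (\<nu> j) r\<close>. Integration by parts then supplies a binomial factor, and the
  weight of coordinate j grows like \<open>\<rho> j\<close> squared times the r-th power of
  \<open>\<nu> j\<close>. Once r * q / 2 is at least 2, the inverse weights to the power q / 2 sum
  over \<open>\<nu> j\<close> to at most 1 plus a multiple of \<open>\<rho> j powr - q\<close>, so
  that the product over j converges. Differentiability in \<open>y\<close> is not known in advance:
  the Taylor coefficients are defined by recursive variational problems, and only then is the one of
  the raised index recognised as a multiple of the coordinate derivative. All estimates concern
  gradients, whose L2 norm is the V norm, so that Bessel's inequality holds in V.\<close>

abbreviation std_gaussian :: "real measure" where
  "std_gaussian \<equiv> density lborel std_normal_density"

lemma prob_space_std_gaussian: "prob_space std_gaussian"
  by (rule prob_space_normal_density) simp

interpretation std_gaussian: prob_space std_gaussian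
  by (rule prob_space_std_gaussian)

text \<open>Exponential growth is the right class here: moving one coordinate of \<open>y\<close>
  changes the logarithm of the diffusion coefficient at most linearly, so the solution and its
  Taylor coefficients grow exponentially along coordinate lines. Polynomials belong to the class,
  and all its measurable members are Gaussian integrable.\<close>

definition exp_bounded :: "(real \<Rightarrow> real) \<Rightarrow> bool" where
  "exp_bounded f \<longleftrightarrow> (\<exists>C c. 0 \<le> c \<and> (\<forall>t. \<bar>f t\<bar> \<le> C * exp (c * \<bar>t\<bar>)))"

lemma exp_boundedI: "0 \<le> c \<Longrightarrow> (\<And>t. \<bar>f t\<bar> \<le> C * exp (c * \<bar>t\<bar>)) \<Longrightarrow> exp_bounded f"
  unfolding exp_bounded_def by blast

lemma exp_bounded_mult:
  assumes "exp_bounded f" "exp_bounded g"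
  shows "exp_bounded (\<lambda>t. f t * g t)"
proof -
  obtain C c D d where *: "0 \<le> c" "\<And>t. \<bar>f t\<bar> \<le> C * exp (c * \<bar>t\<bar>)"
    "0 \<le> d" "\<And>t. \<bar>g t\<bar> \<le> D * exp (d * \<bar>t\<bar>)"
    using assms unfolding exp_bounded_def by blast
  show ?thesis
  proof (rule exp_boundedI[of "c + d" _ "C * D"])
    fix t
    have "\<bar>f t * g t\<bar> \<le> (C * exp (c * \<bar>t\<bar>)) * (D * exp (d * \<bar>t\<bar>))"
      unfolding abs_mult by (intro mult_mono * order_trans[OF abs_ge_zero *(2)[of t]]) auto
    then show "\<bar>f t * g t\<bar> \<le> C * D * exp ((c + d) * \<bar>t\<bar>)"
      by (simp add: exp_add ring_distribs mult_ac)
  qed (use * in auto)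
qed

lemma exp_bounded_add:
  assumes "exp_bounded f" "exp_bounded g"
  shows "exp_bounded (\<lambda>t. f t + g t)"
proof -
  obtain C c D d where *: "0 \<le> c" "\<And>t. \<bar>f t\<bar> \<le> C * exp (c * \<bar>t\<bar>)"
    "0 \<le> d" "\<And>t. \<bar>g t\<bar> \<le> D * exp (d * \<bar>t\<bar>)"
    using assms unfolding exp_bounded_def by blast
  have C: "0 \<le> C" using *(2)[of 0] by simp
  have D: "0 \<le> D" using *(4)[of 0] by simp
  show ?thesis
  proof (rule exp_boundedI[of "c + d" _ "C + D"])
    fix t
    have "C * exp (c * \<bar>t\<bar>) \<le> C * exp ((c + d) * \<bar>t\<bar>)"
      using C *(3) by (intro mult_left_mono) (auto intro!: mult_right_mono)
    moreover have "D * exp (d * \<bar>t\<bar>) \<le> D * exp ((c + d) * \<bar>t\<bar>)"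
      using D *(1) by (intro mult_left_mono) (auto intro!: mult_right_mono)
    ultimately show "\<bar>f t + g t\<bar> \<le> (C + D) * exp ((c + d) * \<bar>t\<bar>)"
      using *(2)[of t] *(4)[of t] abs_triangle_ineq[of "f t" "g t"] unfolding ring_distribs(2)[of C D] by linarith
  qed (use * in auto)
qed

lemma exp_bounded_const: "exp_bounded (\<lambda>t. c)"
  by (rule exp_boundedI[of 0 _ "\<bar>c\<bar>"]) auto

lemma exp_bounded_ident: "exp_bounded (\<lambda>t. t)"
proof (rule exp_boundedI[of 1 _ 1])
  show "\<bar>t\<bar> \<le> 1 * exp (1 * \<bar>t\<bar>)" for t :: real
    using exp_ge_add_one_self[of "\<bar>t\<bar>"] by (simp only: mult_1)
qed simp

lemma exp_bounded_poly: "exp_bounded (poly p)"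
proof (induction p)
  case 0
  then show ?case using exp_bounded_const[of 0] by simp
next
  case (pCons a p)
  have "exp_bounded (\<lambda>t. a + t * poly p t)"
    by (intro exp_bounded_add exp_bounded_const exp_bounded_mult exp_bounded_ident pCons)
  then show ?case by (simp add: poly_pCons[abs_def])
qed

text \<open>Completing the square turns \<open>exp (k * t)\<close> times the standard density into a
  constant times the normal density with mean \<open>k\<close>. The exponential of the absolute
  value is then dominated by the two cases k = c and k = - c.\<close>

lemma integrable_exp_std_gaussian: "integrable std_gaussian (\<lambda>t. exp (c * \<bar>t\<bar>))"
proof -
  have *: "integrable std_gaussian (\<lambda>t. exp (k * t))" for k :: real
  proof -
    have "exp (k * t) * std_normal_density t = exp (k\<^sup>2 / 2) * normal_density k 1 t" for t
      unfolding normal_density_def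
      by (simp flip: exp_add add: field_simps power2_eq_square)
    moreover have "integrable lborel (\<lambda>t. exp (k\<^sup>2 / 2) * normal_density k 1 t)"
      by (intro integrable_mult_right integrable_normal_density) simp
    ultimately show ?thesis
      by (subst integrable_density) (auto simp: mult.commute)
  qed
  have "integrable std_gaussian (\<lambda>t. exp (c * t) + exp (- c * t))"
    by (intro Bochner_Integration.integrable_add *)
  then show ?thesis
  proof (rule Bochner_Integration.integrable_bound)
    have "\<bar>exp (c * \<bar>t\<bar>)\<bar> \<le> \<bar>exp (c * t) + exp (- c * t)\<bar>" for t
      using exp_gt_zero[of "c * t"] exp_gt_zero[of "- c * t"]
      by (cases "t \<ge> 0") (simp_all del: exp_gt_zero)
    then show "AE t in std_gaussian. norm (exp (c * \<bar>t\<bar>)) \<le> norm (exp (c * t) + exp (- c * t))"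
      unfolding real_norm_def by (intro AE_I2)
  qed simp
qed

lemma integrable_exp_bounded:
  assumes [measurable]: "f \<in> borel_measurable borel" and "exp_bounded f"
  shows "integrable std_gaussian f"
proof -
  obtain C c where *: "\<And>t. \<bar>f t\<bar> \<le> C * exp (c * \<bar>t\<bar>)"
    using assms unfolding exp_bounded_def by blast
  show ?thesis
    by (rule Bochner_Integration.integrable_bound[OF integrable_mult_right[OF integrable_exp_std_gaussian[of c], of C]])
       (auto intro!: AE_I2 order_trans[OF * abs_ge_self])
qed

text \<open>The monic probabilists' Hermite polynomials. The recursion is read off from
  differentiating a polynomial times the density, with alternating signs removed.\<close>

fun herm_poly :: "nat \<Rightarrow> real poly" where
  "herm_poly 0 = 1"
| "herm_poly (Suc n) = [:0, 1:] * herm_poly n - pderiv (herm_poly n)"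

section \<open>Rodrigues' formula and the derivative relations of the Hermite polynomials\<close>

lemma std_normal_density_has_derivative:
  "(std_normal_density has_real_derivative - t * std_normal_density t) (at t)"
  unfolding normal_density_def
  by (auto intro!: derivative_eq_intros simp: power2_eq_square field_simps real_div_sqrt)

lemma deriv_std_normal_density:
  "(deriv ^^ n) std_normal_density = (\<lambda>t. (-1) ^ n * poly (herm_poly n) t * std_normal_density t)"
proof (induction n)
  case (Suc n)
  have "((\<lambda>t. (-1) ^ n * poly (herm_poly n) t * std_normal_density t) has_real_derivative
      (-1) ^ Suc n * poly (herm_poly (Suc n)) t * std_normal_density t) (at t)" for t
    by (rule derivative_eq_intros poly_DERIV std_normal_density_has_derivative refl)+
       (simp add: algebra_simps)
  then show ?case by (auto simp: Suc fun_eq_iff DERIV_imp_deriv)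
qed simp

lemma hermite_eq_poly: "hermite n t = poly (herm_poly n) t / sqrt (fact n)"
proof -
  have "std_normal_density t \<noteq> 0" using normal_density_pos[of 1 0 t] by simp
  moreover have "(-1) ^ n * (-1) ^ n = (1::real)" by (simp flip: power_mult_distrib)
  ultimately show ?thesis
    unfolding hermite_def deriv_std_normal_density by (simp add: field_simps)
qed

lemma hermite_0 [simp]: "hermite 0 t = 1"
  by (simp add: hermite_eq_poly)

lemma hermite_measurable [measurable]: "hermite n \<in> borel_measurable borel"
  unfolding hermite_eq_poly[abs_def]
  by (intro borel_measurable_continuous_onI continuous_intros) auto

lemma exp_bounded_hermite: "exp_bounded (hermite n)"
  using exp_bounded_mult[OF exp_bounded_poly[of "herm_poly n"] exp_bounded_const[of "1 / sqrt (fact n)"]]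
  by (simp add: hermite_eq_poly[abs_def])

text \<open>Differentiation of the weighted polynomial raises the degree by one; the normalization
  by \<open>sqrt (fact n)\<close> leaves the factor \<open>sqrt (Suc n)\<close>. Integration by
  parts rests on this relation.\<close>

lemma hermite_density_has_derivative:
  "((\<lambda>t. hermite n t * std_normal_density t) has_real_derivative
     - sqrt (real (Suc n)) * hermite (Suc n) t * std_normal_density t) (at t)"
proof -
  have "((\<lambda>t. poly (herm_poly n) t * std_normal_density t) has_real_derivative
      - poly (herm_poly (Suc n)) t * std_normal_density t) (at t)"
    by (rule derivative_eq_intros poly_DERIV std_normal_density_has_derivative refl)+
       (simp add: algebra_simps)
  from DERIV_cdivide[OF this, of "sqrt (fact n)"] show ?thesis
    by (simp add: hermite_eq_poly real_sqrt_mult divide_simps del: herm_poly.simps)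
qed

text \<open>By completing the square the product is a constant times a Gaussian in \<bar>t\<bar> -
  c. It makes the boundary terms in the integration by parts vanish.\<close>

lemma filterlim_exp_std_normal_density:
  "((\<lambda>t. exp (c * \<bar>t\<bar>) * std_normal_density t) \<longlongrightarrow> 0) at_top"
  "((\<lambda>t. exp (c * \<bar>t\<bar>) * std_normal_density t) \<longlongrightarrow> 0) at_bot"
proof -
  have eq: "exp (c * \<bar>t\<bar>) * std_normal_density t =
      1 / sqrt (2 * pi) * exp (c\<^sup>2 / 2) * exp (- ((\<bar>t\<bar> - c)\<^sup>2 / 2))" for t
    unfolding normal_density_def
    by (simp flip: exp_add add: field_simps power2_eq_square)
  have *: "((\<lambda>t. 1 / sqrt (2 * pi) * exp (c\<^sup>2 / 2) * exp (- ((\<bar>t\<bar> - c)\<^sup>2 / 2))) \<longlongrightarrow> 0) F"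
    if "filterlim (\<lambda>t::real. \<bar>t\<bar>) at_top F" for F
  proof (rule tendsto_mult_right_zero)
    have "filterlim (\<lambda>t. \<bar>t\<bar> - c) at_top F"
      using filterlim_tendsto_add_at_top[OF tendsto_const[of "- c"] that] by simp
    then have "filterlim (\<lambda>t. (\<bar>t\<bar> - c)\<^sup>2 / 2) at_top F"
      using filterlim_tendsto_pos_mult_at_top[OF tendsto_const[of "1/2"], of "\<lambda>t. (\<bar>t\<bar> - c)\<^sup>2" F]
        filterlim_pow_at_top[of 2 "\<lambda>t. \<bar>t\<bar> - c" F] by simp
    then show "((\<lambda>t. exp (- ((\<bar>t\<bar> - c)\<^sup>2 / 2))) \<longlongrightarrow> 0) F"
      by (intro filterlim_compose[OF exp_at_bot] filterlim_compose[OF filterlim_uminus_at_bot_at_top])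
  qed
  have bot: "filterlim (\<lambda>t::real. \<bar>t\<bar>) at_top at_bot"
    unfolding filterlim_at_bot_mirror[of "\<lambda>t. \<bar>t\<bar>"] abs_minus_cancel by (rule filterlim_abs_real)
  show "((\<lambda>t. exp (c * \<bar>t\<bar>) * std_normal_density t) \<longlongrightarrow> 0) at_top"
    unfolding eq by (rule *[OF filterlim_abs_real])
  show "((\<lambda>t. exp (c * \<bar>t\<bar>) * std_normal_density t) \<longlongrightarrow> 0) at_bot"
    unfolding eq by (rule *[OF bot])
qed

text \<open>The derivative of F times \<open>hermite n\<close> times the density is the difference
  of the two integrands. This product vanishes at both ends because \<open>F\<close> times
  \<open>hermite n\<close> grows at most exponentially, so its derivative has integral 0.\<close>

lemma gaussian_integration_by_parts:
  fixes F F' :: "real \<Rightarrow> real"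
  assumes F: "\<And>t. (F has_real_derivative F' t) (at t)" and cont: "continuous_on UNIV F'"
    and bF: "exp_bounded F" and bF': "exp_bounded F'"
  shows "(\<integral>t. F' t * hermite n t \<partial>std_gaussian) =
    sqrt (real (Suc n)) * (\<integral>t. F t * hermite (Suc n) t \<partial>std_gaussian)"
proof -
  have contF: "continuous_on UNIV F"
    by (auto intro!: continuous_at_imp_continuous_on DERIV_isCont F)
  have [measurable]: "F \<in> borel_measurable borel" "F' \<in> borel_measurable borel"
    by (auto intro!: borel_measurable_continuous_onI contF cont)
  have conth: "continuous_on UNIV (hermite k)" for k
    unfolding hermite_eq_poly[abs_def] by (intro continuous_intros) auto
  have contg: "continuous_on UNIV std_normal_density"
    by (auto intro!: continuous_at_imp_continuous_on DERIV_isCont std_normal_density_has_derivative)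
  define G where "G t = F t * (hermite n t * std_normal_density t)" for t
  define G' where "G' t = F' t * (hermite n t * std_normal_density t) -
      sqrt (real (Suc n)) * (F t * (hermite (Suc n) t * std_normal_density t))" for t
  have G: "(G has_real_derivative G' t) (at t)" for t
    unfolding G_def[abs_def] G'_def
    by (rule derivative_eq_intros F hermite_density_has_derivative refl)+ (simp add: mult_ac del: of_nat_Suc)
  have cont': "continuous_on UNIV G'"
    unfolding G'_def[abs_def] by (intro continuous_intros cont contF conth contg)
  have i1: "integrable std_gaussian (\<lambda>t. F' t * hermite n t)"
    by (intro integrable_exp_bounded exp_bounded_mult bF' exp_bounded_hermite) measurable
  have i2: "integrable std_gaussian (\<lambda>t. F t * hermite (Suc n) t)"
    by (intro integrable_exp_bounded exp_bounded_mult bF exp_bounded_hermite) measurable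
  have i1': "integrable lborel (\<lambda>t. F' t * (hermite n t * std_normal_density t))"
    using i1 by (subst (asm) integrable_density) (auto simp: mult_ac)
  have i2': "integrable lborel (\<lambda>t. F t * (hermite (Suc n) t * std_normal_density t))"
    using i2 by (subst (asm) integrable_density) (auto simp: mult_ac)
  have intG': "integrable lborel G'"
    unfolding G'_def[abs_def]
    by (intro Bochner_Integration.integrable_diff i1' integrable_mult_right i2')
  obtain C c where C: "\<And>t. \<bar>F t * hermite n t\<bar> \<le> C * exp (c * \<bar>t\<bar>)"
    using exp_bounded_mult[OF bF exp_bounded_hermite] unfolding exp_bounded_def by blast
  have Gb: "\<bar>G t\<bar> \<le> C * (exp (c * \<bar>t\<bar>) * std_normal_density t)" for t
    unfolding G_def using mult_right_mono[OF C[of t], of "std_normal_density t"]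
    by (simp add: abs_mult mult_ac)
  have lim: "(G \<longlongrightarrow> 0) at_top" "(G \<longlongrightarrow> 0) at_bot"
    by (rule Lim_null_comparison[OF always_eventually[rule_format]], simp, rule Gb,
        rule tendsto_mult_right_zero, rule filterlim_exp_std_normal_density)+
  have "(LBINT x=-\<infinity>..\<infinity>. G' x) = 0 - 0"
  proof (rule interval_integral_FTC_integrable)
    show "(G has_vector_derivative G' x) (at x)" for x
      using G[of x] by (simp add: has_real_derivative_iff_has_vector_derivative)
    show "isCont G' x" for x using cont' by (simp add: continuous_on_eq_continuous_at)
    show "set_integrable lborel (einterval (-\<infinity>) \<infinity>) G'"
      using intG' by (simp add: set_integrable_def)
    show "((G \<circ> real_of_ereal) \<longlongrightarrow> 0) (at_right (-\<infinity>))"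
      using lim by (simp add: ereal_tendsto_simps)
    show "((G \<circ> real_of_ereal) \<longlongrightarrow> 0) (at_left \<infinity>)"
      using lim by (simp add: ereal_tendsto_simps)
  qed auto
  then have "(\<integral>t. G' t \<partial>lborel) = 0"
    by (simp add: interval_integral_to_infinity_eq interval_lebesgue_integral_def set_lebesgue_integral_def)
  then have "(\<integral>t. F' t * (hermite n t * std_normal_density t) \<partial>lborel) =
     sqrt (real (Suc n)) * (\<integral>t. F t * (hermite (Suc n) t * std_normal_density t) \<partial>lborel)"
    unfolding G'_def by (simp add: Bochner_Integration.integral_diff[OF i1' integrable_mult_right[OF i2']] del: of_nat_Suc)
  then show ?thesis
    by (subst (1 2) integral_density) (auto simp: mult_ac)
qed

text \<open>The Appell property, obtained by differentiating the recursion.\<close>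

lemma pderiv_herm_poly: "pderiv (herm_poly (Suc n)) = smult (real (Suc n)) (herm_poly n)"
proof (induction n)
  case (Suc n)
  have "pderiv (herm_poly (Suc (Suc n))) = herm_poly (Suc n) +
      ([:0, 1:] * pderiv (herm_poly (Suc n)) - pderiv (pderiv (herm_poly (Suc n))))"
    by (simp only: herm_poly.simps(2)[of "Suc n"] pderiv_diff pderiv_mult) (simp add: pderiv_pCons)
  \<comment> \<open>After the induction hypothesis the bracket is \<open>Suc n\<close> times the
    right side of the recursion for \<open>herm_poly (Suc n)\<close>.\<close>
  also have "\<dots> = herm_poly (Suc n) + smult (real (Suc n)) (herm_poly (Suc n))"
    unfolding Suc by (simp add: pderiv_smult smult_diff_right)
  also have "\<dots> = smult (real (Suc (Suc n))) (herm_poly (Suc n))"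
    by (simp only: of_nat_Suc[of "Suc n"] smult_add_left smult_1_left)
  finally show ?case .
qed (simp add: pderiv_pCons)

lemma hermite_Suc_has_derivative:
  "(hermite (Suc n) has_real_derivative sqrt (real (Suc n)) * hermite n t) (at t)"
proof -
  have "((\<lambda>t. poly (herm_poly (Suc n)) t / sqrt (fact (Suc n))) has_real_derivative
      poly (pderiv (herm_poly (Suc n))) t / sqrt (fact (Suc n))) (at t)"
    by (intro DERIV_cdivide poly_DERIV)
  moreover have "poly (pderiv (herm_poly (Suc n))) t / sqrt (fact (Suc n)) = sqrt (real (Suc n)) * hermite n t"
    unfolding pderiv_herm_poly hermite_eq_poly
  proof -
    have "sqrt (real (Suc n)) * sqrt (real (Suc n)) = real (Suc n)" by simp
    then show "poly (smult (real (Suc n)) (herm_poly n)) t / sqrt (fact (Suc n)) =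
        sqrt (real (Suc n)) * (poly (herm_poly n) t / sqrt (fact n))"
      by (simp add: real_sqrt_mult field_simps del: of_nat_Suc)
  qed
  ultimately show ?thesis by (simp add: hermite_eq_poly[abs_def] del: herm_poly.simps)
qed

text \<open>Integration by parts with a Hermite polynomial as \<open>F\<close> lowers both indices
  at once, which gives the induction. When exactly one index is 0, taking \<open>F\<close> constant
  1 shows that the integral is 0.\<close>

lemma hermite_orthonormal: "(\<integral>t. hermite m t * hermite n t \<partial>std_gaussian) = (if m = n then 1 else 0)"
proof (induction m arbitrary: n)
  case 0
  show ?case
  proof (cases n)
    case (Suc k)
    have "(\<integral>t. 0 * hermite k t \<partial>std_gaussian) =
        sqrt (real (Suc k)) * (\<integral>t. 1 * hermite (Suc k) t \<partial>std_gaussian)"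
      by (rule gaussian_integration_by_parts) (auto intro: exp_bounded_const)
    then show ?thesis using Suc by simp
  qed (use std_gaussian.prob_space in simp)
next
  case (Suc m)
  show ?case
  proof (cases n)
    case 0
    have "(\<integral>t. 0 * hermite m t \<partial>std_gaussian) =
        sqrt (real (Suc m)) * (\<integral>t. 1 * hermite (Suc m) t \<partial>std_gaussian)"
      by (rule gaussian_integration_by_parts) (auto intro: exp_bounded_const)
    then show ?thesis using 0 by simp
  next
    case (Suc k)
    have c: "continuous_on UNIV (\<lambda>t. sqrt (real (Suc m)) * hermite m t)"
      unfolding hermite_eq_poly[abs_def] by (intro continuous_intros) auto
    have "(\<integral>t. (sqrt (real (Suc m)) * hermite m t) * hermite k t \<partial>std_gaussian) =
        sqrt (real (Suc k)) * (\<integral>t. hermite (Suc m) t * hermite (Suc k) t \<partial>std_gaussian)"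
      by (rule gaussian_integration_by_parts[OF hermite_Suc_has_derivative c])
         (intro exp_bounded_hermite exp_bounded_mult exp_bounded_const)+
    then have "sqrt (real (Suc k)) * (\<integral>t. hermite (Suc m) t * hermite (Suc k) t \<partial>std_gaussian)
       = sqrt (real (Suc m)) * (if m = k then 1 else 0)"
      by (simp add: mult.assoc Suc.IH)
    moreover have "sqrt (real (Suc k)) \<noteq> 0" by simp
    ultimately show ?thesis unfolding Suc by (cases "m = k") (simp_all del: of_nat_Suc)
  qed
qed

text \<open>The polynomials are monic, so a power is a multiple of the Hermite polynomial of that
  degree minus lower powers. It turns vanishing Hermite coefficients into vanishing moments.\<close>

lemma power_in_span_hermite: "\<exists>a. \<forall>t. t ^ n = (\<Sum>k\<le>n. a k * hermite k t)"
proof -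
  have lead: "degree (herm_poly n) \<le> n \<and> coeff (herm_poly n) n = 1" for n
  proof (induction n)
    case (Suc n)
    have "degree (pderiv (herm_poly n)) \<le> n"
      using Suc degree_pderiv[of "herm_poly n"] by linarith
    moreover have "degree (pCons 0 (herm_poly n)) \<le> Suc n"
      using Suc degree_pCons_le[of 0 "herm_poly n"] by simp
    ultimately show ?case
      using Suc by (auto intro!: degree_diff_le simp: coeff_eq_0)
  qed simp
  show ?thesis
  proof (induction n rule: less_induct)
    case (less n)
    obtain a where a: "\<And>m t. m < n \<Longrightarrow> t ^ m = (\<Sum>k\<le>m. a m k * hermite k t)"
      using less by metis
    define b where "b = coeff (herm_poly n)"
    have 1: "t ^ n = sqrt (fact n) * hermite n t - (\<Sum>m<n. b m * t ^ m)" for t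
    proof -
      have "poly (herm_poly n) t = (\<Sum>m\<le>n. b m * t ^ m)"
        unfolding poly_altdef b_def using lead[of n]
        by (intro sum.mono_neutral_left) (auto simp: coeff_eq_0)
      then show ?thesis using lead[of n]
        by (simp add: hermite_eq_poly b_def lessThan_Suc_atMost[symmetric])
    qed
    have 2: "(\<Sum>m<n. b m * t ^ m) = (\<Sum>m<n. \<Sum>k\<le>n. (if k \<le> m then b m * a m k else 0) * hermite k t)" for t
    proof (rule sum.cong[OF refl])
      fix m assume "m \<in> {..<n}"
      then have "b m * t ^ m = (\<Sum>k\<le>m. b m * a m k * hermite k t)"
        by (simp add: a[of m t] sum_distrib_left mult.assoc)
      also have "\<dots> = (\<Sum>k\<le>n. (if k \<le> m then b m * a m k else 0) * hermite k t)"
        using \<open>m \<in> {..<n}\<close> by (intro sum.mono_neutral_cong_left) auto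
      finally show "b m * t ^ m = \<dots>" .
    qed
    have 3: "(\<Sum>m<n. \<Sum>k\<le>n. (if k \<le> m then b m * a m k else 0) * hermite k t) =
       (\<Sum>k\<le>n. (\<Sum>m<n. if k \<le> m then b m * a m k else 0) * hermite k t)" for t
      by (subst sum.swap) (simp add: sum_distrib_right)
    have "(\<Sum>k\<le>n. (if k = n then sqrt (fact n) else 0) * hermite k t) = sqrt (fact n) * hermite n t" for t
      by (subst sum.remove[of _ n]) (auto intro!: sum.neutral)
    then have "t ^ n = (\<Sum>k\<le>n. ((if k = n then sqrt (fact n) else 0) - (\<Sum>m<n. if k \<le> m then b m * a m k else 0)) * hermite k t)" for t
      unfolding 1[of t] 2[of t] 3[of t] by (simp only: left_diff_distrib sum_subtractf)
    then show ?case by (intro exI allI)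
  qed
qed

section \<open>Orthonormal systems and vector valued functions\<close>

text \<open>\<open>square_integrable\<close> is tied to Lebesgue measure and Euclidean values; here
  the domain is mostly the Gaussian product space and the values lie in a Hilbert space that is
  itself an L2 space.\<close>

definition square_integrable_on :: "'m measure \<Rightarrow> ('m \<Rightarrow> 'h::{real_inner, banach, second_countable_topology}) \<Rightarrow> bool" where
  "square_integrable_on M F \<longleftrightarrow> F \<in> borel_measurable M \<and> integrable M (\<lambda>x. (norm (F x))\<^sup>2)"

lemma square_integrable_on_measurable [measurable_dest]:
  "square_integrable_on M F \<Longrightarrow> F \<in> borel_measurable M"
  by (simp add: square_integrable_on_def)

lemma square_integrable_on_bound:
  assumes "F \<in> borel_measurable M" "integrable M h" "AE x in M. (norm (F x))\<^sup>2 \<le> h x"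
  shows "square_integrable_on M F"
  unfolding square_integrable_on_def
proof
  show "integrable M (\<lambda>x. (norm (F x))\<^sup>2)"
  proof (rule Bochner_Integration.integrable_bound[OF assms(2)])
    show "AE x in M. norm ((norm (F x))\<^sup>2) \<le> norm (h x)"
      using assms(3) by eventually_elim simp
  qed (use assms(1) in measurable)
qed fact

lemma square_integrable_on_zero [simp]: "square_integrable_on M (\<lambda>x. 0)"
  by (simp add: square_integrable_on_def)

lemma square_integrable_on_add:
  assumes [measurable_dest]: "square_integrable_on M F" "square_integrable_on M G"
  shows "square_integrable_on M (\<lambda>x. F x + G x)"
proof (rule square_integrable_on_bound)
  show "integrable M (\<lambda>x. 2 * (norm (F x))\<^sup>2 + 2 * (norm (G x))\<^sup>2)"
    using assms by (auto simp: square_integrable_on_def)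
qed (use assms in \<open>auto simp: norm_add_sq_le\<close>)

lemma square_integrable_on_scaleR_left:
  assumes "square_integrable_on M f"
  shows "square_integrable_on M (\<lambda>x. f x *\<^sub>R (c::'h::{real_inner, banach, second_countable_topology}))"
  using assms by (auto simp: square_integrable_on_def power_mult_distrib)

lemma square_integrable_on_uminus: "square_integrable_on M F \<Longrightarrow> square_integrable_on M (\<lambda>x. - F x)"
  by (auto simp: square_integrable_on_def)

lemma square_integrable_on_diff:
  "square_integrable_on M F \<Longrightarrow> square_integrable_on M G \<Longrightarrow> square_integrable_on M (\<lambda>x. F x - G x)"
  using square_integrable_on_add[OF _ square_integrable_on_uminus, of M F G] by simp

lemma square_integrable_on_sum:
  assumes "finite I" "\<And>i. i \<in> I \<Longrightarrow> square_integrable_on M (F i)"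
  shows "square_integrable_on M (\<lambda>x. \<Sum>i\<in>I. F i x)"
  using assms by (induction I rule: finite_induct) (auto intro!: square_integrable_on_add)

lemma integrable_norm_mult_norm:
  assumes "square_integrable_on M F" "square_integrable_on M G"
  shows "integrable M (\<lambda>x. norm (F x) * norm (G x))"
proof (rule Bochner_Integration.integrable_bound)
  note [measurable_dest] = assms
  show "integrable M (\<lambda>x. (norm (F x))\<^sup>2 + (norm (G x))\<^sup>2)"
    using assms by (auto simp: square_integrable_on_def)
  show "(\<lambda>x. norm (F x) * norm (G x)) \<in> borel_measurable M" using assms by measurable
  have "norm (F x) * norm (G x) \<le> (norm (F x))\<^sup>2 + (norm (G x))\<^sup>2" for x
    using sum_squares_bound[of "norm (F x)" "norm (G x)"]
      mult_nonneg_nonneg[OF norm_ge_zero[of "F x"] norm_ge_zero[of "G x"]] by linarith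
  then show "AE x in M. norm (norm (F x) * norm (G x)) \<le> norm ((norm (F x))\<^sup>2 + (norm (G x))\<^sup>2)"
    by simp
qed

lemma integrable_inner_square_integrable:
  assumes "square_integrable_on M F" "square_integrable_on M G"
  shows "integrable M (\<lambda>x. F x \<bullet> G x)"
  by (rule Bochner_Integration.integrable_bound[OF integrable_norm_mult_norm[OF assms]])
     (use assms in \<open>auto intro!: AE_I2 Cauchy_Schwarz_ineq2\<close>)

lemma integrable_scaleR_square_integrable:
  assumes "square_integrable_on M f" "square_integrable_on M F"
  shows "integrable M (\<lambda>x. f x *\<^sub>R F x)"
  by (rule Bochner_Integration.integrable_bound[OF integrable_norm_mult_norm[OF assms]])
     (use assms in \<open>auto intro!: AE_I2\<close>)

text \<open>The integral of the square of s times the first norm minus the second is a quadratic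
  polynomial in s that is never negative.\<close>

lemma integral_Cauchy_Schwarz:
  assumes "square_integrable_on M F" and that: "square_integrable_on M f"
  shows "(\<integral>x. norm (f x) * norm (F x) \<partial>M)\<^sup>2 \<le> (\<integral>x. (norm (f x))\<^sup>2 \<partial>M) * (\<integral>x. (norm (F x))\<^sup>2 \<partial>M)"
proof -
  define A where "A = (\<integral>x. (norm (f x))\<^sup>2 \<partial>M)"
  define B where "B = (\<integral>x. (norm (F x))\<^sup>2 \<partial>M)"
  define C where "C = (\<integral>x. norm (f x) * norm (F x) \<partial>M)"
  have quad: "0 \<le> s\<^sup>2 * A - 2 * s * C + B" for s
  proof -
    have "0 \<le> (\<integral>x. (s * norm (f x) - norm (F x))\<^sup>2 \<partial>M)" by simp
    also have "(\<lambda>x. (s * norm (f x) - norm (F x))\<^sup>2) =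
       (\<lambda>x. s\<^sup>2 * (norm (f x))\<^sup>2 - 2 * s * (norm (f x) * norm (F x)) + (norm (F x))\<^sup>2)"
      by (auto simp: power2_eq_square algebra_simps)
    also have "(\<integral>x. s\<^sup>2 * (norm (f x))\<^sup>2 - 2 * s * (norm (f x) * norm (F x)) + (norm (F x))\<^sup>2 \<partial>M) =
        s\<^sup>2 * A - 2 * s * C + B"
      unfolding A_def B_def C_def using assms that integrable_norm_mult_norm[OF that assms(1)]
      by (simp add: square_integrable_on_def)
    finally show ?thesis .
  qed
  have "C\<^sup>2 \<le> A * B"
  proof (cases "A = 0")
    case True
    have "0 \<le> A" "0 \<le> B" by (simp_all add: A_def B_def)
    have "C = 0"
    proof (rule ccontr)
      assume "C \<noteq> 0"
      \<comment> \<open>With \<open>A = 0\<close> the quadratic is affine in s, and this choice of s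
        gives it the value -1.\<close>
      then show False using quad[of "(B + 1) / (2 * C)"] True \<open>0 \<le> B\<close> by simp
    qed
    then show ?thesis using True by simp
  next
    case False
    moreover have "0 \<le> A" by (simp add: A_def)
    ultimately have "0 < A" by simp
    then show ?thesis using quad[of "C / A"] by (simp add: field_simps power2_eq_square)
  qed
  then show ?thesis by (simp add: A_def B_def C_def)
qed

lemma (in prob_space) integrable_square_integrable:
  assumes "square_integrable_on M F"
  shows "integrable M F"
proof -
  have "square_integrable_on M (\<lambda>x. 1::real)" by (simp add: square_integrable_on_def)
  from integrable_scaleR_square_integrable[OF this assms] show ?thesis by simp
qed

lemma (in prob_space) integral_norm_le_sqrt:
  assumes "square_integrable_on M F"
  shows "(\<integral>x. norm (F x) \<partial>M) \<le> sqrt (\<integral>x. (norm (F x))\<^sup>2 \<partial>M)"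
proof (rule real_le_rsqrt)
  have "square_integrable_on M (\<lambda>x. 1::real)" by (simp add: square_integrable_on_def)
  from integral_Cauchy_Schwarz[OF assms this] show "(\<integral>x. norm (F x) \<partial>M)\<^sup>2 \<le> (\<integral>x. (norm (F x))\<^sup>2 \<partial>M)"
    by (simp add: prob_space)
qed

text \<open>Fatou's lemma for squared norms. The bound is asked only eventually because it is
  applied along a subsequence of partial sums.\<close>

lemma square_integral_Fatou:
  fixes F :: "'m \<Rightarrow> 'h::{real_inner, banach, second_countable_topology}"
  assumes [measurable]: "\<And>n. square_integrable_on M (S n)" "F \<in> borel_measurable M"
    and lim: "AE x in M. (\<lambda>n. S n x) \<longlonglongrightarrow> F x"
    and bound: "eventually (\<lambda>n. (\<integral>x. (norm (S n x))\<^sup>2 \<partial>M) \<le> B) sequentially"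
  shows "square_integrable_on M F" "(\<integral>x. (norm (F x))\<^sup>2 \<partial>M) \<le> B"
proof -
  have [measurable]: "S n \<in> borel_measurable M" for n
    using assms(1) by (rule square_integrable_on_measurable)
  obtain n where "(\<integral>x. (norm (S n x))\<^sup>2 \<partial>M) \<le> B"
    using eventually_happens'[OF sequentially_bot bound] by blast
  moreover have "0 \<le> (\<integral>x. (norm (S n x))\<^sup>2 \<partial>M)" by simp
  ultimately have B: "0 \<le> B" by linarith
  have "(\<integral>\<^sup>+x. ennreal ((norm (F x))\<^sup>2) \<partial>M) = (\<integral>\<^sup>+x. liminf (\<lambda>n. ennreal ((norm (S n x))\<^sup>2)) \<partial>M)"
  proof (rule nn_integral_cong_AE, use lim in eventually_elim)
    case (elim x)
    have "(\<lambda>n. ennreal ((norm (S n x))\<^sup>2)) \<longlonglongrightarrow> ennreal ((norm (F x))\<^sup>2)"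
      by (intro tendsto_intros tendsto_ennrealI elim)
    then show ?case by (intro lim_imp_Liminf[symmetric]) auto
  qed
  also have "\<dots> \<le> liminf (\<lambda>n. \<integral>\<^sup>+x. ennreal ((norm (S n x))\<^sup>2) \<partial>M)"
    by (intro nn_integral_liminf) measurable
  also have "\<dots> = liminf (\<lambda>n. ennreal (\<integral>x. (norm (S n x))\<^sup>2 \<partial>M))"
    using assms(1) by (subst nn_integral_eq_integral) (auto simp: square_integrable_on_def)
  also have "\<dots> \<le> liminf (\<lambda>n. ennreal B)"
    using bound by (intro Liminf_mono) (auto elim!: eventually_mono intro!: ennreal_leI)
  finally have *: "(\<integral>\<^sup>+x. ennreal ((norm (F x))\<^sup>2) \<partial>M) \<le> ennreal B"
    by (simp add: Liminf_const)
  then have "integrable M (\<lambda>x. (norm (F x))\<^sup>2)"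
    by (intro integrableI_nonneg) (auto intro: le_less_trans)
  then show "square_integrable_on M F" by (simp add: square_integrable_on_def)
  show "(\<integral>x. (norm (F x))\<^sup>2 \<partial>M) \<le> B"
    using * B \<open>integrable M (\<lambda>x. (norm (F x))\<^sup>2)\<close>
    by (simp add: nn_integral_eq_integral)
qed

text \<open>The system is scalar while the expanded functions have values in a Hilbert space, so the
  coefficients are vectors given by Bochner integrals. The value type stays polymorphic.\<close>

locale orthonormal_system = prob_space M for M :: "'m measure" +
  fixes e :: "'i \<Rightarrow> 'm \<Rightarrow> real" and I :: "'i set"
  assumes e_square: "\<And>i. i \<in> I \<Longrightarrow> square_integrable_on M (e i)"
    and e_orthonormal: "\<And>i j. i \<in> I \<Longrightarrow> j \<in> I \<Longrightarrow> (\<integral>x. e i x * e j x \<partial>M) = (if i = j then 1 else 0)"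
begin

definition coef :: "('m \<Rightarrow> 'h::{real_inner, banach, second_countable_topology}) \<Rightarrow> 'i \<Rightarrow> 'h" where
  "coef F i = (\<integral>x. e i x *\<^sub>R F x \<partial>M)"

definition psum :: "('i \<Rightarrow> 'h::{real_inner, banach, second_countable_topology}) \<Rightarrow> 'i set \<Rightarrow> 'm \<Rightarrow> 'h" where
  "psum c L x = (\<Sum>i\<in>L. e i x *\<^sub>R c i)"

lemma psum_square: "finite L \<Longrightarrow> L \<subseteq> I \<Longrightarrow> square_integrable_on M (psum c L)"
  unfolding psum_def[abs_def]
  by (intro square_integrable_on_sum square_integrable_on_scaleR_left e_square) auto

lemma coef_integrable:
  "square_integrable_on M F \<Longrightarrow> i \<in> I \<Longrightarrow> integrable M (\<lambda>x. e i x *\<^sub>R F x)"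
  by (intro integrable_scaleR_square_integrable e_square)

lemma e_mult_integrable: "i \<in> I \<Longrightarrow> j \<in> I \<Longrightarrow> integrable M (\<lambda>x. e i x * e j x)"
  using integrable_scaleR_square_integrable[OF e_square e_square, of i j] by simp

lemma psum_norm:
  fixes c :: "'i \<Rightarrow> 'h::{real_inner, banach, second_countable_topology}"
  assumes "finite L" "L \<subseteq> I"
  shows "(\<integral>x. (norm (psum c L x))\<^sup>2 \<partial>M) = (\<Sum>i\<in>L. (norm (c i))\<^sup>2)"
proof -
  have "(\<integral>x. (norm (psum c L x))\<^sup>2 \<partial>M) = (\<integral>x. (\<Sum>i\<in>L. \<Sum>j\<in>L. (e i x * e j x) * (c i \<bullet> c j)) \<partial>M)"
    unfolding power2_norm_eq_inner psum_def
    by (simp add: inner_sum_left inner_sum_right sum_distrib_left mult_ac inner_commute)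
  also have "\<dots> = (\<Sum>i\<in>L. \<Sum>j\<in>L. (if i = j then 1 else 0) * (c i \<bullet> c j))"
    using assms
    by (subst Bochner_Integration.integral_sum; (intro Bochner_Integration.integrable_sum integrable_mult_left e_mult_integrable)?)
       (auto intro!: sum.cong simp: Bochner_Integration.integral_sum e_mult_integrable e_orthonormal subset_iff)
  also have "\<dots> = (\<Sum>i\<in>L. (norm (c i))\<^sup>2)"
    using assms by (simp add: power2_norm_eq_inner if_distrib[of "\<lambda>x. x * _"] cong: if_cong)
  finally show ?thesis .
qed

lemma coef_psum:
  assumes "finite L" "L \<subseteq> I" "i \<in> I"
  shows "coef (psum c L) i = (if i \<in> L then c i else 0)"
proof -
  have "coef (psum c L) i = (\<integral>x. (\<Sum>j\<in>L. (e i x * e j x) *\<^sub>R c j) \<partial>M)"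
    unfolding coef_def psum_def by (simp add: scaleR_sum_right)
  also have "\<dots> = (\<Sum>j\<in>L. (if i = j then 1 else 0) *\<^sub>R c j)"
    using assms e_mult_integrable[OF assms(3)]
    by (subst Bochner_Integration.integral_sum) (auto intro!: sum.cong simp: e_orthonormal subset_iff)
  also have "\<dots> = (if i \<in> L then c i else 0)"
    using assms by (simp add: if_distrib[of "\<lambda>x. x *\<^sub>R _"] cong: if_cong)
  finally show ?thesis .
qed

lemma coef_diff:
  assumes "square_integrable_on M F" "square_integrable_on M G" "i \<in> I"
  shows "coef (\<lambda>x. F x - G x) i = coef F i - coef G i"
  unfolding coef_def using coef_integrable[OF assms(1,3)] coef_integrable[OF assms(2,3)]
  by (simp add: scaleR_diff_right)

lemma norm_coef_le:
  assumes "square_integrable_on M F" "i \<in> I"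
  shows "(norm (coef F i))\<^sup>2 \<le> (\<integral>x. (norm (F x))\<^sup>2 \<partial>M)"
proof -
  have "(norm (coef F i))\<^sup>2 \<le> (\<integral>x. norm (e i x) * norm (F x) \<partial>M)\<^sup>2"
    unfolding coef_def
    by (intro power_mono order_trans[OF integral_norm_bound]) auto
  also have "\<dots> \<le> (\<integral>x. (norm (e i x))\<^sup>2 \<partial>M) * (\<integral>x. (norm (F x))\<^sup>2 \<partial>M)"
    by (intro integral_Cauchy_Schwarz assms e_square)
  also have "(\<integral>x. (norm (e i x))\<^sup>2 \<partial>M) = 1"
    using e_orthonormal[of i i] assms by (simp add: power2_eq_square)
  finally show ?thesis by simp
qed

text \<open>In the squared distance from \<open>F\<close> to its partial sum, the inner product of
  the two and the squared norm of the partial sum both equal the sum of the squared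
  coefficients.\<close>

lemma Bessel:
  assumes F: "square_integrable_on M F" and L: "finite L" "L \<subseteq> I"
  shows "(\<Sum>i\<in>L. (norm (coef F i))\<^sup>2) \<le> (\<integral>x. (norm (F x))\<^sup>2 \<partial>M)"
proof -
  let ?P = "psum (coef F) L"
  note P = psum_square[OF L, of "coef F"]
  have inner: "(\<integral>x. F x \<bullet> ?P x \<partial>M) = (\<Sum>i\<in>L. (norm (coef F i))\<^sup>2)"
  proof -
    have "(\<integral>x. F x \<bullet> ?P x \<partial>M) = (\<integral>x. (\<Sum>i\<in>L. (e i x *\<^sub>R F x) \<bullet> coef F i) \<partial>M)"
      by (simp add: psum_def inner_sum_right)
    also have "\<dots> = (\<Sum>i\<in>L. \<integral>x. (e i x *\<^sub>R F x) \<bullet> coef F i \<partial>M)"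
      by (intro Bochner_Integration.integral_sum integrable_inner_left coef_integrable F) (use L in auto)
    also have "\<dots> = (\<Sum>i\<in>L. coef F i \<bullet> coef F i)"
      unfolding coef_def using coef_integrable[OF F] L by (intro sum.cong integral_inner_left refl) auto
    finally show ?thesis by (simp add: power2_norm_eq_inner)
  qed
  have "0 \<le> (\<integral>x. (norm (F x - ?P x))\<^sup>2 \<partial>M)" by simp
  also have "(\<lambda>x. (norm (F x - ?P x))\<^sup>2) = (\<lambda>x. (norm (F x))\<^sup>2 - 2 * (F x \<bullet> ?P x) + (norm (?P x))\<^sup>2)"
    by (auto simp: power2_norm_eq_inner inner_diff_left inner_diff_right inner_commute)
  also have "(\<integral>x. (norm (F x))\<^sup>2 - 2 * (F x \<bullet> ?P x) + (norm (?P x))\<^sup>2 \<partial>M) =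
     (\<integral>x. (norm (F x))\<^sup>2 \<partial>M) - 2 * (\<integral>x. F x \<bullet> ?P x \<partial>M) + (\<integral>x. (norm (?P x))\<^sup>2 \<partial>M)"
    using F P integrable_inner_square_integrable[OF F P] by (simp add: square_integrable_on_def)
  finally show ?thesis unfolding inner psum_norm[OF L] by simp
qed

lemma psum_diff:
  assumes "finite L'" "L \<subseteq> L'"
  shows "psum c L' x - psum c L x = psum c (L' - L) x"
  unfolding psum_def using assms by (simp add: sum_diff)

text \<open>The partial sums are Cauchy in \<open>L\<^sup>2\<close>, hence an almost everywhere convergent subsequence exists;
  by completeness its limit is \<open>F\<close>, and Fatou's lemma bounds the remainder.\<close>

lemma remainder_le:
  fixes F :: "'m \<Rightarrow> 'h::{real_inner, banach, second_countable_topology}"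
  assumes complete: "\<And>R :: 'm \<Rightarrow> 'h. square_integrable_on M R \<Longrightarrow> (\<And>i. i \<in> I \<Longrightarrow> coef R i = 0) \<Longrightarrow> AE x in M. R x = 0"
    and I: "countable I" and F: "square_integrable_on M F" and L: "finite L" "L \<subseteq> I"
    and tail: "\<And>L'. finite L' \<Longrightarrow> L' \<subseteq> I - L \<Longrightarrow> (\<Sum>i\<in>L'. (norm (coef F i))\<^sup>2) \<le> \<epsilon>"
  shows "(\<integral>x. (norm (F x - psum (coef F) L x))\<^sup>2 \<partial>M) \<le> \<epsilon>"
proof -
  define c where "c = coef F"
  \<comment> \<open>Finite sets exhausting the countable \<open>I\<close>; they turn the unordered
    expansion into a sequence of partial sums.\<close>
  define J where "J n = {i \<in> I. to_nat_on I i < n}" for n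
  have J_fin: "finite (J n)" for n
  proof (rule inj_on_finite)
    show "inj_on (to_nat_on I) (J n)" using I by (auto simp: J_def intro: inj_on_subset)
    show "to_nat_on I ` J n \<subseteq> {..<n}" by (auto simp: J_def)
  qed simp
  have J_sub: "J n \<subseteq> I" for n by (auto simp: J_def)
  have J_mono: "J m \<subseteq> J n" if "m \<le> n" for m n using that by (auto simp: J_def)
  have J_ex: "\<exists>N. \<forall>n\<ge>N. K \<subseteq> J n" if "finite K" "K \<subseteq> I" for K
  proof (intro exI allI impI subsetI)
    fix n i assume "n \<ge> Suc (Max (to_nat_on I ` K))" "i \<in> K"
    moreover have "to_nat_on I i \<le> Max (to_nat_on I ` K)"
      using that \<open>i \<in> K\<close> by (intro Max_ge) auto
    ultimately have "to_nat_on I i < n" by linarith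
    then show "i \<in> J n" using that \<open>i \<in> K\<close> by (auto simp: J_def)
  qed
  have norm_diff: "(\<integral>x. (norm (psum c (J n) x - psum c K x))\<^sup>2 \<partial>M) = (\<Sum>i\<in>J n - K. (norm (c i))\<^sup>2)"
    if "K \<subseteq> J n" for n K
  proof -
    have "J n - K \<subseteq> I" using J_sub by blast
    then show ?thesis using that J_fin by (simp add: psum_diff psum_norm)
  qed
  have summ: "(\<lambda>i. (norm (c i))\<^sup>2) summable_on I"
    by (rule nonneg_bdd_above_summable_on)
       (auto intro!: bdd_aboveI2[where M = "\<integral>x. (norm (F x))\<^sup>2 \<partial>M"] Bessel[OF F] simp: c_def)
  have ex_tail: "\<exists>N. \<forall>n\<ge>N. (\<Sum>i\<in>J n - J N. (norm (c i))\<^sup>2) \<le> \<delta>" if "\<delta> > 0" for \<delta>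
  proof -
    define s where "s = (\<Sum>\<^sub>\<infinity>i\<in>I. (norm (c i))\<^sup>2)"
    obtain K where K: "finite K" "K \<subseteq> I" "dist (\<Sum>i\<in>K. (norm (c i))\<^sup>2) s \<le> \<delta>"
      using infsum_finite_approximation[OF summ \<open>\<delta> > 0\<close>] by (auto simp: s_def)
    obtain N where N: "K \<subseteq> J N" using J_ex[OF K(1,2)] by auto
    have "(\<Sum>i\<in>J n - J N. (norm (c i))\<^sup>2) \<le> \<delta>" if "n \<ge> N" for n
    proof -
      have "(\<Sum>i\<in>J n - J N. (norm (c i))\<^sup>2) + (\<Sum>i\<in>K. (norm (c i))\<^sup>2) =
          (\<Sum>i\<in>(J n - J N) \<union> K. (norm (c i))\<^sup>2)"
        using K N J_fin by (intro sum.union_disjoint[symmetric]) auto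
      also have "\<dots> \<le> s"
        unfolding s_def using J_fin J_sub K by (intro finite_sum_le_infsum summ) auto
      finally show ?thesis using K(3) by (simp add: dist_real_def)
    qed
    then show ?thesis by blast
  qed
  define S where "S n = psum c (J n)" for n
  have S_sq: "square_integrable_on M (S n)" for n
    unfolding S_def by (intro psum_square J_fin J_sub)
  have norm_S: "(\<integral>x. (norm (S n x - S m x))\<^sup>2 \<partial>M) = (\<Sum>i\<in>J n - J m. (norm (c i))\<^sup>2)" if "m \<le> n" for m n
    unfolding S_def by (intro norm_diff J_mono that)
  have "\<exists>N. \<forall>i\<ge>N. \<forall>j\<ge>N. (\<integral>x. norm (S i x - S j x) \<partial>M) < \<delta>" if "\<delta> > 0" for \<delta>
  proof -
    \<comment> \<open>The L1 distance is at most the square root of this tail. Two such distances,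
      one for each index, add up to less than \<delta>.\<close>
    obtain N where N: "\<And>n. n \<ge> N \<Longrightarrow> (\<Sum>i\<in>J n - J N. (norm (c i))\<^sup>2) \<le> (\<delta> / 3)\<^sup>2"
      using ex_tail[of "(\<delta> / 3)\<^sup>2"] \<open>\<delta> > 0\<close> zero_less_power[of "\<delta> / 3" 2] by fastforce
    have b: "(\<integral>x. norm (S n x - S N x) \<partial>M) \<le> \<delta> / 3" if "n \<ge> N" for n
    proof -
      have "(\<integral>x. norm (S n x - S N x) \<partial>M) \<le> sqrt (\<integral>x. (norm (S n x - S N x))\<^sup>2 \<partial>M)"
        by (intro integral_norm_le_sqrt square_integrable_on_diff S_sq)
      also have "\<dots> \<le> sqrt ((\<delta> / 3)\<^sup>2)" unfolding norm_S[OF that] by (intro real_sqrt_le_mono N that)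
      finally show ?thesis using \<open>\<delta> > 0\<close> by simp
    qed
    have "(\<integral>x. norm (S i x - S j x) \<partial>M) < \<delta>" if "i \<ge> N" "j \<ge> N" for i j
    proof -
      have int: "integrable M (\<lambda>x. S i x - S j x)" for i j
        by (intro integrable_square_integrable square_integrable_on_diff S_sq)
      have "(\<integral>x. norm (S i x - S j x) \<partial>M) \<le> (\<integral>x. norm (S i x - S N x) + norm (S j x - S N x) \<partial>M)"
      proof (rule integral_mono)
        show "norm (S i x - S j x) \<le> norm (S i x - S N x) + norm (S j x - S N x)" for x
          using norm_triangle_ineq4[of "S i x - S N x" "S j x - S N x"] by simp
      qed (intro Bochner_Integration.integrable_add integrable_norm int)+
      also have "\<dots> = (\<integral>x. norm (S i x - S N x) \<partial>M) + (\<integral>x. norm (S j x - S N x) \<partial>M)"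
        by (intro Bochner_Integration.integral_add integrable_norm int)
      finally show ?thesis using b[OF that(1)] b[OF that(2)] \<open>\<delta> > 0\<close> by linarith
    qed
    then show ?thesis by blast
  qed
  then obtain r where r: "strict_mono r" and Cau: "AE x in M. Cauchy (\<lambda>i. S (r i) x)"
    using cauchy_L1_AE_cauchy_subseq[of M S] integrable_square_integrable[OF S_sq] by blast
  define T where "T x = lim (\<lambda>i. S (r i) x)" for x
  have [measurable]: "S n \<in> borel_measurable M" for n by (rule square_integrable_on_measurable[OF S_sq])
  have [measurable]: "F \<in> borel_measurable M" by (rule square_integrable_on_measurable[OF F])
  have [measurable]: "T \<in> borel_measurable M"
    unfolding T_def[abs_def] by (rule borel_measurable_lim_metric) measurable
  have lim: "AE x in M. (\<lambda>i. S (r i) x) \<longlonglongrightarrow> T x"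
    using Cau by eventually_elim (auto simp: T_def Cauchy_convergent_iff convergent_LIMSEQ_iff)
  \<comment> \<open>The set \<open>K\<close> is left free for three uses: the empty set gives square
    integrability of \<open>T\<close>, the sets \<open>J m\<close> give L2 convergence to
    \<open>T\<close>, and \<open>L\<close> gives the bound claimed.\<close>
  have fatou: "square_integrable_on M (\<lambda>x. T x - psum c K x) \<and> (\<integral>x. (norm (T x - psum c K x))\<^sup>2 \<partial>M) \<le> B"
    if K: "finite K" "K \<subseteq> I" and B: "\<And>n. K \<subseteq> J n \<Longrightarrow> (\<Sum>i\<in>J n - K. (norm (c i))\<^sup>2) \<le> B" for K B
  proof -
    note PK = psum_square[OF K, of c]
    have [measurable]: "psum c K \<in> borel_measurable M" by (rule square_integrable_on_measurable[OF PK])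
    obtain N where N: "\<And>n. n \<ge> N \<Longrightarrow> K \<subseteq> J n" using J_ex[OF K] by blast
    have ev: "\<forall>\<^sub>F n in sequentially. (\<integral>x. (norm (S (r n) x - psum c K x))\<^sup>2 \<partial>M) \<le> B"
    proof (rule eventually_sequentiallyI[of N])
      fix n assume "n \<ge> N"
      then have "K \<subseteq> J (r n)" using N[of "r n"] seq_suble[OF r, of n] by simp
      from norm_diff[OF this] B[OF this]
      show "(\<integral>x. (norm (S (r n) x - psum c K x))\<^sup>2 \<partial>M) \<le> B" unfolding S_def by simp
    qed
    have l: "AE x in M. (\<lambda>n. S (r n) x - psum c K x) \<longlonglongrightarrow> T x - psum c K x"
      using lim by eventually_elim (intro tendsto_intros)
    from square_integral_Fatou[OF square_integrable_on_diff[OF S_sq PK] _ l ev] show ?thesis by simp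
  qed
  have "J 0 = {}" by (simp add: J_def)
  obtain B0 where "\<And>n. (\<Sum>i\<in>J n. (norm (c i))\<^sup>2) \<le> B0"
    using Bessel[OF F J_fin J_sub] unfolding c_def by blast
  then have T_sq: "square_integrable_on M T"
    using fatou[of "{}" B0] by (simp add: psum_def)
  have TS: "(\<lambda>N. \<integral>x. (norm (T x - S N x))\<^sup>2 \<partial>M) \<longlonglongrightarrow> 0"
  proof (rule LIMSEQ_I)
    fix \<delta> :: real assume "\<delta> > 0"
    then obtain N where N: "\<And>n. n \<ge> N \<Longrightarrow> (\<Sum>i\<in>J n - J N. (norm (c i))\<^sup>2) \<le> \<delta> / 2"
      using ex_tail[of "\<delta> / 2"] by fastforce
    have "(\<integral>x. (norm (T x - S m x))\<^sup>2 \<partial>M) \<le> \<delta> / 2" if "m \<ge> N" for m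
      unfolding S_def
    proof (rule fatou[OF J_fin J_sub, THEN conjunct2])
      fix n assume "J m \<subseteq> J n"
      then have sub: "J n - J m \<subseteq> J (max n N) - J N"
        using J_mono[of n "max n N"] J_mono[OF that] by auto
      have "(\<Sum>i\<in>J n - J m. (norm (c i))\<^sup>2) \<le> (\<Sum>i\<in>J (max n N) - J N. (norm (c i))\<^sup>2)"
        using J_fin by (intro sum_mono2 sub) auto
      also have "\<dots> \<le> \<delta> / 2" by (intro N) simp
      finally show "(\<Sum>i\<in>J n - J m. (norm (c i))\<^sup>2) \<le> \<delta> / 2" .
    qed
    moreover have "0 \<le> (\<integral>x. (norm (T x - S m x))\<^sup>2 \<partial>M)" for m by simp
    ultimately show "\<exists>no. \<forall>n\<ge>no. norm ((\<integral>x. (norm (T x - S n x))\<^sup>2 \<partial>M) - 0) < \<delta>"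
      using \<open>\<delta> > 0\<close> by (intro exI[of _ N]) fastforce
  qed
  \<comment> \<open>Coefficients are continuous in the L2 norm, and those of the partial sums are
    eventually constant.\<close>
  have coefT: "coef T i = c i" if i: "i \<in> I" for i
  proof -
    have "(\<lambda>n. (norm (coef T i - coef (S n) i))\<^sup>2) \<longlonglongrightarrow> 0"
    proof (rule Lim_null_comparison[OF always_eventually[rule_format] TS])
      show "norm ((norm (coef T i - coef (S n) i))\<^sup>2) \<le> (\<integral>x. (norm (T x - S n x))\<^sup>2 \<partial>M)" for n
        using norm_coef_le[OF square_integrable_on_diff[OF T_sq S_sq] i, of n]
          coef_diff[OF T_sq S_sq i, of n] by simp
    qed
    moreover obtain N where N: "\<And>n. n \<ge> N \<Longrightarrow> i \<in> J n" using J_ex[of "{i}"] i by auto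
    have "\<forall>\<^sub>F n in sequentially. (norm (coef T i - coef (S n) i))\<^sup>2 = (norm (coef T i - c i))\<^sup>2"
      by (rule eventually_sequentiallyI[of N])
         (use N i in \<open>simp add: S_def coef_psum[OF J_fin J_sub]\<close>)
    ultimately have "(\<lambda>n::nat. (norm (coef T i - c i))\<^sup>2) \<longlonglongrightarrow> 0"
      by (rule Lim_transform_eventually)
    then show ?thesis by (simp add: LIMSEQ_const_iff)
  qed
  have "AE x in M. F x - T x = 0"
    by (intro complete square_integrable_on_diff F T_sq)
       (simp add: coef_diff[OF F T_sq] coefT c_def)
  then have "(\<integral>x. (norm (F x - psum c L x))\<^sup>2 \<partial>M) = (\<integral>x. (norm (T x - psum c L x))\<^sup>2 \<partial>M)"
    using square_integrable_on_measurable[OF psum_square[OF L, of c]]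
    by (intro integral_cong_AE) auto
  also have "\<dots> \<le> \<epsilon>"
  proof (rule fatou[OF L, THEN conjunct2])
    fix n
    have "J n - L \<subseteq> I - L" using J_sub by blast
    then show "(\<Sum>i\<in>J n - L. (norm (c i))\<^sup>2) \<le> \<epsilon>"
      unfolding c_def using J_fin by (intro tail) auto
  qed
  finally show ?thesis by (simp add: c_def)
qed

end

section \<open>The infinite product of standard Gaussian measures\<close>

interpretation gaussians: product_prob_space "\<lambda>_::nat. std_gaussian" UNIV
  by standard

lemma prob_space_gaussian_product: "prob_space gaussian_product"
  unfolding gaussian_product_def by (rule gaussians.prob_space_axioms)

interpretation gaussian_product: prob_space gaussian_product
  by (rule prob_space_gaussian_product)

lemma sets_gaussian_product: "sets gaussian_product = sets (Pi\<^sub>M UNIV (\<lambda>_. borel))"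
  unfolding gaussian_product_def by (intro sets_PiM_cong) auto

lemma space_gaussian_product [simp]: "space gaussian_product = UNIV"
  by (simp add: gaussian_product_def space_PiM)

lemma sets_gaussian_product_borel: "sets gaussian_product = sets borel"
  unfolding sets_gaussian_product by (rule sets_PiM_equal_borel)

lemma measurable_coordinate [measurable]: "(\<lambda>y. y j) \<in> borel_measurable gaussian_product"
proof -
  have "(\<lambda>y. y j) \<in> borel_measurable (Pi\<^sub>M UNIV (\<lambda>_::nat. borel :: real measure))"
    by measurable
  then show ?thesis using measurable_cong_sets[OF sets_gaussian_product refl] by blast
qed

text \<open>The marginal of the infinite product on finitely many coordinates is a finite product
  measure, where the factors separate.\<close>

lemma
  fixes f :: "nat \<Rightarrow> real \<Rightarrow> real"
  assumes J: "finite J" and f: "\<And>j. j \<in> J \<Longrightarrow> integrable std_gaussian (f j)"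
  shows integrable_prod_coordinates: "integrable gaussian_product (\<lambda>y. \<Prod>j\<in>J. f j (y j))"
    and integral_prod_coordinates:
      "(\<integral>y. (\<Prod>j\<in>J. f j (y j)) \<partial>gaussian_product) = (\<Prod>j\<in>J. \<integral>t. f j t \<partial>std_gaussian)"
proof -
  let ?P = "Pi\<^sub>M J (\<lambda>_. std_gaussian)"
  have d: "distr gaussian_product ?P (\<lambda>y. restrict y J) = ?P"
    unfolding gaussian_product_def by (rule gaussians.distr_PiM_restrict_finite[OF J]) simp
  have m: "(\<lambda>y. restrict y J) \<in> measurable gaussian_product ?P"
    unfolding gaussian_product_def by (rule measurable_restrict_subset) simp
  have i: "integrable ?P (\<lambda>x. \<Prod>j\<in>J. f j (x j))"
    by (intro gaussians.product_integrable_prod J f)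
  then have "integrable (distr gaussian_product ?P (\<lambda>y. restrict y J)) (\<lambda>x. \<Prod>j\<in>J. f j (x j))"
    by (simp only: d)
  from integrable_distr[OF m this] show "integrable gaussian_product (\<lambda>y. \<Prod>j\<in>J. f j (y j))"
    by (simp cong: prod.cong)
  have "(\<integral>x. (\<Prod>j\<in>J. f j (x j)) \<partial>distr gaussian_product ?P (\<lambda>y. restrict y J)) =
      (\<integral>y. (\<Prod>j\<in>J. f j (restrict y J j)) \<partial>gaussian_product)"
    using i by (intro integral_distr m) auto
  then show "(\<integral>y. (\<Prod>j\<in>J. f j (y j)) \<partial>gaussian_product) = (\<Prod>j\<in>J. \<integral>t. f j t \<partial>std_gaussian)"
    unfolding d by (simp add: gaussians.product_integral_prod[OF J f] cong: prod.cong)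
qed

text \<open>Replacing one coordinate by an independent standard Gaussian leaves the product measure
  invariant. This is the form of Fubini's theorem that lets one-dimensional integration by parts act
  inside an integral over all coordinates.\<close>

lemma
  fixes F :: "(nat \<Rightarrow> real) \<Rightarrow> 'h::{banach, second_countable_topology}"
  assumes F: "integrable gaussian_product F"
  shows integral_resample: "(\<integral>y. F y \<partial>gaussian_product) = (\<integral>y. \<integral>t. F (y(j := t)) \<partial>std_gaussian \<partial>gaussian_product)"
    and integrable_resample: "integrable gaussian_product (\<lambda>y. \<integral>t. F (y(j := t)) \<partial>std_gaussian)"
proof -
  interpret P: pair_sigma_finite std_gaussian gaussian_product ..
  let ?P = "std_gaussian \<Otimes>\<^sub>M gaussian_product" and ?g = "\<lambda>(t, y). y(j := t)"
  have d: "distr ?P gaussian_product ?g = gaussian_product"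
    using distr_pair_PiM_eq_PiM[of UNIV "\<lambda>_. std_gaussian" j] prob_space_std_gaussian
    by (simp add: gaussian_product_def)
  have m: "?g \<in> measurable ?P gaussian_product"
    unfolding gaussian_product_def
    by (rule measurable_PiM_single') (auto simp: split_beta' space_pair_measure space_PiM fun_upd_def)
  have [measurable]: "F \<in> borel_measurable gaussian_product" using F by simp
  have "integrable (distr ?P gaussian_product ?g) F" using F by (simp only: d)
  from integrable_distr[OF m this] have i: "integrable ?P (\<lambda>(t, y). F (y(j := t)))"
    by (simp add: split_beta')
  have "(\<integral>y. F y \<partial>gaussian_product) = (\<integral>y. F y \<partial>distr ?P gaussian_product ?g)" by (simp only: d)
  also have "\<dots> = (\<integral>z. F (?g z) \<partial>?P)" by (intro integral_distr m) simp
  also have "\<dots> = (\<integral>z. (\<lambda>(t, y). F (y(j := t))) z \<partial>?P)" by (simp add: split_beta')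
  also have "\<dots> = (\<integral>y. \<integral>t. F (y(j := t)) \<partial>std_gaussian \<partial>gaussian_product)"
    by (rule P.integral_snd[OF i, symmetric])
  finally show "(\<integral>y. F y \<partial>gaussian_product) = (\<integral>y. \<integral>t. F (y(j := t)) \<partial>std_gaussian \<partial>gaussian_product)" .
  show "integrable gaussian_product (\<lambda>y. \<integral>t. F (y(j := t)) \<partial>std_gaussian)"
    by (rule P.integrable_snd[OF i])
qed

section \<open>Tensor products of Hermite polynomials\<close>

lemma hermite_multi_eq_prod:
  assumes "finite J" "{j. \<nu> j \<noteq> 0} \<subseteq> J"
  shows "hermite_multi \<nu> y = (\<Prod>j\<in>J. hermite (\<nu> j) (y j))"
  unfolding hermite_multi_def using assms by (intro prod.mono_neutral_left) auto

lemma hermite_multi_measurable [measurable]: "hermite_multi \<nu> \<in> borel_measurable gaussian_product"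
  unfolding hermite_multi_def[abs_def] by measurable

lemma square_integrable_prod_coordinates:
  assumes "finite J" "\<And>j. j \<in> J \<Longrightarrow> f j \<in> borel_measurable borel" "\<And>j. j \<in> J \<Longrightarrow> exp_bounded (f j)"
  shows "square_integrable_on gaussian_product (\<lambda>y. \<Prod>j\<in>J. f j (y j))"
  unfolding square_integrable_on_def
proof
  show "(\<lambda>y. \<Prod>j\<in>J. f j (y j)) \<in> borel_measurable gaussian_product"
    using assms(2) by (intro borel_measurable_prod) (auto intro: measurable_compose[OF measurable_coordinate])
  have "integrable gaussian_product (\<lambda>y. \<Prod>j\<in>J. f j (y j) * f j (y j))"
    using assms by (intro integrable_prod_coordinates integrable_exp_bounded exp_bounded_mult borel_measurable_times) auto
  then show "integrable gaussian_product (\<lambda>y. (norm (\<Prod>j\<in>J. f j (y j)))\<^sup>2)"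
    by (simp add: power2_eq_square prod.distrib)
qed

interpretation hermite: orthonormal_system gaussian_product hermite_multi multi_indices
proof
  fix \<nu> assume "\<nu> \<in> multi_indices"
  then have fin: "finite {j. \<nu> j \<noteq> 0}" by (simp add: multi_indices_def)
  show "square_integrable_on gaussian_product (hermite_multi \<nu>)"
    unfolding hermite_multi_def[abs_def] by (intro square_integrable_prod_coordinates fin exp_bounded_hermite) simp
  fix \<mu> assume "\<mu> \<in> multi_indices"
  then have fin': "finite {j. \<mu> j \<noteq> 0}" by (simp add: multi_indices_def)
  define J where "J = {j. \<nu> j \<noteq> 0} \<union> {j. \<mu> j \<noteq> 0}"
  have J: "finite J" using fin fin' by (simp add: J_def)
  have "(\<integral>y. hermite_multi \<nu> y * hermite_multi \<mu> y \<partial>gaussian_product) =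
      (\<integral>y. (\<Prod>j\<in>J. hermite (\<nu> j) (y j) * hermite (\<mu> j) (y j)) \<partial>gaussian_product)"
    using J by (subst (1 2) hermite_multi_eq_prod[of J]) (auto simp: J_def prod.distrib)
  also have "\<dots> = (\<Prod>j\<in>J. if \<nu> j = \<mu> j then 1 else 0)"
    by (subst integral_prod_coordinates[OF J])
       (auto simp: hermite_orthonormal intro!: integrable_exp_bounded exp_bounded_mult exp_bounded_hermite)
  also have "\<dots> = (if \<nu> = \<mu> then 1 else 0)"
  proof (cases "\<nu> = \<mu>")
    case False
    then obtain j where "\<nu> j \<noteq> \<mu> j" by blast
    then have "j \<in> J" by (auto simp: J_def)
    then show ?thesis using \<open>\<nu> j \<noteq> \<mu> j\<close> False J by (auto intro!: prod_zero)
  qed simp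
  finally show "(\<integral>y. hermite_multi \<nu> y * hermite_multi \<mu> y \<partial>gaussian_product) = (if \<nu> = \<mu> then 1 else 0)" .
qed

lemma countable_multi_indices: "countable multi_indices"
proof (rule countable_subset)
  show "multi_indices \<subseteq> range (\<lambda>xs j. if j < length xs then xs ! j else 0)"
  proof
    fix \<nu> :: "nat \<Rightarrow> nat" assume "\<nu> \<in> multi_indices"
    then have "finite {j. \<nu> j \<noteq> 0}" by (simp add: multi_indices_def)
    then obtain n where n: "\<And>j. \<nu> j \<noteq> 0 \<Longrightarrow> j < n"
      using finite_nat_set_iff_bounded by auto
    then have "\<nu> = (\<lambda>j. if j < length (map \<nu> [0..<n]) then map \<nu> [0..<n] ! j else 0)"
      using n by (fastforce simp: fun_eq_iff)
    then show "\<nu> \<in> range (\<lambda>xs j. if j < length xs then xs ! j else 0)" by blast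
  qed
qed simp

subsection \<open>Completeness of the Hermite polynomials\<close>

text \<open>Vanishing moments of \<open>X\<close> under the signed measure with density \<open>W\<close> give a vanishing
  characteristic function, by expanding the exponential.\<close>

lemma (in prob_space) vanishing_moments:
  fixes W X :: "'a \<Rightarrow> real"
  assumes [measurable]: "X \<in> borel_measurable M" and W: "W \<in> borel_measurable M"
    and int: "\<And>c. integrable M (\<lambda>x. W x * exp (c * \<bar>X x\<bar>))"
    and mom: "\<And>n. (\<integral>x. W x * X x ^ n \<partial>M) = 0"
    and B: "B \<in> sets borel"
  shows "(\<integral>x. W x * indicator B (X x) \<partial>M) = 0"
proof -
  note [measurable] = W B
  have intW: "integrable M W" using int[of 0] by simp
  \<comment> \<open>A single term of the exponential series is at most its sum.\<close>
  have powb: "\<bar>x\<bar> ^ n \<le> fact n * exp \<bar>x\<bar>" for x :: real and n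
  proof -
    have "\<bar>x\<bar> ^ n /\<^sub>R fact n \<le> (\<Sum>k. \<bar>x\<bar> ^ k /\<^sub>R fact k)"
      using sum_le_suminf[OF summable_exp_generic[of "\<bar>x\<bar>"], of "{n}"] by simp
    then show ?thesis by (simp add: exp_def field_simps)
  qed
  have intWX: "integrable M (\<lambda>x. W x * X x ^ n)" for n
  proof (rule Bochner_Integration.integrable_bound[OF integrable_mult_right[OF int[of 1], of "fact n"]])
    show "AE x in M. norm (W x * X x ^ n) \<le> norm (fact n * (W x * exp (1 * \<bar>X x\<bar>)))"
      using mult_left_mono[OF powb abs_ge_zero] by (auto simp: abs_mult power_abs mult_ac)
  qed measurable
  have char0: "(\<integral>x. complex_of_real (W x) * iexp (t * X x) \<partial>M) = 0" for t
  proof -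
    \<comment> \<open>Partial sums of the exponential series times \<open>W\<close>. Each has
      integral 0 by the moment hypothesis, and all are dominated by the absolute value of
      \<open>W\<close> times the exponential of \<bar>t\<bar> \<bar>X\<bar>.\<close>
    define s where "s n x = (\<Sum>k<n. complex_of_real (W x) * ((\<i> * complex_of_real (t * X x)) ^ k /\<^sub>R fact k))" for n x
    have s0: "(\<integral>x. s n x \<partial>M) = 0" for n
    proof -
      have "s n = (\<lambda>x. \<Sum>k<n. complex_of_real (W x * X x ^ k) * ((\<i> * complex_of_real t) ^ k /\<^sub>R fact k))"
        by (auto simp: s_def fun_eq_iff power_mult_distrib scaleR_conv_of_real mult_ac)
      moreover have "(\<integral>x. complex_of_real (W x * X x ^ k) * ((\<i> * complex_of_real t) ^ k /\<^sub>R fact k) \<partial>M) = 0" for k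
        using mom[of k] by (simp only: integral_mult_left_zero integral_complex_of_real of_real_0 mult_zero_left)
      moreover have "integrable M (\<lambda>x. complex_of_real (W x * X x ^ k) * ((\<i> * complex_of_real t) ^ k /\<^sub>R fact k))" for k
        by (intro integrable_mult_left integrable_of_real intWX)
      ultimately show ?thesis by (simp only: Bochner_Integration.integral_sum sum.neutral_const)
    qed
    have "(\<lambda>n. \<integral>x. s n x \<partial>M) \<longlonglongrightarrow> (\<integral>x. complex_of_real (W x) * iexp (t * X x) \<partial>M)"
    proof (rule integral_dominated_convergence)
      show "integrable M (\<lambda>x. \<bar>W x * exp (\<bar>t\<bar> * \<bar>X x\<bar>)\<bar>)" using int[of "\<bar>t\<bar>"] by (rule integrable_abs)
      show "AE x in M. (\<lambda>n. s n x) \<longlonglongrightarrow> complex_of_real (W x) * iexp (t * X x)"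
        unfolding s_def sum_distrib_left[symmetric]
        unfolding exp_def by (intro AE_I2 tendsto_mult tendsto_const summable_LIMSEQ summable_exp_generic)
      show "AE x in M. norm (s n x) \<le> \<bar>W x * exp (\<bar>t\<bar> * \<bar>X x\<bar>)\<bar>" for n
      proof (rule AE_I2)
        fix x
        have "norm (s n x) = \<bar>W x\<bar> * norm (\<Sum>k<n. (\<i> * complex_of_real (t * X x)) ^ k /\<^sub>R fact k)"
          unfolding s_def sum_distrib_left[symmetric] by (simp only: norm_mult norm_of_real)
        also have "norm (\<Sum>k<n. (\<i> * complex_of_real (t * X x)) ^ k /\<^sub>R fact k) \<le> (\<Sum>k<n. \<bar>t * X x\<bar> ^ k /\<^sub>R fact k)"
          by (rule order_trans[OF norm_sum]) (auto intro!: sum_mono simp: norm_mult norm_power abs_mult)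
        also have "\<dots> \<le> exp \<bar>t * X x\<bar>"
          unfolding exp_def by (intro sum_le_suminf summable_exp_generic) auto
        finally show "norm (s n x) \<le> \<bar>W x * exp (\<bar>t\<bar> * \<bar>X x\<bar>)\<bar>"
          by (simp add: abs_mult mult_left_mono)
      qed
      show "s n \<in> borel_measurable M" for n unfolding s_def[abs_def] by measurable
    qed measurable
    then show ?thesis by (simp add: s0 LIMSEQ_const_iff)
  qed
  \<comment> \<open>Positive and negative part of \<open>W\<close> have the same mass
    \<open>m\<close>, by the zeroth moment. If \<open>m\<close> is positive, dividing by it makes
    the images under \<open>X\<close> of the two densities probability laws on the line, which are
    determined by their characteristic functions.\<close>
  define P where "P x = max 0 (W x)" for x
  define N where "N x = max 0 (- W x)" for x
  have [measurable]: "P \<in> borel_measurable M" "N \<in> borel_measurable M"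
    unfolding P_def[abs_def] N_def[abs_def] by measurable
  have PN: "W x = P x - N x" "0 \<le> P x" "0 \<le> N x" for x by (auto simp: P_def N_def)
  have intP: "integrable M P" "integrable M N"
    unfolding P_def[abs_def] N_def[abs_def] using intW by (auto intro!: integrable_max)
  define m where "m = (\<integral>x. P x \<partial>M)"
  have mN: "(\<integral>x. N x \<partial>M) = m"
    using mom[of 0] intP unfolding PN(1) by (simp add: m_def)
  have eqB: "(\<integral>x. P x * indicator B (X x) \<partial>M) = (\<integral>x. N x * indicator B (X x) \<partial>M)"
  proof (cases "m = 0")
    case True
    then have "AE x in M. P x = 0" "AE x in M. N x = 0"
      using integral_nonneg_eq_0_iff_AE[OF intP(1)] integral_nonneg_eq_0_iff_AE[OF intP(2)] PN mN
      by (auto simp: m_def)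
    then have "AE x in M. P x * indicator B (X x) = N x * indicator B (X x)"
      by eventually_elim simp
    then show ?thesis by (intro integral_cong_AE) auto
  next
    case False
    moreover have "0 \<le> m" using PN by (simp add: m_def)
    ultimately have m: "0 < m" by simp
    define D where "D V = distr (density M (\<lambda>x. ennreal (V x / m))) borel X" for V :: "'a \<Rightarrow> real"
    have D: "real_distribution (D V)" "char (D V) t = (\<integral>x. complex_of_real (V x) * iexp (t * X x) \<partial>M) / m"
      "measure (D V) B = (\<integral>x. V x * indicator B (X x) \<partial>M) / m"
      if [measurable]: "V \<in> borel_measurable M" and V: "integrable M V" "\<And>x. 0 \<le> V x" "(\<integral>x. V x \<partial>M) = m" for V t
    proof -
      have "emeasure (density M (\<lambda>x. ennreal (V x / m))) (space M) = (\<integral>\<^sup>+x. ennreal (V x / m) \<partial>M)"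
        by (subst emeasure_density) (auto intro!: nn_integral_cong)
      also have "\<dots> = ennreal (\<integral>x. V x / m \<partial>M)"
        using V m by (intro nn_integral_eq_integral) auto
      also have "\<dots> = 1" using V m by simp
      finally interpret V: prob_space "density M (\<lambda>x. ennreal (V x / m))"
        by (intro prob_spaceI) simp
      show "real_distribution (D V)" unfolding D_def by (rule V.real_distribution_distr) simp
      have "char (D V) t = (\<integral>x. (V x / m) *\<^sub>R iexp (t * X x) \<partial>M)"
        unfolding char_def D_def using V m by (simp add: integral_distr integral_density)
      then show "char (D V) t = (\<integral>x. complex_of_real (V x) * iexp (t * X x) \<partial>M) / m"
        by (simp add: scaleR_conv_of_real)
      have "measure (D V) B = (\<integral>x. indicator B x \<partial>D V)" by (simp add: D_def)
      also have "\<dots> = (\<integral>x. indicator B (X x) \<partial>density M (\<lambda>x. ennreal (V x / m)))"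
        unfolding D_def by (rule integral_distr) measurable
      also have "\<dots> = (\<integral>x. (V x / m) *\<^sub>R indicator B (X x) \<partial>M)"
        using V m by (intro integral_density) auto
      finally show "measure (D V) B = (\<integral>x. V x * indicator B (X x) \<partial>M) / m" by simp
    qed
    have intc: "integrable M (\<lambda>x. complex_of_real (V x) * iexp (t * X x))"
      if [measurable]: "V \<in> borel_measurable M" and V: "integrable M V" for V :: "'a \<Rightarrow> real" and t
      by (rule Bochner_Integration.integrable_bound[OF V]) (auto simp: norm_mult)
    have "char (D P) = char (D N)"
    proof
      fix t
      have "(\<integral>x. complex_of_real (W x) * iexp (t * X x) \<partial>M) =
        (\<integral>x. complex_of_real (P x) * iexp (t * X x) \<partial>M) - (\<integral>x. complex_of_real (N x) * iexp (t * X x) \<partial>M)"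
        unfolding PN(1) of_real_diff left_diff_distrib by (intro Bochner_Integration.integral_diff intc intP) measurable
      then show "char (D P) t = char (D N) t"
        using char0[of t] intP PN mN by (simp add: D m_def)
    qed
    then have "D P = D N"
      using intP PN mN by (intro Levy_uniqueness D) (auto simp: m_def)
    then have "measure (D P) B = measure (D N) B" by simp
    then show ?thesis using m intP PN mN by (simp add: D m_def)
  qed
  have "integrable M (\<lambda>x. V x * indicator B (X x))"
    if [measurable]: "V \<in> borel_measurable M" and V: "integrable M V" for V :: "'a \<Rightarrow> real"
    by (rule Bochner_Integration.integrable_bound[OF V]) (auto simp: indicator_def)
  then show ?thesis using eqB intP unfolding PN(1) by (simp add: left_diff_distrib)
qed

text \<open>The factors of the Hermite product are replaced by indicator functions one coordinate
  after the other.\<close>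

lemma hermite_orthogonal_box:
  fixes w :: "(nat \<Rightarrow> real) \<Rightarrow> real"
  assumes w: "square_integrable_on gaussian_product w"
    and orth: "\<And>\<nu>. \<nu> \<in> multi_indices \<Longrightarrow> (\<integral>y. w y * hermite_multi \<nu> y \<partial>gaussian_product) = 0"
    and B: "\<And>j. B j \<in> sets borel" and \<nu>: "\<nu> \<in> multi_indices" "\<And>j. j < k \<Longrightarrow> \<nu> j = 0"
  shows "(\<integral>y. w y * (\<Prod>j<k. indicator (B j) (y j)) * hermite_multi \<nu> y \<partial>gaussian_product) = 0"
  using \<nu>
proof (induction k arbitrary: \<nu>)
  case 0
  then show ?case using orth by simp
next
  case (Suc k)
  note [measurable] = B square_integrable_on_measurable[OF w]
  define I where "I y = (\<Prod>j<k. indicator (B j) (y j) :: real)" for y :: "nat \<Rightarrow> real"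
  have [measurable]: "I \<in> borel_measurable gaussian_product"
    unfolding I_def[abs_def] by measurable
  have I01: "\<bar>I y\<bar> \<le> 1" for y
    unfolding I_def abs_prod by (intro prod_le_1) (auto simp: indicator_def)
  define S where "S = insert k {j. \<nu> j \<noteq> 0}"
  have S: "finite S" using Suc.prems by (simp add: S_def multi_indices_def)
  define W where "W y = w y * I y * hermite_multi \<nu> y" for y
  have [measurable]: "W \<in> borel_measurable gaussian_product" unfolding W_def[abs_def] by measurable
  \<comment> \<open>Since \<open>\<nu> k = 0\<close>, the product for \<nu> contains no polynomial
    in \<open>y k\<close>, and one of any degree can be adjoined.\<close>
  have upd: "hermite_multi (\<nu>(k := i)) y = hermite i (y k) * hermite_multi \<nu> y" for i y
  proof -
    have "hermite_multi (\<nu>(k := i)) y = (\<Prod>j\<in>insert k (S - {k}). hermite ((\<nu>(k := i)) j) (y j))"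
      using S by (intro hermite_multi_eq_prod) (auto simp: S_def)
    also have "\<dots> = hermite i (y k) * (\<Prod>j\<in>S - {k}. hermite (\<nu> j) (y j))"
      using S by (subst prod.insert) (auto intro!: prod.cong)
    also have "(\<Prod>j\<in>S - {k}. hermite (\<nu> j) (y j)) = hermite_multi \<nu> y"
      using S Suc.prems(2)[of k] by (intro hermite_multi_eq_prod[symmetric]) (auto simp: S_def)
    finally show ?thesis .
  qed
  have idx: "\<nu>(k := i) \<in> multi_indices" for i
  proof -
    have "{j. (\<nu>(k := i)) j \<noteq> 0} \<subseteq> S" by (auto simp: S_def)
    from finite_subset[OF this S] show ?thesis unfolding multi_indices_def by simp
  qed
  have int: "integrable gaussian_product (\<lambda>y. w y * I y * (hermite_multi \<nu> y * g (y k)))"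
    if g: "g \<in> borel_measurable borel" "exp_bounded g" for g
  proof -
    have "square_integrable_on gaussian_product (\<lambda>y. \<Prod>j\<in>S. hermite (\<nu> j) (y j) * (if j = k then g (y j) else 1))"
    proof (rule square_integrable_prod_coordinates[OF S])
      show "exp_bounded (\<lambda>t. hermite (\<nu> j) t * (if j = k then g t else 1))" for j
        by (cases "j = k") (auto intro!: exp_bounded_mult exp_bounded_hermite g exp_bounded_const)
    qed (use g(1) in measurable)
    moreover have "hermite_multi \<nu> y = (\<Prod>j\<in>S. hermite (\<nu> j) (y j))" for y
      by (rule hermite_multi_eq_prod[OF S]) (auto simp: S_def)
    then have "(\<lambda>y. \<Prod>j\<in>S. hermite (\<nu> j) (y j) * (if j = k then g (y j) else 1)) =
        (\<lambda>y. hermite_multi \<nu> y * g (y k))"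
      using S by (simp add: prod.distrib) (simp add: S_def)
    ultimately have "square_integrable_on gaussian_product (\<lambda>y. hermite_multi \<nu> y * g (y k))"
      by simp
    from integrable_norm_mult_norm[OF w this] show ?thesis
    proof (rule Bochner_Integration.integrable_bound)
      have [measurable]: "(\<lambda>y. g (y k)) \<in> borel_measurable gaussian_product"
        using g(1) by measurable
      show "(\<lambda>y. w y * I y * (hermite_multi \<nu> y * g (y k))) \<in> borel_measurable gaussian_product"
        by measurable
      have "\<bar>w y\<bar> * \<bar>I y\<bar> * \<bar>hermite_multi \<nu> y * g (y k)\<bar> \<le> \<bar>w y\<bar> * 1 * \<bar>hermite_multi \<nu> y * g (y k)\<bar>" for y
        by (intro mult_right_mono mult_left_mono I01) auto
      then show "AE y in gaussian_product. norm (w y * I y * (hermite_multi \<nu> y * g (y k))) \<le>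
          norm (norm (w y) * norm (hermite_multi \<nu> y * g (y k)))"
        by (intro AE_I2) (simp add: abs_mult mult_ac)
    qed
  qed
  \<comment> \<open>\<open>W\<close> already contains the indicators of the first \<open>k\<close>
    coordinates. The induction hypothesis for all \<open>\<nu>(k := i)\<close> says that it is
    orthogonal to every polynomial in \<open>y k\<close>, so the indicator of \<open>B k\<close> may
    be inserted.\<close>
  have "(\<integral>y. W y * indicator (B k) (y k) \<partial>gaussian_product) = 0"
  proof (rule gaussian_product.vanishing_moments)
    show "integrable gaussian_product (\<lambda>y. W y * exp (c * \<bar>y k\<bar>))" for c
    proof -
      have "exp_bounded (\<lambda>t. exp (c * \<bar>t\<bar>))"
        by (rule exp_boundedI[of "\<bar>c\<bar>" _ 1]) (auto intro!: mult_right_mono)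
      from int[OF _ this] show ?thesis unfolding W_def by (simp add: mult_ac)
    qed
    show "(\<integral>y. W y * y k ^ n \<partial>gaussian_product) = 0" for n
    proof -
      obtain a where a: "\<And>t. t ^ n = (\<Sum>i\<le>n. a i * hermite i t)"
        using power_in_span_hermite by blast
      have "(\<integral>y. W y * y k ^ n \<partial>gaussian_product) =
          (\<integral>y. (\<Sum>i\<le>n. a i * (w y * I y * (hermite_multi \<nu> y * hermite i (y k)))) \<partial>gaussian_product)"
        unfolding a W_def by (simp add: sum_distrib_left mult_ac)
      also have "\<dots> = (\<Sum>i\<le>n. a i * (\<integral>y. w y * I y * (hermite_multi \<nu> y * hermite i (y k)) \<partial>gaussian_product))"
        by (subst Bochner_Integration.integral_sum)
           (auto intro!: integrable_mult_right int exp_bounded_hermite)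
      also have "(\<lambda>i. \<integral>y. w y * I y * (hermite_multi \<nu> y * hermite i (y k)) \<partial>gaussian_product) = (\<lambda>i. 0)"
      proof
        fix i
        have "(\<integral>y. w y * (\<Prod>j<k. indicator (B j) (y j)) * hermite_multi (\<nu>(k := i)) y \<partial>gaussian_product) = 0"
          by (rule Suc.IH[OF idx]) (use Suc.prems(2) in simp)
        then show "(\<integral>y. w y * I y * (hermite_multi \<nu> y * hermite i (y k)) \<partial>gaussian_product) = 0"
          by (simp only: upd I_def mult_ac)
      qed
      finally show ?thesis by simp
    qed
  qed (use B in measurable)
  then show ?case by (simp add: W_def I_def mult_ac)
qed

text \<open>Testing with a vector \<open>v\<close> reduces the claim to a scalar function. Its
  integrals over boxes vanish, so its positive and negative part are densities of measures that
  agree on cylinder sets, hence everywhere; and a function all of whose set integrals vanish is zero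
  almost everywhere.\<close>

lemma hermite_complete:
  fixes R :: "(nat \<Rightarrow> real) \<Rightarrow> 'h::{real_inner, banach, second_countable_topology}"
  assumes R: "square_integrable_on gaussian_product R"
    and orth: "\<And>\<nu>. \<nu> \<in> multi_indices \<Longrightarrow> hermite.coef R \<nu> = 0"
  shows "AE y in gaussian_product. R y = 0"
proof -
  note [measurable] = square_integrable_on_measurable[OF R]
  have intR: "integrable gaussian_product R"
    by (rule gaussian_product.integrable_square_integrable[OF R])
  have "set_lebesgue_integral gaussian_product A R \<bullet> v = 0" if A: "A \<in> sets gaussian_product" for A v
  proof -
    note [measurable] = A
    define w where "w y = R y \<bullet> v" for y
    have w: "square_integrable_on gaussian_product w"
    proof (rule square_integrable_on_bound)
      show "integrable gaussian_product (\<lambda>y. (norm v)\<^sup>2 * (norm (R y))\<^sup>2)"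
        using R by (auto simp: square_integrable_on_def)
      have "(norm (w y))\<^sup>2 \<le> (norm (R y) * norm v)\<^sup>2" for y
        unfolding w_def real_norm_def by (intro power_mono Cauchy_Schwarz_ineq2) simp
      then show "AE y in gaussian_product. (norm (w y))\<^sup>2 \<le> (norm v)\<^sup>2 * (norm (R y))\<^sup>2"
        by (intro AE_I2) (simp add: power_mult_distrib mult_ac)
    qed (unfold w_def[abs_def], measurable)
    note [measurable] = square_integrable_on_measurable[OF w]
    have intw: "integrable gaussian_product w"
      by (rule gaussian_product.integrable_square_integrable[OF w])
    have wH: "(\<integral>y. w y * hermite_multi \<nu> y \<partial>gaussian_product) = 0" if \<nu>: "\<nu> \<in> multi_indices" for \<nu>
    proof -
      have "(\<integral>y. w y * hermite_multi \<nu> y \<partial>gaussian_product) = (\<integral>y. (hermite_multi \<nu> y *\<^sub>R R y) \<bullet> v \<partial>gaussian_product)"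
        by (simp add: w_def mult_ac)
      also have "\<dots> = hermite.coef R \<nu> \<bullet> v"
        unfolding hermite.coef_def by (intro integral_inner_left hermite.coef_integrable R \<nu>)
      finally show ?thesis using orth[OF \<nu>] by simp
    qed
    have zero: "(\<lambda>_. 0) \<in> multi_indices" by (simp add: multi_indices_def)
    have box: "(\<integral>y. w y * (\<Prod>j<k. indicator (B j) (y j)) \<partial>gaussian_product) = 0"
      if "\<And>j. B j \<in> sets borel" for B k
      using hermite_orthogonal_box[OF w wH that zero, of k] by (simp add: hermite_multi_def)
    define P where "P y = max 0 (w y)" for y
    define N where "N y = max 0 (- w y)" for y
    have [measurable]: "P \<in> borel_measurable gaussian_product" "N \<in> borel_measurable gaussian_product"
      unfolding P_def[abs_def] N_def[abs_def] by measurable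
    have PN: "w y = P y - N y" "0 \<le> P y" "0 \<le> N y" for y by (auto simp: P_def N_def)
    have intP: "integrable gaussian_product P" "integrable gaussian_product N"
      unfolding P_def[abs_def] N_def[abs_def] using intw by (auto intro!: integrable_max)
    have ind: "integrable gaussian_product (\<lambda>y. V y * indicator C y)"
      if [measurable]: "C \<in> sets gaussian_product" and V: "integrable gaussian_product V" for V :: "_ \<Rightarrow> real" and C
      using integrable_mult_indicator[OF that(1) V] by (simp add: mult.commute)
    have em: "emeasure (density gaussian_product (\<lambda>y. ennreal (V y))) C = ennreal (\<integral>y. V y * indicator C y \<partial>gaussian_product)"
      if [measurable]: "C \<in> sets gaussian_product" and V: "integrable gaussian_product V" "\<And>y. 0 \<le> V y" for V C
    proof -
      have [measurable]: "V \<in> borel_measurable gaussian_product" using V by simp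
      have "emeasure (density gaussian_product (\<lambda>y. ennreal (V y))) C = (\<integral>\<^sup>+y. ennreal (V y * indicator C y) \<partial>gaussian_product)"
        by (subst emeasure_density) (auto intro!: nn_integral_cong simp: indicator_def)
      also have "\<dots> = ennreal (\<integral>y. V y * indicator C y \<partial>gaussian_product)"
        using V ind[OF that(1) V(1)] by (intro nn_integral_eq_integral) auto
      finally show ?thesis .
    qed
    have "density gaussian_product (\<lambda>y. ennreal (P y)) = density gaussian_product (\<lambda>y. ennreal (N y))"
    proof (rule measure_eqI_PiM_infinite)
      show "sets (density gaussian_product (\<lambda>y. ennreal (P y))) = sets (Pi\<^sub>M UNIV (\<lambda>_. borel))"
        "sets (density gaussian_product (\<lambda>y. ennreal (N y))) = sets (Pi\<^sub>M UNIV (\<lambda>_. borel))"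
        by (simp_all add: sets_gaussian_product)
      show "finite_measure (density gaussian_product (\<lambda>y. ennreal (P y)))"
        using em[OF sets.top intP(1) PN(2)] by (intro finite_measureI) simp
      fix A :: "nat \<Rightarrow> real set" and J :: "nat set"
      assume J: "finite J" and A: "\<And>j. j \<in> J \<Longrightarrow> A j \<in> sets borel"
      obtain k where k: "\<And>j. j \<in> J \<Longrightarrow> j < k" using J finite_nat_set_iff_bounded by auto
      \<comment> \<open>The box lemma speaks of an initial segment of coordinates; those outside
        \<open>J\<close> are left unconstrained.\<close>
      define B where "B j = (if j \<in> J then A j else UNIV)" for j
      have B: "B j \<in> sets borel" for j using A by (simp add: B_def)
      let ?E = "prod_emb UNIV (\<lambda>_. borel) J (Pi\<^sub>E J A)"
      have E: "?E = {y. \<forall>j<k. y j \<in> B j}"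
        using k by (auto simp: prod_emb_def space_PiM B_def PiE_iff)
      have indE: "indicator ?E y = (\<Prod>j<k. indicator (B j) (y j) :: real)" for y
        unfolding E by (auto simp: indicator_def prod_zero_iff)
      have Es: "?E \<in> sets gaussian_product"
        unfolding sets_gaussian_product using J A by (intro sets_PiM_I) auto
      have "(\<integral>y. P y * indicator ?E y \<partial>gaussian_product) - (\<integral>y. N y * indicator ?E y \<partial>gaussian_product) =
          (\<integral>y. w y * indicator ?E y \<partial>gaussian_product)"
        unfolding PN(1) by (simp add: left_diff_distrib ind[OF Es] intP)
      also have "\<dots> = 0" unfolding indE by (rule box[OF B])
      finally show "emeasure (density gaussian_product (\<lambda>y. ennreal (P y))) ?E = emeasure (density gaussian_product (\<lambda>y. ennreal (N y))) ?E"
        by (simp add: em Es intP PN)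
    qed
    then have "emeasure (density gaussian_product (\<lambda>y. ennreal (P y))) A = emeasure (density gaussian_product (\<lambda>y. ennreal (N y))) A"
      by simp
    then have "(\<integral>y. P y * indicator A y \<partial>gaussian_product) = (\<integral>y. N y * indicator A y \<partial>gaussian_product)"
      using PN by (simp add: em A intP)
    then have "(\<integral>y. w y * indicator A y \<partial>gaussian_product) = 0"
      unfolding PN(1) by (simp add: left_diff_distrib ind[OF A] intP)
    moreover have "set_lebesgue_integral gaussian_product A R \<bullet> v = (\<integral>y. (indicator A y *\<^sub>R R y) \<bullet> v \<partial>gaussian_product)"
      unfolding set_lebesgue_integral_def
      by (intro integral_inner_left[symmetric] integrable_mult_indicator A intR)
    ultimately show ?thesis by (simp add: w_def mult_ac)
  qed
  then have "set_lebesgue_integral gaussian_product A R = 0" if "A \<in> sets gaussian_product" for A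
    using that inner_eq_zero_iff by blast
  then show ?thesis by (intro gaussian_product.density_zero[OF intR])
qed

lemmas hermite_remainder_le = hermite.remainder_le[OF hermite_complete countable_multi_indices]

section \<open>The Poincare inequality\<close>

text \<open>By translation invariance all difference quotients in direction \<open>b\<close> have
  integral 0. They are uniformly bounded and supported in a fixed ball, so dominated convergence
  passes to the derivative.\<close>

lemma integral_directional_derivative_eq_0:
  fixes h :: "'a::euclidean_space \<Rightarrow> real"
  assumes deriv: "\<And>x. (h has_derivative h' x) (at x)" and cont: "continuous_on UNIV (\<lambda>x. h' x b)"
    and zero: "\<And>x. norm x > R \<Longrightarrow> h x = 0"
  shows "(\<integral>x. h' x b \<partial>lborel) = 0"
proof -
  \<comment> \<open>The steps have length at most \<open>norm b\<close>, so outside this ball both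
    values in a difference quotient vanish.\<close>
  define R' where "R' = \<bar>R\<bar> + norm b"
  have conth: "continuous_on UNIV h"
    using deriv by (intro continuous_at_imp_continuous_on) (auto intro: has_derivative_continuous)
  have hint: "integrable lborel h"
  proof -
    have "integrable lborel (\<lambda>x. indicator (cball 0 R) x *\<^sub>R h x)"
      by (intro borel_integrable_compact continuous_on_subset[OF conth]) auto
    also have "(\<lambda>x. indicator (cball 0 R) x *\<^sub>R h x) = h"
      using zero by (auto simp: indicator_def fun_eq_iff)
    finally show ?thesis .
  qed
  have [measurable]: "h \<in> borel_measurable borel" by (rule borel_measurable_continuous_onI[OF conth])
  have [measurable]: "(\<lambda>x. h' x b) \<in> borel_measurable borel" by (rule borel_measurable_continuous_onI[OF cont])
  \<comment> \<open>The larger ball contains the intermediate points supplied by the mean value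
    theorem.\<close>
  have "compact ((\<lambda>x. h' x b) ` cball 0 (R' + norm b))"
    by (intro compact_continuous_image continuous_on_subset[OF cont]) auto
  then obtain C where C: "\<And>x. norm x \<le> R' + norm b \<Longrightarrow> \<bar>h' x b\<bar> \<le> C"
    unfolding compact_eq_bounded_closed bounded_iff by fastforce
  define s where "s n x = real (Suc n) * (h (x + b /\<^sub>R real (Suc n)) - h x)" for n x
  have trans: "(\<integral>x. h (x + c) \<partial>lborel) = (\<integral>x. h x \<partial>lborel)" "integrable lborel (\<lambda>x. h (x + c))" for c
  proof -
    have d: "distr lborel borel ((+) c) = (lborel :: 'a measure)" by (rule lborel_distr_plus)
    have "(\<integral>x. h x \<partial>distr lborel borel ((+) c)) = (\<integral>x. h (c + x) \<partial>lborel)"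
      by (rule integral_distr) measurable
    then show "(\<integral>x. h (x + c) \<partial>lborel) = (\<integral>x. h x \<partial>lborel)" unfolding d by (simp add: add.commute)
    have "integrable (distr lborel borel ((+) c)) h" unfolding d by (rule hint)
    from integrable_distr[OF _ this] show "integrable lborel (\<lambda>x. h (x + c))" by (simp add: add.commute)
  qed
  have "(\<lambda>n. \<integral>x. s n x \<partial>lborel) \<longlonglongrightarrow> (\<integral>x. h' x b \<partial>lborel)"
  proof (rule integral_dominated_convergence)
    show "integrable lborel (\<lambda>x::'a. indicator (cball 0 R') x *\<^sub>R C)"
      by (intro borel_integrable_compact) auto
    show "AE x in lborel. (\<lambda>n. s n x) \<longlonglongrightarrow> h' x b"
    proof (rule AE_I2)
      fix x
      interpret bounded_linear "h' x" using deriv by (rule has_derivative_bounded_linear)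
      have "((\<lambda>t. x + t *\<^sub>R b) has_derivative (\<lambda>t. t *\<^sub>R b)) (at 0)"
        by (auto intro!: derivative_eq_intros)
      from has_derivative_compose[OF this, of h "h' x"]
      have "((\<lambda>t. h (x + t *\<^sub>R b)) has_derivative (\<lambda>t. h' x (t *\<^sub>R b))) (at 0)"
        by (simp add: deriv)
      then have "((\<lambda>t. h (x + t *\<^sub>R b)) has_real_derivative h' x b) (at 0)"
        by (simp add: has_field_derivative_def scaleR mult.commute[of _ "h' x b"])
      then have *: "((\<lambda>t. (h (x + t *\<^sub>R b) - h x) / t) \<longlongrightarrow> h' x b) (at 0)"
        by (simp add: DERIV_def)
      have "filterlim (\<lambda>n. inverse (real (Suc n))) (at 0) sequentially"
        unfolding filterlim_at using LIMSEQ_inverse_real_of_nat by simp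
      from filterlim_compose[OF * this] show "(\<lambda>n. s n x) \<longlonglongrightarrow> h' x b"
        unfolding s_def by (simp add: divide_inverse mult.commute)
    qed
    show "AE x in lborel. norm (s n x) \<le> indicator (cball 0 R') x *\<^sub>R C" for n
    proof (rule AE_I2)
      fix x
      define c where "c = b /\<^sub>R real (Suc n)"
      have nc: "norm c \<le> norm b"
        unfolding c_def by (simp add: divide_simps mult_le_cancel_left1)
      show "norm (s n x) \<le> indicator (cball 0 R') x *\<^sub>R C"
      proof (cases "norm x \<le> R'")
        case True
        have "\<exists>t\<in>{0<..<1}. h (x + 1 *\<^sub>R c) - h (x + 0 *\<^sub>R c) = h' (x + t *\<^sub>R c) ((1 - 0) *\<^sub>R c)"
        proof (rule mvt_simple)
          fix t :: real
          have "((\<lambda>t. x + t *\<^sub>R c) has_derivative (\<lambda>t. t *\<^sub>R c)) (at t)"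
            by (auto intro!: derivative_eq_intros)
          from has_derivative_compose[OF this deriv]
          show "((\<lambda>t. h (x + t *\<^sub>R c)) has_derivative (\<lambda>s. h' (x + t *\<^sub>R c) (s *\<^sub>R c))) (at t within {0..1})"
            by (rule has_derivative_at_withinI)
        qed simp
        then obtain t where t: "0 < t" "t < 1" "h (x + c) - h x = h' (x + t *\<^sub>R c) c" by auto
        interpret bounded_linear "h' (x + t *\<^sub>R c)" using deriv by (rule has_derivative_bounded_linear)
        have "norm (x + t *\<^sub>R c) \<le> R' + norm b"
        proof -
          have "norm (t *\<^sub>R c) \<le> norm c" using t by (simp add: mult_left_le_one_le)
          then show ?thesis using norm_triangle_ineq[of x "t *\<^sub>R c"] True nc by linarith
        qed
        moreover have "s n x = h' (x + t *\<^sub>R c) b"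
        proof -
          have "s n x = real (Suc n) * h' (x + t *\<^sub>R c) c" using t(3) by (simp only: s_def c_def)
          also have "\<dots> = h' (x + t *\<^sub>R c) b"
            unfolding scaleR[of "inverse (real (Suc n))" b, folded c_def] by (simp del: of_nat_Suc)
          finally show ?thesis .
        qed
        ultimately show ?thesis using C True by (simp add: indicator_def)
      next
        case False
        have "norm (x + c) > R"
          using norm_triangle_ineq2[of x "- c"] nc False by (simp add: R'_def; linarith)
        moreover have "norm x > R" using False by (simp add: R'_def; smt (verit) norm_ge_zero)
        ultimately have "s n x = 0" using zero by (simp add: s_def c_def)
        then show ?thesis using False by (simp add: indicator_def)
      qed
    qed
    show "s n \<in> borel_measurable lborel" for n unfolding s_def by measurable
  qed measurable
  moreover have "(\<integral>x. s n x \<partial>lborel) = 0" for n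
  proof -
    have "(\<integral>x. s n x \<partial>lborel) = real (Suc n) * ((\<integral>x. h (x + b /\<^sub>R real (Suc n)) \<partial>lborel) - (\<integral>x. h x \<partial>lborel))"
      unfolding s_def integral_mult_right_zero
      by (subst Bochner_Integration.integral_diff[OF trans(2) hint]) simp
    then show ?thesis by (simp only: trans(1) diff_self mult_zero_right)
  qed
  ultimately show ?thesis by (simp add: LIMSEQ_const_iff)
qed

section \<open>Test functions, their gradients and the Poincare estimate\<close>

lemma test_function_derivative:
  assumes "\<phi> \<in> test_functions D"
  shows "(\<phi> has_derivative frechet_derivative \<phi> (at x)) (at x)"
    "continuous_on UNIV (\<lambda>x. frechet_derivative \<phi> (at x) h)"
    "continuous_on UNIV \<phi>"
proof -
  have C: "Ck_fun k \<phi>" for k using assms by (auto simp: test_functions_def)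
  show "(\<phi> has_derivative frechet_derivative \<phi> (at x)) (at x)"
    using C[of "Suc 0"] frechet_derivative_works by auto
  show "continuous_on UNIV (\<lambda>x. frechet_derivative \<phi> (at x) h)" using C[of "Suc 0"] by simp
  show "continuous_on UNIV \<phi>" using C[of 0] by simp
qed

lemma gradient_inner_Basis:
  assumes "b \<in> Basis"
  shows "gradient \<phi> x \<bullet> b = frechet_derivative \<phi> (at x) b"
proof -
  have "gradient \<phi> x \<bullet> b = (\<Sum>c\<in>Basis. if c = b then frechet_derivative \<phi> (at x) c else 0)"
    unfolding gradient_def inner_sum_left using assms by (intro sum.cong) (auto simp: inner_Basis)
  then show ?thesis using assms by simp
qed

lemma test_function_eq_0:
  assumes "\<phi> \<in> test_functions D" "x \<notin> D"
  shows "\<phi> x = 0" "gradient \<phi> x = 0"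
proof -
  let ?K = "closure {x. \<phi> x \<noteq> 0}"
  have x: "x \<notin> ?K" using assms by (auto simp: test_functions_def)
  have zero: "\<phi> z = 0" if "z \<notin> ?K" for z
    using that subsetD[OF closure_subset[of "{x. \<phi> x \<noteq> 0}"], of z] by auto
  show "\<phi> x = 0" using zero x by blast
  have "(\<phi> has_derivative (\<lambda>h. 0)) (at x)"
  proof (rule has_derivative_transform_within_open)
    show "((\<lambda>_. 0 :: real) has_derivative (\<lambda>h. 0)) (at x)" by simp
    show "open (- ?K)" by (simp add: open_Compl)
    show "x \<in> - ?K" using x by simp
    show "0 = \<phi> z" if "z \<in> - ?K" for z using zero[of z] that by simp
  qed
  then have "frechet_derivative \<phi> (at x) = (\<lambda>h. 0)"
    by (rule frechet_derivative_at[symmetric])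
  then show "gradient \<phi> x = 0" by (simp add: gradient_def)
qed

text \<open>The derivative of \<open>(x \<bullet> b) * (\<phi> x)\<^sup>2\<close> in direction
  \<open>b\<close> has integral 0, which expresses the integral of the square of \<phi> through a
  mixed term with the derivative. On \<open>D\<close> the factor \<open>x \<bullet> b\<close> is at
  most \<open>R\<close>, and Young's inequality absorbs half of the left side; this is the origin of
  the constant \<open>2 * R\<close>.\<close>

lemma Poincare_test_function:
  fixes D :: "'a::euclidean_space set"
  assumes D: "\<And>x. x \<in> D \<Longrightarrow> norm x \<le> R" and \<phi>: "\<phi> \<in> test_functions D" and R: "0 \<le> R"
  shows "norm (mk_L2 \<phi>) \<le> 2 * R * norm (mk_L2 (gradient \<phi>))"
proof -
  obtain b :: 'a where b: "b \<in> Basis" using nonempty_Basis by blast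
  define d where "d x = frechet_derivative \<phi> (at x) b" for x
  note \<phi>' = test_function_derivative[OF \<phi>]
  have contd: "continuous_on UNIV d" unfolding d_def by (rule \<phi>'(2))
  define h' where "h' x v = (v \<bullet> b) * (\<phi> x)\<^sup>2 + (x \<bullet> b) * (2 * \<phi> x * frechet_derivative \<phi> (at x) v)" for x v
  have "((\<lambda>x. (x \<bullet> b) * (\<phi> x)\<^sup>2) has_derivative h' x) (at x)" for x
    unfolding h'_def[abs_def] by (rule derivative_eq_intros \<phi>'(1) refl)+ (auto simp: fun_eq_iff algebra_simps)
  moreover have "continuous_on UNIV (\<lambda>x. h' x b)"
    unfolding h'_def by (intro continuous_intros \<phi>')
  moreover have "(x \<bullet> b) * (\<phi> x)\<^sup>2 = 0" if "norm x > R" for x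
    using D[of x] that test_function_eq_0[OF \<phi>, of x] by (cases "x \<in> D") auto
  ultimately have "(\<integral>x. h' x b \<partial>lborel) = 0" by (rule integral_directional_derivative_eq_0)
  moreover have h'b: "h' x b = (\<phi> x)\<^sup>2 + 2 * (x \<bullet> b) * \<phi> x * d x" for x
    using b by (simp add: h'_def d_def)
  ultimately have 0: "(\<integral>x. (\<phi> x)\<^sup>2 + 2 * (x \<bullet> b) * \<phi> x * d x \<partial>lborel) = 0" by simp
  note sq = square_integrable_test_function[OF \<phi>]
  have i1: "integrable lborel (\<lambda>x. (\<phi> x)\<^sup>2)" using sq(1) by (simp add: square_integrable_def)
  have i2: "integrable lborel (\<lambda>x. (norm (gradient \<phi> x))\<^sup>2)" using sq(2) by (simp add: square_integrable_def)
  have pt: "(1/2) * (\<phi> x)\<^sup>2 - 2 * R\<^sup>2 * (norm (gradient \<phi> x))\<^sup>2 \<le> (\<phi> x)\<^sup>2 + 2 * (x \<bullet> b) * \<phi> x * d x"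
    and bd: "\<bar>(\<phi> x)\<^sup>2 + 2 * (x \<bullet> b) * \<phi> x * d x\<bar> \<le> 2 * (\<phi> x)\<^sup>2 + 2 * R\<^sup>2 * (norm (gradient \<phi> x))\<^sup>2" for x
  proof -
    have "\<bar>2 * (x \<bullet> b) * \<phi> x * d x\<bar> \<le> (1/2) * (\<phi> x)\<^sup>2 + 2 * R\<^sup>2 * (norm (gradient \<phi> x))\<^sup>2"
    proof (cases "x \<in> D")
      case True
      have "\<bar>x \<bullet> b\<bar> \<le> R" using Basis_le_norm[OF b, of x] D[OF True] by linarith
      moreover have "\<bar>d x\<bar> \<le> norm (gradient \<phi> x)"
        using Basis_le_norm[OF b, of "gradient \<phi> x"] by (simp add: gradient_inner_Basis[OF b] d_def)
      ultimately have "\<bar>x \<bullet> b\<bar> * \<bar>d x\<bar> \<le> R * norm (gradient \<phi> x)" using R by (intro mult_mono) auto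
      then have "2 * \<bar>\<phi> x\<bar> * (\<bar>x \<bullet> b\<bar> * \<bar>d x\<bar>) \<le> 2 * \<bar>\<phi> x\<bar> * (R * norm (gradient \<phi> x))"
        by (intro mult_left_mono) auto
      also have "\<dots> \<le> (1/2) * (\<phi> x)\<^sup>2 + 2 * (R * norm (gradient \<phi> x))\<^sup>2"
      proof -
        have "0 \<le> 2 * (\<bar>\<phi> x\<bar> / 2 - R * norm (gradient \<phi> x))\<^sup>2" by simp
        then show ?thesis by (simp add: power2_diff field_simps)
      qed
      finally show ?thesis by (simp add: abs_mult power_mult_distrib mult_ac)
    qed (simp add: test_function_eq_0[OF \<phi>])
    then show "(1/2) * (\<phi> x)\<^sup>2 - 2 * R\<^sup>2 * (norm (gradient \<phi> x))\<^sup>2 \<le> (\<phi> x)\<^sup>2 + 2 * (x \<bullet> b) * \<phi> x * d x"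
      and "\<bar>(\<phi> x)\<^sup>2 + 2 * (x \<bullet> b) * \<phi> x * d x\<bar> \<le> 2 * (\<phi> x)\<^sup>2 + 2 * R\<^sup>2 * (norm (gradient \<phi> x))\<^sup>2"
      using zero_le_power2[of "\<phi> x"] by linarith+
  qed
  have [measurable]: "\<phi> \<in> borel_measurable borel" "d \<in> borel_measurable borel"
    by (auto intro!: borel_measurable_continuous_onI contd \<phi>'(3))
  have "(\<integral>x. (1/2) * (\<phi> x)\<^sup>2 - 2 * R\<^sup>2 * (norm (gradient \<phi> x))\<^sup>2 \<partial>lborel) \<le>
      (\<integral>x. (\<phi> x)\<^sup>2 + 2 * (x \<bullet> b) * \<phi> x * d x \<partial>lborel)"
  proof (rule integral_mono[OF _ _ pt])
    show "integrable lborel (\<lambda>x. (\<phi> x)\<^sup>2 + 2 * (x \<bullet> b) * \<phi> x * d x)"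
      by (rule Bochner_Integration.integrable_bound[of _ "\<lambda>x. 2 * (\<phi> x)\<^sup>2 + 2 * R\<^sup>2 * (norm (gradient \<phi> x))\<^sup>2"])
         (auto simp: bd intro!: Bochner_Integration.integrable_add integrable_mult_right i1 i2 AE_I2 order_trans[OF _ abs_ge_self])
  qed (intro Bochner_Integration.integrable_diff integrable_mult_right i1 i2)
  then have "(1/2) * (\<integral>x. (\<phi> x)\<^sup>2 \<partial>lborel) \<le> 2 * R\<^sup>2 * (\<integral>x. (norm (gradient \<phi> x))\<^sup>2 \<partial>lborel)"
    unfolding 0 using i1 i2 by simp
  then have "(norm (mk_L2 \<phi>))\<^sup>2 \<le> (2 * R * norm (mk_L2 (gradient \<phi>)))\<^sup>2"
    unfolding power_mult_distrib norm_mk_L2_sq[OF sq(1)] norm_mk_L2_sq[OF sq(2)] by simp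
  then show ?thesis by (rule power2_le_imp_le) (use R in simp)
qed

section \<open>The space \<open>H\<^sup>1\<^sub>0\<close> as a closed subspace\<close>

lemma Ck_fun_add: "Ck_fun k f \<Longrightarrow> Ck_fun k g \<Longrightarrow> Ck_fun k (\<lambda>x. f x + g x)"
proof (induction k arbitrary: f g)
  case (Suc k)
  have "frechet_derivative (\<lambda>x. f x + g x) (at x) h = frechet_derivative f (at x) h + frechet_derivative g (at x) h" for x h
  proof -
    have "((\<lambda>x. f x + g x) has_derivative (\<lambda>h. frechet_derivative f (at x) h + frechet_derivative g (at x) h)) (at x)"
      using Suc.prems by (intro has_derivative_add) (auto simp: frechet_derivative_works)
    then show ?thesis by (simp add: frechet_derivative_at[symmetric])
  qed
  then show ?case using Suc by (auto intro!: differentiable_add)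
qed (auto intro: continuous_intros)

lemma Ck_fun_scaleR: "Ck_fun k f \<Longrightarrow> Ck_fun k (\<lambda>x. c * f x)"
proof (induction k arbitrary: f)
  case (Suc k)
  have "frechet_derivative (\<lambda>x. c * f x) (at x) h = c * frechet_derivative f (at x) h" for x h
  proof -
    have "((\<lambda>x. c * f x) has_derivative (\<lambda>h. c * frechet_derivative f (at x) h)) (at x)"
      using Suc.prems by (intro has_derivative_mult_right) (auto simp: frechet_derivative_works)
    then show ?thesis by (simp add: frechet_derivative_at[symmetric])
  qed
  then show ?case using Suc by auto
qed (auto intro: continuous_intros)

lemma gradient_add:
  assumes "\<phi> \<in> test_functions D" "\<psi> \<in> test_functions D'"
  shows "gradient (\<lambda>x. \<phi> x + \<psi> x) x = gradient \<phi> x + gradient \<psi> x"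
proof -
  have "((\<lambda>x. \<phi> x + \<psi> x) has_derivative (\<lambda>h. frechet_derivative \<phi> (at x) h + frechet_derivative \<psi> (at x) h)) (at x)"
    by (intro has_derivative_add test_function_derivative(1)[OF assms(1)] test_function_derivative(1)[OF assms(2)])
  then show ?thesis
    unfolding gradient_def by (simp add: frechet_derivative_at[symmetric] scaleR_add_left sum.distrib)
qed

lemma gradient_scale:
  assumes "\<phi> \<in> test_functions D"
  shows "gradient (\<lambda>x. c * \<phi> x) x = c *\<^sub>R gradient \<phi> x"
proof -
  have "((\<lambda>x. c * \<phi> x) has_derivative (\<lambda>h. c * frechet_derivative \<phi> (at x) h)) (at x)"
    by (intro has_derivative_mult_right test_function_derivative[OF assms])
  then show ?thesis
    unfolding gradient_def by (simp add: frechet_derivative_at[symmetric] scaleR_sum_right)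
qed

lemma test_functions_add:
  assumes "\<phi> \<in> test_functions D" "\<psi> \<in> test_functions D"
  shows "(\<lambda>x. \<phi> x + \<psi> x) \<in> test_functions D"
proof -
  let ?S = "\<lambda>\<phi>. closure {x::'a. \<phi> x \<noteq> (0::real)}"
  have "{x. \<phi> x + \<psi> x \<noteq> 0} \<subseteq> {x. \<phi> x \<noteq> 0} \<union> {x. \<psi> x \<noteq> 0}" by auto
  then have sub: "?S (\<lambda>x. \<phi> x + \<psi> x) \<subseteq> ?S \<phi> \<union> ?S \<psi>"
    unfolding closure_Un[symmetric] by (rule closure_mono)
  have "compact ((?S \<phi> \<union> ?S \<psi>) \<inter> ?S (\<lambda>x. \<phi> x + \<psi> x))"
    using assms by (intro compact_Int_closed compact_Un closed_closure) (auto simp: test_functions_def)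
  then have "compact (?S (\<lambda>x. \<phi> x + \<psi> x))" unfolding Int_absorb1[OF sub] .
  then show ?thesis using sub assms by (auto simp: test_functions_def Ck_fun_add)
qed

lemma test_functions_scale:
  assumes "\<phi> \<in> test_functions D"
  shows "(\<lambda>x. c * \<phi> x) \<in> test_functions D"
proof -
  let ?S = "\<lambda>\<phi>. closure {x::'a. \<phi> x \<noteq> (0::real)}"
  have sub: "?S (\<lambda>x. c * \<phi> x) \<subseteq> ?S \<phi>" by (intro closure_mono) auto
  have "compact (?S \<phi> \<inter> ?S (\<lambda>x. c * \<phi> x))"
    using assms by (intro compact_Int_closed closed_closure) (auto simp: test_functions_def)
  then have "compact (?S (\<lambda>x. c * \<phi> x))" unfolding Int_absorb1[OF sub] .
  then show ?thesis using sub assms by (auto simp: test_functions_def Ck_fun_scaleR)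
qed

lemma zero_test_function: "(\<lambda>x. 0) \<in> test_functions D"
proof -
  have "Ck_fun k (\<lambda>x::'a. 0)" for k
  proof (induction k)
    case (Suc k)
    have "frechet_derivative (\<lambda>x::'a. 0::real) (at x) = (\<lambda>h. 0)" for x
      by (rule frechet_derivative_at[symmetric]) simp
    then show ?case using Suc by simp
  qed simp
  then show ?thesis by (simp add: test_functions_def)
qed

lemma closure_subspace_subspace:
  fixes S :: "'h::real_normed_vector set"
  assumes S: "subspace S"
  shows "subspace (closure S)"
  unfolding subspace_def
proof (intro conjI ballI allI)
  show "0 \<in> closure S" using S closure_subset by (auto simp: subspace_def)
next
  fix x y assume "x \<in> closure S" "y \<in> closure S"
  then obtain f g where "\<forall>n::nat. f n \<in> S" "f \<longlonglongrightarrow> x" "\<forall>n::nat. g n \<in> S" "g \<longlonglongrightarrow> y"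
    unfolding closure_sequential by blast
  then have "\<forall>n. f n + g n \<in> S" "(\<lambda>n. f n + g n) \<longlonglongrightarrow> x + y"
    using S by (auto simp: subspace_def intro: tendsto_add)
  then show "x + y \<in> closure S"
    unfolding closure_sequential by (intro exI[of _ "\<lambda>n. f n + g n"] conjI)
next
  fix c x assume "x \<in> closure S"
  then obtain f where "\<forall>n::nat. f n \<in> S" "f \<longlonglongrightarrow> x" unfolding closure_sequential by blast
  then have "\<forall>n. c *\<^sub>R f n \<in> S" "(\<lambda>n. c *\<^sub>R f n) \<longlonglongrightarrow> c *\<^sub>R x"
    using S by (auto simp: subspace_def intro: tendsto_intros)
  then show "c *\<^sub>R x \<in> closure S"
    unfolding closure_sequential by (intro exI[of _ "\<lambda>n. c *\<^sub>R f n"] conjI)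
qed

lemma subspace_H1_0: "subspace (H1_0 D)"
  unfolding H1_0_def
proof (rule closure_subspace_subspace, unfold subspace_def, intro conjI ballI allI)
  let ?I = "\<lambda>\<phi>. (mk_L2 \<phi>, mk_L2 (gradient \<phi>))"
  have "gradient (\<lambda>x::'a. 0) = (\<lambda>x. 0)"
    using test_function_eq_0[OF zero_test_function[of "{}"]] by auto
  then show "0 \<in> ?I ` test_functions D"
    by (intro image_eqI[OF _ zero_test_function]) (simp add: mk_L2_zero zero_prod_def)
  fix v assume "v \<in> ?I ` test_functions D"
  then obtain \<phi> where \<phi>: "\<phi> \<in> test_functions D" "v = ?I \<phi>" by blast
  note s1 = square_integrable_test_function[OF \<phi>(1)]
  show "c *\<^sub>R v \<in> ?I ` test_functions D" for c
    by (rule image_eqI[OF _ test_functions_scale[OF \<phi>(1), of c]])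
       (simp add: \<phi>(2) s1 mk_L2_scaleR gradient_scale[OF \<phi>(1), abs_def])
  fix w assume "w \<in> ?I ` test_functions D"
  then obtain \<psi> where \<psi>: "\<psi> \<in> test_functions D" "w = ?I \<psi>" by blast
  note s2 = square_integrable_test_function[OF \<psi>(1)]
  show "v + w \<in> ?I ` test_functions D"
    by (rule image_eqI[OF _ test_functions_add[OF \<phi>(1) \<psi>(1)]])
       (simp add: \<phi>(2) \<psi>(2) s1 s2 mk_L2_add gradient_add[OF \<phi>(1) \<psi>(1), abs_def])
qed

lemma closed_H1_0: "closed (H1_0 D)"
  by (simp add: H1_0_def)

text \<open>The estimate for test functions is a closed condition, so it survives the closure. It
  makes \<open>V_norm\<close> equivalent to the product norm on \<open>H1_0\<close>, as coercivity
  in a complete space demands.\<close>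

lemma Poincare:
  fixes D :: "'a::euclidean_space set"
  assumes "bounded D"
  obtains C where "0 \<le> C" "\<And>v. v \<in> H1_0 D \<Longrightarrow> norm v \<le> C * V_norm v"
proof -
  obtain R where R: "\<And>x. x \<in> D \<Longrightarrow> norm x \<le> R" using assms by (auto simp: bounded_iff)
  define C where "C = 1 + 2 * \<bar>R\<bar>"
  have C: "norm v \<le> C * V_norm v" if v: "v \<in> H1_0 D" for v
  proof -
    let ?S = "{v::'a H1. norm (fst v) \<le> 2 * \<bar>R\<bar> * norm (snd v)}"
    have "H1_0 D \<subseteq> ?S"
      unfolding H1_0_def
    proof (rule closure_minimal)
      show "(\<lambda>\<phi>. (mk_L2 \<phi>, mk_L2 (gradient \<phi>))) ` test_functions D \<subseteq> ?S"
        using Poincare_test_function[of D "\<bar>R\<bar>"] order_trans[OF R abs_ge_self] by auto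
      show "closed ?S" by (intro closed_Collect_le continuous_intros)
    qed
    then have "norm (fst v) \<le> 2 * \<bar>R\<bar> * norm (snd v)" using v by auto
    then show ?thesis
      using norm_Pair_le[of "fst v" "snd v"] by (simp add: C_def V_norm_def algebra_simps)
  qed
  show ?thesis by (rule that[OF _ C]) (simp_all add: C_def)
qed

lemma V_norm_le_norm: "V_norm v \<le> norm v"
  unfolding V_norm_def by (metis norm_snd_le prod.collapse)

section \<open>Variational problems in \<open>H\<^sup>1\<^sub>0\<close>\<close>

text \<open>The solution minimises \<open>B v v - 2 l v\<close>; by the parallelogram identity minimising sequences
  are Cauchy.\<close>

lemma Lax_Milgram_symmetric:
  fixes B :: "'h::{real_inner, complete_space} \<Rightarrow> 'h \<Rightarrow> real"
  assumes S: "subspace S" "closed S"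
    and sym: "\<And>u v. B u v = B v u"
    and add: "\<And>u v w. B (u + v) w = B u w + B v w" and scale: "\<And>c u v. B (c *\<^sub>R u) v = c * B u v"
    and coercive: "0 < \<alpha>" "\<And>u. u \<in> S \<Longrightarrow> \<alpha> * (norm u)\<^sup>2 \<le> B u u"
    and bounded: "\<And>u v. \<bar>B u v\<bar> \<le> \<beta> * norm u * norm v"
    and l_add: "\<And>u v. u \<in> S \<Longrightarrow> v \<in> S \<Longrightarrow> l (u + v) = l u + l v"
    and l_scale: "\<And>c u. u \<in> S \<Longrightarrow> l (c *\<^sub>R u) = c * l u"
    and l_bounded: "\<And>u. u \<in> S \<Longrightarrow> \<bar>l u\<bar> \<le> K * norm u"
  shows "\<exists>u\<in>S. \<forall>v\<in>S. B u v = l v"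
proof -
  have add': "B w (u + v) = B w u + B w v" and scale': "B v (c *\<^sub>R u) = c * B v u" for u v w c
    using add[of u v w] scale[of c u v] by (simp_all add: sym)
  define J where "J v = B v v - 2 * l v" for v
  have S': "0 \<in> S" "\<And>u v. u \<in> S \<Longrightarrow> v \<in> S \<Longrightarrow> u + v \<in> S" "\<And>c u. u \<in> S \<Longrightarrow> c *\<^sub>R u \<in> S"
    using S(1) by (auto simp: subspace_def)
  \<comment> \<open>Completing the square in \<open>norm v\<close>.\<close>
  have J_bdd: "- K\<^sup>2 / \<alpha> \<le> J v" if "v \<in> S" for v
  proof -
    have "0 \<le> (\<alpha> * norm v - K)\<^sup>2 / \<alpha>" using coercive(1) by simp
    also have "\<dots> = \<alpha> * (norm v)\<^sup>2 - 2 * (K * norm v) + K\<^sup>2 / \<alpha>"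
      using coercive(1) by (simp add: power2_eq_square field_simps)
    finally show ?thesis unfolding J_def using coercive(2)[OF that] l_bounded[OF that] by simp
  qed
  define m where "m = Inf (J ` S)"
  have bb: "bdd_below (J ` S)" using J_bdd by (intro bdd_belowI2[of _ "- K\<^sup>2 / \<alpha>"])
  have m_le: "m \<le> J v" if "v \<in> S" for v unfolding m_def using that by (intro cInf_lower bb) auto
  have "\<exists>v\<in>S. J v < m + inverse (real (Suc n))" for n
  proof -
    have "Inf (J ` S) < m + inverse (real (Suc n))" by (simp add: m_def)
    then show ?thesis using cInf_lessD[of "J ` S" "m + inverse (real (Suc n))"] S'(1) by auto
  qed
  then obtain x where x: "\<And>n. x n \<in> S" "\<And>n. J (x n) < m + inverse (real (Suc n))" by metis
  \<comment> \<open>Parallelogram identity for the energy: the midpoint lies in \<open>S\<close>, so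
    its functional value is at least the infimum \<open>m\<close>.\<close>
  have par: "\<alpha> * (norm (u - v))\<^sup>2 \<le> 2 * (J u + J v - 2 * m)" if "u \<in> S" "v \<in> S" for u v
  proof -
    have d: "u - v \<in> S" using S'(2)[OF that(1) S'(3)[OF that(2), of "-1"]] by simp
    have h: "(1/2) *\<^sub>R (u + v) \<in> S" by (intro S' that)
    have "B (u - v) (u - v) = 2 * (J u + J v) - 4 * J ((1/2) *\<^sub>R (u + v))"
    proof -
      have "u - v = u + (-1) *\<^sub>R v" by simp
      then have "B (u - v) (u - v) = B u u - 2 * B u v + B v v"
        by (simp only: add add' scale scale') (simp add: sym)
      moreover have "J ((1/2) *\<^sub>R (u + v)) = (B u u + 2 * B u v + B v v) / 4 - (l u + l v)"
        unfolding J_def l_scale[OF S'(2)[OF that]] l_add[OF that]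
        by (simp only: add add' scale scale') (simp add: sym[of v u] field_simps)
      ultimately show ?thesis unfolding J_def[of u] J_def[of v] by (simp add: field_simps)
    qed
    then show ?thesis using coercive(2)[OF d] m_le[OF h] by simp
  qed
  have "Cauchy x"
  proof (rule metric_CauchyI)
    fix e :: real assume "e > 0"
    then have "0 < \<alpha> * e\<^sup>2 / 4" using coercive(1) by simp
    then obtain N where N: "inverse (real (Suc N)) < \<alpha> * e\<^sup>2 / 4" using reals_Archimedean by blast
    have Jn: "J (x n) < m + \<alpha> * e\<^sup>2 / 4" if "n \<ge> N" for n
    proof -
      have "inverse (real (Suc n)) \<le> inverse (real (Suc N))" using that by (intro le_imp_inverse_le) auto
      then show ?thesis using x(2)[of n] N by linarith
    qed
    show "\<exists>M. \<forall>m\<ge>M. \<forall>n\<ge>M. dist (x m) (x n) < e"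
    proof (intro exI[of _ N] allI impI)
      fix i j assume "N \<le> i" "N \<le> j"
      then have "\<alpha> * (norm (x i - x j))\<^sup>2 < \<alpha> * e\<^sup>2"
      proof -
        have *: "p < q" if "p \<le> 2 * (r + r' - 2 * m)" "r < m + q / 4" "r' < m + q / 4" for p q r r' :: real
          using that by (simp add: field_simps)
        show ?thesis
          by (rule *[OF par[OF x(1)[of i] x(1)[of j]] Jn[OF \<open>N \<le> i\<close>] Jn[OF \<open>N \<le> j\<close>]])
      qed
      then have "(norm (x i - x j))\<^sup>2 < e\<^sup>2" using coercive(1) by simp
      then show "dist (x i) (x j) < e" unfolding dist_norm by (rule power_less_imp_less_base) (use \<open>e > 0\<close> in simp)
    qed
  qed
  then obtain u where u: "x \<longlonglongrightarrow> u" by (auto simp: Cauchy_convergent_iff convergent_def)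
  have uS: "u \<in> S" using closed_sequentially[OF S(2) x(1) u] .
  have diffS: "v - w \<in> S" if "v \<in> S" "w \<in> S" for v w
    using S'(2)[OF that(1) S'(3)[OF that(2), of "-1"]] by simp
  have Ju: "J u \<le> m"
  proof (rule LIMSEQ_le)
    show "(\<lambda>n. J (x n)) \<longlonglongrightarrow> J u"
    proof -
      have nx: "(\<lambda>n. norm (x n - u)) \<longlonglongrightarrow> 0" using u by (simp add: LIM_zero tendsto_norm_zero)
      \<comment> \<open>In the expansion of \<open>J (u + d)\<close> around \<open>u\<close> every
        remaining term is at least of first order in \<open>norm d\<close>.\<close>
      have "(\<lambda>n. J (x n) - J u) \<longlonglongrightarrow> 0"
      proof (rule Lim_null_comparison[OF always_eventually[rule_format]])
        fix n
        define d where "d = x n - u"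
        have dS: "d \<in> S" unfolding d_def by (intro diffS x uS)
        have xn: "x n = u + d" by (simp add: d_def)
        have "J (x n) - J u = 2 * B u d + B d d - 2 * l d"
          unfolding J_def xn l_add[OF uS dS] add add' by (simp add: sym)
        moreover have "\<bar>B u d\<bar> \<le> \<beta> * norm u * norm d" "\<bar>B d d\<bar> \<le> \<beta> * norm d * norm d" "\<bar>l d\<bar> \<le> K * norm d"
          using bounded l_bounded[OF dS] by auto
        ultimately show "norm (J (x n) - J u) \<le>
           (2 * (\<beta> * norm u) + \<beta> * norm (x n - u) + 2 * K) * norm (x n - u)"
          unfolding d_def[symmetric] real_norm_def by (simp add: algebra_simps abs_le_iff)
      next
        show "(\<lambda>n. (2 * (\<beta> * norm u) + \<beta> * norm (x n - u) + 2 * K) * norm (x n - u)) \<longlonglongrightarrow> 0"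
          by (rule tendsto_eq_intros nx refl)+ simp
      qed
      then show ?thesis by (simp add: LIM_zero_iff)
    qed
    show "(\<lambda>n. m + inverse (real (Suc n))) \<longlonglongrightarrow> m"
      by (rule LIMSEQ_inverse_real_of_nat_add)
    show "\<exists>N. \<forall>n\<ge>N. J (x n) \<le> m + inverse (real (Suc n))" using x(2) less_imp_le by blast
  qed
  have "B u v = l v" if v: "v \<in> S" for v
  proof -
    have q: "0 \<le> 2 * t * (B u v - l v) + t\<^sup>2 * B v v" for t
    proof -
      have tv: "t *\<^sub>R v \<in> S" by (intro S' v)
      have "J u \<le> J (u + t *\<^sub>R v)" using Ju m_le[OF S'(2)[OF uS tv]] by simp
      also have "\<dots> = J u + (2 * t * (B u v - l v) + t\<^sup>2 * B v v)"
        unfolding J_def l_add[OF uS tv] l_scale[OF v] add add' scale scale'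
        by (simp add: sym[of v u] power2_eq_square algebra_simps)
      finally show ?thesis by simp
    qed
    define b where "b = B u v - l v"
    \<comment> \<open>The quadratic in \<open>t\<close> is tested at \<open>- b / c\<close>, close
      to its minimiser; the summand 1 keeps the quotient meaningful when \<open>B v v\<close> is
      0.\<close>
    define c where "c = \<bar>B v v\<bar> + 1"
    have "0 < c" by (simp add: c_def)
    have "0 \<le> 2 * (- b / c) * b + (- b / c)\<^sup>2 * B v v" using q[of "- b / c"] by (simp add: b_def)
    also have "\<dots> \<le> 2 * (- b / c) * b + (- b / c)\<^sup>2 * c"
      by (intro add_left_mono mult_left_mono) (auto simp: c_def)
    also have "\<dots> = - b\<^sup>2 / c" using \<open>0 < c\<close> by (simp add: power2_eq_square field_simps)
    finally have "b\<^sup>2 \<le> 0" using \<open>0 < c\<close> by (simp add: field_simps)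
    then show ?thesis by (simp add: b_def)
  qed
  then show ?thesis using uS by blast
qed

section \<open>Energy forms with bounded coefficients\<close>

definition bounded_borel :: "('a::euclidean_space \<Rightarrow> real) \<Rightarrow> bool" where
  "bounded_borel w \<longleftrightarrow> w \<in> borel_measurable borel \<and> (\<exists>B. \<forall>x. \<bar>w x\<bar> \<le> B)"

lemma bounded_borelI: "w \<in> borel_measurable borel \<Longrightarrow> (\<And>x. \<bar>w x\<bar> \<le> B) \<Longrightarrow> bounded_borel w"
  by (auto simp: bounded_borel_def)

lemma bounded_borel_measurable [measurable_dest]: "bounded_borel w \<Longrightarrow> w \<in> borel_measurable borel"
  by (simp add: bounded_borel_def)

lemma bounded_borelE:
  assumes "bounded_borel w"
  obtains B where "0 \<le> B" "\<And>x. \<bar>w x\<bar> \<le> B"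
  using assms unfolding bounded_borel_def by (meson abs_ge_zero order_trans)

lemma bounded_borel_const: "bounded_borel (\<lambda>x. c)"
  by (rule bounded_borelI[of _ "\<bar>c\<bar>"]) auto

lemma bounded_borel_mult:
  assumes "bounded_borel w" "bounded_borel w'"
  shows "bounded_borel (\<lambda>x. w x * w' x)"
proof -
  note [measurable] = assms[THEN bounded_borel_measurable]
  obtain B B' where "0 \<le> B" "\<And>x. \<bar>w x\<bar> \<le> B" "0 \<le> B'" "\<And>x. \<bar>w' x\<bar> \<le> B'"
    using assms by (metis bounded_borelE)
  then show ?thesis by (intro bounded_borelI[of _ "B * B'"]) (auto simp: abs_mult intro!: mult_mono)
qed

lemma bounded_borel_add:
  assumes "bounded_borel w" "bounded_borel w'"
  shows "bounded_borel (\<lambda>x. w x + w' x)"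
proof -
  note [measurable] = assms[THEN bounded_borel_measurable]
  obtain B B' where "\<And>x. \<bar>w x\<bar> \<le> B" "\<And>x. \<bar>w' x\<bar> \<le> B'"
    using assms by (metis bounded_borelE)
  then show ?thesis
    by (intro bounded_borelI[of _ "B + B'"]) (auto intro!: abs_triangle_ineq[THEN order_trans] add_mono)
qed

lemma bounded_borel_scale: "bounded_borel w \<Longrightarrow> bounded_borel (\<lambda>x. c * w x)"
  by (intro bounded_borel_mult bounded_borel_const)

lemma bounded_borel_diff: "bounded_borel w \<Longrightarrow> bounded_borel w' \<Longrightarrow> bounded_borel (\<lambda>x. w x - w' x)"
  using bounded_borel_add[OF _ bounded_borel_scale[of w' "-1"], of w] by simp

lemma bounded_borel_sum: "(\<And>i. i \<in> I \<Longrightarrow> bounded_borel (w i)) \<Longrightarrow> bounded_borel (\<lambda>x. \<Sum>i\<in>I. w i x)"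
  by (induction I rule: infinite_finite_induct) (auto intro: bounded_borel_const bounded_borel_add)

lemma bounded_borel_abs: "bounded_borel w \<Longrightarrow> bounded_borel (\<lambda>x. \<bar>w x\<bar>)"
  by (auto simp: bounded_borel_def)

text \<open>The integral runs over the whole space. Gradients of elements of \<open>H1_0 D\<close>
  vanish almost everywhere outside \<open>D\<close>, so for them this is the form of the weak
  formulation, and no restricted measure has to be carried along.\<close>

definition aform :: "('a::euclidean_space \<Rightarrow> real) \<Rightarrow> 'a H1 \<Rightarrow> 'a H1 \<Rightarrow> real" where
  "aform w u v = (\<integral>x. w x * (weak_grad u x \<bullet> weak_grad v x) \<partial>lborel)"

lemma measurable_weak_grad [measurable]: "weak_grad u \<in> borel_measurable borel"
  unfolding weak_grad_def using measurable_rep_L2[of "snd u"] by simp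

lemma integrable_weak_grad: "integrable lborel (\<lambda>x. (norm (weak_grad u x))\<^sup>2)"
  using square_integrable_rep[of "snd u"] by (simp add: weak_grad_def square_integrable_def)

lemma V_norm_square: "(V_norm u)\<^sup>2 = (\<integral>x. (norm (weak_grad u x))\<^sup>2 \<partial>lborel)"
  using norm_mk_L2_sq[of "rep_L2 (snd u)"] by (simp add: V_norm_def weak_grad_def)

lemma V_norm_nonneg [simp]: "0 \<le> V_norm u"
  by (simp add: V_norm_def)

lemma integrable_aform:
  assumes "bounded_borel w"
  shows "integrable lborel (\<lambda>x. w x * (weak_grad u x \<bullet> weak_grad v x))"
proof -
  note [measurable] = assms[THEN bounded_borel_measurable]
  obtain B where B: "0 \<le> B" "\<And>x. \<bar>w x\<bar> \<le> B" using bounded_borelE[OF assms] by blast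
  have i: "integrable lborel (\<lambda>x. B * (weak_grad u x \<bullet> weak_grad v x))"
    unfolding weak_grad_def by (intro integrable_mult_right square_integrable_inner) auto
  show ?thesis
    by (rule Bochner_Integration.integrable_bound[OF i])
       (use B in \<open>auto simp: abs_mult intro!: mult_right_mono\<close>)
qed

lemma weak_grad_add: "AE x in lborel. weak_grad (u + v) x = weak_grad u x + weak_grad v x"
proof -
  have "mk_L2 (\<lambda>x. rep_L2 (snd u) x + rep_L2 (snd v) x) = snd u + snd v"
    by (subst mk_L2_add[symmetric]) auto
  moreover have "square_integrable (\<lambda>x. rep_L2 (snd u) x + rep_L2 (snd v) x)"
    by (intro square_integrable_add) auto
  ultimately show ?thesis
    using rep_mk_L2[of "\<lambda>x. rep_L2 (snd u) x + rep_L2 (snd v) x"] by (simp add: weak_grad_def)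
qed

lemma weak_grad_scaleR: "AE x in lborel. weak_grad (c *\<^sub>R u) x = c *\<^sub>R weak_grad u x"
proof -
  have "mk_L2 (\<lambda>x. c *\<^sub>R rep_L2 (snd u) x) = c *\<^sub>R snd u"
    by (subst mk_L2_scaleR[symmetric]) auto
  moreover have "square_integrable (\<lambda>x. c *\<^sub>R rep_L2 (snd u) x)"
    by (intro square_integrable_scaleR) auto
  ultimately show ?thesis
    using rep_mk_L2[of "\<lambda>x. c *\<^sub>R rep_L2 (snd u) x"] by (simp add: weak_grad_def)
qed

lemma aform_commute: "aform w u v = aform w v u"
  by (simp add: aform_def inner_commute)

lemma aform_add_left:
  assumes w: "bounded_borel w"
  shows "aform w (u + u') v = aform w u v + aform w u' v"
proof -
  note [measurable] = w[THEN bounded_borel_measurable]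
  have "aform w (u + u') v = (\<integral>x. w x * (weak_grad u x \<bullet> weak_grad v x) + w x * (weak_grad u' x \<bullet> weak_grad v x) \<partial>lborel)"
    unfolding aform_def using weak_grad_add[of u u']
    by (intro integral_cong_AE) (auto elim!: eventually_mono simp: inner_add_left algebra_simps)
  then show ?thesis using integrable_aform[OF w] by (simp add: aform_def)
qed

lemma aform_scaleR_left:
  assumes w: "bounded_borel w"
  shows "aform w (c *\<^sub>R u) v = c * aform w u v"
proof -
  note [measurable] = w[THEN bounded_borel_measurable]
  have "aform w (c *\<^sub>R u) v = (\<integral>x. c * (w x * (weak_grad u x \<bullet> weak_grad v x)) \<partial>lborel)"
    unfolding aform_def using weak_grad_scaleR[of c u]
    by (intro integral_cong_AE) (auto elim!: eventually_mono)
  then show ?thesis by (simp add: aform_def)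
qed

lemma aform_add_right: "bounded_borel w \<Longrightarrow> aform w v (u + u') = aform w v u + aform w v u'"
  using aform_add_left[of w u u' v] by (simp add: aform_commute)

lemma aform_scaleR_right: "bounded_borel w \<Longrightarrow> aform w v (c *\<^sub>R u) = c * aform w v u"
  using aform_scaleR_left[of w c u v] by (simp add: aform_commute)

lemma aform_diff_left: "bounded_borel w \<Longrightarrow> aform w (u - u') v = aform w u v - aform w u' v"
  using aform_add_left[of w u "(-1) *\<^sub>R u'" v] aform_scaleR_left[of w "-1" u' v] by simp

lemma aform_coeff_scale: "aform (\<lambda>x. c * w x) u v = c * aform w u v"
  by (simp add: aform_def mult.assoc)

lemma aform_coeff_diff:
  "bounded_borel w \<Longrightarrow> bounded_borel w' \<Longrightarrow> aform (\<lambda>x. w x - w' x) u v = aform w u v - aform w' u v"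
  unfolding aform_def left_diff_distrib by (intro Bochner_Integration.integral_diff integrable_aform)

lemma aform_coeff_sum:
  assumes "\<And>i. i \<in> I \<Longrightarrow> bounded_borel (w i)"
  shows "aform (\<lambda>x. \<Sum>i\<in>I. w i x) u v = (\<Sum>i\<in>I. aform (w i) u v)"
  unfolding aform_def sum_distrib_right
  by (intro Bochner_Integration.integral_sum integrable_aform assms)

lemma aform_diag_mono:
  assumes "bounded_borel w" "bounded_borel w'" "\<And>x. w x \<le> w' x"
  shows "aform w u u \<le> aform w' u u"
  unfolding aform_def
  by (intro integral_mono integrable_aform assms mult_right_mono) auto

lemma aform_const: "aform (\<lambda>x. c) u u = c * (V_norm u)\<^sup>2"
  by (simp add: aform_def V_norm_square power2_norm_eq_inner)

text \<open>Young's inequality is applied under the integral, so the weight \<bar>w\<bar> is kept in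
  both energies. Sums over many weights can then be taken pointwise before any estimate of the
  energies.\<close>

lemma aform_Young:
  assumes w: "bounded_borel w"
  shows "\<bar>aform w u v\<bar> \<le> (aform (\<lambda>x. \<bar>w x\<bar>) u u + aform (\<lambda>x. \<bar>w x\<bar>) v v) / 2"
proof -
  note i = integrable_aform[OF bounded_borel_abs[OF w]]
  have "\<bar>aform w u v\<bar> \<le> (\<integral>x. \<bar>w x * (weak_grad u x \<bullet> weak_grad v x)\<bar> \<partial>lborel)"
    unfolding aform_def by (rule integral_abs_bound)
  also have "\<dots> \<le> (\<integral>x. (\<bar>w x\<bar> * (weak_grad u x \<bullet> weak_grad u x) + \<bar>w x\<bar> * (weak_grad v x \<bullet> weak_grad v x)) / 2 \<partial>lborel)"
  proof (rule integral_mono)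
    fix x
    have "\<bar>weak_grad u x \<bullet> weak_grad v x\<bar> \<le> norm (weak_grad u x) * norm (weak_grad v x)"
      by (rule Cauchy_Schwarz_ineq2)
    also have "\<dots> \<le> (weak_grad u x \<bullet> weak_grad u x + weak_grad v x \<bullet> weak_grad v x) / 2"
      using sum_squares_bound[of "norm (weak_grad u x)" "norm (weak_grad v x)"]
      by (simp add: power2_norm_eq_inner)
    finally have "\<bar>w x\<bar> * \<bar>weak_grad u x \<bullet> weak_grad v x\<bar> \<le> \<bar>w x\<bar> * ((weak_grad u x \<bullet> weak_grad u x + weak_grad v x \<bullet> weak_grad v x) / 2)"
      by (intro mult_left_mono) auto
    then show "\<bar>w x * (weak_grad u x \<bullet> weak_grad v x)\<bar> \<le>
       (\<bar>w x\<bar> * (weak_grad u x \<bullet> weak_grad u x) + \<bar>w x\<bar> * (weak_grad v x \<bullet> weak_grad v x)) / 2"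
      by (simp add: abs_mult distrib_left)
  qed (use integrable_aform[OF w] i in auto)
  also have "\<dots> = (aform (\<lambda>x. \<bar>w x\<bar>) u u + aform (\<lambda>x. \<bar>w x\<bar>) v v) / 2"
    unfolding aform_def using i by simp
  finally show ?thesis .
qed

lemma aform_bound:
  assumes w: "w \<in> borel_measurable borel" "\<And>x. \<bar>w x\<bar> \<le> B"
  shows "\<bar>aform w u v\<bar> \<le> B * V_norm u * V_norm v"
proof -
  have bw: "bounded_borel w" using w by (rule bounded_borelI)
  have B: "0 \<le> B" using w(2)[of undefined] by linarith
  have i: "integrable lborel (\<lambda>x. norm (weak_grad u x) * norm (weak_grad v x))"
  proof (rule Bochner_Integration.integrable_bound[OF Bochner_Integration.integrable_add[OF integrable_weak_grad[of u] integrable_weak_grad[of v]]])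
    have "norm (weak_grad u x) * norm (weak_grad v x) \<le> (norm (weak_grad u x))\<^sup>2 + (norm (weak_grad v x))\<^sup>2" for x
      using sum_squares_bound[of "norm (weak_grad u x)" "norm (weak_grad v x)"]
        mult_nonneg_nonneg[OF norm_ge_zero[of "weak_grad u x"] norm_ge_zero[of "weak_grad v x"]] by linarith
    then show "AE x in lborel. norm (norm (weak_grad u x) * norm (weak_grad v x)) \<le>
        norm ((norm (weak_grad u x))\<^sup>2 + (norm (weak_grad v x))\<^sup>2)" by simp
  qed simp
  have "\<bar>aform w u v\<bar> \<le> (\<integral>x. \<bar>w x * (weak_grad u x \<bullet> weak_grad v x)\<bar> \<partial>lborel)"
    unfolding aform_def by (rule integral_abs_bound)
  also have "\<dots> \<le> (\<integral>x. B * (norm (weak_grad u x) * norm (weak_grad v x)) \<partial>lborel)"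
  proof (rule integral_mono)
    show "\<bar>w x * (weak_grad u x \<bullet> weak_grad v x)\<bar> \<le> B * (norm (weak_grad u x) * norm (weak_grad v x))" for x
      unfolding abs_mult by (intro mult_mono w Cauchy_Schwarz_ineq2 B) auto
  qed (use integrable_aform[OF bw] i in auto)
  also have "\<dots> = B * (\<integral>x. norm (weak_grad u x) * norm (weak_grad v x) \<partial>lborel)" by simp
  also have "(\<integral>x. norm (weak_grad u x) * norm (weak_grad v x) \<partial>lborel) \<le> V_norm u * V_norm v"
  proof -
    have "square_integrable_on lborel (weak_grad u)" for u :: "'a H1"
      using integrable_weak_grad by (simp add: square_integrable_on_def)
    from integral_Cauchy_Schwarz[OF this this, of u v]
    have "(\<integral>x. norm (weak_grad u x) * norm (weak_grad v x) \<partial>lborel)\<^sup>2 \<le> (V_norm u * V_norm v)\<^sup>2"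
      by (simp add: V_norm_square power_mult_distrib)
    then show ?thesis by (rule power2_le_imp_le) simp
  qed
  finally show ?thesis using B by (simp add: mult_left_mono mult.assoc)
qed

section \<open>Solvability, a priori bound and uniqueness of variational problems\<close>

locale bounded_open_set =
  fixes D :: "'a::euclidean_space set"
  assumes bounded_D: "bounded D" and open_D: "open D"
begin

text \<open>Membership in \<open>H_minus1\<close> with the constant made explicit, since it enters
  the bound for the solution.\<close>

definition functional :: "('a H1 \<Rightarrow> real) \<Rightarrow> real \<Rightarrow> bool" where
  "functional l K \<longleftrightarrow> (\<forall>v\<in>H1_0 D. \<forall>w\<in>H1_0 D. l (v + w) = l v + l w) \<and>
     (\<forall>c. \<forall>v\<in>H1_0 D. l (c *\<^sub>R v) = c * l v) \<and> (\<forall>v\<in>H1_0 D. \<bar>l v\<bar> \<le> K * V_norm v)"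

lemma H1_0_0 [simp]: "0 \<in> H1_0 D"
  and H1_0_add: "u \<in> H1_0 D \<Longrightarrow> v \<in> H1_0 D \<Longrightarrow> u + v \<in> H1_0 D"
  and H1_0_scaleR: "u \<in> H1_0 D \<Longrightarrow> c *\<^sub>R u \<in> H1_0 D"
  using subspace_H1_0[of D] by (auto simp: subspace_def)

lemma H1_0_diff: "u \<in> H1_0 D \<Longrightarrow> v \<in> H1_0 D \<Longrightarrow> u - v \<in> H1_0 D"
  using subspace_H1_0 by (rule subspace_diff)

lemma variational_solution_exists:
  assumes a: "bounded_borel a" "0 < \<alpha>" "\<And>x. \<alpha> \<le> a x" and l: "functional l K"
  shows "\<exists>u\<in>H1_0 D. \<forall>v\<in>H1_0 D. aform a u v = l v"
proof -
  obtain C where C: "0 \<le> C" "\<And>v. v \<in> H1_0 D \<Longrightarrow> norm v \<le> C * V_norm v"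
    using Poincare[OF bounded_D] by blast
  obtain B where B: "0 \<le> B" "\<And>x. \<bar>a x\<bar> \<le> B" using bounded_borelE[OF a(1)] by blast
  have K: "\<bar>l v\<bar> \<le> \<bar>K\<bar> * norm v" if "v \<in> H1_0 D" for v
  proof -
    have "\<bar>l v\<bar> \<le> K * V_norm v" using l that by (auto simp: functional_def)
    also have "\<dots> \<le> \<bar>K\<bar> * norm v" by (intro mult_mono V_norm_le_norm) auto
    finally show ?thesis .
  qed
  show ?thesis
  proof (rule Lax_Milgram_symmetric[OF subspace_H1_0 closed_H1_0 aform_commute aform_add_left[OF a(1)] aform_scaleR_left[OF a(1)]])
    \<comment> \<open>\<open>C + 1\<close> replaces \<open>C\<close>, which may be 0, to keep the
      coercivity constant in the product norm meaningful.\<close>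
    show "0 < \<alpha> / (C + 1)\<^sup>2" using a C by simp
    show "\<alpha> / (C + 1)\<^sup>2 * (norm u)\<^sup>2 \<le> aform a u u" if u: "u \<in> H1_0 D" for u
    proof -
      have "norm u \<le> (C + 1) * V_norm u" using C(2)[OF u] V_norm_nonneg[of u] unfolding distrib_right mult_1 by linarith
      then have "(norm u)\<^sup>2 \<le> ((C + 1) * V_norm u)\<^sup>2" by (intro power_mono) auto
      then have "\<alpha> / (C + 1)\<^sup>2 * (norm u)\<^sup>2 \<le> \<alpha> / (C + 1)\<^sup>2 * ((C + 1) * V_norm u)\<^sup>2"
        using a C by (intro mult_left_mono) auto
      also have "\<dots> = \<alpha> * (V_norm u)\<^sup>2" using C(1) by (simp add: power_mult_distrib)
      also have "\<dots> = aform (\<lambda>x. \<alpha>) u u" by (simp add: aform_const)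
      also have "\<dots> \<le> aform a u u" by (intro aform_diag_mono bounded_borel_const a)
      finally show ?thesis .
    qed
    show "\<bar>aform a u v\<bar> \<le> B * norm u * norm v" for u v
    proof -
      have "\<bar>aform a u v\<bar> \<le> B * V_norm u * V_norm v" by (intro aform_bound bounded_borel_measurable a B)
      also have "\<dots> \<le> B * norm u * norm v" using B by (intro mult_mono V_norm_le_norm) auto
      finally show ?thesis .
    qed
  qed (use l K in \<open>auto simp: functional_def\<close>)
qed

lemma V_norm_eq_0: "u \<in> H1_0 D \<Longrightarrow> V_norm u = 0 \<Longrightarrow> u = 0"
  using Poincare[OF bounded_D] by (metis mult_zero_right norm_le_zero_iff)

lemma coercive:
  assumes "bounded_borel a" "\<And>x. \<alpha> \<le> a x"
  shows "\<alpha> * (V_norm u)\<^sup>2 \<le> aform a u u"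
  using aform_diag_mono[OF bounded_borel_const assms] by (simp add: aform_const)

text \<open>Only the energy of \<open>u\<close> itself is estimated in the hypothesis, so the bound
  serves solutions as well as errors that solve a perturbed problem.\<close>

lemma variational_bound:
  assumes a: "bounded_borel a" "0 < \<alpha>" "\<And>x. \<alpha> \<le> a x" and K: "0 \<le> K"
    and le: "aform a u u \<le> K * V_norm u"
  shows "V_norm u \<le> K / \<alpha>"
proof (cases "V_norm u = 0")
  case False
  then have pos: "0 < V_norm u" using V_norm_nonneg[of u] by linarith
  have "\<alpha> * (V_norm u)\<^sup>2 \<le> K * V_norm u"
    using coercive[OF a(1,3), of u] le by linarith
  then have "\<alpha> * V_norm u \<le> K" using pos by (simp add: power2_eq_square)
  then show ?thesis using a(2) by (simp add: pos_le_divide_eq mult.commute)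
qed (use a K in simp)

lemma variational_unique:
  assumes a: "bounded_borel a" "0 < \<alpha>" "\<And>x. \<alpha> \<le> a x" and u: "u \<in> H1_0 D" "u' \<in> H1_0 D"
    and eq: "\<And>v. v \<in> H1_0 D \<Longrightarrow> aform a u v = aform a u' v"
  shows "u = u'"
proof -
  have d: "u - u' \<in> H1_0 D" using u by (rule H1_0_diff)
  have "\<alpha> * (V_norm (u - u'))\<^sup>2 \<le> aform a (u - u') (u - u')" by (rule coercive[OF a(1,3)])
  also have "\<dots> = 0" using eq[OF d] a(1) by (simp add: aform_diff_left)
  finally have "(V_norm (u - u'))\<^sup>2 \<le> 0" using a(2) by (simp add: mult_le_0_iff)
  then have "V_norm (u - u') = 0" by simp
  then show ?thesis using V_norm_eq_0[OF d] by simp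
qed

end

section \<open>Taylor coefficients of the solution\<close>

definition mi_size :: "(nat \<Rightarrow> nat) \<Rightarrow> nat" where
  "mi_size \<mu> = (\<Sum>j | \<mu> j \<noteq> 0. \<mu> j)"

abbreviation mi_zero :: "nat \<Rightarrow> nat" where
  "mi_zero \<equiv> \<lambda>_. 0"

definition mi_pow :: "(nat \<Rightarrow> real) \<Rightarrow> (nat \<Rightarrow> nat) \<Rightarrow> real" where
  "mi_pow \<rho> \<mu> = (\<Prod>j | \<mu> j \<noteq> 0. \<rho> j ^ \<mu> j)"

definition mi_fact :: "(nat \<Rightarrow> nat) \<Rightarrow> real" where
  "mi_fact \<mu> = (\<Prod>j | \<mu> j \<noteq> 0. fact (\<mu> j))"

text \<open>The coefficient of \<open>h\<close> to the power \<mu> in the exponential of the sum of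
  \<open>h j * \<phi> j x\<close>, that is, the relative change of the diffusion coefficient when
  \<open>y\<close> moves by \<open>h\<close>.\<close>

definition exp_coeff :: "(nat \<Rightarrow> 'a \<Rightarrow> real) \<Rightarrow> (nat \<Rightarrow> nat) \<Rightarrow> 'a \<Rightarrow> real" where
  "exp_coeff \<phi> \<mu> x = mi_pow (\<lambda>j. \<phi> j x) \<mu> / mi_fact \<mu>"

lemma zero_multi_index [simp]: "mi_zero \<in> multi_indices"
  by (simp add: multi_indices_def)

lemma multi_indices_down: "\<mu> \<in> multi_indices \<Longrightarrow> \<kappa> \<le> \<mu> \<Longrightarrow> \<kappa> \<in> multi_indices"
proof -
  assume "\<mu> \<in> multi_indices" "\<kappa> \<le> \<mu>"
  moreover have "{j. \<kappa> j \<noteq> 0} \<subseteq> {j. \<mu> j \<noteq> 0}"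
    using \<open>\<kappa> \<le> \<mu>\<close> by (auto simp: le_fun_def) (metis le_zero_eq neq0_conv)
  ultimately show ?thesis by (auto simp: multi_indices_def intro: finite_subset)
qed

lemma diff_le_fun: "\<mu> - \<kappa> \<le> (\<mu> :: nat \<Rightarrow> nat)"
  by (simp add: le_fun_def)

lemma multi_indices_diff: "\<mu> \<in> multi_indices \<Longrightarrow> \<mu> - \<kappa> \<in> multi_indices"
  by (erule multi_indices_down) (rule diff_le_fun)

lemma multi_indices_update: "\<mu> \<in> multi_indices \<Longrightarrow> \<mu>(j := k) \<in> multi_indices"
proof -
  assume "\<mu> \<in> multi_indices"
  moreover have "{i. (\<mu>(j := k)) i \<noteq> 0} \<subseteq> insert j {i. \<mu> i \<noteq> 0}" by auto
  ultimately show ?thesis by (auto simp: multi_indices_def intro: finite_subset[of _ "insert j {i. \<mu> i \<noteq> 0}"] simp del: fun_upd_apply)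
qed

lemma finite_multi_indices_le:
  assumes "\<mu> \<in> multi_indices"
  shows "finite {\<kappa>. \<kappa> \<le> \<mu>}"
proof (rule finite_subset)
  let ?J = "{j. \<mu> j \<noteq> 0}"
  have J: "finite ?J" using assms by (simp add: multi_indices_def)
  show "finite ((\<lambda>f j. if j \<in> ?J then f j else 0) ` PiE ?J (\<lambda>j. {..\<mu> j}))"
    using J by (intro finite_imageI finite_PiE) auto
  show "{\<kappa>. \<kappa> \<le> \<mu>} \<subseteq> (\<lambda>f j. if j \<in> ?J then f j else 0) ` PiE ?J (\<lambda>j. {..\<mu> j})"
  proof
    fix \<kappa> assume "\<kappa> \<in> {\<kappa>. \<kappa> \<le> \<mu>}"
    then have le: "\<kappa> j \<le> \<mu> j" for j by (auto simp: le_fun_def)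
    have "\<kappa> = (\<lambda>j. if j \<in> ?J then restrict \<kappa> ?J j else 0)"
    proof
      fix j show "\<kappa> j = (if j \<in> ?J then restrict \<kappa> ?J j else 0)" using le[of j] by auto
    qed
    moreover have "restrict \<kappa> ?J \<in> PiE ?J (\<lambda>j. {..\<mu> j})" using le by auto
    ultimately show "\<kappa> \<in> (\<lambda>f j. if j \<in> ?J then f j else 0) ` PiE ?J (\<lambda>j. {..\<mu> j})" by blast
  qed
qed

lemma mi_size_eq: "finite J \<Longrightarrow> {j. \<mu> j \<noteq> 0} \<subseteq> J \<Longrightarrow> mi_size \<mu> = (\<Sum>j\<in>J. \<mu> j)"
  unfolding mi_size_def by (intro sum.mono_neutral_left) auto

lemma mi_pow_eq: "finite J \<Longrightarrow> {j. \<mu> j \<noteq> 0} \<subseteq> J \<Longrightarrow> mi_pow \<rho> \<mu> = (\<Prod>j\<in>J. \<rho> j ^ \<mu> j)"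
  unfolding mi_pow_def by (intro prod.mono_neutral_left) auto

lemma mi_fact_eq: "finite J \<Longrightarrow> {j. \<mu> j \<noteq> 0} \<subseteq> J \<Longrightarrow> mi_fact \<mu> = (\<Prod>j\<in>J. fact (\<mu> j))"
  unfolding mi_fact_def by (intro prod.mono_neutral_left) auto

lemma mi_fact_pos: "0 < mi_fact \<mu>"
  unfolding mi_fact_def by (intro prod_pos) auto

lemma mi_size_diff_less:
  assumes \<mu>: "\<mu> \<in> multi_indices" and \<kappa>: "\<kappa> \<le> \<mu>" "\<kappa> \<noteq> mi_zero"
  shows "mi_size (\<mu> - \<kappa>) < mi_size \<mu>"
proof -
  let ?J = "{j. \<mu> j \<noteq> 0}"
  have J: "finite ?J" using \<mu> by (simp add: multi_indices_def)
  obtain j where j: "\<kappa> j \<noteq> 0" using \<kappa>(2) by blast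
  have le: "\<kappa> j \<le> \<mu> j" for j using \<kappa>(1) by (auto simp: le_fun_def)
  have "mi_size (\<mu> - \<kappa>) = (\<Sum>j\<in>?J. (\<mu> - \<kappa>) j)" by (intro mi_size_eq J) auto
  also have "\<dots> < (\<Sum>j\<in>?J. \<mu> j)"
  proof (rule sum_strict_mono_ex1[OF J])
    show "\<exists>i\<in>?J. (\<mu> - \<kappa>) i < \<mu> i" using j le[of j] by (intro bexI[of _ j]) auto
  qed simp
  finally show ?thesis by (simp add: mi_size_def)
qed

lemma exp_coeff_zero [simp]: "exp_coeff \<phi> mi_zero x = 1"
  by (simp add: exp_coeff_def mi_pow_def mi_fact_def)

text \<open>Comparison of coefficients in the rule that differentiating the exponential in direction
  \<open>j\<close> multiplies it by \<open>\<phi> j x\<close>.\<close>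

lemma exp_coeff_Suc:
  assumes \<kappa>: "\<kappa> \<in> multi_indices"
  shows "real (Suc (\<kappa> j)) * exp_coeff \<phi> (\<kappa>(j := Suc (\<kappa> j))) x = \<phi> j x * exp_coeff \<phi> \<kappa> x"
proof -
  let ?J = "insert j {i. \<kappa> i \<noteq> 0}"
  have J: "finite ?J" using \<kappa> by (simp add: multi_indices_def)
  define A where "A = (\<Prod>i\<in>?J - {j}. \<phi> i x ^ \<kappa> i)"
  define B where "B = (\<Prod>i\<in>?J - {j}. fact (\<kappa> i) :: real)"
  have B: "B \<noteq> 0" using J by (simp add: B_def)
  have *: "exp_coeff \<phi> (\<kappa>(j := m)) x = (A * \<phi> j x ^ m) / (B * fact m)" for m
  proof -
    have "{i. (\<kappa>(j := m)) i \<noteq> 0} \<subseteq> ?J" by auto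
    note eq = mi_pow_eq[OF J this] mi_fact_eq[OF J this]
    have "(\<Prod>i\<in>?J. \<phi> i x ^ (\<kappa>(j := m)) i) = \<phi> j x ^ m * (\<Prod>i\<in>?J - {j}. \<phi> i x ^ (\<kappa>(j := m)) i)"
      using J by (subst prod.remove[of _ j]) auto
    also have "(\<Prod>i\<in>?J - {j}. \<phi> i x ^ (\<kappa>(j := m)) i) = A"
      unfolding A_def by (rule prod.cong) auto
    finally have p: "mi_pow (\<lambda>i. \<phi> i x) (\<kappa>(j := m)) = A * \<phi> j x ^ m" by (simp only: eq mult.commute)
    have "(\<Prod>i\<in>?J. fact ((\<kappa>(j := m)) i) :: real) = fact m * (\<Prod>i\<in>?J - {j}. fact ((\<kappa>(j := m)) i))"
      using J by (subst prod.remove[of _ j]) auto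
    also have "(\<Prod>i\<in>?J - {j}. fact ((\<kappa>(j := m)) i) :: real) = B"
      unfolding B_def by (rule prod.cong) auto
    finally have "mi_fact (\<kappa>(j := m)) = B * fact m" by (simp only: eq mult.commute)
    then show ?thesis using p by (simp add: exp_coeff_def)
  qed
  have "exp_coeff \<phi> \<kappa> x = (A * \<phi> j x ^ \<kappa> j) / (B * fact (\<kappa> j))" using *[of "\<kappa> j"] by simp
  then show ?thesis unfolding * using B by (simp add: field_simps del: of_nat_Suc)
qed

lemma exp_coeff_scale: "exp_coeff (\<lambda>j x. \<rho> j * \<phi> j x) \<mu> x = mi_pow \<rho> \<mu> * exp_coeff \<phi> \<mu> x"
  by (simp add: exp_coeff_def mi_pow_def power_mult_distrib prod.distrib)

lemma mi_pow_diff: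
  assumes "\<mu> \<in> multi_indices" "\<kappa> \<le> \<mu>"
  shows "mi_pow \<rho> \<mu> = mi_pow \<rho> \<kappa> * mi_pow \<rho> (\<mu> - \<kappa>)"
proof -
  let ?J = "{j. \<mu> j \<noteq> 0}"
  have J: "finite ?J" using assms by (simp add: multi_indices_def)
  have le: "\<kappa> j \<le> \<mu> j" for j using assms by (auto simp: le_fun_def)
  have "{j. \<kappa> j \<noteq> 0} \<subseteq> ?J" using le by (auto) (metis le_zero_eq neq0_conv)
  then show ?thesis
    using J le by (simp add: mi_pow_eq[of ?J] prod.distrib[symmetric] power_add[symmetric] subset_iff)
qed

lemma bounded_borel_exp_coeff:
  assumes "\<And>j. bounded_borel (\<phi> j)"
  shows "bounded_borel (exp_coeff \<phi> \<mu>)"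
proof -
  have p: "bounded_borel (\<lambda>x. \<phi> j x ^ k)" for j k
    by (induction k) (auto intro: bounded_borel_const bounded_borel_mult assms)
  have "bounded_borel (\<lambda>x. \<Prod>j\<in>J. \<phi> j x ^ \<mu> j)" for J
    by (induction J rule: infinite_finite_induct) (auto intro: bounded_borel_const bounded_borel_mult p)
  then have "bounded_borel (\<lambda>x. (1 / mi_fact \<mu>) * (\<Prod>j | \<mu> j \<noteq> 0. \<phi> j x ^ \<mu> j))"
    by (rule bounded_borel_scale)
  then show ?thesis by (simp add: exp_coeff_def[abs_def] mi_pow_def)
qed

text \<open>A finite set of multi-indices fits into a box, and over a box the sum of products is a
  product of sums. The normalization \<open>f j 0 = 1\<close> lets every product be extended to all
  coordinates below \<open>n\<close>.\<close>

lemma sum_multi_index_prod_le: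
  fixes f :: "nat \<Rightarrow> nat \<Rightarrow> real"
  assumes S: "finite S" "S \<subseteq> multi_indices" and f: "\<And>j i. 0 \<le> f j i" "\<And>j. f j 0 = 1"
  obtains n r where "(\<Sum>\<mu>\<in>S. \<Prod>j | \<mu> j \<noteq> 0. f j (\<mu> j)) \<le> (\<Prod>j<n. \<Sum>i\<le>r. f j i)"
proof -
  define J where "J = (\<Union>\<mu>\<in>S. {j. \<mu> j \<noteq> 0})"
  have "finite J" unfolding J_def using S by (auto simp: multi_indices_def)
  then obtain n where n: "\<And>j. j \<in> J \<Longrightarrow> j < n" using finite_nat_set_iff_bounded by auto
  define r where "r = Max (insert 0 (\<Union>\<mu>\<in>S. \<mu> ` {..<n}))"
  have r: "\<mu> j \<le> r" if "\<mu> \<in> S" "j < n" for \<mu> j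
    unfolding r_def using that S by (intro Max_ge) auto
  have supp: "{j. \<mu> j \<noteq> 0} \<subseteq> {..<n}" if "\<mu> \<in> S" for \<mu>
    using n that by (auto simp: J_def)
  have inj: "inj_on (\<lambda>\<mu>. restrict \<mu> {..<n}) S"
  proof (rule inj_onI)
    fix \<mu> \<kappa> assume *: "\<mu> \<in> S" "\<kappa> \<in> S" "restrict \<mu> {..<n} = restrict \<kappa> {..<n}"
    show "\<mu> = \<kappa>"
    proof
      fix j show "\<mu> j = \<kappa> j"
      proof (cases "j < n")
        case True
        then show ?thesis using fun_cong[OF *(3), of j] by simp
      next
        case False
        have "\<nu> j = 0" if "\<nu> \<in> S" for \<nu>
          using supp[OF that] False by (cases "\<nu> j = 0") auto
        from this[OF *(1)] this[OF *(2)] show ?thesis by simp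
      qed
    qed
  qed
  have "(\<Sum>\<mu>\<in>S. \<Prod>j | \<mu> j \<noteq> 0. f j (\<mu> j)) = (\<Sum>\<mu>\<in>S. \<Prod>j<n. f j (restrict \<mu> {..<n} j))"
  proof (rule sum.cong[OF refl])
    fix \<mu> assume "\<mu> \<in> S"
    then have "(\<Prod>j | \<mu> j \<noteq> 0. f j (\<mu> j)) = (\<Prod>j<n. f j (\<mu> j))"
      using f by (intro prod.mono_neutral_left supp) auto
    then show "(\<Prod>j | \<mu> j \<noteq> 0. f j (\<mu> j)) = (\<Prod>j<n. f j (restrict \<mu> {..<n} j))" by simp
  qed
  also have "\<dots> = (\<Sum>g\<in>(\<lambda>\<mu>. restrict \<mu> {..<n}) ` S. \<Prod>j<n. f j (g j))"
    by (subst sum.reindex[OF inj]) simp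
  also have "\<dots> \<le> (\<Sum>g\<in>PiE {..<n} (\<lambda>_. {..r}). \<Prod>j<n. f j (g j))"
  proof (rule sum_mono2)
    show "(\<lambda>\<mu>. restrict \<mu> {..<n}) ` S \<subseteq> PiE {..<n} (\<lambda>_. {..r})"
      using r by (auto simp only: restrict_PiE_iff image_subset_iff)
  qed (auto intro: finite_PiE prod_nonneg f)
  also have "\<dots> = (\<Prod>j<n. \<Sum>i\<le>r. f j i)"
    by (rule prod_sum_PiE[symmetric]) auto
  finally show ?thesis by (rule that)
qed

text \<open>The absolute values are the Taylor coefficients of a product of exponentials, whose
  total is the exponential of the sum. The 1 subtracted is the coefficient of the zero
  index.\<close>

lemma sum_exp_coeff_le:
  fixes \<phi> :: "nat \<Rightarrow> 'a \<Rightarrow> real"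
  assumes S: "finite S" "S \<subseteq> multi_indices" "mi_zero \<notin> S"
    and bound: "\<And>n. (\<Sum>j<n. \<bar>\<phi> j x\<bar>) \<le> k"
  shows "(\<Sum>\<mu>\<in>S. \<bar>exp_coeff \<phi> \<mu> x\<bar>) \<le> exp k - 1"
proof -
  have T: "finite (insert mi_zero S)" "insert mi_zero S \<subseteq> multi_indices" using S by auto
  define f where "f j i = \<bar>\<phi> j x\<bar> ^ i / fact i" for j i
  have abs: "\<bar>exp_coeff \<phi> \<mu> x\<bar> = (\<Prod>j | \<mu> j \<noteq> 0. f j (\<mu> j))" for \<mu>
    by (simp add: exp_coeff_def mi_pow_def mi_fact_def f_def prod_dividef abs_prod power_abs)
  obtain n r where nr: "(\<Sum>\<mu>\<in>insert mi_zero S. \<Prod>j | \<mu> j \<noteq> 0. f j (\<mu> j)) \<le> (\<Prod>j<n. \<Sum>i\<le>r. f j i)"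
    by (rule sum_multi_index_prod_le[OF T, of f]) (auto simp: f_def)
  have "1 + (\<Sum>\<mu>\<in>S. \<bar>exp_coeff \<phi> \<mu> x\<bar>) = (\<Sum>\<mu>\<in>insert mi_zero S. \<Prod>j | \<mu> j \<noteq> 0. f j (\<mu> j))"
    using S by (simp add: abs)
  also note nr
  also have "(\<Prod>j<n. \<Sum>i\<le>r. f j i) \<le> (\<Prod>j<n. exp \<bar>\<phi> j x\<bar>)"
  proof (intro prod_mono conjI)
    fix j
    have "(\<Sum>i\<le>r. \<bar>\<phi> j x\<bar> ^ i /\<^sub>R fact i) \<le> (\<Sum>i. \<bar>\<phi> j x\<bar> ^ i /\<^sub>R fact i)"
      by (intro sum_le_suminf summable_exp_generic) auto
    then show "(\<Sum>i\<le>r. f j i) \<le> exp \<bar>\<phi> j x\<bar>"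
      by (simp add: f_def exp_def divide_inverse mult.commute)
  qed (auto intro!: sum_nonneg simp: f_def)
  also have "\<dots> = exp (\<Sum>j<n. \<bar>\<phi> j x\<bar>)" by (simp add: exp_sum)
  also have "\<dots> \<le> exp k" using bound by simp
  finally show ?thesis by simp
qed

context bounded_open_set
begin

lemma functional_aform: "bounded_borel w \<Longrightarrow> \<exists>K. functional (aform w u) K"
proof -
  assume w: "bounded_borel w"
  then obtain B where "\<And>x. \<bar>w x\<bar> \<le> B" by (auto simp: bounded_borel_def)
  then have "\<bar>aform w u v\<bar> \<le> B * V_norm u * V_norm v" for v
    using w by (intro aform_bound) auto
  then have "functional (aform w u) (B * V_norm u)"
    using w unfolding functional_def by (simp add: aform_add_right aform_scaleR_right)
  then show ?thesis by blast
qed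

lemma functional_diff:
  assumes "functional l K" "functional l' K'"
  shows "functional (\<lambda>v. l v - l' v) (K + K')"
proof -
  have "\<bar>l v - l' v\<bar> \<le> (K + K') * V_norm v" if "v \<in> H1_0 D" for v
  proof -
    have "\<bar>l v\<bar> \<le> K * V_norm v" "\<bar>l' v\<bar> \<le> K' * V_norm v" using assms that by (auto simp: functional_def)
    then show ?thesis unfolding distrib_right by linarith
  qed
  then show ?thesis using assms by (auto simp: functional_def algebra_simps)
qed

lemma functional_zero: "functional (\<lambda>v. 0) 0"
  by (simp add: functional_def)

lemma functional_sum:
  assumes "finite I" "\<And>i. i \<in> I \<Longrightarrow> \<exists>K. functional (l i) K"
  shows "\<exists>K. functional (\<lambda>v. \<Sum>i\<in>I. l i v) K"
  using assms
proof (induction I rule: finite_induct)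
  case (insert i I)
  obtain K where K: "functional (l i) K" using insert.prems by blast
  obtain K' where "functional (\<lambda>v. \<Sum>i\<in>I. l i v) K'" using insert.IH insert.prems by blast
  note this = K this
  from functional_diff[OF this(1) functional_diff[OF functional_zero this(2)]]
  have "functional (\<lambda>v. l i v + (\<Sum>i\<in>I. l i v)) (K + (0 + K'))" by simp
  then show ?case using insert by auto
qed (auto intro: functional_zero)

end

text \<open>Coefficientwise form of the equation for the power series in the parameter: the product
  of the series of the diffusion coefficient and the series of the solution has \<open>l\<close> as
  its only nonzero right side, at order 0. The term with \<kappa> = 0 contains the unknown; all
  others have smaller order and are moved to the right.\<close>

function taylor ::
  "'a::euclidean_space set \<Rightarrow> (nat \<Rightarrow> 'a \<Rightarrow> real) \<Rightarrow> ('a H1 \<Rightarrow> real) \<Rightarrow> ('a \<Rightarrow> real) \<Rightarrow> (nat \<Rightarrow> nat) \<Rightarrow> 'a H1" where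
  "taylor D \<phi> l a \<mu> = (if \<mu> \<in> multi_indices then
     (THE u. u \<in> H1_0 D \<and> (\<forall>v\<in>H1_0 D. aform a u v = (if \<mu> = mi_zero then l v else 0) -
        (\<Sum>\<kappa> | \<kappa> \<le> \<mu> \<and> \<kappa> \<noteq> mi_zero. aform (\<lambda>x. a x * exp_coeff \<phi> \<kappa> x) (taylor D \<phi> l a (\<mu> - \<kappa>)) v)))
     else 0)"
  by pat_completeness auto
termination
  by (relation "Wellfounded.measure (\<lambda>(D, \<phi>, l, a, \<mu>). mi_size \<mu>)") (auto intro: mi_size_diff_less)

declare taylor.simps [simp del]

locale parametric_problem = bounded_open_set D for D :: "'a::euclidean_space set" +
  fixes \<phi> :: "nat \<Rightarrow> 'a \<Rightarrow> real" and l :: "'a H1 \<Rightarrow> real" and K :: real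
  assumes \<phi>: "\<And>j. bounded_borel (\<phi> j)" and l: "functional l K" and K: "0 \<le> K"
begin

definition admissible :: "('a \<Rightarrow> real) \<Rightarrow> bool" where
  "admissible a \<longleftrightarrow> bounded_borel a \<and> (\<exists>\<alpha>>0. \<forall>x. \<alpha> \<le> a x)"

abbreviation t :: "('a \<Rightarrow> real) \<Rightarrow> (nat \<Rightarrow> nat) \<Rightarrow> 'a H1" where
  "t a \<mu> \<equiv> taylor D \<phi> l a \<mu>"

lemma bounded_borel_coeff: "bounded_borel a \<Longrightarrow> bounded_borel (\<lambda>x. a x * exp_coeff \<phi> \<kappa> x)"
  by (intro bounded_borel_mult bounded_borel_exp_coeff \<phi>)

text \<open>The right side of the recursion is a bounded functional because each lower coefficient
  enters through a bounded form. Hence the problem is uniquely solvable, the description by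
  \<open>THE\<close> is met, and the term with \<kappa> = 0 can be put back into the sum.\<close>

lemma
  assumes a: "admissible a" and \<mu>: "\<mu> \<in> multi_indices"
  shows taylor_in_H1_0: "t a \<mu> \<in> H1_0 D"
    and taylor_eq: "v \<in> H1_0 D \<Longrightarrow> (\<Sum>\<kappa> | \<kappa> \<le> \<mu>. aform (\<lambda>x. a x * exp_coeff \<phi> \<kappa> x) (t a (\<mu> - \<kappa>)) v) = (if \<mu> = mi_zero then l v else 0)"
proof -
  obtain \<alpha> where \<alpha>: "bounded_borel a" "0 < \<alpha>" "\<And>x. \<alpha> \<le> a x" using a by (auto simp: admissible_def)
  define L where "L v = (if \<mu> = mi_zero then l v else 0) -
        (\<Sum>\<kappa> | \<kappa> \<le> \<mu> \<and> \<kappa> \<noteq> mi_zero. aform (\<lambda>x. a x * exp_coeff \<phi> \<kappa> x) (t a (\<mu> - \<kappa>)) v)" for v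
  have fin: "finite {\<kappa>. \<kappa> \<le> \<mu>}" using \<mu> by (rule finite_multi_indices_le)
  have fin': "finite {\<kappa>. \<kappa> \<le> \<mu> \<and> \<kappa> \<noteq> mi_zero}" by (rule finite_subset[OF _ fin]) auto
  have "\<exists>K. functional L K"
  proof -
    obtain K1 where "functional (\<lambda>v. \<Sum>\<kappa> | \<kappa> \<le> \<mu> \<and> \<kappa> \<noteq> mi_zero. aform (\<lambda>x. a x * exp_coeff \<phi> \<kappa> x) (t a (\<mu> - \<kappa>)) v) K1"
      using functional_sum[OF fin', of "\<lambda>\<kappa>. aform (\<lambda>x. a x * exp_coeff \<phi> \<kappa> x) (t a (\<mu> - \<kappa>))"]
        functional_aform[OF bounded_borel_coeff[OF \<alpha>(1)]] by blast
    moreover have "functional (\<lambda>v. if \<mu> = mi_zero then l v else 0) K"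
      using l K by (cases "\<mu> = mi_zero") (auto simp: functional_def)
    ultimately show ?thesis unfolding L_def[abs_def] using functional_diff by blast
  qed
  then obtain u where u: "u \<in> H1_0 D" "\<forall>v\<in>H1_0 D. aform a u v = L v"
    using variational_solution_exists[OF \<alpha>] by blast
  have "t a \<mu> = (THE u. u \<in> H1_0 D \<and> (\<forall>v\<in>H1_0 D. aform a u v = L v))"
    using \<mu> unfolding L_def by (subst taylor.simps) simp
  also have "\<dots> = u"
    using u variational_unique[OF \<alpha>] by (intro the_equality) auto
  finally have tu: "t a \<mu> = u" .
  then show "t a \<mu> \<in> H1_0 D" using u by simp
  show "(\<Sum>\<kappa> | \<kappa> \<le> \<mu>. aform (\<lambda>x. a x * exp_coeff \<phi> \<kappa> x) (t a (\<mu> - \<kappa>)) v) = (if \<mu> = mi_zero then l v else 0)"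
    if v: "v \<in> H1_0 D"
  proof -
    have "{\<kappa>. \<kappa> \<le> \<mu>} = insert mi_zero {\<kappa>. \<kappa> \<le> \<mu> \<and> \<kappa> \<noteq> mi_zero}" by (auto simp: le_fun_def)
    moreover have "\<mu> - mi_zero = \<mu>" by (auto simp: fun_eq_iff)
    ultimately have "(\<Sum>\<kappa> | \<kappa> \<le> \<mu>. aform (\<lambda>x. a x * exp_coeff \<phi> \<kappa> x) (t a (\<mu> - \<kappa>)) v) =
       aform a (t a \<mu>) v + (\<Sum>\<kappa> | \<kappa> \<le> \<mu> \<and> \<kappa> \<noteq> mi_zero. aform (\<lambda>x. a x * exp_coeff \<phi> \<kappa> x) (t a (\<mu> - \<kappa>)) v)"
      using fin' by simp
    then show ?thesis using u(2) v by (simp add: tu L_def)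
  qed
qed

lemma taylor_zero_eq: "admissible a \<Longrightarrow> v \<in> H1_0 D \<Longrightarrow> aform a (t a mi_zero) v = l v"
proof -
  assume "admissible a" "v \<in> H1_0 D"
  moreover have "{\<kappa>. \<kappa> \<le> mi_zero} = {mi_zero}" by (auto simp: le_fun_def)
  moreover have "mi_zero - mi_zero = mi_zero" by (auto simp: fun_eq_iff)
  ultimately show ?thesis using taylor_eq[of a mi_zero v] by simp
qed

text \<open>The scaled coefficients \<open>s \<mu>\<close> solve \<open>s = s 0 - P (c * s)\<close> with \<open>*\<close> the convolution over
  multi-indices; Young's inequality and \<open>\<Sum> \<bar>c \<kappa>\<bar> < 1\<close> absorb the last term.\<close>

lemma taylor_energy_bound:
  assumes a: "admissible a" and S: "finite S" "S \<subseteq> multi_indices" "mi_zero \<in> S"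
    and down: "\<And>\<mu> \<kappa>. \<mu> \<in> S \<Longrightarrow> \<kappa> \<le> \<mu> \<Longrightarrow> \<kappa> \<in> S"
    and bound: "\<And>n x. (\<Sum>j<n. \<bar>\<rho> j * \<phi> j x\<bar>) \<le> k"
  shows "(2 - exp k) * (\<Sum>\<mu>\<in>S. (mi_pow \<rho> \<mu>)\<^sup>2 * aform a (t a \<mu>) (t a \<mu>)) \<le> aform a (t a mi_zero) (t a mi_zero)"
proof -
  obtain \<alpha> where \<alpha>: "bounded_borel a" "0 < \<alpha>" "\<And>x. \<alpha> \<le> a x" using a by (auto simp: admissible_def)
  have a_pos: "0 \<le> a x" for x using \<alpha>(2) \<alpha>(3)[of x] by linarith
  \<comment> \<open>Scaling the coefficient of order \<mu> by \<rho> to the power \<mu> gives the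
    same system with \<open>\<phi> j\<close> replaced by \<open>\<rho> j * \<phi> j\<close>.\<close>
  define c where "c = exp_coeff (\<lambda>j x. \<rho> j * \<phi> j x)"
  define s where "s \<mu> = mi_pow \<rho> \<mu> *\<^sub>R t a \<mu>" for \<mu>
  define E where "E \<mu> = aform a (s \<mu>) (s \<mu>)" for \<mu>
  \<comment> \<open>The two halves that Young's inequality makes of a mixed term are
    \<open>d \<kappa> (\<mu> - \<kappa>)\<close> and \<open>d \<kappa> \<mu>\<close>.\<close>
  define d where "d \<kappa> \<mu> = aform (\<lambda>x. a x * \<bar>c \<kappa> x\<bar>) (s \<mu>) (s \<mu>)" for \<kappa> \<mu>
  have bc: "bounded_borel (c \<kappa>)" for \<kappa>
    unfolding c_def by (intro bounded_borel_exp_coeff bounded_borel_scale \<phi>)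
  have bac: "bounded_borel (\<lambda>x. a x * \<bar>c \<kappa> x\<bar>)" for \<kappa>
    by (intro bounded_borel_mult bounded_borel_abs bc \<alpha>(1))
  have d_nonneg: "0 \<le> d \<kappa> \<mu>" for \<kappa> \<mu>
    using aform_diag_mono[OF bounded_borel_const[of 0] bac, of \<kappa> "s \<mu>"] a_pos
    by (simp add: d_def aform_const)
  have E_eq: "E \<mu> = (mi_pow \<rho> \<mu>)\<^sup>2 * aform a (t a \<mu>) (t a \<mu>)" for \<mu>
    by (simp add: E_def s_def aform_scaleR_left aform_scaleR_right \<alpha>(1) power2_eq_square)
  define Z where "Z = S - {mi_zero}"
  have Z: "finite Z" "S = insert mi_zero Z" "mi_zero \<notin> Z" using S by (auto simp: Z_def)
  define P where "P = (SIGMA \<mu>:Z. {\<kappa>. \<kappa> \<le> \<mu> \<and> \<kappa> \<noteq> mi_zero})"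
  have finN: "finite {\<kappa>. \<kappa> \<le> \<mu> \<and> \<kappa> \<noteq> mi_zero}" if "\<mu> \<in> Z" for \<mu>
    by (rule finite_subset[OF _ finite_multi_indices_le[of \<mu>]]) (use that S Z in auto)
  \<comment> \<open>The equation of order \<mu> is tested with the scaled coefficient
    \<open>s \<mu>\<close> itself.\<close>
  have E_le: "E \<mu> \<le> (\<Sum>\<kappa> | \<kappa> \<le> \<mu> \<and> \<kappa> \<noteq> mi_zero. (d \<kappa> (\<mu> - \<kappa>) + d \<kappa> \<mu>) / 2)" if "\<mu> \<in> Z" for \<mu>
  proof -
    have \<mu>: "\<mu> \<in> multi_indices" "\<mu> \<noteq> mi_zero" using that S Z by auto
    let ?N = "{\<kappa>. \<kappa> \<le> \<mu> \<and> \<kappa> \<noteq> mi_zero}"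
    have fin: "finite ?N" by (rule finite_subset[OF _ finite_multi_indices_le[OF \<mu>(1)]]) auto
    have tH: "t a \<mu> \<in> H1_0 D" by (rule taylor_in_H1_0[OF a \<mu>(1)])
    have sH: "s \<mu> \<in> H1_0 D" unfolding s_def by (intro H1_0_scaleR tH)
    have set: "{\<kappa>. \<kappa> \<le> \<mu>} = insert mi_zero ?N" by (auto simp: le_fun_def)
    have m0: "\<mu> - mi_zero = \<mu>" by (auto simp: fun_eq_iff)
    have "0 = mi_pow \<rho> \<mu> * (\<Sum>\<kappa> | \<kappa> \<le> \<mu>. aform (\<lambda>x. a x * exp_coeff \<phi> \<kappa> x) (t a (\<mu> - \<kappa>)) (s \<mu>))"
      using taylor_eq[OF a \<mu>(1) sH] \<mu>(2) by simp
    also have "\<dots> = (\<Sum>\<kappa> | \<kappa> \<le> \<mu>. aform (\<lambda>x. a x * c \<kappa> x) (s (\<mu> - \<kappa>)) (s \<mu>))"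
      unfolding sum_distrib_left
    proof (rule sum.cong[OF refl])
      fix \<kappa> assume "\<kappa> \<in> {\<kappa>. \<kappa> \<le> \<mu>}"
      then have r: "mi_pow \<rho> \<mu> = mi_pow \<rho> \<kappa> * mi_pow \<rho> (\<mu> - \<kappa>)" using mi_pow_diff[OF \<mu>(1)] by simp
      have "(\<lambda>x. a x * c \<kappa> x) = (\<lambda>x. mi_pow \<rho> \<kappa> * (a x * exp_coeff \<phi> \<kappa> x))"
        by (auto simp: c_def exp_coeff_scale)
      then have "aform (\<lambda>x. a x * c \<kappa> x) (s (\<mu> - \<kappa>)) (s \<mu>) = mi_pow \<rho> \<kappa> * (mi_pow \<rho> (\<mu> - \<kappa>) * aform (\<lambda>x. a x * exp_coeff \<phi> \<kappa> x) (t a (\<mu> - \<kappa>)) (s \<mu>))"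
        by (simp only: aform_coeff_scale s_def aform_scaleR_left[OF bounded_borel_coeff[OF \<alpha>(1)]])
      then show "mi_pow \<rho> \<mu> * aform (\<lambda>x. a x * exp_coeff \<phi> \<kappa> x) (t a (\<mu> - \<kappa>)) (s \<mu>) = aform (\<lambda>x. a x * c \<kappa> x) (s (\<mu> - \<kappa>)) (s \<mu>)"
        by (simp only: r mult.assoc)
    qed
    also have "\<dots> = E \<mu> + (\<Sum>\<kappa>\<in>?N. aform (\<lambda>x. a x * c \<kappa> x) (s (\<mu> - \<kappa>)) (s \<mu>))"
      unfolding set using fin by (simp add: m0 E_def c_def)
    finally have "E \<mu> = - (\<Sum>\<kappa>\<in>?N. aform (\<lambda>x. a x * c \<kappa> x) (s (\<mu> - \<kappa>)) (s \<mu>))" by linarith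
    also have "\<dots> \<le> (\<Sum>\<kappa>\<in>?N. \<bar>aform (\<lambda>x. a x * c \<kappa> x) (s (\<mu> - \<kappa>)) (s \<mu>)\<bar>)"
      unfolding sum_negf[symmetric] by (intro sum_mono) linarith
    also have "\<dots> \<le> (\<Sum>\<kappa>\<in>?N. (d \<kappa> (\<mu> - \<kappa>) + d \<kappa> \<mu>) / 2)"
    proof (rule sum_mono)
      fix \<kappa>
      have "(\<lambda>x. \<bar>a x * c \<kappa> x\<bar>) = (\<lambda>x. a x * \<bar>c \<kappa> x\<bar>)" using a_pos by (auto simp: abs_mult)
      then show "\<bar>aform (\<lambda>x. a x * c \<kappa> x) (s (\<mu> - \<kappa>)) (s \<mu>)\<bar> \<le> (d \<kappa> (\<mu> - \<kappa>) + d \<kappa> \<mu>) / 2"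
        using aform_Young[OF bounded_borel_mult[OF \<alpha>(1) bc], of \<kappa> "s (\<mu> - \<kappa>)" "s \<mu>"] by (simp add: d_def)
    qed
    finally show ?thesis .
  qed
  have P_sum: "(\<Sum>\<mu>\<in>Z. \<Sum>\<kappa> | \<kappa> \<le> \<mu> \<and> \<kappa> \<noteq> mi_zero. f \<mu> \<kappa>) = (\<Sum>(\<mu>, \<kappa>)\<in>P. f \<mu> \<kappa>)" for f :: "_ \<Rightarrow> _ \<Rightarrow> real"
    unfolding P_def
    by (rule sum.Sigma[OF Z(1)]) (intro ballI finN)
  have PD: "\<kappa> \<in> Z" "\<mu> \<in> S" "\<mu> - \<kappa> \<in> S" if "(\<mu>, \<kappa>) \<in> P" for \<mu> \<kappa>
  proof -
    have *: "\<mu> \<in> S" "\<kappa> \<le> \<mu>" "\<kappa> \<noteq> mi_zero" using that by (auto simp: P_def Z_def)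
    then show "\<kappa> \<in> Z" "\<mu> \<in> S" unfolding Z_def using down[OF *(1,2)] by blast+
    show "\<mu> - \<kappa> \<in> S" by (rule down[OF *(1) diff_le_fun])
  qed
  have le1: "(\<Sum>(\<mu>, \<kappa>)\<in>P. d \<kappa> \<mu>) \<le> (\<Sum>(\<kappa>, \<mu>)\<in>Z \<times> S. d \<kappa> \<mu>)"
  proof -
    have "(\<Sum>(\<mu>, \<kappa>)\<in>P. d \<kappa> \<mu>) = (\<Sum>(\<kappa>, \<mu>)\<in>prod.swap ` P. d \<kappa> \<mu>)"
      by (subst sum.reindex) (auto simp: inj_on_def intro!: sum.cong)
    also have "\<dots> \<le> (\<Sum>(\<kappa>, \<mu>)\<in>Z \<times> S. d \<kappa> \<mu>)"
    proof (rule sum_mono2)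
      show "prod.swap ` P \<subseteq> Z \<times> S" using PD by auto
    qed (use Z(1) S(1) d_nonneg in auto)
    finally show ?thesis .
  qed
  \<comment> \<open>A pair is determined by \<kappa> and the difference \<mu> - \<kappa>, and that
    difference stays in \<open>S\<close> because \<open>S\<close> is closed downwards.\<close>
  have le2: "(\<Sum>(\<mu>, \<kappa>)\<in>P. d \<kappa> (\<mu> - \<kappa>)) \<le> (\<Sum>(\<kappa>, \<mu>)\<in>Z \<times> S. d \<kappa> \<mu>)"
  proof -
    have inj: "inj_on (\<lambda>(\<mu>, \<kappa>). (\<kappa>, \<mu> - \<kappa>)) P"
    proof (rule inj_onI)
      fix z z' assume z: "z \<in> P" "z' \<in> P" "(case z of (\<mu>, \<kappa>) \<Rightarrow> (\<kappa>, \<mu> - \<kappa>)) = (case z' of (\<mu>, \<kappa>) \<Rightarrow> (\<kappa>, \<mu> - \<kappa>))"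
      obtain \<mu> \<kappa> \<mu>' where zz: "z = (\<mu>, \<kappa>)" "z' = (\<mu>', \<kappa>)" using z(3) by (cases z; cases z') auto
      then have *: "(\<mu>, \<kappa>) \<in> P" "(\<mu>', \<kappa>) \<in> P" "\<mu> - \<kappa> = \<mu>' - \<kappa>" using z by auto
      have "\<mu> = \<mu>'"
      proof
        fix j
        have "\<kappa> j \<le> \<mu> j" "\<kappa> j \<le> \<mu>' j" using * by (auto simp: P_def le_fun_def)
        then show "\<mu> j = \<mu>' j" using fun_cong[OF *(3), of j] by simp
      qed
      then show "z = z'" by (simp add: zz)
    qed
    have "(\<Sum>(\<mu>, \<kappa>)\<in>P. d \<kappa> (\<mu> - \<kappa>)) = (\<Sum>(\<kappa>, \<mu>)\<in>(\<lambda>(\<mu>, \<kappa>). (\<kappa>, \<mu> - \<kappa>)) ` P. d \<kappa> \<mu>)"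
      by (subst sum.reindex[OF inj]) (auto intro!: sum.cong)
    also have "\<dots> \<le> (\<Sum>(\<kappa>, \<mu>)\<in>Z \<times> S. d \<kappa> \<mu>)"
    proof (rule sum_mono2)
      show "(\<lambda>(\<mu>, \<kappa>). (\<kappa>, \<mu> - \<kappa>)) ` P \<subseteq> Z \<times> S" using PD by auto
    qed (use Z(1) S(1) d_nonneg in auto)
    finally show ?thesis .
  qed
  \<comment> \<open>For fixed \<mu> the weights are summed pointwise under the integral, where the
    nonzero orders contribute at most \<open>exp k - 1\<close> times the coefficient.\<close>
  have le3: "(\<Sum>(\<kappa>, \<mu>)\<in>Z \<times> S. d \<kappa> \<mu>) \<le> (exp k - 1) * (\<Sum>\<mu>\<in>S. E \<mu>)"
  proof -
    have "(\<Sum>(\<kappa>, \<mu>)\<in>Z \<times> S. d \<kappa> \<mu>) = (\<Sum>\<mu>\<in>S. \<Sum>\<kappa>\<in>Z. d \<kappa> \<mu>)"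
      by (subst sum.cartesian_product[symmetric]) (rule sum.swap)
    also have "\<dots> \<le> (\<Sum>\<mu>\<in>S. (exp k - 1) * E \<mu>)"
    proof (rule sum_mono)
      fix \<mu>
      have "(\<Sum>\<kappa>\<in>Z. d \<kappa> \<mu>) = aform (\<lambda>x. \<Sum>\<kappa>\<in>Z. a x * \<bar>c \<kappa> x\<bar>) (s \<mu>) (s \<mu>)"
        unfolding d_def by (intro aform_coeff_sum[symmetric] bac)
      also have "\<dots> \<le> aform (\<lambda>x. (exp k - 1) * a x) (s \<mu>) (s \<mu>)"
      proof (rule aform_diag_mono)
        fix x
        have "(\<Sum>\<kappa>\<in>Z. \<bar>c \<kappa> x\<bar>) \<le> exp k - 1"
          unfolding c_def using Z S bound by (intro sum_exp_coeff_le) auto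
        then show "(\<Sum>\<kappa>\<in>Z. a x * \<bar>c \<kappa> x\<bar>) \<le> (exp k - 1) * a x"
          unfolding sum_distrib_left[symmetric] mult.commute[of "exp k - 1"] by (rule mult_left_mono[OF _ a_pos])
      qed (intro bounded_borel_sum bounded_borel_scale bac \<alpha>)+
      also have "\<dots> = (exp k - 1) * E \<mu>" by (simp add: aform_coeff_scale E_def)
      finally show "(\<Sum>\<kappa>\<in>Z. d \<kappa> \<mu>) \<le> (exp k - 1) * E \<mu>" .
    qed
    finally show ?thesis by (simp add: sum_distrib_left)
  qed
  have "(\<Sum>\<mu>\<in>S. E \<mu>) = E mi_zero + (\<Sum>\<mu>\<in>Z. E \<mu>)" using Z by simp
  also have "(\<Sum>\<mu>\<in>Z. E \<mu>) \<le> (\<Sum>\<mu>\<in>Z. \<Sum>\<kappa> | \<kappa> \<le> \<mu> \<and> \<kappa> \<noteq> mi_zero. (d \<kappa> (\<mu> - \<kappa>) + d \<kappa> \<mu>) / 2)"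
    by (intro sum_mono E_le)
  also have "\<dots> = ((\<Sum>(\<mu>, \<kappa>)\<in>P. d \<kappa> (\<mu> - \<kappa>)) + (\<Sum>(\<mu>, \<kappa>)\<in>P. d \<kappa> \<mu>)) / 2"
    unfolding P_sum by (simp add: sum.distrib sum_divide_distrib[symmetric] split_beta')
  also have "\<dots> \<le> (exp k - 1) * (\<Sum>\<mu>\<in>S. E \<mu>)"   proof -
    have *: "(p + q) / 2 \<le> r" if "p \<le> d" "q \<le> d" "d \<le> r" for p q r d :: real
      using that by (simp add: field_simps)
    show ?thesis by (rule *[OF le2 le1 le3])
  qed
  finally have "(\<Sum>\<mu>\<in>S. E \<mu>) \<le> E mi_zero + (exp k - 1) * (\<Sum>\<mu>\<in>S. E \<mu>)" by simp
  then have "(2 - exp k) * (\<Sum>\<mu>\<in>S. E \<mu>) \<le> E mi_zero" by (simp add: algebra_simps)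
  moreover have "E mi_zero = aform a (t a mi_zero) (t a mi_zero)" by (simp add: E_eq mi_pow_def)
  ultimately show ?thesis by (simp only: E_eq)
qed

end

section \<open>Differentiability of the Taylor coefficients along a coordinate\<close>

lemma abs_exp_minus_one_le: "\<bar>exp z - 1\<bar> \<le> \<bar>z\<bar> * exp \<bar>z\<bar>" for z :: real
proof (cases "0 \<le> z")
  case True
  have "1 - z \<le> exp (- z)" using exp_ge_add_one_self[of "- z"] by simp
  then have "exp z * (1 - z) \<le> exp z * exp (- z)" by (intro mult_left_mono) auto
  then have "exp z - 1 \<le> z * exp z" by (simp add: exp_minus algebra_simps)
  then show ?thesis using True by simp
next
  case False
  have "1 + z \<le> exp z" by (rule exp_ge_add_one_self)
  moreover have "exp z \<le> 1" using False by simp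
  ultimately have "\<bar>exp z - 1\<bar> \<le> \<bar>z\<bar>" using False by linarith
  also have "\<dots> \<le> \<bar>z\<bar> * exp \<bar>z\<bar>" by (simp add: mult_le_cancel_left1)
  finally show ?thesis .
qed

lemma abs_exp_minus_one_minus_le: "\<bar>exp z - 1 - z\<bar> \<le> z\<^sup>2 * exp \<bar>z\<bar>" for z :: real
proof -
  have "1 - z \<le> exp (- z)" using exp_ge_add_one_self[of "- z"] by simp
  then have "exp z * (1 - z) \<le> exp z * exp (- z)" by (intro mult_left_mono) auto
  then have "exp z - 1 - z \<le> z * (exp z - 1)" by (simp add: exp_minus algebra_simps)
  moreover have "0 \<le> exp z - 1 - z" using exp_ge_add_one_self[of z] by linarith
  moreover have "z * (exp z - 1) \<le> \<bar>z\<bar> * \<bar>exp z - 1\<bar>" unfolding abs_mult[symmetric] by (rule abs_ge_self)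
  moreover have "\<bar>z\<bar> * \<bar>exp z - 1\<bar> \<le> \<bar>z\<bar> * (\<bar>z\<bar> * exp \<bar>z\<bar>)"
    by (intro mult_left_mono abs_exp_minus_one_le) simp
  ultimately have "\<bar>exp z - 1 - z\<bar> \<le> \<bar>z\<bar> * (\<bar>z\<bar> * exp \<bar>z\<bar>)" by linarith
  then show ?thesis by (simp add: power2_eq_square)
qed

context parametric_problem
begin

definition shift :: "('a \<Rightarrow> real) \<Rightarrow> nat \<Rightarrow> real \<Rightarrow> 'a \<Rightarrow> real" where
  "shift w j h x = w x * exp (h * \<phi> j x)"

lemma shift_0 [simp]: "shift w j 0 = w"
  by (simp add: shift_def fun_eq_iff)

lemma shift_shift: "shift (shift w j h) j k = shift w j (h + k)"
  by (simp add: shift_def fun_eq_iff exp_add distrib_right)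

lemma bounded_borel_exp: "bounded_borel (\<lambda>x. exp (h * \<phi> j x))"
proof -
  obtain B where B: "\<And>x. \<bar>\<phi> j x\<bar> \<le> B" using \<phi>[of j] by (auto simp: bounded_borel_def)
  have [measurable]: "\<phi> j \<in> borel_measurable borel" using \<phi> by (rule bounded_borel_measurable)
  show ?thesis
  proof (rule bounded_borelI)
    fix x
    have "h * \<phi> j x \<le> \<bar>h\<bar> * \<bar>\<phi> j x\<bar>" unfolding abs_mult[symmetric] by (rule abs_ge_self)
    also have "\<dots> \<le> \<bar>h\<bar> * B" by (intro mult_left_mono B) simp
    finally show "\<bar>exp (h * \<phi> j x)\<bar> \<le> exp (\<bar>h\<bar> * B)" by simp
  qed simp
qed

lemma bounded_borel_shift: "bounded_borel w \<Longrightarrow> bounded_borel (shift w j h)"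
  unfolding shift_def[abs_def] by (intro bounded_borel_mult bounded_borel_exp)

lemma shift_ge:
  assumes B: "\<And>x. \<bar>\<phi> j x\<bar> \<le> B" and a: "0 < \<alpha>" "\<alpha> \<le> a x"
  shows "\<alpha> * exp (- (\<bar>h\<bar> * B)) \<le> shift a j h x"
proof -
  have "- (h * \<phi> j x) \<le> \<bar>h\<bar> * \<bar>\<phi> j x\<bar>" unfolding abs_mult[symmetric] by (rule abs_ge_minus_self)
  also have "\<dots> \<le> \<bar>h\<bar> * B" by (intro mult_left_mono B) simp
  finally show ?thesis unfolding shift_def using a by (intro mult_mono) auto
qed

lemma admissible_shift: "admissible a \<Longrightarrow> admissible (shift a j h)"
proof -
  assume a: "admissible a"
  then obtain \<alpha> where \<alpha>: "bounded_borel a" "0 < \<alpha>" "\<And>x. \<alpha> \<le> a x" by (auto simp: admissible_def)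
  obtain B where B: "\<And>x. \<bar>\<phi> j x\<bar> \<le> B" using \<phi>[of j] by (auto simp: bounded_borel_def)
  have "0 < \<alpha> * exp (- (\<bar>h\<bar> * B))" using \<alpha> by simp
  then show ?thesis
    unfolding admissible_def using bounded_borel_shift[OF \<alpha>(1)] shift_ge[of j B \<alpha> a, OF B \<alpha>(2) \<alpha>(3)]
    by (intro conjI exI[of _ "\<alpha> * exp (- (\<bar>h\<bar> * B))"] allI)
qed

text \<open>The product rule for a form whose coefficient and first argument both depend on
  \<open>h\<close>. The remainder is bounded uniformly in the second argument, so \<open>v\<close>
  may later be the error, which itself depends on \<open>h\<close>.\<close>

lemma aform_shift_derivative:
  fixes G :: "real \<Rightarrow> 'a H1"
  assumes w: "bounded_borel w" and G: "(G has_vector_derivative G') (at 0)"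
  shows "\<exists>R. ((\<lambda>h. R h / \<bar>h\<bar>) \<longlongrightarrow> 0) (at 0) \<and> (\<forall>h. 0 \<le> R h) \<and>
    (\<forall>h v. \<bar>h\<bar> \<le> 1 \<longrightarrow> \<bar>aform (shift w j h) (G h) v - aform w (G 0) v
       - h * (aform (\<lambda>x. w x * \<phi> j x) (G 0) v + aform w G' v)\<bar> \<le> R h * V_norm v)"
proof -
  obtain W where W: "0 \<le> W" "\<And>x. \<bar>w x\<bar> \<le> W" using bounded_borelE[OF w] by blast
  obtain B where B: "0 \<le> B" "\<And>x. \<bar>\<phi> j x\<bar> \<le> B" using bounded_borelE[OF \<phi>[of j]] by blast
  note [measurable] = bounded_borel_measurable[OF w] bounded_borel_measurable[OF \<phi>[of j]]
  define r where "r h = G h - G 0 - h *\<^sub>R G'" for h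
  have r_lim: "((\<lambda>h. norm (r h) / \<bar>h\<bar>) \<longlongrightarrow> 0) (at 0)"
    using G unfolding has_vector_derivative_def has_derivative_at r_def by simp
  \<comment> \<open>The first summand comes from the remainder of \<open>G\<close>. The quadratic
    ones are the second-order remainder of the exponential at \<open>G 0\<close> and the product of
    the two first-order changes.\<close>
  define R where "R h = W * exp B * norm (r h) + (\<bar>h\<bar> * \<bar>h\<bar>) * (W * (B\<^sup>2 * exp B) * V_norm (G 0) + W * (B * exp B) * V_norm G')" for h
  have "((\<lambda>h. W * exp B * (norm (r h) / \<bar>h\<bar>) + \<bar>h\<bar> * (W * (B\<^sup>2 * exp B) * V_norm (G 0) + W * (B * exp B) * V_norm G')) \<longlongrightarrow> 0) (at 0)"
    by (rule tendsto_eq_intros r_lim refl)+ simp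
  moreover have "\<forall>\<^sub>F h in at 0. W * exp B * (norm (r h) / \<bar>h\<bar>) + \<bar>h\<bar> * (W * (B\<^sup>2 * exp B) * V_norm (G 0) + W * (B * exp B) * V_norm G') = R h / \<bar>h\<bar>"
    unfolding eventually_at_filter R_def add_divide_distrib
    by (rule always_eventually) (auto simp del: abs_mult_self_eq)
  ultimately have lim: "((\<lambda>h. R h / \<bar>h\<bar>) \<longlongrightarrow> 0) (at 0)" by (rule Lim_transform_eventually)
  have le: "\<bar>aform (shift w j h) (G h) v - aform w (G 0) v - h * (aform (\<lambda>x. w x * \<phi> j x) (G 0) v + aform w G' v)\<bar> \<le> R h * V_norm v"
    if h: "\<bar>h\<bar> \<le> 1" for h v
  proof -
    have hB: "\<bar>h * \<phi> j x\<bar> \<le> \<bar>h\<bar> * B" "\<bar>h * \<phi> j x\<bar> \<le> B" for x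
    proof -
      show "\<bar>h * \<phi> j x\<bar> \<le> \<bar>h\<bar> * B" unfolding abs_mult by (intro mult_left_mono B) simp
      also have "\<dots> \<le> B" using h B by (simp add: mult_left_le_one_le)
      finally show "\<bar>h * \<phi> j x\<bar> \<le> B" .
    qed
    define w1 where "w1 x = shift w j h x - w x" for x
    define w2 where "w2 x = w1 x - h * (w x * \<phi> j x)" for x
    have bw: "bounded_borel (shift w j h)" "bounded_borel w1" "bounded_borel (\<lambda>x. w x * \<phi> j x)" "bounded_borel (\<lambda>x. h * (w x * \<phi> j x))" "bounded_borel w2"
      unfolding w1_def[abs_def] w2_def[abs_def]
      by (intro bounded_borel_diff bounded_borel_shift bounded_borel_scale bounded_borel_mult w \<phi>)+
    have b0: "\<bar>shift w j h x\<bar> \<le> W * exp B" for x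
    proof -
      have "h * \<phi> j x \<le> B" using hB(2)[of x] by linarith
      then show ?thesis unfolding shift_def abs_mult by (intro mult_mono W) auto
    qed
    have b1: "\<bar>w1 x\<bar> \<le> \<bar>h\<bar> * (W * (B * exp B))" for x
    proof -
      have "\<bar>w1 x\<bar> = \<bar>w x\<bar> * \<bar>exp (h * \<phi> j x) - 1\<bar>"
        unfolding w1_def shift_def abs_mult[symmetric] by (simp add: algebra_simps)
      also have "\<dots> \<le> W * ((\<bar>h\<bar> * B) * exp B)"
        by (intro mult_mono W order_trans[OF abs_exp_minus_one_le]) (use hB B in auto)
      finally show ?thesis by (simp add: mult_ac)
    qed
    have b2: "\<bar>w2 x\<bar> \<le> (\<bar>h\<bar> * \<bar>h\<bar>) * (W * (B\<^sup>2 * exp B))" for x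
    proof -
      have "\<bar>w2 x\<bar> = \<bar>w x\<bar> * \<bar>exp (h * \<phi> j x) - 1 - h * \<phi> j x\<bar>"
        unfolding w2_def w1_def shift_def abs_mult[symmetric] by (simp add: algebra_simps)
      also have "\<bar>exp (h * \<phi> j x) - 1 - h * \<phi> j x\<bar> \<le> \<bar>h * \<phi> j x\<bar>\<^sup>2 * exp \<bar>h * \<phi> j x\<bar>"
        using abs_exp_minus_one_minus_le[of "h * \<phi> j x"] by simp
      also have "\<dots> \<le> (\<bar>h\<bar> * B)\<^sup>2 * exp B"
        using hB B by (intro mult_mono power_mono) auto
      finally have "\<bar>w2 x\<bar> \<le> \<bar>w x\<bar> * ((\<bar>h\<bar> * B)\<^sup>2 * exp B)" by (simp add: mult_left_mono)
      also have "\<dots> \<le> W * ((\<bar>h\<bar> * B)\<^sup>2 * exp B)" by (intro mult_right_mono W) auto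
      finally show ?thesis by (simp add: power2_eq_square mult_ac)
    qed
    have "G h = r h + G 0 + h *\<^sub>R G'" by (simp add: r_def)
    then have "aform (shift w j h) (G h) v = aform (shift w j h) (r h) v + aform (shift w j h) (G 0) v + h * aform (shift w j h) G' v"
      by (simp only: aform_add_left[OF bw(1)] aform_scaleR_left[OF bw(1)])
    moreover have "aform (shift w j h) g v = aform w g v + aform w1 g v" for g
      using aform_coeff_diff[OF bw(1) w, of g v] by (simp add: w1_def[abs_def])
    moreover have "aform w1 (G 0) v = h * aform (\<lambda>x. w x * \<phi> j x) (G 0) v + aform w2 (G 0) v"
      using aform_coeff_diff[OF bw(2) bw(4), of "G 0" v] by (simp add: w2_def[abs_def] aform_coeff_scale)
    ultimately have eq: "aform (shift w j h) (G h) v - aform w (G 0) v - h * (aform (\<lambda>x. w x * \<phi> j x) (G 0) v + aform w G' v) =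
        aform (shift w j h) (r h) v + aform w2 (G 0) v + h * aform w1 G' v"
      by (simp add: algebra_simps)
    have e0: "\<bar>aform (shift w j h) (r h) v\<bar> \<le> W * exp B * norm (r h) * V_norm v"
    proof -
      have "\<bar>aform (shift w j h) (r h) v\<bar> \<le> W * exp B * V_norm (r h) * V_norm v"
        by (intro aform_bound b0 bounded_borel_measurable bw)
      also have "\<dots> \<le> W * exp B * norm (r h) * V_norm v"
        using W by (intro mult_right_mono mult_left_mono V_norm_le_norm) auto
      finally show ?thesis .
    qed
    have e2: "\<bar>aform w2 (G 0) v\<bar> \<le> (\<bar>h\<bar> * \<bar>h\<bar>) * (W * (B\<^sup>2 * exp B)) * V_norm (G 0) * V_norm v"
      by (intro aform_bound b2 bounded_borel_measurable bw)
    have e1: "\<bar>h * aform w1 G' v\<bar> \<le> \<bar>h\<bar> * (\<bar>h\<bar> * (W * (B * exp B)) * V_norm G' * V_norm v)"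
      unfolding abs_mult by (intro mult_left_mono aform_bound b1 bounded_borel_measurable bw) simp
    have "\<bar>aform (shift w j h) (r h) v + aform w2 (G 0) v + h * aform w1 G' v\<bar> \<le>
       W * exp B * norm (r h) * V_norm v + (\<bar>h\<bar> * \<bar>h\<bar>) * (W * (B\<^sup>2 * exp B)) * V_norm (G 0) * V_norm v +
       \<bar>h\<bar> * (\<bar>h\<bar> * (W * (B * exp B)) * V_norm G' * V_norm v)"
      by (intro abs_triangle_ineq[THEN order_trans] add_mono e0 e1 e2)
    also have "\<dots> = R h * V_norm v" by (simp add: R_def algebra_simps)
    finally show ?thesis unfolding eq .
  qed
  have "0 \<le> R h" for h unfolding R_def using W B by (intro add_nonneg_nonneg mult_nonneg_nonneg) auto
  then show ?thesis using lim le by blast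
qed

text \<open>Multiplying the equation for the index \<open>\<mu>\<close> raised at \<open>j\<close> by \<open>\<mu> j + 1 = \<kappa> j + (\<mu> j + 1 - \<kappa> j)\<close>
  gives the formally differentiated equation for \<open>\<mu>\<close>.\<close>

lemma taylor_derivative_equation:
  assumes a: "admissible a" and \<mu>: "\<mu> \<in> multi_indices" and v: "v \<in> H1_0 D"
  shows "(\<Sum>\<kappa> | \<kappa> \<le> \<mu>. aform (\<lambda>x. a x * exp_coeff \<phi> \<kappa> x * \<phi> j x) (t a (\<mu> - \<kappa>)) v +
     aform (\<lambda>x. a x * exp_coeff \<phi> \<kappa> x) (real (Suc ((\<mu> - \<kappa>) j)) *\<^sub>R t a ((\<mu> - \<kappa>)(j := Suc ((\<mu> - \<kappa>) j)))) v) = 0"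
proof -
  have ba: "bounded_borel a" using a by (auto simp: admissible_def)
  define \<mu>' where "\<mu>' = \<mu>(j := Suc (\<mu> j))"
  have \<mu>': "\<mu>' \<in> multi_indices" unfolding \<mu>'_def by (intro multi_indices_update \<mu>)
  have "\<mu>' j \<noteq> 0" by (simp add: \<mu>'_def)
  then have nz: "\<mu>' \<noteq> mi_zero" by auto
  define g where "g \<kappa> = aform (\<lambda>x. a x * exp_coeff \<phi> \<kappa> x) (t a (\<mu>' - \<kappa>)) v" for \<kappa>
  have fin: "finite {\<kappa>. \<kappa> \<le> \<mu>}" "finite {\<kappa>. \<kappa> \<le> \<mu>'}"
    using \<mu> \<mu>' finite_multi_indices_le by auto
  have "(\<Sum>\<kappa> | \<kappa> \<le> \<mu>'. g \<kappa>) = 0" unfolding g_def using taylor_eq[OF a \<mu>' v] nz by simp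
  then have "0 = (\<Sum>\<kappa> | \<kappa> \<le> \<mu>'. real (Suc (\<mu> j)) * g \<kappa>)" by (simp add: sum_distrib_left[symmetric])
  also have "\<dots> = (\<Sum>\<kappa> | \<kappa> \<le> \<mu>'. real (\<kappa> j) * g \<kappa>) + (\<Sum>\<kappa> | \<kappa> \<le> \<mu>'. (real (Suc (\<mu> j)) - real (\<kappa> j)) * g \<kappa>)"
    by (simp add: sum.distrib[symmetric] algebra_simps)
  also have "(\<Sum>\<kappa> | \<kappa> \<le> \<mu>'. real (\<kappa> j) * g \<kappa>) = (\<Sum>\<kappa> | \<kappa> \<le> \<mu>. aform (\<lambda>x. a x * exp_coeff \<phi> \<kappa> x * \<phi> j x) (t a (\<mu> - \<kappa>)) v)"
  proof -
    let ?up = "\<lambda>\<kappa>::nat \<Rightarrow> nat. \<kappa>(j := Suc (\<kappa> j))"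
    \<comment> \<open>The factor \<open>\<kappa> j\<close> removes the indices that vanish at
      \<open>j\<close>. The remaining ones are raised indices, for which
      \<open>exp_coeff_Suc\<close> trades this factor for \<open>\<phi> j\<close>.\<close>
    have img: "{\<kappa>. \<kappa> \<le> \<mu>' \<and> \<kappa> j \<noteq> 0} = ?up ` {\<kappa>. \<kappa> \<le> \<mu>}"
    proof (intro equalityI subsetI)
      fix \<kappa> assume "\<kappa> \<in> {\<kappa>. \<kappa> \<le> \<mu>' \<and> \<kappa> j \<noteq> 0}"
      then have \<kappa>: "\<And>i. \<kappa> i \<le> \<mu>' i" "\<kappa> j \<noteq> 0" by (auto simp: le_fun_def)
      have "(\<kappa>(j := \<kappa> j - 1)) i \<le> \<mu> i" for i
        using \<kappa>(1)[of i] by (auto simp: \<mu>'_def split: if_splits)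
      then show "\<kappa> \<in> ?up ` {\<kappa>. \<kappa> \<le> \<mu>}"
        using \<kappa>(2) by (intro image_eqI[of _ _ "\<kappa>(j := \<kappa> j - 1)"]) (auto simp: le_fun_def)
    qed (auto simp: le_fun_def \<mu>'_def)
    have inj: "inj_on ?up A" for A
    proof (rule inj_onI)
      fix \<kappa> \<kappa>' assume e: "?up \<kappa> = ?up \<kappa>'"
      show "\<kappa> = \<kappa>'"
      proof
        fix i show "\<kappa> i = \<kappa>' i" using fun_cong[OF e, of i] by (auto split: if_splits)
      qed
    qed
    have "(\<Sum>\<kappa> | \<kappa> \<le> \<mu>'. real (\<kappa> j) * g \<kappa>) = (\<Sum>\<kappa> | \<kappa> \<le> \<mu>' \<and> \<kappa> j \<noteq> 0. real (\<kappa> j) * g \<kappa>)"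
      using fin by (intro sum.mono_neutral_right) auto
    also have "\<dots> = (\<Sum>\<kappa> | \<kappa> \<le> \<mu>. real (?up \<kappa> j) * g (?up \<kappa>))"
      unfolding img by (subst sum.reindex[OF inj]) simp
    also have "\<dots> = (\<Sum>\<kappa> | \<kappa> \<le> \<mu>. aform (\<lambda>x. a x * exp_coeff \<phi> \<kappa> x * \<phi> j x) (t a (\<mu> - \<kappa>)) v)"
    proof (rule sum.cong[OF refl])
      fix \<kappa> assume "\<kappa> \<in> {\<kappa>. \<kappa> \<le> \<mu>}"
      then have \<kappa>: "\<kappa> \<in> multi_indices" using multi_indices_down[OF \<mu>] by simp
      have d: "\<mu>' - ?up \<kappa> = \<mu> - \<kappa>" by (auto simp: \<mu>'_def fun_eq_iff)
      have "(\<lambda>x. real (Suc (\<kappa> j)) * (a x * exp_coeff \<phi> (?up \<kappa>) x)) = (\<lambda>x. a x * exp_coeff \<phi> \<kappa> x * \<phi> j x)"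
      proof
        fix x
        show "real (Suc (\<kappa> j)) * (a x * exp_coeff \<phi> (?up \<kappa>) x) = a x * exp_coeff \<phi> \<kappa> x * \<phi> j x"
          using exp_coeff_Suc[OF \<kappa>, of j \<phi> x] by (metis mult.assoc mult.commute)
      qed
      then show "real (?up \<kappa> j) * g (?up \<kappa>) = aform (\<lambda>x. a x * exp_coeff \<phi> \<kappa> x * \<phi> j x) (t a (\<mu> - \<kappa>)) v"
        unfolding g_def d by (simp add: aform_coeff_scale[symmetric] del: of_nat_Suc)
    qed
    finally show ?thesis .
  qed
  also have "(\<Sum>\<kappa> | \<kappa> \<le> \<mu>'. (real (Suc (\<mu> j)) - real (\<kappa> j)) * g \<kappa>) =
    (\<Sum>\<kappa> | \<kappa> \<le> \<mu>. aform (\<lambda>x. a x * exp_coeff \<phi> \<kappa> x) (real (Suc ((\<mu> - \<kappa>) j)) *\<^sub>R t a ((\<mu> - \<kappa>)(j := Suc ((\<mu> - \<kappa>) j)))) v)"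
  proof -
    \<comment> \<open>The factor \<open>Suc (\<mu> j) - \<kappa> j\<close> vanishes exactly at the
      top value of the j-th entry, which leaves the indices below \<mu>.\<close>
    have le_eq: "{\<kappa>. \<kappa> \<le> \<mu>' \<and> \<kappa> j \<noteq> Suc (\<mu> j)} = {\<kappa>. \<kappa> \<le> \<mu>}"
    proof (intro equalityI subsetI)
      fix \<kappa> assume "\<kappa> \<in> {\<kappa>. \<kappa> \<le> \<mu>' \<and> \<kappa> j \<noteq> Suc (\<mu> j)}"
      then have \<kappa>: "\<And>i. \<kappa> i \<le> \<mu>' i" "\<kappa> j \<noteq> Suc (\<mu> j)" by (auto simp: le_fun_def)
      have "\<kappa> i \<le> \<mu> i" for i using \<kappa>(1)[of i] \<kappa>(2) by (cases "i = j") (auto simp: \<mu>'_def)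
      then show "\<kappa> \<in> {\<kappa>. \<kappa> \<le> \<mu>}" by (simp add: le_fun_def)
    next
      fix \<kappa> assume "\<kappa> \<in> {\<kappa>. \<kappa> \<le> \<mu>}"
      then have \<kappa>: "\<And>i. \<kappa> i \<le> \<mu> i" by (auto simp: le_fun_def)
      show "\<kappa> \<in> {\<kappa>. \<kappa> \<le> \<mu>' \<and> \<kappa> j \<noteq> Suc (\<mu> j)}"
        using \<kappa> by (auto simp: le_fun_def \<mu>'_def intro: le_SucI) (metis not_less_eq_eq order_refl)
    qed
    have "(\<Sum>\<kappa> | \<kappa> \<le> \<mu>'. (real (Suc (\<mu> j)) - real (\<kappa> j)) * g \<kappa>) = (\<Sum>\<kappa> | \<kappa> \<le> \<mu>' \<and> \<kappa> j \<noteq> Suc (\<mu> j). (real (Suc (\<mu> j)) - real (\<kappa> j)) * g \<kappa>)"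
      using fin by (intro sum.mono_neutral_right) auto
    also have "\<dots> = (\<Sum>\<kappa> | \<kappa> \<le> \<mu>. aform (\<lambda>x. a x * exp_coeff \<phi> \<kappa> x) (real (Suc ((\<mu> - \<kappa>) j)) *\<^sub>R t a ((\<mu> - \<kappa>)(j := Suc ((\<mu> - \<kappa>) j)))) v)"
      unfolding le_eq
    proof (rule sum.cong[OF refl])
      fix \<kappa> assume "\<kappa> \<in> {\<kappa>. \<kappa> \<le> \<mu>}"
      then have le: "\<kappa> j \<le> \<mu> j" by (simp add: le_fun_def)
      have d: "\<mu>' - \<kappa> = (\<mu> - \<kappa>)(j := Suc ((\<mu> - \<kappa>) j))"
        using le by (auto simp: \<mu>'_def fun_eq_iff)
      have c: "real (Suc (\<mu> j)) - real (\<kappa> j) = real (Suc ((\<mu> - \<kappa>) j))" using le by simp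
      show "(real (Suc (\<mu> j)) - real (\<kappa> j)) * g \<kappa> = aform (\<lambda>x. a x * exp_coeff \<phi> \<kappa> x) (real (Suc ((\<mu> - \<kappa>) j)) *\<^sub>R t a ((\<mu> - \<kappa>)(j := Suc ((\<mu> - \<kappa>) j)))) v"
        unfolding g_def d c aform_scaleR_left[OF bounded_borel_coeff[OF ba]] ..
    qed
    finally show ?thesis .
  qed
  finally show ?thesis by (simp only: sum.distrib)
qed

text \<open>Induction on the order. The coefficients of lower order are differentiable by
  hypothesis, the differentiated equation supplies a candidate for the derivative, and the error of
  the resulting linear approximation solves a variational problem whose right side is of smaller
  order than \<open>h\<close>.\<close>

lemma taylor_derivative_0:
  assumes a: "admissible a" and \<mu>: "\<mu> \<in> multi_indices"
  shows "((\<lambda>h. t (shift a j h) \<mu>) has_vector_derivative real (Suc (\<mu> j)) *\<^sub>R t a (\<mu>(j := Suc (\<mu> j)))) (at 0)"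
  using \<mu>
proof (induction "mi_size \<mu>" arbitrary: \<mu> rule: less_induct)
  case (less \<mu>)
  note \<mu> = less.prems
  obtain \<alpha> where \<alpha>: "bounded_borel a" "0 < \<alpha>" "\<And>x. \<alpha> \<le> a x" using a by (auto simp: admissible_def)
  obtain B where B: "0 \<le> B" "\<And>x. \<bar>\<phi> j x\<bar> \<le> B" using bounded_borelE[OF \<phi>[of j]] by blast
  obtain C where C: "0 \<le> C" "\<And>v. v \<in> H1_0 D \<Longrightarrow> norm v \<le> C * V_norm v"
    using Poincare[OF bounded_D] by blast
  have fin: "finite {\<kappa>. \<kappa> \<le> \<mu>}" using \<mu> by (rule finite_multi_indices_le)
  define T' where "T' \<kappa> = real (Suc (\<kappa> j)) *\<^sub>R t a (\<kappa>(j := Suc (\<kappa> j)))" for \<kappa>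
  \<comment> \<open>The coefficient of order \<mu> is replaced by its linear approximation, since
    its differentiability is still to be shown; the lower ones are kept, being covered by the
    induction hypothesis.\<close>
  define X where "X \<kappa> h = (if \<kappa> = mi_zero then t a \<mu> + h *\<^sub>R T' \<mu> else t (shift a j h) (\<mu> - \<kappa>))" for \<kappa> h
  have m0: "\<mu> - mi_zero = \<mu>" by (auto simp: fun_eq_iff)
  have X0: "X \<kappa> 0 = t a (\<mu> - \<kappa>)" for \<kappa> by (simp add: X_def m0)
  have X': "(X \<kappa> has_vector_derivative T' (\<mu> - \<kappa>)) (at 0)" if "\<kappa> \<le> \<mu>" for \<kappa>
  proof (cases "\<kappa> = mi_zero")
    case True
    have "((\<lambda>h. t a \<mu> + h *\<^sub>R T' \<mu>) has_vector_derivative T' \<mu>) (at 0)"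
      by (auto intro!: derivative_eq_intros)
    then show ?thesis using True by (simp add: X_def[abs_def] m0)
  next
    case False
    then show ?thesis
      using less.hyps[OF mi_size_diff_less[OF \<mu> that False] multi_indices_diff[OF \<mu>]]
      by (simp add: X_def[abs_def] T'_def)
  qed
  define w where "w \<kappa> x = a x * exp_coeff \<phi> \<kappa> x" for \<kappa> x
  have bw: "bounded_borel (w \<kappa>)" for \<kappa> unfolding w_def[abs_def] by (rule bounded_borel_coeff[OF \<alpha>(1)])
  define P where "P \<kappa> R \<longleftrightarrow> ((\<lambda>h. R h / \<bar>h\<bar>) \<longlongrightarrow> 0) (at 0) \<and> (\<forall>h. 0 \<le> R h) \<and>
    (\<forall>h v. \<bar>h\<bar> \<le> 1 \<longrightarrow> \<bar>aform (shift (w \<kappa>) j h) (X \<kappa> h) v - aform (w \<kappa>) (X \<kappa> 0) v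
       - h * (aform (\<lambda>x. w \<kappa> x * \<phi> j x) (X \<kappa> 0) v + aform (w \<kappa>) (T' (\<mu> - \<kappa>)) v)\<bar> \<le> R h * V_norm v)" for \<kappa> R
  have "\<forall>\<kappa>. \<exists>R. \<kappa> \<le> \<mu> \<longrightarrow> P \<kappa> R"
    unfolding P_def using aform_shift_derivative[OF bw X'] by blast
  from choice[OF this] obtain R where PR: "\<And>\<kappa>. \<kappa> \<le> \<mu> \<Longrightarrow> P \<kappa> (R \<kappa>)" by blast
  have R: "((\<lambda>h. R \<kappa> h / \<bar>h\<bar>) \<longlongrightarrow> 0) (at 0)" "0 \<le> R \<kappa> h"
    "\<bar>h\<bar> \<le> 1 \<Longrightarrow> \<bar>aform (shift (w \<kappa>) j h) (X \<kappa> h) v - aform (w \<kappa>) (X \<kappa> 0) v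
       - h * (aform (\<lambda>x. w \<kappa> x * \<phi> j x) (X \<kappa> 0) v + aform (w \<kappa>) (T' (\<mu> - \<kappa>)) v)\<bar> \<le> R \<kappa> h * V_norm v"
    if "\<kappa> \<le> \<mu>" for \<kappa> h v
    using PR[OF that] unfolding P_def by blast+
  define Rs where "Rs h = (\<Sum>\<kappa> | \<kappa> \<le> \<mu>. R \<kappa> h)" for h
  have Rs_lim: "((\<lambda>h. Rs h / \<bar>h\<bar>) \<longlongrightarrow> 0) (at 0)"
    unfolding Rs_def sum_divide_distrib by (rule tendsto_null_sum) (use R(1) in auto)
  have Rs_nonneg: "0 \<le> Rs h" for h unfolding Rs_def using R(2) by (intro sum_nonneg) auto
  define e where "e h = t (shift a j h) \<mu> - (t a \<mu> + h *\<^sub>R T' \<mu>)" for h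
  have tH: "t a \<mu> \<in> H1_0 D" "T' \<mu> \<in> H1_0 D"
    unfolding T'_def by (intro taylor_in_H1_0[OF a] H1_0_scaleR multi_indices_update \<mu>)+
  have eH: "e h \<in> H1_0 D" for h
    unfolding e_def by (intro H1_0_diff H1_0_add H1_0_scaleR tH taylor_in_H1_0[OF admissible_shift[OF a] \<mu>])
  \<comment> \<open>The equation at \<open>h\<close> minus the equation at 0 minus \<open>h\<close>
    times the differentiated equation leaves the form of the error, because only the term with
    \<kappa> = 0 was approximated, up to the remainders. It is tested with the error. For
    \<bar>h\<bar> \<le> 1 the shifted coefficients have a common lower bound.\<close>
  have e_bound: "V_norm (e h) \<le> Rs h / (\<alpha> * exp (- B))" if h: "\<bar>h\<bar> \<le> 1" for h
  proof (rule variational_bound[OF bounded_borel_shift[OF \<alpha>(1)] _ _ Rs_nonneg])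
    show "0 < \<alpha> * exp (- B)" using \<alpha> by simp
    show "\<alpha> * exp (- B) \<le> shift a j h x" for x
    proof -
      have "\<bar>h\<bar> * B \<le> B" using h B by (simp add: mult_left_le_one_le)
      then have "\<alpha> * exp (- B) \<le> \<alpha> * exp (- (\<bar>h\<bar> * B))" using \<alpha>(2) by simp
      also have "\<dots> \<le> shift a j h x" by (rule shift_ge[OF B(2) \<alpha>(2,3)])
      finally show ?thesis .
    qed
    define v where "v = e h"
    have v: "v \<in> H1_0 D" unfolding v_def by (rule eH)
    define \<delta> where "\<delta> = (if \<mu> = mi_zero then l v else 0)"
    have sh: "shift (w \<kappa>) j h = (\<lambda>x. shift a j h x * exp_coeff \<phi> \<kappa> x)" for \<kappa>
      by (auto simp: shift_def w_def)
    have F0: "(\<Sum>\<kappa> | \<kappa> \<le> \<mu>. aform (w \<kappa>) (X \<kappa> 0) v) = \<delta>"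
      unfolding X0 w_def \<delta>_def by (rule taylor_eq[OF a \<mu> v])
    have F': "(\<Sum>\<kappa> | \<kappa> \<le> \<mu>. aform (\<lambda>x. w \<kappa> x * \<phi> j x) (X \<kappa> 0) v + aform (w \<kappa>) (T' (\<mu> - \<kappa>)) v) = 0"
      unfolding X0 w_def T'_def by (rule taylor_derivative_equation[OF a \<mu> v])
    have Fh: "(\<Sum>\<kappa> | \<kappa> \<le> \<mu>. aform (shift (w \<kappa>) j h) (t (shift a j h) (\<mu> - \<kappa>)) v) = \<delta>"
      unfolding sh \<delta>_def by (rule taylor_eq[OF admissible_shift[OF a] \<mu> v])
    have diff: "(\<Sum>\<kappa> | \<kappa> \<le> \<mu>. aform (shift (w \<kappa>) j h) (t (shift a j h) (\<mu> - \<kappa>)) v - aform (shift (w \<kappa>) j h) (X \<kappa> h) v) =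
        aform (shift a j h) (e h) v"
    proof -
      have "(\<Sum>\<kappa> | \<kappa> \<le> \<mu>. aform (shift (w \<kappa>) j h) (t (shift a j h) (\<mu> - \<kappa>)) v - aform (shift (w \<kappa>) j h) (X \<kappa> h) v) =
        (\<Sum>\<kappa>\<in>{mi_zero}. aform (shift (w \<kappa>) j h) (t (shift a j h) (\<mu> - \<kappa>)) v - aform (shift (w \<kappa>) j h) (X \<kappa> h) v)"
        using fin by (intro sum.mono_neutral_right) (auto simp: X_def le_fun_def)
      also have "\<dots> = aform (shift a j h) (t (shift a j h) \<mu>) v - aform (shift a j h) (t a \<mu> + h *\<^sub>R T' \<mu>) v"
        by (simp add: X_def m0 sh)
      also have "\<dots> = aform (shift a j h) (e h) v"
        unfolding e_def by (rule aform_diff_left[symmetric, OF bounded_borel_shift[OF \<alpha>(1)]])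
      finally show ?thesis .
    qed
    have "aform (shift a j h) (e h) v = - (\<Sum>\<kappa> | \<kappa> \<le> \<mu>. aform (shift (w \<kappa>) j h) (X \<kappa> h) v - aform (w \<kappa>) (X \<kappa> 0) v
       - h * (aform (\<lambda>x. w \<kappa> x * \<phi> j x) (X \<kappa> 0) v + aform (w \<kappa>) (T' (\<mu> - \<kappa>)) v))"
      unfolding diff[symmetric] sum_subtractf sum_distrib_left[symmetric] F' Fh F0 by simp
    also have "\<dots> \<le> (\<Sum>\<kappa> | \<kappa> \<le> \<mu>. \<bar>aform (shift (w \<kappa>) j h) (X \<kappa> h) v - aform (w \<kappa>) (X \<kappa> 0) v
       - h * (aform (\<lambda>x. w \<kappa> x * \<phi> j x) (X \<kappa> 0) v + aform (w \<kappa>) (T' (\<mu> - \<kappa>)) v)\<bar>)"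
      unfolding sum_negf[symmetric] by (intro sum_mono abs_ge_minus_self)
    also have "\<dots> \<le> (\<Sum>\<kappa> | \<kappa> \<le> \<mu>. R \<kappa> h * V_norm v)"
      by (intro sum_mono R(3) h) simp
    also have "\<dots> = Rs h * V_norm v" by (simp add: Rs_def sum_distrib_right)
    finally show "aform (shift a j h) (e h) (e h) \<le> Rs h * V_norm (e h)" by (simp only: v_def)
  qed
  have "((\<lambda>h. norm (e h) / \<bar>h\<bar>) \<longlongrightarrow> 0) (at 0)"
  proof (rule Lim_null_comparison)
    have "\<forall>\<^sub>F h in at 0. h \<in> {-1<..<1} \<and> h \<noteq> (0::real)"
      by (intro eventually_conj eventually_at_in_open' eventually_neq_at_within) auto
    then show "\<forall>\<^sub>F h in at 0. norm (norm (e h) / \<bar>h\<bar>) \<le> C / (\<alpha> * exp (- B)) * (Rs h / \<bar>h\<bar>)"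
    proof eventually_elim
      case (elim h)
      have "norm (e h) \<le> C * (Rs h / (\<alpha> * exp (- B)))"
        using elim by (intro order_trans[OF C(2)[OF eH]] mult_left_mono e_bound C(1)) auto
      then have "norm (e h) / \<bar>h\<bar> \<le> C * (Rs h / (\<alpha> * exp (- B))) / \<bar>h\<bar>" by (intro divide_right_mono) auto
      then show ?case by simp
    qed
    show "((\<lambda>h. C / (\<alpha> * exp (- B)) * (Rs h / \<bar>h\<bar>)) \<longlongrightarrow> 0) (at 0)"
      by (rule tendsto_mult_right_zero[OF Rs_lim])
  qed
  then show ?case
    unfolding has_vector_derivative_def has_derivative_at T'_def[symmetric]
    by (auto simp: e_def algebra_simps intro!: bounded_linear_intros)
qed

text \<open>Shifts along a coordinate compose additively, so the derivative at \<open>h0\<close> is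
  the derivative at 0 for the coefficient already shifted by \<open>h0\<close>.\<close>

lemma taylor_has_derivative:
  assumes a: "admissible a" and \<mu>: "\<mu> \<in> multi_indices"
  shows "((\<lambda>h. t (shift a j h) \<mu>) has_vector_derivative
     real (Suc (\<mu> j)) *\<^sub>R t (shift a j h0) (\<mu>(j := Suc (\<mu> j)))) (at h0)"
proof -
  have 1: "((\<lambda>h. h - h0) has_vector_derivative 1) (at h0)"
    by (auto intro!: derivative_eq_intros)
  have 2: "((\<lambda>h. t (shift (shift a j h0) j h) \<mu>) has_vector_derivative
     real (Suc (\<mu> j)) *\<^sub>R t (shift a j h0) (\<mu>(j := Suc (\<mu> j)))) (at (h0 - h0))"
    using taylor_derivative_0[OF admissible_shift[OF a] \<mu>] by simp
  from vector_diff_chain_at[OF 1 2] show ?thesis by (simp add: o_def shift_shift)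
qed

end

section \<open>The lognormal coefficient\<close>

text \<open>\<open>\<phi> j\<close> is a Borel representative of the j-th function for which the
  bound \<open>c j\<close> and the overlap condition hold at every point of the space.\<close>

locale lognormal = parametric_problem D \<phi> l K
  for D :: "'a::euclidean_space set" and \<phi> l K +
  fixes c :: "nat \<Rightarrow> real" and M :: nat and q :: real
  assumes \<phi>_le: "\<And>j x. \<bar>\<phi> j x\<bar> \<le> c j"
    and overlap: "\<And>x. finite {j. \<phi> j x \<noteq> 0}" "\<And>x. card {j. \<phi> j x \<noteq> 0} \<le> M"
    and q: "0 < q" and c_summable: "summable (\<lambda>j. c j powr q)"
begin

lemma c_nonneg [simp]: "0 \<le> c j"
  using \<phi>_le[of j undefined] by linarith

text \<open>When \<open>c j\<close> is the essential supremum norm, finite overlap makes this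
  equivalent to convergence of the series in that norm; the condition involves the coordinates of
  \<open>y\<close> only.\<close>

definition good :: "(nat \<Rightarrow> real) \<Rightarrow> bool" where
  "good y \<longleftrightarrow> (\<lambda>j. \<bar>y j\<bar> * c j) \<longlonglongrightarrow> 0"

definition W :: "(nat \<Rightarrow> real) \<Rightarrow> real" where
  "W y = (SUP j. \<bar>y j\<bar> * c j)"

text \<open>Pointwise the series has finitely many terms, so this sum makes sense for every
  \<open>y\<close>, whether or not the series converges in the supremum norm.\<close>

definition b :: "(nat \<Rightarrow> real) \<Rightarrow> 'a \<Rightarrow> real" where
  "b y x = (\<Sum>j | \<phi> j x \<noteq> 0. y j * \<phi> j x)"

definition a :: "(nat \<Rightarrow> real) \<Rightarrow> 'a \<Rightarrow> real" where
  "a y x = exp (b y x)"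

definition trunc :: "nat \<Rightarrow> (nat \<Rightarrow> real) \<Rightarrow> nat \<Rightarrow> real" where
  "trunc n y j = (if j < n then y j else 0)"

lemma W_ge: "good y \<Longrightarrow> \<bar>y j\<bar> * c j \<le> W y"
  unfolding good_def W_def
  by (intro cSUP_upper bounded_imp_bdd_above convergent_imp_bounded) (auto simp: convergent_def)

lemma W_nonneg: "good y \<Longrightarrow> 0 \<le> W y"
  using W_ge[of y 0] by (meson abs_ge_zero c_nonneg mult_nonneg_nonneg order_trans)

lemma W_le: "(\<And>j. \<bar>y j\<bar> * c j \<le> s) \<Longrightarrow> W y \<le> s"
  unfolding W_def by (intro cSUP_least) auto

lemma b_bound:
  assumes "\<And>j. \<bar>z j\<bar> * c j \<le> s"
  shows "\<bar>b z x\<bar> \<le> real M * s"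
proof -
  have s: "0 \<le> s" using assms[of 0] by (meson abs_ge_zero c_nonneg mult_nonneg_nonneg order_trans)
  have "\<bar>b z x\<bar> \<le> (\<Sum>j | \<phi> j x \<noteq> 0. \<bar>z j * \<phi> j x\<bar>)"
    unfolding b_def by (rule sum_abs)
  also have "\<dots> \<le> (\<Sum>j | \<phi> j x \<noteq> 0. s)"
    unfolding abs_mult by (intro sum_mono order_trans[OF mult_left_mono[OF \<phi>_le] assms]) auto
  also have "\<dots> = real (card {j. \<phi> j x \<noteq> 0}) * s" by simp
  also have "\<dots> \<le> real M * s" using overlap(2)[of x] s by (intro mult_right_mono) auto
  finally show ?thesis .
qed

lemma b_diff: "b y x - b y' x = b (\<lambda>j. y j - y' j) x"
  by (simp add: b_def sum_subtractf[symmetric] left_diff_distrib)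

lemma b_eq_sum:
  assumes "\<And>j. n \<le> j \<Longrightarrow> y j = 0 \<or> \<phi> j x = 0"
  shows "b y x = (\<Sum>j<n. y j * \<phi> j x)"
proof -
  have "b y x = (\<Sum>j\<in>{j. \<phi> j x \<noteq> 0} \<union> {..<n}. y j * \<phi> j x)"
    unfolding b_def using overlap(1) by (intro sum.mono_neutral_left) auto
  also have "\<dots> = (\<Sum>j<n. y j * \<phi> j x)"
    using overlap(1) assms by (intro sum.mono_neutral_right) (auto simp: not_less[symmetric])
  finally show ?thesis .
qed

lemma b_trunc: "b (trunc n y) x = (\<Sum>j<n. y j * \<phi> j x)"
  by (subst b_eq_sum[of n]) (auto simp: trunc_def)

lemma measurable_b [measurable]: "b y \<in> borel_measurable borel"
proof (rule borel_measurable_LIMSEQ_real)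
  fix x
  obtain N where N: "\<And>j. \<phi> j x \<noteq> 0 \<Longrightarrow> j < N" using overlap(1)[of x] finite_nat_set_iff_bounded by auto
  have "\<forall>\<^sub>F n in sequentially. b y x = (\<Sum>j<n. y j * \<phi> j x)"
    by (intro eventually_sequentiallyI[of N] b_eq_sum) (use N in \<open>fastforce simp: not_less[symmetric]\<close>)
  then show "(\<lambda>n. \<Sum>j<n. y j * \<phi> j x) \<longlonglongrightarrow> b y x"
    by (rule Lim_transform_eventually[OF tendsto_const])
next
  have [measurable]: "\<phi> j \<in> borel_measurable borel" for j using \<phi> by (rule bounded_borel_measurable)
  show "(\<lambda>x. \<Sum>j<n. y j * \<phi> j x) \<in> borel_measurable borel" for n by measurable
qed

lemma abs_b_le: "good y \<Longrightarrow> \<bar>b y x\<bar> \<le> real M * W y"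
  by (intro b_bound W_ge)

lemma a_bounds:
  assumes "good y"
  shows "bounded_borel (a y)" "exp (- (real M * W y)) \<le> a y x" "a y x \<le> exp (real M * W y)"
proof -
  have *: "- (real M * W y) \<le> b y x" "b y x \<le> real M * W y" for x
    using abs_b_le[OF assms, of x] by linarith+
  show "exp (- (real M * W y)) \<le> a y x" "a y x \<le> exp (real M * W y)" using *[of x] by (simp_all add: a_def)
  show "bounded_borel (a y)"
    by (rule bounded_borelI[of _ "exp (real M * W y)"]) (use *(2) in \<open>auto simp: a_def[abs_def]\<close>)
qed

lemma admissible_a: "good y \<Longrightarrow> admissible (a y)"
  unfolding admissible_def using a_bounds by (blast intro: exp_gt_zero)

lemma good_trunc: "good (trunc n y)"
  unfolding good_def
  by (rule Lim_transform_eventually[OF tendsto_const eventually_sequentiallyI[of n]]) (simp add: trunc_def)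

lemma good_upd: "good y \<Longrightarrow> good (y(j := h))"
  unfolding good_def
  by (erule Lim_transform_eventually, rule eventually_sequentiallyI[of "Suc j"]) simp

lemma good_upd_iff: "good (y(j := h)) \<longleftrightarrow> good y"
  using good_upd[of y j h] good_upd[of "y(j := h)" j "y j"] by auto

lemma W_upd: "good y \<Longrightarrow> W (y(j := h)) \<le> W y + c j * \<bar>h\<bar>"
proof (rule W_le)
  fix i assume y: "good y"
  show "\<bar>(y(j := h)) i\<bar> * c i \<le> W y + c j * \<bar>h\<bar>"
  proof (cases "i = j")
    case True
    then show ?thesis using W_nonneg[OF y] by (simp add: mult.commute)
  next
    case False
    then have "\<bar>(y(j := h)) i\<bar> * c i \<le> W y" using W_ge[OF y, of i] by simp
    then show ?thesis using mult_nonneg_nonneg[OF c_nonneg[of j] abs_ge_zero[of h]] by linarith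
  qed
qed

text \<open>With the base point at 0 the coefficients on a whole coordinate line are shifts of a
  single one, which does not depend on the current value of \<open>y j\<close>.\<close>

lemma a_upd: "a (y(j := h)) = shift (a (y(j := 0))) j h"
proof
  fix x
  have "b (y(j := h)) x - b (y(j := 0)) x = b (\<lambda>i. if i = j then h else 0) x"
    unfolding b_diff by (rule arg_cong[of _ _ "\<lambda>z. b z x"]) auto
  also have "\<dots> = h * \<phi> j x"
    unfolding b_def using overlap(1)[of x] by (simp add: if_distrib[of "\<lambda>r. r * _"] cong: if_cong)
  finally have "b (y(j := h)) x = b (y(j := 0)) x + h * \<phi> j x" by linarith
  then show "a (y(j := h)) x = shift (a (y(j := 0))) j h x" by (simp add: a_def shift_def exp_add)
qed

text \<open>The value 0 off the good set matches the default of \<open>solution_map\<close>, so that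
  the two maps will agree everywhere and not just almost everywhere.\<close>

definition T :: "(nat \<Rightarrow> nat) \<Rightarrow> (nat \<Rightarrow> real) \<Rightarrow> 'a H1" where
  "T \<mu> y = (if good y then t (a y) \<mu> else 0)"

section \<open>Bounds, continuity and measurability of the Taylor coefficients in the
  parameter\<close>

lemma T_in_H1_0: "\<mu> \<in> multi_indices \<Longrightarrow> T \<mu> y \<in> H1_0 D"
  by (simp add: T_def taylor_in_H1_0 admissible_a)

lemma T_0_eq: "good y \<Longrightarrow> v \<in> H1_0 D \<Longrightarrow> aform (a y) (T mi_zero y) v = l v"
  by (simp add: T_def taylor_zero_eq admissible_a)

lemma l_le: "v \<in> H1_0 D \<Longrightarrow> \<bar>l v\<bar> \<le> K * V_norm v"
  using l by (simp add: functional_def)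

lemma V_norm_T_0:
  assumes y: "good y"
  shows "V_norm (T mi_zero y) \<le> K * exp (real M * W y)"
proof -
  have "V_norm (T mi_zero y) \<le> K / exp (- (real M * W y))"
  proof (rule variational_bound[OF a_bounds(1)[OF y] _ a_bounds(2)[OF y] K])
    show "aform (a y) (T mi_zero y) (T mi_zero y) \<le> K * V_norm (T mi_zero y)"
      using T_0_eq[OF y T_in_H1_0] l_le[OF T_in_H1_0, of mi_zero y] by simp
  qed simp
  then show ?thesis by (simp add: exp_minus field_simps)
qed

text \<open>The energy bound loses a factor \<open>exp (real M * W y)\<close> twice: once in passing
  from the energy to the V norm on the left, and once in bounding the energy of the solution on the
  right.\<close>

lemma T_square_sum:
  assumes y: "good y" and S: "finite S" "S \<subseteq> multi_indices" "mi_zero \<in> S"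
    and down: "\<And>\<mu> \<kappa>. \<mu> \<in> S \<Longrightarrow> \<kappa> \<le> \<mu> \<Longrightarrow> \<kappa> \<in> S"
    and bound: "\<And>n x. (\<Sum>j<n. \<bar>\<rho> j * \<phi> j x\<bar>) \<le> k" and k: "exp k < 2"
  shows "(\<Sum>\<mu>\<in>S. (mi_pow \<rho> \<mu>)\<^sup>2 * (V_norm (T \<mu> y))\<^sup>2) \<le> K\<^sup>2 / (2 - exp k) * exp (2 * (real M * W y))"
proof -
  define E where "E = exp (real M * W y)"
  have E: "0 < E" by (simp add: E_def)
  have Einv: "exp (- (real M * W y)) = 1 / E" by (simp add: E_def exp_minus inverse_eq_divide)
  have low: "(V_norm u)\<^sup>2 / E \<le> aform (a y) u u" for u
    using coercive[OF a_bounds(1,2)[OF y], of u] by (simp add: Einv)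
  have "(2 - exp k) * (\<Sum>\<mu>\<in>S. (mi_pow \<rho> \<mu>)\<^sup>2 * (V_norm (T \<mu> y))\<^sup>2) / E =
      (2 - exp k) * (\<Sum>\<mu>\<in>S. (mi_pow \<rho> \<mu>)\<^sup>2 * ((V_norm (T \<mu> y))\<^sup>2 / E))"
    by (simp add: sum_divide_distrib[symmetric])
  also have "\<dots> \<le> (2 - exp k) * (\<Sum>\<mu>\<in>S. (mi_pow \<rho> \<mu>)\<^sup>2 * aform (a y) (T \<mu> y) (T \<mu> y))"
    using k by (intro mult_left_mono sum_mono low) auto
  also have "\<dots> \<le> aform (a y) (T mi_zero y) (T mi_zero y)"
    using taylor_energy_bound[OF admissible_a[OF y] S down bound] y by (simp add: T_def)
  also have "\<dots> = l (T mi_zero y)" using y by (intro T_0_eq T_in_H1_0) auto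
  also have "\<dots> \<le> K * V_norm (T mi_zero y)" using l_le[OF T_in_H1_0, of mi_zero y] by simp
  also have "\<dots> \<le> K * (K * E)" unfolding E_def by (intro mult_left_mono V_norm_T_0 y K)
  finally have "(\<Sum>\<mu>\<in>S. (mi_pow \<rho> \<mu>)\<^sup>2 * (V_norm (T \<mu> y))\<^sup>2) \<le> K * (K * E) * E / (2 - exp k)"
    using k E by (simp add: field_simps)
  also have "\<dots> = K\<^sup>2 / (2 - exp k) * (E * E)" by (simp add: power2_eq_square)
  also have "E * E = exp (2 * (real M * W y))" unfolding E_def exp_add[symmetric] by simp
  finally show ?thesis .
qed

lemma T_has_derivative:
  assumes y: "good y" and \<mu>: "\<mu> \<in> multi_indices"
  shows "((\<lambda>h. T \<mu> (y(j := h))) has_vector_derivative real (Suc (\<mu> j)) *\<^sub>R T (\<mu>(j := Suc (\<mu> j))) (y(j := h0))) (at h0)"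
proof -
  have "T \<nu> (y(j := h)) = t (shift (a (y(j := 0))) j h) \<nu>" for \<nu> h
    using y unfolding T_def good_upd_iff by (subst a_upd) simp
  then show ?thesis using taylor_has_derivative[OF admissible_a[OF good_upd[OF y]] \<mu>] by simp
qed

text \<open>The difference of two solutions solves a variational problem driven by the difference of
  the coefficients, which is uniformly small when the exponents are uniformly close.\<close>

lemma T_0_tendsto:
  assumes y: "good y" and yn: "\<And>n. good (yn n)" and bd: "\<And>n x. \<bar>b (yn n) x - b y x\<bar> \<le> \<delta> n" and \<delta>: "\<delta> \<longlonglongrightarrow> 0"
  shows "(\<lambda>n. T mi_zero (yn n)) \<longlonglongrightarrow> T mi_zero y"
proof -
  obtain C where C: "0 \<le> C" "\<And>v. v \<in> H1_0 D \<Longrightarrow> norm v \<le> C * V_norm v"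
    using Poincare[OF bounded_D] by blast
  define E where "E = exp (real M * W y)"
  define u where "u = T mi_zero y"
  have \<delta>0: "0 \<le> \<delta> n" for n using bd[of n undefined] by linarith
  have E: "0 < E" by (simp add: E_def)
  have est: "norm (T mi_zero (yn n) - u) \<le> C * (E * (\<delta> n * exp (\<delta> n)) * V_norm u / (exp (- \<delta> n) / E))" for n
  proof -
    define u' where "u' = T mi_zero (yn n)"
    have uH: "u \<in> H1_0 D" "u' \<in> H1_0 D" unfolding u_def u'_def by (auto intro: T_in_H1_0)
    have dH: "u' - u \<in> H1_0 D" by (rule H1_0_diff[OF uH(2,1)])
    have bb: "bounded_borel (\<lambda>x. a y x - a (yn n) x)"
      by (intro bounded_borel_diff a_bounds y yn)
    have low: "exp (- \<delta> n) / E \<le> a (yn n) x" for x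
    proof -
      have "- \<delta> n - real M * W y \<le> b (yn n) x" using bd[of n x] abs_b_le[OF y, of x] by linarith
      then have "exp (- \<delta> n - real M * W y) \<le> a (yn n) x" by (simp add: a_def)
      then show ?thesis by (simp add: E_def exp_diff)
    qed
    have diff: "\<bar>a y x - a (yn n) x\<bar> \<le> E * (\<delta> n * exp (\<delta> n))" for x
    proof -
      have "a y x - a (yn n) x = - (a y x * (exp (b (yn n) x - b y x) - 1))"
        by (simp add: a_def algebra_simps exp_diff)
      then have "\<bar>a y x - a (yn n) x\<bar> = a y x * \<bar>exp (b (yn n) x - b y x) - 1\<bar>"
        by (simp add: abs_mult a_def)
      also have "\<dots> \<le> E * (\<bar>b (yn n) x - b y x\<bar> * exp \<bar>b (yn n) x - b y x\<bar>)"
        unfolding E_def by (intro mult_mono a_bounds y abs_exp_minus_one_le) auto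
      also have "\<dots> \<le> E * (\<delta> n * exp (\<delta> n))"
        using E \<delta>0 by (intro mult_left_mono mult_mono bd) (auto intro: bd)
      finally show ?thesis .
    qed
    have "aform (a (yn n)) (u' - u) (u' - u) = l (u' - u) - aform (a (yn n)) u (u' - u)"
      unfolding aform_diff_left[OF a_bounds(1)[OF yn]] u'_def[symmetric]
      using T_0_eq[OF yn dH, of n] by (simp add: u'_def)
    also have "\<dots> = aform (\<lambda>x. a y x - a (yn n) x) u (u' - u)"
      unfolding aform_coeff_diff[OF a_bounds(1)[OF y] a_bounds(1)[OF yn]]
      using T_0_eq[OF y dH] by (simp add: u_def)
    also have "\<dots> \<le> E * (\<delta> n * exp (\<delta> n)) * V_norm u * V_norm (u' - u)"
      using aform_bound[OF bounded_borel_measurable[OF bb] diff, of u "u' - u"] by linarith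
    finally have "V_norm (u' - u) \<le> E * (\<delta> n * exp (\<delta> n)) * V_norm u / (exp (- \<delta> n) / E)"
      using E \<delta>0 by (intro variational_bound[OF a_bounds(1)[OF yn] _ low]) auto
    then have "C * V_norm (u' - u) \<le> C * (E * (\<delta> n * exp (\<delta> n)) * V_norm u / (exp (- \<delta> n) / E))"
      by (intro mult_left_mono C)
    with C(2)[OF dH] show ?thesis unfolding u'_def by linarith
  qed
  have "(\<lambda>n. C * (E * (\<delta> n * exp (\<delta> n)) * V_norm u / (exp (- \<delta> n) / E))) \<longlonglongrightarrow> C * (E * (0 * exp 0) * V_norm u / (exp (- 0) / E))"
    using E by (intro tendsto_intros \<delta>) auto
  then have "(\<lambda>n. T mi_zero (yn n) - u) \<longlonglongrightarrow> 0"
    by (intro Lim_null_comparison[OF always_eventually[rule_format, OF est]]) simp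
  then show ?thesis by (simp add: u_def LIM_zero_iff)
qed

text \<open>The truncation error is a sum of the same kind with coordinates below \<open>n\<close>
  removed, so it is at most \<open>M\<close> times the supremum of the tail; that supremum tends to
  0 for a good \<open>y\<close>.\<close>

lemma b_trunc_uniform:
  assumes y: "good y"
  obtains \<delta> where "\<delta> \<longlonglongrightarrow> 0" "\<And>n x. \<bar>b (trunc n y) x - b y x\<bar> \<le> \<delta> n"
proof -
  define s where "s n = (SUP j. \<bar>y (n + j)\<bar> * c (n + j))" for n
  have bdd: "bdd_above (range (\<lambda>j. \<bar>y (n + j)\<bar> * c (n + j)))" for n
    using W_ge[OF y] by (intro bdd_aboveI2[of _ _ "W y"]) auto
  have s_ge: "\<bar>y j\<bar> * c j \<le> s n" if "n \<le> j" for n j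
  proof -
    have "\<bar>y (n + (j - n))\<bar> * c (n + (j - n)) \<le> s n"
      unfolding s_def by (rule cSUP_upper[OF UNIV_I bdd])
    then show ?thesis using that by simp
  qed
  have s0: "0 \<le> s n" for n using s_ge[of n n] by (meson abs_ge_zero c_nonneg mult_nonneg_nonneg order_refl order_trans)
  have s_lim: "s \<longlonglongrightarrow> 0"
  proof (rule LIMSEQ_I)
    fix e :: real assume "e > 0"
    then obtain N where N: "\<And>n. n \<ge> N \<Longrightarrow> \<bar>y n\<bar> * c n < e / 2"
      using y[unfolded good_def, THEN LIMSEQ_D, of "e / 2"] by (auto simp: abs_mult)
    have "s n \<le> e / 2" if "n \<ge> N" for n
      unfolding s_def using N that by (intro cSUP_least) (auto intro: less_imp_le)
    then show "\<exists>no. \<forall>n\<ge>no. norm (s n - 0) < e"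
      using s0 \<open>e > 0\<close> by (intro exI[of _ N]) fastforce
  qed
  show ?thesis
  proof
    show "\<bar>b (trunc n y) x - b y x\<bar> \<le> real M * s n" for n x
      unfolding b_diff
    proof (rule b_bound)
      show "\<bar>trunc n y j - y j\<bar> * c j \<le> s n" for j
        using s_ge[of n j] s0[of n] by (auto simp: trunc_def)
    qed
    show "(\<lambda>n. real M * s n) \<longlonglongrightarrow> 0" using tendsto_mult_left[OF s_lim, of "real M"] by simp
  qed
qed

lemma T_0_trunc_tendsto:
  assumes y: "good y"
  shows "(\<lambda>n. T mi_zero (trunc n y)) \<longlonglongrightarrow> T mi_zero y"
proof -
  obtain \<delta> where "\<delta> \<longlonglongrightarrow> 0" "\<And>n x. \<bar>b (trunc n y) x - b y x\<bar> \<le> \<delta> n"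
    using b_trunc_uniform[OF y] by blast
  then show ?thesis by (intro T_0_tendsto[OF y good_trunc])
qed

lemma measurable_good [measurable]: "Measurable.pred gaussian_product good"
proof -
  have "good y \<longleftrightarrow> (\<forall>k. \<exists>N. \<forall>n\<ge>N. \<bar>y n\<bar> * c n < inverse (real (Suc k)))" for y
  proof
    assume "good y"
    then show "\<forall>k. \<exists>N. \<forall>n\<ge>N. \<bar>y n\<bar> * c n < inverse (real (Suc k))"
      unfolding good_def using LIMSEQ_D[of "\<lambda>j. \<bar>y j\<bar> * c j" 0] by (fastforce simp: abs_mult)
  next
    assume *: "\<forall>k. \<exists>N. \<forall>n\<ge>N. \<bar>y n\<bar> * c n < inverse (real (Suc k))"
    show "good y" unfolding good_def
    proof (rule LIMSEQ_I)
      fix e :: real assume "e > 0"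
      then obtain k where "inverse (real (Suc k)) < e" using reals_Archimedean by blast
      then show "\<exists>no. \<forall>n\<ge>no. norm (\<bar>y n\<bar> * c n - 0) < e"
        using *[rule_format, of k] by (auto simp: abs_mult) (meson less_trans)
    qed
  qed
  then show ?thesis by (simp only: pred_def) measurable
qed

text \<open>On the good set the solution is the limit of the solutions for truncated parameters,
  each of which depends continuously on finitely many coordinates.\<close>

lemma measurable_T_0: "T mi_zero \<in> borel_measurable gaussian_product"
proof (rule borel_measurable_LIMSEQ_metric)
  fix y
  show "(\<lambda>n. if good y then T mi_zero (trunc n y) else 0) \<longlonglongrightarrow> T mi_zero y"
    using T_0_trunc_tendsto[of y] by (cases "good y") (auto simp: T_def[of _ y])
next
  fix n
  have "continuous_on UNIV (\<lambda>y. T mi_zero (trunc n y))"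
    unfolding continuous_on_sequentially o_def
  proof (intro ballI allI impI, elim conjE)
    fix y and x :: "nat \<Rightarrow> nat \<Rightarrow> real" assume x: "x \<longlonglongrightarrow> y"
    have coord: "(\<lambda>m. x m j) \<longlonglongrightarrow> y j" for j
      using continuous_on_tendsto_compose[OF continuous_on_product_coordinates[of j] x] by simp
    show "(\<lambda>m. T mi_zero (trunc n (x m))) \<longlonglongrightarrow> T mi_zero (trunc n y)"
    proof (rule T_0_tendsto[OF good_trunc good_trunc])
      show "\<bar>b (trunc n (x m)) z - b (trunc n y) z\<bar> \<le> (\<Sum>j<n. \<bar>x m j - y j\<bar> * c j)" for m z
      proof -
        have "\<bar>b (trunc n (x m)) z - b (trunc n y) z\<bar> = \<bar>\<Sum>j<n. (x m j - y j) * \<phi> j z\<bar>"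
          by (simp add: b_trunc sum_subtractf[symmetric] left_diff_distrib)
        also have "\<dots> \<le> (\<Sum>j<n. \<bar>(x m j - y j) * \<phi> j z\<bar>)" by (rule sum_abs)
        also have "\<dots> \<le> (\<Sum>j<n. \<bar>x m j - y j\<bar> * c j)"
          unfolding abs_mult by (intro sum_mono mult_left_mono \<phi>_le) auto
        finally show ?thesis .
      qed
      have "(\<lambda>m. \<Sum>j<n. \<bar>x m j - y j\<bar> * c j) \<longlonglongrightarrow> (\<Sum>j<n. \<bar>y j - y j\<bar> * c j)"
        by (intro tendsto_intros coord)
      then show "(\<lambda>m. \<Sum>j<n. \<bar>x m j - y j\<bar> * c j) \<longlonglongrightarrow> 0" by simp
    qed
  qed
  then have "(\<lambda>y. T mi_zero (trunc n y)) \<in> borel_measurable borel" by (rule borel_measurable_continuous_onI)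
  then have [measurable]: "(\<lambda>y. T mi_zero (trunc n y)) \<in> borel_measurable gaussian_product"
    using measurable_cong_sets[OF sets_gaussian_product_borel refl] by blast
  show "(\<lambda>y. if good y then T mi_zero (trunc n y) else 0) \<in> borel_measurable gaussian_product"
    by measurable
qed

text \<open>A coefficient of positive order is a multiple of a coordinate derivative of one of lower
  order, hence a pointwise limit of measurable difference quotients. Outside the good set all of
  these are 0.\<close>

lemma measurable_T [measurable]: "\<mu> \<in> multi_indices \<Longrightarrow> T \<mu> \<in> borel_measurable gaussian_product"
proof (induction "mi_size \<mu>" arbitrary: \<mu> rule: less_induct)
  case (less \<mu>)
  show ?case
  proof (cases "\<mu> = mi_zero")
    case True
    then show ?thesis using measurable_T_0 by simp
  next
    case False
    then obtain j where j: "\<mu> j \<noteq> 0" by auto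
    define \<nu> where "\<nu> = \<mu>(j := \<mu> j - 1)"
    have up: "\<nu>(j := Suc (\<nu> j)) = \<mu>" using j by (simp add: \<nu>_def)
    have \<nu>: "\<nu> \<in> multi_indices" unfolding \<nu>_def by (intro multi_indices_update less.prems)
    have "\<nu> = \<mu> - (mi_zero(j := 1))" by (auto simp: \<nu>_def fun_eq_iff)
    moreover have "mi_zero(j := 1) \<le> \<mu>" using j by (auto simp: le_fun_def)
    moreover have "mi_zero(j := 1) \<noteq> mi_zero" by (metis fun_upd_same zero_neq_one)
    ultimately have "mi_size \<nu> < mi_size \<mu>" using mi_size_diff_less[OF less.prems] by simp
    from less.hyps[OF this \<nu>] have [measurable]: "T \<nu> \<in> borel_measurable gaussian_product" .
    show ?thesis
    proof (rule borel_measurable_LIMSEQ_metric)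
      fix n
      have [measurable]: "(\<lambda>y. y(j := y j + inverse (real (Suc n)))) \<in> measurable gaussian_product gaussian_product"
      proof -
        have "(\<lambda>y. y(j := y j + inverse (real (Suc n)))) \<in> measurable gaussian_product (Pi\<^sub>M UNIV (\<lambda>_. borel))"
          by (rule measurable_PiM_single') (auto simp: fun_upd_def)
        then show ?thesis using measurable_cong_sets[OF refl sets_gaussian_product] by blast
      qed
      show "(\<lambda>y. (real (Suc n) / real (Suc (\<nu> j))) *\<^sub>R (T \<nu> (y(j := y j + inverse (real (Suc n)))) - T \<nu> y)) \<in> borel_measurable gaussian_product"
        by measurable
    next
      fix y
      show "(\<lambda>n. (real (Suc n) / real (Suc (\<nu> j))) *\<^sub>R (T \<nu> (y(j := y j + inverse (real (Suc n)))) - T \<nu> y)) \<longlonglongrightarrow> T \<mu> y"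
      proof (cases "good y")
        case True
        define G where "G h = T \<nu> (y(j := h))" for h
        have G: "(G has_vector_derivative real (Suc (\<nu> j)) *\<^sub>R T \<mu> y) (at (y j))"
          using T_has_derivative[OF True \<nu>, of j "y j"] unfolding up G_def[abs_def] by simp
        have *: "((\<lambda>h. (G (y j + h) - G (y j)) /\<^sub>R h) \<longlongrightarrow> real (Suc (\<nu> j)) *\<^sub>R T \<mu> y) (at 0)"
        proof -
          let ?D = "real (Suc (\<nu> j)) *\<^sub>R T \<mu> y"
          have "((\<lambda>h. norm (G (y j + h) - G (y j) - h *\<^sub>R ?D) / norm h) \<longlongrightarrow> 0) (at 0)"
            using G by (simp only: has_vector_derivative_def has_derivative_at)
          moreover have "\<forall>\<^sub>F h in at 0. norm (G (y j + h) - G (y j) - h *\<^sub>R ?D) / norm h = norm ((G (y j + h) - G (y j)) /\<^sub>R h - ?D)"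
            unfolding eventually_at_filter
          proof (intro always_eventually allI impI)
            fix h :: real assume "h \<noteq> 0"
            then have "(G (y j + h) - G (y j)) /\<^sub>R h - ?D = (G (y j + h) - G (y j) - h *\<^sub>R ?D) /\<^sub>R h"
              by (simp add: scaleR_diff_right)
            then show "norm (G (y j + h) - G (y j) - h *\<^sub>R ?D) / norm h = norm ((G (y j + h) - G (y j)) /\<^sub>R h - ?D)"
              by (simp only: norm_scaleR) (simp add: divide_inverse)
          qed
          ultimately have "((\<lambda>h. norm ((G (y j + h) - G (y j)) /\<^sub>R h - ?D)) \<longlongrightarrow> 0) (at 0)"
            by (rule Lim_transform_eventually)
          then show ?thesis unfolding tendsto_norm_zero_iff by (simp only: LIM_zero_iff)
        qed
        have "filterlim (\<lambda>n. inverse (real (Suc n))) (at 0) sequentially"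
          unfolding filterlim_at using LIMSEQ_inverse_real_of_nat by simp
        from tendsto_scaleR[OF tendsto_const filterlim_compose[OF * this], of "1 / real (Suc (\<nu> j))"]
        show ?thesis by (simp add: G_def)
      qed (simp add: T_def good_upd_iff)
    qed
  qed
qed

end

section \<open>Weighted summability of the Hermite coefficients\<close>

context lognormal
begin

text \<open>The supremum is controlled through a sum: \<open>exp (k * s)\<close> is at most
  \<open>exp k + s powr q * exp (k * s)\<close> for nonnegative s. With s = \<bar>y j\<bar>
  \<open>c j\<close> the last term has expectation at most a constant times
  \<open>c j powr q\<close>, which is summable. Almost sure finiteness of the sum also shows that
  almost every \<open>y\<close> is good.\<close>

lemma moments:
  assumes k: "0 < k"
  obtains g where "integrable gaussian_product g" "AE y in gaussian_product. good y \<and> exp (k * W y) \<le> g y"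
proof -
  have "bounded (range c)"
  proof -
    have "(\<lambda>j. c j powr q) \<longlonglongrightarrow> 0" using c_summable by (rule summable_LIMSEQ_zero)
    then have "bounded (range (\<lambda>j. c j powr q))" by (intro convergent_imp_bounded) (auto simp: convergent_def)
    then obtain B where B: "\<And>j. c j powr q \<le> B" by (fastforce simp: bounded_iff)
    have "c j \<le> B powr (1 / q)" for j
    proof -
      have "(c j powr q) powr (1 / q) \<le> B powr (1 / q)" using q by (intro powr_mono2 B) auto
      then show ?thesis using q by (simp add: powr_powr)
    qed
    then show ?thesis by (auto simp: bounded_iff)
  qed
  then obtain B where B: "\<And>j. c j \<le> B" by (fastforce simp: bounded_iff)
  define F where "F j s = (\<bar>s\<bar> * c j) powr q * exp (k * (\<bar>s\<bar> * c j))" for j s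
  have [measurable]: "F j \<in> borel_measurable borel" for j unfolding F_def[abs_def] by measurable
  have F_nonneg: "0 \<le> F j s" for j s by (simp add: F_def)
  define A where "A = (\<integral>s. exp ((q + k * B) * \<bar>s\<bar>) \<partial>std_gaussian)"
  have F_le: "F j s \<le> c j powr q * exp ((q + k * B) * \<bar>s\<bar>)" for j s
  proof -
    have "\<bar>s\<bar> powr q \<le> exp \<bar>s\<bar> powr q"
      using q exp_ge_add_one_self[of "\<bar>s\<bar>"] by (intro powr_mono2) (auto simp del: exp_ge_add_one_self)
    also have "\<dots> = exp (q * \<bar>s\<bar>)" by (simp add: powr_def)
    finally have 1: "\<bar>s\<bar> powr q \<le> exp (q * \<bar>s\<bar>)" .
    have "k * (\<bar>s\<bar> * c j) \<le> k * (\<bar>s\<bar> * B)" using k by (intro mult_left_mono B) auto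
    then have 2: "exp (k * (\<bar>s\<bar> * c j)) \<le> exp (k * B * \<bar>s\<bar>)" by (simp add: mult_ac)
    have "F j s = c j powr q * (\<bar>s\<bar> powr q * exp (k * (\<bar>s\<bar> * c j)))"
      by (simp add: F_def powr_mult)
    also have "\<dots> \<le> c j powr q * (exp (q * \<bar>s\<bar>) * exp (k * B * \<bar>s\<bar>))"
      by (intro mult_left_mono mult_mono 1 2) auto
    finally show ?thesis by (simp add: exp_add[symmetric] distrib_right)
  qed
  have iF: "integrable std_gaussian (F j)" for j
    by (rule Bochner_Integration.integrable_bound[OF integrable_mult_right[OF integrable_exp_std_gaussian[of "q + k * B"], of "c j powr q"]])
       (auto simp: F_nonneg F_le intro!: AE_I2 order_trans[OF F_le abs_ge_self])
  have nnF: "(\<integral>\<^sup>+y. ennreal (F j (y j)) \<partial>gaussian_product) \<le> ennreal (c j powr q * A)" for j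
  proof -
    have "integrable gaussian_product (\<lambda>y. F j (y j))" "(\<integral>y. F j (y j) \<partial>gaussian_product) = (\<integral>s. F j s \<partial>std_gaussian)"
      using integrable_prod_coordinates[of "{j}" F] integral_prod_coordinates[of "{j}" F] iF by auto
    then have "(\<integral>\<^sup>+y. ennreal (F j (y j)) \<partial>gaussian_product) = ennreal (\<integral>s. F j s \<partial>std_gaussian)"
      by (simp add: nn_integral_eq_integral F_nonneg)
    also have "(\<integral>s. F j s \<partial>std_gaussian) \<le> (\<integral>s. c j powr q * exp ((q + k * B) * \<bar>s\<bar>) \<partial>std_gaussian)"
      by (intro integral_mono iF integrable_mult_right integrable_exp_std_gaussian F_le)
    also have "\<dots> = c j powr q * A" by (simp add: A_def)
    finally show ?thesis by (simp add: ennreal_leI)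
  qed
  define Z where "Z y = (\<Sum>j. ennreal (F j (y j)))" for y
  have [measurable]: "Z \<in> borel_measurable gaussian_product" unfolding Z_def[abs_def] by measurable
  have "(\<integral>\<^sup>+y. Z y \<partial>gaussian_product) = (\<Sum>j. \<integral>\<^sup>+y. ennreal (F j (y j)) \<partial>gaussian_product)"
    unfolding Z_def by (intro nn_integral_suminf) measurable
  also have "\<dots> \<le> (\<Sum>j. ennreal (c j powr q * A))" by (intro suminf_le nnF summableI)
  also have "\<dots> < \<infinity>"
  proof -
    have "0 \<le> A" by (simp add: A_def)
    then show ?thesis using summable_mult2[OF c_summable, of A] by (subst suminf_ennreal2) auto
  qed
  finally have Zfin: "(\<integral>\<^sup>+y. Z y \<partial>gaussian_product) < \<infinity>" .
  then have AEZ: "AE y in gaussian_product. Z y \<noteq> \<infinity>" by (intro nn_integral_PInf_AE) auto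
  define g where "g y = exp k + enn2real (Z y)" for y
  have "integrable gaussian_product (\<lambda>y. enn2real (Z y))"
  proof (rule integrableI_nonneg)
    have "(\<integral>\<^sup>+y. ennreal (enn2real (Z y)) \<partial>gaussian_product) = (\<integral>\<^sup>+y. Z y \<partial>gaussian_product)"
      using AEZ by (intro nn_integral_cong_AE) (auto elim!: eventually_mono simp: ennreal_enn2real less_top)
    then show "(\<integral>\<^sup>+y. ennreal (enn2real (Z y)) \<partial>gaussian_product) < \<infinity>" using Zfin by simp
  qed auto
  then have "integrable gaussian_product g" unfolding g_def[abs_def] by simp
  moreover have "AE y in gaussian_product. good y \<and> exp (k * W y) \<le> g y"
    using AEZ
  proof eventually_elim
    case (elim y)
    have s: "summable (\<lambda>j. F j (y j))"
      using elim by (intro summable_suminf_not_top) (auto simp: Z_def F_nonneg)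
    have "(\<lambda>j. (\<bar>y j\<bar> * c j) powr q) \<longlonglongrightarrow> 0"
    proof (rule Lim_null_comparison[OF always_eventually[rule_format] summable_LIMSEQ_zero[OF s]])
      show "norm ((\<bar>y j\<bar> * c j) powr q) \<le> F j (y j)" for j
        using k by (simp add: F_def mult_le_cancel_left1)
    qed
    then have "(\<lambda>j. ((\<bar>y j\<bar> * c j) powr q) powr (1 / q)) \<longlonglongrightarrow> 0 powr (1 / q)"
      using q by (intro tendsto_powr' tendsto_const) auto
    then have good: "good y" using q by (simp add: good_def powr_powr)
    have gj: "exp (k * (\<bar>y j\<bar> * c j)) \<le> g y" for j
    proof -
      have "F j (y j) \<le> (\<Sum>j. F j (y j))" using sum_le_suminf[OF s, of "{j}"] by (simp add: F_nonneg)
      also have "\<dots> = enn2real (Z y)"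
        unfolding Z_def using s by (subst suminf_ennreal2) (auto simp: F_nonneg suminf_nonneg)
      finally have "F j (y j) \<le> enn2real (Z y)" .
      \<comment> \<open>Up to 1 the constant \<open>exp k\<close> suffices; beyond 1 the power in
        \<open>F\<close> is at least 1.\<close>
      moreover have "exp (k * (\<bar>y j\<bar> * c j)) \<le> exp k + F j (y j)"
      proof (cases "\<bar>y j\<bar> * c j \<le> 1")
        case True
        then have "k * (\<bar>y j\<bar> * c j) \<le> k" using k by (simp add: mult_le_cancel_left2)
        then show ?thesis using F_nonneg[of j "y j"] by (simp add: add_increasing2)
      next
        case False
        then have "1 \<le> (\<bar>y j\<bar> * c j) powr q" using q by (intro ge_one_powr_ge_zero) auto
        then have "exp (k * (\<bar>y j\<bar> * c j)) \<le> F j (y j)" by (simp add: F_def mult_le_cancel_right1)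
        then show ?thesis using exp_gt_zero[of k] by linarith
      qed
      ultimately show ?thesis by (simp add: g_def)
    qed
    have g: "0 < g y" using gj[of 0] exp_gt_zero less_le_trans by blast
    have "W y \<le> ln (g y) / k"
    proof (rule W_le)
      fix j
      have "k * (\<bar>y j\<bar> * c j) \<le> ln (g y)" using gj[of j] g by (simp add: ln_ge_iff)
      then show "\<bar>y j\<bar> * c j \<le> ln (g y) / k" using k by (simp add: field_simps)
    qed
    then have "k * W y \<le> ln (g y)" using k by (simp add: field_simps)
    then show ?case using good g by (simp add: ln_ge_iff)
  qed
  ultimately show ?thesis by (rule that)
qed

end

section \<open>Hermite coefficients of the Taylor coefficients\<close>

locale weighted_lognormal = lognormal D \<phi> l K c M q
  for D :: "'a::euclidean_space set" and \<phi> l K c M q +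
  fixes \<rho> :: "nat \<Rightarrow> real" and k :: real
  assumes \<rho>_pos: "\<And>j. 0 < \<rho> j" and \<rho>_sum: "\<And>n x. (\<Sum>j<n. \<bar>\<rho> j * \<phi> j x\<bar>) \<le> k" and k_less: "exp k < 2"
begin

text \<open>Passing to the gradient component makes the V norm the norm of a Hilbert space, so that
  Bessel's inequality and completeness apply with sharp constants.\<close>

definition \<tau> :: "(nat \<Rightarrow> nat) \<Rightarrow> (nat \<Rightarrow> real) \<Rightarrow> ('a, 'a) L2" where
  "\<tau> \<mu> y = snd (T \<mu> y)"

lemma norm_\<tau>: "norm (\<tau> \<mu> y) = V_norm (T \<mu> y)"
  by (simp add: \<tau>_def V_norm_def)

lemma measurable_\<tau> [measurable]: "\<mu> \<in> multi_indices \<Longrightarrow> \<tau> \<mu> \<in> borel_measurable gaussian_product"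
  unfolding \<tau>_def[abs_def]
  by (rule measurable_compose[OF measurable_T borel_measurable_continuous_onI]) (auto intro: continuous_intros)

lemma mi_pow_pos: "0 < mi_pow \<rho> \<mu>"
  unfolding mi_pow_def by (intro prod_pos) (auto simp: \<rho>_pos)

lemma \<tau>_square_le:
  assumes y: "good y" and \<mu>: "\<mu> \<in> multi_indices"
  shows "(mi_pow \<rho> \<mu>)\<^sup>2 * (norm (\<tau> \<mu> y))\<^sup>2 \<le> K\<^sup>2 / (2 - exp k) * exp (2 * (real M * W y))"
proof -
  have fin: "finite {\<kappa>. \<kappa> \<le> \<mu>}" using \<mu> by (rule finite_multi_indices_le)
  have "(mi_pow \<rho> \<mu>)\<^sup>2 * (norm (\<tau> \<mu> y))\<^sup>2 \<le> (\<Sum>\<kappa> | \<kappa> \<le> \<mu>. (mi_pow \<rho> \<kappa>)\<^sup>2 * (V_norm (T \<kappa> y))\<^sup>2)"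
    unfolding norm_\<tau> by (rule member_le_sum) (use fin in auto)
  also have "\<dots> \<le> K\<^sup>2 / (2 - exp k) * exp (2 * (real M * W y))"
    by (rule T_square_sum[OF y fin _ _ _ \<rho>_sum k_less])
       (use \<mu> multi_indices_down in \<open>auto simp: le_fun_def intro: order_trans\<close>)
  finally show ?thesis .
qed

lemma \<tau>_bound:
  assumes \<mu>: "\<mu> \<in> multi_indices"
  obtains C where "0 \<le> C" "\<And>y. good y \<Longrightarrow> norm (\<tau> \<mu> y) \<le> C * exp (real M * W y)"
proof
  define C where "C = sqrt (K\<^sup>2 / (2 - exp k)) / mi_pow \<rho> \<mu>"
  show C0: "0 \<le> C" unfolding C_def using k_less mi_pow_pos[of \<mu>] by simp
  fix y assume y: "good y"
  have "(norm (\<tau> \<mu> y))\<^sup>2 \<le> K\<^sup>2 / (2 - exp k) * exp (2 * (real M * W y)) / (mi_pow \<rho> \<mu>)\<^sup>2"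
  proof -
    have "0 < (mi_pow \<rho> \<mu>)\<^sup>2" using mi_pow_pos[of \<mu>] by simp
    then show ?thesis using \<tau>_square_le[OF y \<mu>] by (simp only: pos_le_divide_eq mult.commute)
  qed
  also have "\<dots> = (C * exp (real M * W y))\<^sup>2"
    using k_less by (simp add: C_def power_mult_distrib power_divide exp_double)
  finally show "norm (\<tau> \<mu> y) \<le> C * exp (real M * W y)" by (rule power2_le_imp_le) (use C0 in simp)
qed

lemma obtain_dominating:
  obtains g where "integrable gaussian_product g" "AE y in gaussian_product. good y \<and> exp (2 * (real M * W y)) \<le> g y"
proof -
  obtain g where g: "integrable gaussian_product g" "AE y in gaussian_product. good y \<and> exp ((2 * real M + 1) * W y) \<le> g y"
    \<comment> \<open>The summand 1 provides the positive exponent that \<open>moments\<close> asks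
      for even when \<open>M\<close> is 0.\<close>
    by (rule moments[of "2 * real M + 1"]) auto
  have "AE y in gaussian_product. good y \<and> exp (2 * (real M * W y)) \<le> g y"
    using g(2)
  proof eventually_elim
    case (elim y)
    have "exp (2 * (real M * W y)) \<le> exp ((2 * real M + 1) * W y)"
      using W_nonneg[of y] elim by (simp add: algebra_simps)
    then show ?case using elim by linarith
  qed
  with g(1) show ?thesis by (rule that)
qed

lemma AE_good: "AE y in gaussian_product. good y"
  by (rule obtain_dominating) auto

lemma square_integrable_\<tau>:
  assumes \<mu>: "\<mu> \<in> multi_indices"
  shows "square_integrable_on gaussian_product (\<tau> \<mu>)"
proof -
  obtain g where g: "integrable gaussian_product g" "AE y in gaussian_product. good y \<and> exp (2 * (real M * W y)) \<le> g y"
    by (rule obtain_dominating)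
  obtain C where C: "0 \<le> C" "\<And>y. good y \<Longrightarrow> norm (\<tau> \<mu> y) \<le> C * exp (real M * W y)"
    using \<tau>_bound[OF \<mu>] by blast
  show ?thesis
  proof (rule square_integrable_on_bound)
    show "integrable gaussian_product (\<lambda>y. C\<^sup>2 * g y)" by (rule integrable_mult_right[OF g(1)])
    show "AE y in gaussian_product. (norm (\<tau> \<mu> y))\<^sup>2 \<le> C\<^sup>2 * g y"
      using g(2)
    proof eventually_elim
      case (elim y)
      then have "(norm (\<tau> \<mu> y))\<^sup>2 \<le> (C * exp (real M * W y))\<^sup>2" by (intro power_mono C) auto
      also have "\<dots> = C\<^sup>2 * exp (2 * (real M * W y))" by (simp add: power_mult_distrib exp_double)
      also have "\<dots> \<le> C\<^sup>2 * g y" using elim by (intro mult_left_mono) auto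
      finally show ?case .
    qed
  qed (use \<mu> in measurable)
qed

text \<open>Pairing with a fixed \<open>z\<close> gives a real function of one coordinate, whose
  derivative is the pairing of the coefficient of raised index. Both grow at most exponentially
  because \<open>W\<close> increases at most linearly along the line.\<close>

lemma line_integration_by_parts:
  assumes y: "good y" and \<mu>: "\<mu> \<in> multi_indices"
  shows "real (Suc (\<mu> j)) * (\<integral>h. (\<tau> (\<mu>(j := Suc (\<mu> j))) (y(j := h)) \<bullet> z) * hermite n h \<partial>std_gaussian) =
    sqrt (real (Suc n)) * (\<integral>h. (\<tau> \<mu> (y(j := h)) \<bullet> z) * hermite (Suc n) h \<partial>std_gaussian)"
proof -
  define \<mu>' where "\<mu>' = \<mu>(j := Suc (\<mu> j))"
  have \<mu>': "\<mu>' \<in> multi_indices" unfolding \<mu>'_def by (intro multi_indices_update \<mu>)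
  have bl: "bounded_linear (\<lambda>v::'a H1. snd v \<bullet> z)"
    by (intro bounded_linear_compose[OF bounded_linear_inner_left] bounded_linear_snd)
  have der: "((\<lambda>h. \<tau> \<nu> (y(j := h)) \<bullet> z) has_real_derivative
      real (Suc (\<nu> j)) * (\<tau> (\<nu>(j := Suc (\<nu> j))) (y(j := h)) \<bullet> z)) (at h)" if "\<nu> \<in> multi_indices" for \<nu> h
    using bounded_linear.has_vector_derivative[OF bl T_has_derivative[OF y that, of j h]]
    unfolding \<tau>_def by (simp add: has_real_derivative_iff_has_vector_derivative del: of_nat_Suc)
  have cont: "continuous_on UNIV (\<lambda>h. \<tau> \<mu>' (y(j := h)) \<bullet> z)"
    by (intro continuous_at_imp_continuous_on ballI DERIV_isCont[OF der[OF \<mu>']])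
  have eb: "exp_bounded (\<lambda>h. \<tau> \<nu> (y(j := h)) \<bullet> z)" if \<nu>: "\<nu> \<in> multi_indices" for \<nu>
  proof -
    obtain C where C: "0 \<le> C" "\<And>y. good y \<Longrightarrow> norm (\<tau> \<nu> y) \<le> C * exp (real M * W y)"
      using \<tau>_bound[OF \<nu>] by blast
    show ?thesis
    proof (rule exp_boundedI)
      show "0 \<le> real M * c j" by simp
      fix h
      have "real M * W (y(j := h)) \<le> real M * (W y + c j * \<bar>h\<bar>)"
        by (intro mult_left_mono W_upd y) simp
      then have "norm (\<tau> \<nu> (y(j := h))) \<le> C * exp (real M * (W y + c j * \<bar>h\<bar>))"
        by (intro order_trans[OF C(2)[OF good_upd[OF y]]] mult_left_mono C(1)) simp
      then have "norm (\<tau> \<nu> (y(j := h))) * norm z \<le> C * exp (real M * (W y + c j * \<bar>h\<bar>)) * norm z"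
        by (rule mult_right_mono) simp
      then show "\<bar>\<tau> \<nu> (y(j := h)) \<bullet> z\<bar> \<le> C * exp (real M * W y) * norm z * exp (real M * c j * \<bar>h\<bar>)"
        using Cauchy_Schwarz_ineq2[of "\<tau> \<nu> (y(j := h))" z]
        by (simp add: distrib_left exp_add mult_ac)
    qed
  qed
  have "(\<integral>h. real (Suc (\<mu> j)) * (\<tau> \<mu>' (y(j := h)) \<bullet> z) * hermite n h \<partial>std_gaussian) =
    sqrt (real (Suc n)) * (\<integral>h. (\<tau> \<mu> (y(j := h)) \<bullet> z) * hermite (Suc n) h \<partial>std_gaussian)"
  proof (rule gaussian_integration_by_parts)
    show "((\<lambda>h. \<tau> \<mu> (y(j := h)) \<bullet> z) has_real_derivative real (Suc (\<mu> j)) * (\<tau> \<mu>' (y(j := h)) \<bullet> z)) (at h)" for h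
      unfolding \<mu>'_def by (rule der[OF \<mu>])
    show "continuous_on UNIV (\<lambda>h. real (Suc (\<mu> j)) * (\<tau> \<mu>' (y(j := h)) \<bullet> z))"
      by (intro continuous_intros cont)
  qed (intro eb \<mu> \<mu>' exp_bounded_mult exp_bounded_const)+
  then show ?thesis by (simp add: \<mu>'_def mult.assoc del: of_nat_Suc)
qed

lemma hermite_multi_upd:
  assumes "\<kappa> \<in> multi_indices"
  shows "hermite_multi \<kappa> (y(j := h)) = hermite_multi (\<kappa>(j := 0)) y * hermite (\<kappa> j) h"
proof -
  define J where "J = insert j {i. \<kappa> i \<noteq> 0}"
  have J: "finite J" "j \<in> J" using assms by (auto simp: J_def multi_indices_def)
  have "hermite_multi \<kappa> (y(j := h)) = (\<Prod>i\<in>J. hermite (\<kappa> i) ((y(j := h)) i))"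
    by (rule hermite_multi_eq_prod[OF J(1)]) (auto simp: J_def)
  also have "\<dots> = hermite (\<kappa> j) h * (\<Prod>i\<in>J - {j}. hermite (\<kappa> i) ((y(j := h)) i))"
    using J by (subst prod.remove[of _ j]) auto
  also have "(\<Prod>i\<in>J - {j}. hermite (\<kappa> i) ((y(j := h)) i)) = (\<Prod>i\<in>J - {j}. hermite ((\<kappa>(j := 0)) i) (y i))"
    by (intro prod.cong) auto
  also have "\<dots> = hermite_multi (\<kappa>(j := 0)) y"
    using J by (intro hermite_multi_eq_prod[symmetric]) (auto simp: J_def)
  finally show ?thesis by (simp only: mult.commute)
qed

text \<open>Integrating first over coordinate \<open>j\<close>, where the Hermite product splits off
  its factor in that coordinate, reduces the claim to integration by parts on each coordinate
  line.\<close>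

lemma coef_recurrence:
  assumes \<mu>: "\<mu> \<in> multi_indices" and \<kappa>: "\<kappa> \<in> multi_indices"
  shows "real (Suc (\<mu> j)) *\<^sub>R hermite.coef (\<tau> (\<mu>(j := Suc (\<mu> j)))) \<kappa> =
    sqrt (real (Suc (\<kappa> j))) *\<^sub>R hermite.coef (\<tau> \<mu>) (\<kappa>(j := Suc (\<kappa> j)))"
proof -
  define \<mu>' where "\<mu>' = \<mu>(j := Suc (\<mu> j))"
  define \<kappa>' where "\<kappa>' = \<kappa>(j := Suc (\<kappa> j))"
  have mi: "\<mu>' \<in> multi_indices" "\<kappa>' \<in> multi_indices"
    unfolding \<mu>'_def \<kappa>'_def by (intro multi_indices_update \<mu> \<kappa>)+
  define P where "P = hermite_multi (\<kappa>(j := 0))"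
  \<comment> \<open>The factor \<open>P\<close> is common to both sides because \<kappa> and the
    raised index differ only at \<open>j\<close>.\<close>
  define f where "f \<nu> \<eta> z y = P y * (\<integral>h. (\<tau> \<nu> (y(j := h)) \<bullet> z) * hermite (\<eta> j) h \<partial>std_gaussian)" for \<nu> \<eta> z y
  have inner: "hermite.coef (\<tau> \<nu>) \<eta> \<bullet> z = (\<integral>y. f \<nu> \<eta> z y \<partial>gaussian_product)"
    and meas: "f \<nu> \<eta> z \<in> borel_measurable gaussian_product"
    if \<nu>: "\<nu> \<in> multi_indices" and \<eta>: "\<eta> \<in> multi_indices" "\<eta>(j := 0) = \<kappa>(j := 0)" for \<nu> \<eta> z
  proof -
    have i: "integrable gaussian_product (\<lambda>y. hermite_multi \<eta> y *\<^sub>R \<tau> \<nu> y)"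
      by (intro hermite.coef_integrable square_integrable_\<tau> \<nu> \<eta>)
    then have i': "integrable gaussian_product (\<lambda>y. (hermite_multi \<eta> y *\<^sub>R \<tau> \<nu> y) \<bullet> z)"
      by (rule integrable_inner_left)
    have eq: "(\<integral>h. (hermite_multi \<eta> (y(j := h)) *\<^sub>R \<tau> \<nu> (y(j := h))) \<bullet> z \<partial>std_gaussian) = f \<nu> \<eta> z y" for y
    proof -
      have "(\<integral>h. (hermite_multi \<eta> (y(j := h)) *\<^sub>R \<tau> \<nu> (y(j := h))) \<bullet> z \<partial>std_gaussian) =
        (\<integral>h. P y * ((\<tau> \<nu> (y(j := h)) \<bullet> z) * hermite (\<eta> j) h) \<partial>std_gaussian)"
        by (simp add: hermite_multi_upd[OF \<eta>(1)] \<eta>(2) P_def mult_ac)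
      then show ?thesis by (simp add: f_def)
    qed
    have "hermite.coef (\<tau> \<nu>) \<eta> \<bullet> z = (\<integral>y. (hermite_multi \<eta> y *\<^sub>R \<tau> \<nu> y) \<bullet> z \<partial>gaussian_product)"
      unfolding hermite.coef_def by (rule integral_inner_left[symmetric, OF i])
    also have "\<dots> = (\<integral>y. f \<nu> \<eta> z y \<partial>gaussian_product)"
      by (subst integral_resample[OF i', of j]) (simp only: eq)
    finally show "hermite.coef (\<tau> \<nu>) \<eta> \<bullet> z = (\<integral>y. f \<nu> \<eta> z y \<partial>gaussian_product)" .
    show "f \<nu> \<eta> z \<in> borel_measurable gaussian_product"
      using integrable_resample[OF i', of j] unfolding eq by (rule borel_measurable_integrable)
  qed
  have eq: "(real (Suc (\<mu> j)) *\<^sub>R hermite.coef (\<tau> \<mu>') \<kappa>) \<bullet> z = (sqrt (real (Suc (\<kappa> j))) *\<^sub>R hermite.coef (\<tau> \<mu>) \<kappa>') \<bullet> z" for z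
  proof -
    have k': "\<kappa>'(j := 0) = \<kappa>(j := 0)" "\<kappa>' j = Suc (\<kappa> j)" by (auto simp: \<kappa>'_def)
    have "(\<integral>y. real (Suc (\<mu> j)) * f \<mu>' \<kappa> z y \<partial>gaussian_product) =
      (\<integral>y. sqrt (real (Suc (\<kappa> j))) * f \<mu> \<kappa>' z y \<partial>gaussian_product)"
    proof (rule integral_cong_AE)
      show "AE y in gaussian_product. real (Suc (\<mu> j)) * f \<mu>' \<kappa> z y =
         sqrt (real (Suc (\<kappa> j))) * f \<mu> \<kappa>' z y"
        using AE_good
      proof eventually_elim
        case (elim y)
        show ?case
          using line_integration_by_parts[OF elim \<mu>, of j z "\<kappa> j"]
          unfolding \<mu>'_def[symmetric] k'(2)[symmetric] f_def mult.left_commute[of _ "P y"] by simp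
      qed
    qed (intro borel_measurable_times borel_measurable_const meas mi \<mu> \<kappa> k' refl)+
    then show ?thesis
      unfolding inner_scaleR_left inner[OF mi(1) \<kappa> refl] inner[OF \<mu> mi(2) k'(1)] by (simp only: integral_mult_right_zero)
  qed
  then have "real (Suc (\<mu> j)) *\<^sub>R hermite.coef (\<tau> \<mu>') \<kappa> = sqrt (real (Suc (\<kappa> j))) *\<^sub>R hermite.coef (\<tau> \<mu>) \<kappa>'"
    by (subst vector_eq_ldot[symmetric]) (simp add: inner_commute)
  then show ?thesis by (simp only: \<mu>'_def \<kappa>'_def)
qed

lemma mi_fact_Suc:
  assumes "\<kappa> \<in> multi_indices"
  shows "mi_fact (\<kappa>(j := Suc (\<kappa> j))) = real (Suc (\<kappa> j)) * mi_fact \<kappa>"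
proof -
  define J where "J = insert j {i. \<kappa> i \<noteq> 0}"
  have J: "finite J" "j \<in> J" using assms by (auto simp: J_def multi_indices_def)
  have 1: "mi_fact \<kappa> = fact (\<kappa> j) * (\<Prod>i\<in>J - {j}. fact (\<kappa> i))"
    using J by (subst mi_fact_eq[of J]) (auto simp: J_def prod.remove[of _ j])
  have "mi_fact (\<kappa>(j := Suc (\<kappa> j))) = (\<Prod>i\<in>J. fact ((\<kappa>(j := Suc (\<kappa> j))) i))"
    by (rule mi_fact_eq[OF J(1)]) (auto simp: J_def)
  also have "\<dots> = fact (Suc (\<kappa> j)) * (\<Prod>i\<in>J - {j}. fact ((\<kappa>(j := Suc (\<kappa> j))) i))"
    using J by (subst prod.remove[of _ j]) auto
  also have "(\<Prod>i\<in>J - {j}. fact ((\<kappa>(j := Suc (\<kappa> j))) i)) = (\<Prod>i\<in>J - {j}. fact (\<kappa> i) :: real)"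
    by (intro prod.cong) auto
  finally show ?thesis unfolding 1 by (simp only: fact_Suc of_nat_mult mult.assoc)
qed

text \<open>Each use of the recurrence lowers the order of the Taylor coefficient and raises the
  Hermite index at the same place, until only the solution is left. The factorials collect the
  factors met on the way.\<close>

lemma coef_closed_form:
  assumes "\<mu> \<in> multi_indices" "\<kappa> \<in> multi_indices"
  shows "hermite.coef (\<tau> \<mu>) \<kappa> = (sqrt (mi_fact (\<lambda>j. \<kappa> j + \<mu> j) / mi_fact \<kappa>) / mi_fact \<mu>) *\<^sub>R
    hermite.coef (\<tau> mi_zero) (\<lambda>j. \<kappa> j + \<mu> j)"
  using assms
proof (induction "mi_size \<mu>" arbitrary: \<mu> \<kappa> rule: less_induct)
  case (less \<mu>)
  show ?case
  proof (cases "\<mu> = mi_zero")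
    case True
    have "mi_fact \<kappa> / mi_fact \<kappa> = 1" using mi_fact_pos[of \<kappa>] by simp
    moreover have "mi_fact mi_zero = 1" by (simp add: mi_fact_def)
    ultimately show ?thesis using True by simp
  next
    case False
    then obtain j where j: "\<mu> j \<noteq> 0" by auto
    define \<nu> where "\<nu> = \<mu>(j := \<mu> j - 1)"
    define \<kappa>' where "\<kappa>' = \<kappa>(j := Suc (\<kappa> j))"
    have up: "\<nu>(j := Suc (\<nu> j)) = \<mu>" "Suc (\<nu> j) = \<mu> j" using j by (simp_all add: \<nu>_def)
    have \<nu>: "\<nu> \<in> multi_indices" unfolding \<nu>_def by (intro multi_indices_update less.prems)
    have \<kappa>': "\<kappa>' \<in> multi_indices" unfolding \<kappa>'_def by (intro multi_indices_update less.prems)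
    have "\<nu> = \<mu> - (mi_zero(j := 1))" by (auto simp: \<nu>_def fun_eq_iff)
    moreover have "mi_zero(j := 1) \<le> \<mu>" using j by (auto simp: le_fun_def)
    moreover have "mi_zero(j := 1) \<noteq> mi_zero" by (metis fun_upd_same zero_neq_one)
    ultimately have size: "mi_size \<nu> < mi_size \<mu>" using mi_size_diff_less[OF less.prems(1)] by simp
    have sum_eq: "(\<lambda>i. \<kappa>' i + \<nu> i) = (\<lambda>i. \<kappa> i + \<mu> i)" using j by (auto simp: \<kappa>'_def \<nu>_def fun_eq_iff)
    have fk: "mi_fact \<kappa>' = real (Suc (\<kappa> j)) * mi_fact \<kappa>" unfolding \<kappa>'_def by (rule mi_fact_Suc[OF less.prems(2)])
    have fm: "mi_fact \<mu> = real (\<mu> j) * mi_fact \<nu>" using mi_fact_Suc[OF \<nu>, of j] unfolding up(1) unfolding up(2) .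
    have rec: "real (\<mu> j) *\<^sub>R hermite.coef (\<tau> \<mu>) \<kappa> = sqrt (real (Suc (\<kappa> j))) *\<^sub>R hermite.coef (\<tau> \<nu>) \<kappa>'"
      using coef_recurrence[OF \<nu> less.prems(2), of j] unfolding up(1) unfolding up(2) \<kappa>'_def .
    have "hermite.coef (\<tau> \<mu>) \<kappa> = (1 / real (\<mu> j)) *\<^sub>R (real (\<mu> j) *\<^sub>R hermite.coef (\<tau> \<mu>) \<kappa>)"
      using j by simp
    also have "\<dots> = (1 / real (\<mu> j) * sqrt (real (Suc (\<kappa> j))) * (sqrt (mi_fact (\<lambda>i. \<kappa> i + \<mu> i) / mi_fact \<kappa>') / mi_fact \<nu>)) *\<^sub>R
        hermite.coef (\<tau> mi_zero) (\<lambda>i. \<kappa> i + \<mu> i)"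
      unfolding rec less.hyps[OF size \<nu> \<kappa>'] sum_eq by (simp del: of_nat_Suc)
    also have "1 / real (\<mu> j) * sqrt (real (Suc (\<kappa> j))) * (sqrt (mi_fact (\<lambda>i. \<kappa> i + \<mu> i) / mi_fact \<kappa>') / mi_fact \<nu>) =
        sqrt (mi_fact (\<lambda>i. \<kappa> i + \<mu> i) / mi_fact \<kappa>) / mi_fact \<mu>"
      unfolding fk fm using mi_fact_pos[of \<kappa>] mi_fact_pos[of \<nu>] j
      by (simp add: real_sqrt_divide real_sqrt_mult field_simps del: of_nat_Suc)
    finally show ?thesis .
  qed
qed

section \<open>Weights from derivatives of bounded order\<close>

definition cut :: "nat \<Rightarrow> (nat \<Rightarrow> nat) \<Rightarrow> nat \<Rightarrow> nat" where
  "cut r \<nu> j = min (\<nu> j) r"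

text \<open>The square of the factor in \<open>coef_closed_form\<close> for the order \<mu> =
  \<open>cut r \<nu>\<close> and the Hermite index \<nu> - \<mu>, times the square of \<rho> to the
  power \<mu>.\<close>

definition weight :: "nat \<Rightarrow> (nat \<Rightarrow> nat) \<Rightarrow> real" where
  "weight r \<nu> = (mi_pow \<rho> (cut r \<nu>))\<^sup>2 * mi_fact \<nu> / (mi_fact (\<nu> - cut r \<nu>) * (mi_fact (cut r \<nu>))\<^sup>2)"

lemma cut_le: "cut r \<nu> \<le> \<nu>"
  by (simp add: cut_def le_fun_def)

text \<open>Each index \<open>\<nu>\<close> is tested against the single derivative \<open>cut r \<nu>\<close>; Bessel's inequality is
  applied to every derivative.\<close>

lemma weighted_coef_sum:
  obtains C where "\<And>r L. finite L \<Longrightarrow> L \<subseteq> multi_indices \<Longrightarrow>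
    (\<Sum>\<nu>\<in>L. weight r \<nu> * (norm (hermite.coef (\<tau> mi_zero) \<nu>))\<^sup>2) \<le> C"
proof -
  obtain g where g: "integrable gaussian_product g" "AE y in gaussian_product. good y \<and> exp (2 * (real M * W y)) \<le> g y"
    by (rule obtain_dominating)
  define C where "C = (\<integral>y. K\<^sup>2 / (2 - exp k) * g y \<partial>gaussian_product)"
  have "(\<Sum>\<nu>\<in>L. weight r \<nu> * (norm (hermite.coef (\<tau> mi_zero) \<nu>))\<^sup>2) \<le> C"
    if L: "finite L" "L \<subseteq> multi_indices" for r L
  proof -
    \<comment> \<open>The downward closure of the orders that occur, as the summed energy bound
      demands.\<close>
    define S where "S = insert mi_zero (\<Union>\<nu>\<in>L. {\<kappa>. \<kappa> \<le> cut r \<nu>})"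
    have cutI: "cut r \<nu> \<in> multi_indices" if "\<nu> \<in> multi_indices" for \<nu>
      by (rule multi_indices_down[OF that cut_le])
    have S: "finite S" "S \<subseteq> multi_indices" "mi_zero \<in> S"
      unfolding S_def using L finite_multi_indices_le[OF cutI] multi_indices_down[OF cutI] by auto
    have down: "\<kappa> \<in> S" if "\<mu> \<in> S" "\<kappa> \<le> \<mu>" for \<mu> \<kappa>
    proof (cases "\<mu> = mi_zero")
      case True
      then have "\<kappa> = mi_zero" using that by (auto simp: le_fun_def)
      then show ?thesis by (simp add: S_def)
    next
      case False
      then show ?thesis using that order_trans[OF that(2)] by (auto simp: S_def)
    qed
    have weq: "weight r \<nu> * (norm (hermite.coef (\<tau> mi_zero) \<nu>))\<^sup>2 =
       (mi_pow \<rho> \<mu>)\<^sup>2 * (norm (hermite.coef (\<tau> \<mu>) (\<nu> - \<mu>)))\<^sup>2" if "\<nu> \<in> L" "cut r \<nu> = \<mu>" for \<nu> \<mu>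
    proof -
      have \<nu>: "\<nu> \<in> multi_indices" using that L by auto
      have \<mu>: "\<mu> \<in> multi_indices" "\<mu> \<le> \<nu>" using cutI[OF \<nu>] cut_le[of r \<nu>] that by auto
      have add: "(\<lambda>j. (\<nu> - \<mu>) j + \<mu> j) = \<nu>" using \<mu>(2) by (auto simp: le_fun_def fun_eq_iff)
      have "(norm (hermite.coef (\<tau> \<mu>) (\<nu> - \<mu>)))\<^sup>2 =
         mi_fact \<nu> / mi_fact (\<nu> - \<mu>) / (mi_fact \<mu>)\<^sup>2 * (norm (hermite.coef (\<tau> mi_zero) \<nu>))\<^sup>2"
        unfolding coef_closed_form[OF \<mu>(1) multi_indices_diff[OF \<nu>]] add
        using mi_fact_pos[of \<nu>] mi_fact_pos[of "\<nu> - \<mu>"] by (simp add: power_mult_distrib power_divide)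
      then show ?thesis by (simp add: weight_def that(2) field_simps)
    qed
    \<comment> \<open>Indices with the same cut \<mu> are grouped together. Within a group \<nu> is
      determined by \<nu> - \<mu>, so Bessel's inequality for the single function
      \<open>\<tau> \<mu>\<close> covers the whole group.\<close>
    have "(\<Sum>\<nu>\<in>L. weight r \<nu> * (norm (hermite.coef (\<tau> mi_zero) \<nu>))\<^sup>2) =
       (\<Sum>\<mu>\<in>cut r ` L. \<Sum>\<nu>\<in>{\<nu>\<in>L. cut r \<nu> = \<mu>}. weight r \<nu> * (norm (hermite.coef (\<tau> mi_zero) \<nu>))\<^sup>2)"
      by (rule sum.image_gen[OF L(1)])
    also have "\<dots> \<le> (\<Sum>\<mu>\<in>cut r ` L. (mi_pow \<rho> \<mu>)\<^sup>2 * (\<integral>y. (norm (\<tau> \<mu> y))\<^sup>2 \<partial>gaussian_product))"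
    proof (rule sum_mono)
      fix \<mu> assume "\<mu> \<in> cut r ` L"
      then have \<mu>: "\<mu> \<in> multi_indices" using L cutI by auto
      let ?L = "{\<nu>\<in>L. cut r \<nu> = \<mu>}"
      have inj: "inj_on (\<lambda>\<nu>. \<nu> - \<mu>) ?L"
      proof (rule inj_onI)
        fix \<nu> \<nu>' assume *: "\<nu> \<in> ?L" "\<nu>' \<in> ?L" "\<nu> - \<mu> = \<nu>' - \<mu>"
        show "\<nu> = \<nu>'"
        proof
          fix j
          have "cut r \<nu> j = \<mu> j" "cut r \<nu>' j = \<mu> j" using *(1,2) by auto
          then have "\<mu> j \<le> \<nu> j" "\<mu> j \<le> \<nu>' j" by (auto simp: cut_def)
          then show "\<nu> j = \<nu>' j" using fun_cong[OF *(3), of j] by simp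
        qed
      qed
      have "(\<Sum>\<nu>\<in>?L. weight r \<nu> * (norm (hermite.coef (\<tau> mi_zero) \<nu>))\<^sup>2) =
          (\<Sum>\<nu>\<in>?L. (mi_pow \<rho> \<mu>)\<^sup>2 * (norm (hermite.coef (\<tau> \<mu>) (\<nu> - \<mu>)))\<^sup>2)"
        by (intro sum.cong refl weq) auto
      also have "\<dots> = (mi_pow \<rho> \<mu>)\<^sup>2 * (\<Sum>\<kappa>\<in>(\<lambda>\<nu>. \<nu> - \<mu>) ` ?L. (norm (hermite.coef (\<tau> \<mu>) \<kappa>))\<^sup>2)"
        by (subst sum.reindex[OF inj]) (simp add: sum_distrib_left)
      also have "\<dots> \<le> (mi_pow \<rho> \<mu>)\<^sup>2 * (\<integral>y. (norm (\<tau> \<mu> y))\<^sup>2 \<partial>gaussian_product)"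
        using L by (intro mult_left_mono hermite.Bessel square_integrable_\<tau> \<mu>) (auto intro: multi_indices_diff)
      finally show "(\<Sum>\<nu>\<in>?L. weight r \<nu> * (norm (hermite.coef (\<tau> mi_zero) \<nu>))\<^sup>2) \<le>
         (mi_pow \<rho> \<mu>)\<^sup>2 * (\<integral>y. (norm (\<tau> \<mu> y))\<^sup>2 \<partial>gaussian_product)" .
    qed
    also have "\<dots> \<le> (\<Sum>\<mu>\<in>S. (mi_pow \<rho> \<mu>)\<^sup>2 * (\<integral>y. (norm (\<tau> \<mu> y))\<^sup>2 \<partial>gaussian_product))"
    proof (rule sum_mono2[OF S(1)])
      show "cut r ` L \<subseteq> S" by (auto simp: S_def)
    qed simp
    also have "\<dots> = (\<integral>y. (\<Sum>\<mu>\<in>S. (mi_pow \<rho> \<mu>)\<^sup>2 * (norm (\<tau> \<mu> y))\<^sup>2) \<partial>gaussian_product)"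
    proof (subst Bochner_Integration.integral_sum)
      show "integrable gaussian_product (\<lambda>y. (mi_pow \<rho> \<mu>)\<^sup>2 * (norm (\<tau> \<mu> y))\<^sup>2)" if "\<mu> \<in> S" for \<mu>
        using square_integrable_\<tau>[of \<mu>] that S(2) by (auto simp: square_integrable_on_def)
    qed simp
    also have "\<dots> \<le> C"
      unfolding C_def
    proof (rule integral_mono_AE)
      show "integrable gaussian_product (\<lambda>y. \<Sum>\<mu>\<in>S. (mi_pow \<rho> \<mu>)\<^sup>2 * (norm (\<tau> \<mu> y))\<^sup>2)"
      proof (rule Bochner_Integration.integrable_sum)
        show "integrable gaussian_product (\<lambda>y. (mi_pow \<rho> \<mu>)\<^sup>2 * (norm (\<tau> \<mu> y))\<^sup>2)" if "\<mu> \<in> S" for \<mu>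
          using square_integrable_\<tau>[of \<mu>] that S(2) by (auto simp: square_integrable_on_def)
      qed
      show "integrable gaussian_product (\<lambda>y. K\<^sup>2 / (2 - exp k) * g y)" by (rule integrable_mult_right[OF g(1)])
      show "AE y in gaussian_product. (\<Sum>\<mu>\<in>S. (mi_pow \<rho> \<mu>)\<^sup>2 * (norm (\<tau> \<mu> y))\<^sup>2) \<le> K\<^sup>2 / (2 - exp k) * g y"
        using g(2)
      proof eventually_elim
        case (elim y)
        have "(\<Sum>\<mu>\<in>S. (mi_pow \<rho> \<mu>)\<^sup>2 * (norm (\<tau> \<mu> y))\<^sup>2) \<le> K\<^sup>2 / (2 - exp k) * exp (2 * (real M * W y))"
          unfolding norm_\<tau> by (rule T_square_sum[OF _ S down \<rho>_sum k_less]) (use elim in auto)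
        also have "\<dots> \<le> K\<^sup>2 / (2 - exp k) * g y" using elim k_less by (intro mult_left_mono) auto
        finally show ?case .
      qed
    qed
    finally show ?thesis .
  qed
  then show ?thesis by (rule that)
qed

end

section \<open>Summability of the inverse weights\<close>

locale summable_lognormal = weighted_lognormal D \<phi> l K c M q \<rho> k
  for D :: "'a::euclidean_space set" and \<phi> l K c M q \<rho> k +
  assumes \<rho>_summable: "summable (\<lambda>j. \<rho> j powr - q)"
begin

definition weight1 :: "nat \<Rightarrow> nat \<Rightarrow> nat \<Rightarrow> real" where
  "weight1 r j n = (\<rho> j ^ min n r)\<^sup>2 * fact n / (fact (n - min n r) * (fact (min n r))\<^sup>2)"

lemma weight1_pos: "0 < weight1 r j n"
  unfolding weight1_def by (intro divide_pos_pos mult_pos_pos zero_less_power \<rho>_pos fact_gt_zero)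

lemma weight_eq_prod:
  assumes "\<nu> \<in> multi_indices"
  shows "weight r \<nu> = (\<Prod>j | \<nu> j \<noteq> 0. weight1 r j (\<nu> j))"
proof -
  let ?J = "{j. \<nu> j \<noteq> 0}"
  have J: "finite ?J" using assms by (simp add: multi_indices_def)
  have sub: "{j. cut r \<nu> j \<noteq> 0} \<subseteq> ?J" "{j. (\<nu> - cut r \<nu>) j \<noteq> 0} \<subseteq> ?J" by (auto simp: cut_def)
  show ?thesis
    unfolding weight_def mi_pow_eq[OF J sub(1)] mi_fact_eq[OF J sub(1)] mi_fact_eq[OF J sub(2)] mi_fact_def[of \<nu>]
    by (simp add: weight1_def prod.distrib prod_dividef prod_power_distrib cut_def)
qed

lemma weight_pos: "\<nu> \<in> multi_indices \<Longrightarrow> 0 < weight r \<nu>"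
  by (simp add: weight_eq_prod weight1_pos prod_pos)

text \<open>Beyond \<open>r\<close> the factor is \<rho> to the power 2 r times a binomial
  coefficient, which grows like the r-th power of \<open>n\<close>; up to \<open>r\<close> the
  growth is absorbed by the constant. As \<rho> is bounded away from 0, one square of it can be kept
  and the other powers estimated from below.\<close>

lemma weight1_lower_bound:
  assumes r: "0 < r"
  obtains A where "0 < A" "\<And>j n. 1 \<le> n \<Longrightarrow> A * (\<rho> j)\<^sup>2 * real n ^ r \<le> weight1 r j n"
proof -
  have "(\<lambda>j. \<rho> j powr - q) \<longlonglongrightarrow> 0" using \<rho>_summable by (rule summable_LIMSEQ_zero)
  then have "bounded (range (\<lambda>j. \<rho> j powr - q))" by (intro convergent_imp_bounded) (auto simp: convergent_def)
  then obtain B where "\<And>j. \<rho> j powr - q \<le> B" by (fastforce simp: bounded_iff)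
  then have B: "\<rho> j powr - q \<le> max B 1" for j using le_max_iff_disj by blast
  \<comment> \<open>A common lower bound of all \<open>\<rho> j\<close>, taken at most 1 so that its
    powers decrease.\<close>
  define m where "m = max B 1 powr (- (1 / q))"
  have m: "0 < m" "m \<le> 1"
  proof -
    show "0 < m" by (simp add: m_def)
    have "max B 1 powr (- (1 / q)) \<le> 1 powr (- (1 / q))" using q by (intro powr_mono2') auto
    then show "m \<le> 1" by (simp add: m_def)
  qed
  have m_le: "m \<le> \<rho> j" for j
  proof -
    have "max B 1 powr (- (1 / q)) \<le> (\<rho> j powr - q) powr (- (1 / q))"
      using q \<rho>_pos[of j] by (intro powr_mono2' B) auto
    also have "\<dots> = \<rho> j" using q \<rho>_pos[of j] by (simp add: powr_powr)
    finally show ?thesis by (simp add: m_def)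
  qed
  have pow: "(\<rho> j)\<^sup>2 * m ^ (2 * r) \<le> (\<rho> j ^ i)\<^sup>2" if i: "1 \<le> i" "i \<le> r" for i j
  proof -
    have "m ^ (2 * r) \<le> m ^ (2 * (i - 1))" using m i by (intro power_decreasing) auto
    also have "\<dots> \<le> \<rho> j ^ (2 * (i - 1))" using m m_le by (intro power_mono) auto
    finally have "(\<rho> j)\<^sup>2 * m ^ (2 * r) \<le> \<rho> j ^ 2 * \<rho> j ^ (2 * (i - 1))" by (intro mult_left_mono) auto
    also have "\<dots> = \<rho> j ^ (2 + 2 * (i - 1))" by (rule power_add[symmetric])
    also have "2 + 2 * (i - 1) = i * 2" using i by simp
    also have "\<rho> j ^ (i * 2) = (\<rho> j ^ i)\<^sup>2" by (rule power_mult)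
    finally show ?thesis .
  qed
  \<comment> \<open>The denominator serves both ranges: \<open>real r ^ r\<close> bounds the power
    of \<open>n\<close> for small \<open>n\<close> and matches the lower bound of the binomial
    coefficient by the r-th power of n / r for large \<open>n\<close>.\<close>
  define A where "A = m ^ (2 * r) / (fact r * real r ^ r)"
  have A: "0 < A" using m r by (simp add: A_def)
  have "A * (\<rho> j)\<^sup>2 * real n ^ r \<le> weight1 r j n" if n: "1 \<le> n" for j n
  proof (cases "n \<le> r")
    case True
    have "A * (\<rho> j)\<^sup>2 * real n ^ r \<le> A * (\<rho> j)\<^sup>2 * real r ^ r"
      using True A by (intro mult_left_mono power_mono) auto
    also have "\<dots> = (\<rho> j)\<^sup>2 * m ^ (2 * r) / fact r" using r by (simp add: A_def)
    also have "\<dots> \<le> (\<rho> j ^ n)\<^sup>2 / fact n"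
      using pow[OF n True] True by (intro frac_le) (auto intro: fact_mono)
    also have "\<dots> = weight1 r j n" using True by (simp add: weight1_def power2_eq_square)
    finally show ?thesis .
  next
    case False
    then have rn: "r \<le> n" by simp
    have "fact n = fact r * fact (n - r) * real (n choose r)"
      using binomial_fact_lemma[OF rn] by (metis of_nat_fact of_nat_mult)
    then have w: "weight1 r j n = (\<rho> j ^ r)\<^sup>2 * real (n choose r) / fact r"
      using rn by (simp add: weight1_def min_absorb2 power2_eq_square)
    have "A * (\<rho> j)\<^sup>2 * real n ^ r = (\<rho> j)\<^sup>2 * m ^ (2 * r) * (real n / real r) ^ r / fact r"
      by (simp add: A_def power_divide mult_ac)
    also have "\<dots> \<le> (\<rho> j ^ r)\<^sup>2 * real (n choose r) / fact r"
      using r by (intro divide_right_mono mult_mono pow binomial_ge_n_over_k_pow_k rn) auto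
    finally show ?thesis unfolding w .
  qed
  with A show ?thesis by (rule that)
qed

lemma weight_sum:
  obtains r C where "\<And>L. finite L \<Longrightarrow> L \<subseteq> multi_indices \<Longrightarrow> (\<Sum>\<nu>\<in>L. weight r \<nu> powr - (q / 2)) \<le> C"
proof -
  \<comment> \<open>At least 4 / q, so that the power r * q / 2 of 1 / n is at least 2 and the sum
    over \<open>n\<close> converges.\<close>
  define r where "r = nat \<lceil>4 / q\<rceil> + 1"
  have r: "0 < r" "2 \<le> real r * (q / 2)"
  proof -
    have "4 / q \<le> real r" unfolding r_def by linarith
    then show "2 \<le> real r * (q / 2)" using q by (simp add: field_simps)
  qed (simp add: r_def)
  obtain A where A: "0 < A" "\<And>j n. 1 \<le> n \<Longrightarrow> A * (\<rho> j)\<^sup>2 * real n ^ r \<le> weight1 r j n"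
    using weight1_lower_bound[OF r(1)] by blast
  define f where "f j n = weight1 r j n powr - (q / 2)" for j n
  define Z where "Z = (\<Sum>n. 1 / real (Suc n) ^ 2)"
  have sZ: "summable (\<lambda>n. 1 / real (Suc n) ^ 2)"
    using inverse_power_summable[of 2, where 'a = real] by (subst summable_Suc_iff) (simp add: inverse_eq_divide)
  have Z0: "0 \<le> Z" unfolding Z_def by (intro suminf_nonneg sZ) auto
  define A' where "A' = A powr - (q / 2)"
  have f_le: "f j n \<le> A' * \<rho> j powr - q * (1 / real n ^ 2)" if n: "1 \<le> n" for j n
  proof -
    have pos: "0 < A * (\<rho> j)\<^sup>2 * real n ^ r" using A(1) \<rho>_pos[of j] n by simp
    have "f j n \<le> (A * (\<rho> j)\<^sup>2 * real n ^ r) powr - (q / 2)"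
      unfolding f_def using q by (intro powr_mono2' A(2) n pos) auto
    also have "\<dots> = A' * (\<rho> j)\<^sup>2 powr - (q / 2) * (real n ^ r) powr - (q / 2)"
      using A(1) \<rho>_pos[of j] n by (simp add: powr_mult A'_def)
    also have "(\<rho> j)\<^sup>2 powr - (q / 2) = \<rho> j powr - q"
      using \<rho>_pos[of j] by (simp add: powr_powr flip: powr_numeral)
    also have "(real n ^ r) powr - (q / 2) = real n powr (- (real r * (q / 2)))"
      using n by (simp add: powr_powr flip: powr_realpow)
    also have "A' * \<rho> j powr - q * real n powr (- (real r * (q / 2))) \<le> A' * \<rho> j powr - q * real n powr (- 2)"
      using r(2) n by (intro mult_left_mono powr_mono) (auto simp: A'_def)
    also have "real n powr (- 2) = 1 / real n ^ 2"
      using n by (simp add: powr_minus inverse_eq_divide flip: powr_numeral)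
    finally show ?thesis .
  qed
  have f0: "f j 0 = 1" for j by (simp add: f_def weight1_def)
  \<comment> \<open>The bound 1 + x \<le> exp x turns the product over coordinates into the
    exponential of a convergent series.\<close>
  have f_sum: "(\<Sum>i\<le>n. f j i) \<le> exp (A' * Z * \<rho> j powr - q)" for j n
  proof -
    have "(\<Sum>i\<le>n. f j i) = 1 + (\<Sum>i<n. f j (Suc i))"
      by (simp add: sum.atMost_shift f0)
    also have "(\<Sum>i<n. f j (Suc i)) \<le> (\<Sum>i<n. A' * \<rho> j powr - q * (1 / real (Suc i) ^ 2))"
      by (intro sum_mono f_le) simp
    also have "\<dots> = A' * \<rho> j powr - q * (\<Sum>i<n. 1 / real (Suc i) ^ 2)" by (rule sum_distrib_left[symmetric])
    also have "\<dots> \<le> A' * \<rho> j powr - q * Z"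
      unfolding Z_def by (intro mult_left_mono sum_le_suminf sZ) (auto simp: A'_def)
    finally have "(\<Sum>i\<le>n. f j i) \<le> 1 + A' * Z * \<rho> j powr - q" by (simp add: mult_ac)
    also have "\<dots> \<le> exp (A' * Z * \<rho> j powr - q)" by (rule exp_ge_add_one_self)
    finally show ?thesis .
  qed
  define C where "C = exp (A' * Z * (\<Sum>j. \<rho> j powr - q))"
  have "(\<Sum>\<nu>\<in>L. weight r \<nu> powr - (q / 2)) \<le> C" if L: "finite L" "L \<subseteq> multi_indices" for L
  proof -
    have "weight r \<nu> powr - (q / 2) = (\<Prod>j | \<nu> j \<noteq> 0. f j (\<nu> j))" if "\<nu> \<in> L" for \<nu>
    proof -
      have "\<nu> \<in> multi_indices" using that L by auto
      then show ?thesis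
        unfolding f_def by (simp add: weight_eq_prod prod_powr_distrib weight1_pos less_imp_le)
    qed
    then have eq: "(\<Sum>\<nu>\<in>L. weight r \<nu> powr - (q / 2)) = (\<Sum>\<nu>\<in>L. \<Prod>j | \<nu> j \<noteq> 0. f j (\<nu> j))"
      by (rule sum.cong[OF refl])
    obtain n s where "(\<Sum>\<nu>\<in>L. \<Prod>j | \<nu> j \<noteq> 0. f j (\<nu> j)) \<le> (\<Prod>j<n. \<Sum>i\<le>s. f j i)"
    proof (rule sum_multi_index_prod_le[OF L])
      show "0 \<le> f j i" for j i by (simp add: f_def)
    qed (rule f0)
    also have "\<dots> \<le> (\<Prod>j<n. exp (A' * Z * \<rho> j powr - q))"
      by (intro prod_mono conjI f_sum sum_nonneg) (simp add: f_def)
    also have "\<dots> = exp (A' * Z * (\<Sum>j<n. \<rho> j powr - q))"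
      by (simp add: exp_sum sum_distrib_left)
    also have "\<dots> \<le> C"
    proof -
      have "(\<Sum>j<n. \<rho> j powr - q) \<le> (\<Sum>j. \<rho> j powr - q)"
        by (intro sum_le_suminf \<rho>_summable) auto
      then show ?thesis using Z0 unfolding C_def by (simp add: A'_def mult_left_mono)
    qed
    finally show ?thesis unfolding eq .
  qed
  then show ?thesis by (rule that)
qed

text \<open>Young's inequality with the conjugate exponents 2 / p and 2 / (2 - p), applied term by
  term, plays the part of Hoelder's inequality for the sums.\<close>

lemma coef_p_sum:
  assumes p: "0 < p" "p < 2" and qp: "q = 2 * p / (2 - p)"
  obtains C where "\<And>L. finite L \<Longrightarrow> L \<subseteq> multi_indices \<Longrightarrow>
    (\<Sum>\<nu>\<in>L. norm (hermite.coef (\<tau> mi_zero) \<nu>) powr p) \<le> C"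
proof -
  obtain r C1 where C1: "\<And>L. finite L \<Longrightarrow> L \<subseteq> multi_indices \<Longrightarrow> (\<Sum>\<nu>\<in>L. weight r \<nu> powr - (q / 2)) \<le> C1"
    by (rule weight_sum) blast
  obtain C2 where C2: "\<And>r L. finite L \<Longrightarrow> L \<subseteq> multi_indices \<Longrightarrow>
    (\<Sum>\<nu>\<in>L. weight r \<nu> * (norm (hermite.coef (\<tau> mi_zero) \<nu>))\<^sup>2) \<le> C2"
    by (rule weighted_coef_sum) blast
  have "(\<Sum>\<nu>\<in>L. norm (hermite.coef (\<tau> mi_zero) \<nu>) powr p) \<le> p / 2 * C2 + (1 - p / 2) * C1"
    if L: "finite L" "L \<subseteq> multi_indices" for L
  proof -
    have "(\<Sum>\<nu>\<in>L. norm (hermite.coef (\<tau> mi_zero) \<nu>) powr p) \<le>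
      (\<Sum>\<nu>\<in>L. p / 2 * (weight r \<nu> * (norm (hermite.coef (\<tau> mi_zero) \<nu>))\<^sup>2) + (1 - p / 2) * weight r \<nu> powr - (q / 2))"
    proof (rule sum_mono)
      fix \<nu> assume "\<nu> \<in> L"
      then have w: "0 < weight r \<nu>" using L by (intro weight_pos) auto
      define x where "x = norm (hermite.coef (\<tau> mi_zero) \<nu>)"
      define w where "w = weight r \<nu>"
      have w: "0 < w" using w by (simp add: w_def)
      show "norm (hermite.coef (\<tau> mi_zero) \<nu>) powr p \<le> p / 2 * (weight r \<nu> * (norm (hermite.coef (\<tau> mi_zero) \<nu>))\<^sup>2) + (1 - p / 2) * weight r \<nu> powr - (q / 2)"
        unfolding x_def[symmetric] w_def[symmetric]
      proof (cases "x = 0")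
        case True
        then show "x powr p \<le> p / 2 * (w * x\<^sup>2) + (1 - p / 2) * w powr - (q / 2)" using p by simp
      next
        case False
        then have x: "0 < x" by (simp add: x_def)
        \<comment> \<open>This identity is the origin of the relation between \<open>p\<close> and
          \<open>q\<close>: it makes the two powers of the weight cancel.\<close>
        have e: "- (q / 2) * (1 - p / 2) = - (p / 2)" using p by (simp add: qp field_simps)
        have "x powr p = (w * x\<^sup>2) powr (p / 2) * (w powr - (q / 2)) powr (1 - p / 2)"
        proof -
          have "(w * x\<^sup>2) powr (p / 2) = w powr (p / 2) * x powr p"
            using w x by (simp add: powr_mult powr_powr flip: powr_numeral)
          moreover have "(w powr - (q / 2)) powr (1 - p / 2) = w powr - (p / 2)"
            unfolding powr_powr e ..
          ultimately show ?thesis using w by (simp add: powr_minus)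
        qed
        also have "\<dots> \<le> p / 2 * (w * x\<^sup>2) + (1 - p / 2) * w powr - (q / 2)"
          using p w x by (intro Youngs_inequality_0) auto
        finally show "x powr p \<le> p / 2 * (w * x\<^sup>2) + (1 - p / 2) * w powr - (q / 2)" .
      qed
    qed
    also have "\<dots> = p / 2 * (\<Sum>\<nu>\<in>L. weight r \<nu> * (norm (hermite.coef (\<tau> mi_zero) \<nu>))\<^sup>2) + (1 - p / 2) * (\<Sum>\<nu>\<in>L. weight r \<nu> powr - (q / 2))"
      by (simp add: sum.distrib sum_distrib_left)
    also have "\<dots> \<le> p / 2 * C2 + (1 - p / 2) * C1"
      using p by (intro add_mono mult_left_mono C1 C2 L) auto
    finally show ?thesis .
  qed
  then show ?thesis by (rule that)
qed

end

section \<open>Borel representatives of the data\<close>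

lemma AE_lebesgue_on_iff:
  assumes "open D"
  shows "(AE x in lebesgue_on D. P x) \<longleftrightarrow> (AE x in lborel. x \<in> D \<longrightarrow> P x)"
  using assms by (subst AE_restrict_space_iff) (auto simp: AE_completion_iff)

lemma borel_measurable_lebesgue_on: "w \<in> borel_measurable borel \<Longrightarrow> w \<in> borel_measurable (lebesgue_on D)"
  by (rule measurable_restrict_space1) (rule measurable_completion, simp)

lemma Linf_norm_le:
  "w \<in> borel_measurable (lebesgue_on D) \<Longrightarrow> AE x in lebesgue_on D. ereal \<bar>w x\<bar> \<le> B \<Longrightarrow> Linf_norm D w \<le> B"
  unfolding Linf_norm_def by (rule esssup_I) auto

lemma AE_le_Linf_norm: "AE x in lebesgue_on D. ereal \<bar>w x\<bar> \<le> Linf_norm D w"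
  unfolding Linf_norm_def by (rule esssup_AE)

text \<open>The essential supremum over a null space is minus infinity; a nonempty open set has
  positive measure.\<close>

lemma Linf_norm_nonneg:
  assumes "open D" "D \<noteq> {}"
  shows "0 \<le> Linf_norm D w"
proof -
  have "D \<notin> null_sets lebesgue"
    using open_not_negligible[OF assms] by (simp add: negligible_iff_null_sets)
  moreover have "D \<in> sets lebesgue" using assms by auto
  ultimately have "emeasure (lebesgue_on D) (space (lebesgue_on D)) \<noteq> 0"
    by (auto simp: emeasure_restrict_space null_sets_def)
  then have "(0::ereal) = esssup (lebesgue_on D) (\<lambda>x. 0)" by (simp add: esssup_const)
  also have "\<dots> \<le> Linf_norm D w" unfolding Linf_norm_def by (rule esssup_mono) auto
  finally show ?thesis .
qed

text \<open>Each function is changed on one null set common to all \<open>j\<close>, and set to 0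
  there and outside \<open>D\<close>. Supports can only shrink, so the overlap condition survives,
  and the bounds hold at every point.\<close>

lemma obtain_borel_representative:
  fixes \<psi> :: "nat \<Rightarrow> 'a::euclidean_space \<Rightarrow> real"
  assumes D: "open D" and meas: "\<And>j. \<psi> j \<in> borel_measurable (lebesgue_on D)"
    and bound: "\<And>j. AE x in lebesgue_on D. \<bar>\<psi> j x\<bar> \<le> c j" and c: "\<And>j. 0 \<le> c j"
  obtains \<phi> where "\<And>j. \<phi> j \<in> borel_measurable borel" "\<And>j x. \<bar>\<phi> j x\<bar> \<le> c j"
    "\<And>j x. \<phi> j x \<noteq> 0 \<Longrightarrow> x \<in> D \<and> \<psi> j x \<noteq> 0" "\<And>j. AE x in lebesgue_on D. \<phi> j x = \<psi> j x"
proof -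
  have "\<exists>g\<in>borel_measurable lborel. AE x in lborel. (if x \<in> D then \<psi> j x else 0) = g x" for j
  proof (rule completion_ex_borel_measurable_real)
    show "(\<lambda>x. if x \<in> D then \<psi> j x else 0) \<in> borel_measurable lebesgue"
      using meas[of j] D by (subst (asm) measurable_restrict_space_iff[where c = 0]) auto
  qed
  then have "\<forall>j. \<exists>g. g \<in> borel_measurable lborel \<and> (AE x in lborel. (if x \<in> D then \<psi> j x else 0) = g x)"
    by blast
  from choice[OF this] obtain g where g: "\<And>j. g j \<in> borel_measurable lborel"
    "\<And>j. AE x in lborel. (if x \<in> D then \<psi> j x else 0) = g j x" by blast
  have "AE x in lborel. \<forall>j. (if x \<in> D then \<psi> j x else 0) = g j x \<and> (x \<in> D \<longrightarrow> \<bar>\<psi> j x\<bar> \<le> c j)"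
    unfolding AE_all_countable using g(2) bound[unfolded AE_lebesgue_on_iff[OF D]] by (auto intro: AE_conjI)
  then obtain N where N: "{x \<in> space lborel. \<not> (\<forall>j. (if x \<in> D then \<psi> j x else 0) = g j x \<and> (x \<in> D \<longrightarrow> \<bar>\<psi> j x\<bar> \<le> c j))} \<subseteq> N"
    "emeasure lborel N = 0" "N \<in> sets lborel" by (rule AE_E)
  define \<phi> where "\<phi> j x = (if x \<in> D - N then g j x else 0)" for j x
  have out: "(if x \<in> D then \<psi> j x else 0) = g j x" "x \<in> D \<Longrightarrow> \<bar>\<psi> j x\<bar> \<le> c j" if "x \<notin> N" for x j
  proof -
    have "x \<in> space lborel" by simp
    then have "\<forall>j. (if x \<in> D then \<psi> j x else 0) = g j x \<and> (x \<in> D \<longrightarrow> \<bar>\<psi> j x\<bar> \<le> c j)"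
      using N(1) that by blast
    then show "(if x \<in> D then \<psi> j x else 0) = g j x" "x \<in> D \<Longrightarrow> \<bar>\<psi> j x\<bar> \<le> c j" by blast+
  qed
  show ?thesis
  proof
    fix j
    have [measurable]: "g j \<in> borel_measurable borel" "N \<in> sets borel" "D \<in> sets borel"
      using g(1)[of j] N(3) D by auto
    show "\<phi> j \<in> borel_measurable borel" unfolding \<phi>_def by measurable
    show "\<bar>\<phi> j x\<bar> \<le> c j" for x using out[of x j] c by (auto simp: \<phi>_def)
    show "x \<in> D \<and> \<psi> j x \<noteq> 0" if "\<phi> j x \<noteq> 0" for x using out(1)[of x j] that by (auto simp: \<phi>_def split: if_splits)
    have "AE x in lborel. x \<notin> N" using N(2,3) by (intro AE_not_in) (simp add: null_sets_def)
    then show "AE x in lebesgue_on D. \<phi> j x = \<psi> j x"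
      unfolding AE_lebesgue_on_iff[OF D]
    proof eventually_elim
      case (elim x)
      then show ?case using out(1)[of x j] by (auto simp: \<phi>_def)
    qed
  qed
qed

context bounded_open_set
begin

text \<open>Vanishing outside \<open>D\<close> is expressed through the form weighted with the
  indicator of the complement. In this shape it is a closed condition on \<open>u\<close> that holds
  for test functions, so it passes to their closure.\<close>

lemma weak_grad_zero_outside:
  assumes u: "u \<in> H1_0 D"
  shows "AE x in lborel. x \<notin> D \<longrightarrow> weak_grad u x = 0"
proof -
  define w :: "'a \<Rightarrow> real" where "w = indicator (- D)"
  have [measurable]: "D \<in> sets borel" using open_D by auto
  have bw: "bounded_borel w" by (rule bounded_borelI[of _ 1]) (auto simp: w_def indicator_def)
  have "u \<in> {u. \<forall>v. aform w u v = 0}"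
  proof (rule subsetD[OF _ u])
    show "H1_0 D \<subseteq> {u. \<forall>v. aform w u v = 0}"
      unfolding H1_0_def
    proof (rule closure_minimal)
      have "bounded_linear (\<lambda>u. aform w u v)" for v
      proof (rule bounded_linear_intro)
        fix u
        have "\<bar>aform w u v\<bar> \<le> 1 * V_norm u * V_norm v"
          by (rule aform_bound) (use bw in \<open>auto simp: w_def indicator_def dest: bounded_borel_measurable\<close>)
        also have "\<dots> \<le> norm u * V_norm v" using V_norm_le_norm[of u] by (simp add: mult_right_mono)
        finally show "norm (aform w u v) \<le> norm u * V_norm v" by simp
      qed (simp_all add: aform_add_left aform_scaleR_left bw)
      then have "closed {u. aform w u v = 0}" for v
        by (rule closed_Collect_eq[OF linear_continuous_on continuous_on_const])
      then show "closed {u. \<forall>v. aform w u v = 0}" by (rule closed_Collect_all)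
      show "(\<lambda>\<phi>. (mk_L2 \<phi>, mk_L2 (gradient \<phi>))) ` test_functions D \<subseteq> {u. \<forall>v. aform w u v = 0}"
      proof clarify
        fix \<phi> and v :: "'a H1" assume \<phi>: "\<phi> \<in> test_functions D"
        have "AE x in lborel. w x * (weak_grad (mk_L2 \<phi>, mk_L2 (gradient \<phi>)) x \<bullet> weak_grad v x) = 0"
          using rep_mk_L2[OF square_integrable_test_function(2)[OF \<phi>]]
        proof eventually_elim
          case (elim x)
          then show ?case
            by (cases "x \<in> D") (simp_all add: weak_grad_def w_def test_function_eq_0[OF \<phi>])
        qed
        then have "aform w (mk_L2 \<phi>, mk_L2 (gradient \<phi>)) v = (\<integral>x. 0 \<partial>(lborel :: 'a measure))"
          unfolding aform_def using bw
          by (intro integral_cong_AE) (auto dest: bounded_borel_measurable intro!: borel_measurable_times borel_measurable_inner)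
        then show "aform w (mk_L2 \<phi>, mk_L2 (gradient \<phi>)) v = 0" by simp
      qed
    qed
  qed
  then have "aform w u u = 0" by blast
  then have "(\<integral>x. w x * (weak_grad u x \<bullet> weak_grad u x) \<partial>lborel) = 0" unfolding aform_def .
  then have "AE x in lborel. w x * (weak_grad u x \<bullet> weak_grad u x) = 0"
    using integral_nonneg_eq_0_iff_AE[OF integrable_aform[OF bw, of u u]] by (auto simp: w_def)
  then show ?thesis by eventually_elim (auto simp: w_def indicator_def)
qed

end

section \<open>Identification with the original boundary value problem\<close>

locale representation = lognormal D \<phi> l K c M q
  for D :: "'a::euclidean_space set" and \<phi> l K c M q +
  fixes \<psi> :: "nat \<Rightarrow> 'a \<Rightarrow> real"
  assumes D_nonempty: "D \<noteq> {}" and \<psi>_Linf: "\<And>j. \<psi> j \<in> Linf D"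
    and c_eq: "\<And>j. Linf_norm D (\<psi> j) = ereal (c j)"
    and \<phi>_\<psi>: "\<And>j. AE x in lebesgue_on D. \<phi> j x = \<psi> j x"
begin

abbreviation S :: "(nat \<Rightarrow> real) \<Rightarrow> nat \<Rightarrow> 'a \<Rightarrow> real" where
  "S y n x \<equiv> (\<Sum>j<n. y j * \<psi> j x)"

lemma \<psi>_measurable [measurable]: "\<psi> j \<in> borel_measurable (lebesgue_on D)"
  using \<psi>_Linf by (simp add: Linf_def)

lemma b_measurable_D [measurable]: "b y \<in> borel_measurable (lebesgue_on D)"
  by (rule borel_measurable_lebesgue_on[OF measurable_b])

lemma S_eq: "AE x in lebesgue_on D. \<forall>n. S y n x = (\<Sum>j<n. y j * \<phi> j x)"
proof -
  have "AE x in lebesgue_on D. \<forall>j. \<phi> j x = \<psi> j x" unfolding AE_all_countable using \<phi>_\<psi> by blast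
  then show ?thesis by eventually_elim simp
qed

lemma S_tendsto_b: "AE x in lebesgue_on D. (\<lambda>n. S y n x) \<longlonglongrightarrow> b y x"
  using S_eq[of y]
proof eventually_elim
  case (elim x)
  obtain N where N: "\<And>j. \<phi> j x \<noteq> 0 \<Longrightarrow> j < N" using overlap(1)[of x] finite_nat_set_iff_bounded by auto
  have "\<forall>\<^sub>F n in sequentially. b y x = S y n x"
    unfolding elim[rule_format]
    by (intro eventually_sequentiallyI[of N] b_eq_sum) (use N in \<open>fastforce simp: not_less[symmetric]\<close>)
  then show ?case by (rule Lim_transform_eventually[OF tendsto_const])
qed

lemma Linf_sums_b:
  assumes y: "good y"
  shows "Linf_sums D (\<lambda>j x. y j * \<psi> j x) (b y)"
proof -
  have "Linf_norm D (b y) \<le> ereal (real M * W y)"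
    by (rule Linf_norm_le) (auto simp: abs_b_le[OF y])
  then have 1: "b y \<in> Linf D" by (auto simp: Linf_def intro: le_less_trans)
  obtain \<delta> where \<delta>: "\<delta> \<longlonglongrightarrow> 0" "\<And>n x. \<bar>b (trunc n y) x - b y x\<bar> \<le> \<delta> n"
    using b_trunc_uniform[OF y] by blast
  have "Linf_norm D (\<lambda>x. b y x - S y n x) \<le> ereal (\<delta> n)" for n
  proof (rule Linf_norm_le)
    show "AE x in lebesgue_on D. ereal \<bar>b y x - S y n x\<bar> \<le> ereal (\<delta> n)"
      using S_eq[of y]
    proof eventually_elim
      case (elim x)
      show ?case using \<delta>(2)[of n x] unfolding elim[rule_format] b_trunc[symmetric] by (simp add: abs_minus_commute)
    qed
  qed measurable
  then have upper: "\<forall>\<^sub>F n in sequentially. Linf_norm D (\<lambda>x. b y x - S y n x) \<le> ereal (\<delta> n)" by simp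
  have lower: "\<forall>\<^sub>F n in sequentially. 0 \<le> Linf_norm D (\<lambda>x. b y x - S y n x)"
    by (intro always_eventually allI Linf_norm_nonneg open_D D_nonempty)
  have lim: "(\<lambda>n. ereal (\<delta> n)) \<longlonglongrightarrow> 0"
    unfolding zero_ereal_def by (rule tendsto_ereal[OF \<delta>(1)])
  have "(\<lambda>n. Linf_norm D (\<lambda>x. b y x - S y n x)) \<longlonglongrightarrow> 0"
    by (rule tendsto_sandwich[OF lower upper tendsto_const lim])
  then show ?thesis using 1 by (simp add: Linf_sums_def)
qed

text \<open>The error norms are extended reals. They are finite from some index on because they tend
  to 0, hence the eventual statement.\<close>

lemma Linf_sums_remainder:
  assumes b': "Linf_sums D (\<lambda>j x. y j * \<psi> j x) b'"
  obtains e where "e \<longlonglongrightarrow> (0::real)" "\<forall>\<^sub>F n in sequentially. AE x in lebesgue_on D. \<bar>b' x - S y n x\<bar> \<le> e n"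
proof
  define E where "E n = Linf_norm D (\<lambda>x. b' x - S y n x)" for n
  have E: "E \<longlonglongrightarrow> 0" using b' by (simp add: Linf_sums_def E_def[abs_def])
  show "(\<lambda>n. real_of_ereal (E n)) \<longlonglongrightarrow> 0"
    by (rule lim_real_of_ereal) (use E in \<open>simp add: zero_ereal_def[symmetric]\<close>)
  have "\<forall>\<^sub>F n in sequentially. E n < 1" using E by (rule order_tendstoD) simp
  then show "\<forall>\<^sub>F n in sequentially. AE x in lebesgue_on D. \<bar>b' x - S y n x\<bar> \<le> real_of_ereal (E n)"
  proof eventually_elim
    case (elim n)
    have "0 \<le> E n" unfolding E_def by (rule Linf_norm_nonneg[OF open_D D_nonempty])
    then obtain r where r: "E n = ereal r" using elim by (cases "E n") auto
    have "AE x in lebesgue_on D. ereal \<bar>b' x - S y n x\<bar> \<le> E n" unfolding E_def by (rule AE_le_Linf_norm)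
    then show ?case unfolding r by simp
  qed
qed

text \<open>Consecutive remainders differ by a single term of the series, whose norm therefore tends
  to 0.\<close>

lemma Linf_sums_imp_good:
  assumes b': "Linf_sums D (\<lambda>j x. y j * \<psi> j x) b'"
  shows "good y"
proof -
  obtain e where e: "e \<longlonglongrightarrow> (0::real)" "\<forall>\<^sub>F n in sequentially. AE x in lebesgue_on D. \<bar>b' x - S y n x\<bar> \<le> e n"
    by (rule Linf_sums_remainder[OF b'])
  have "\<forall>\<^sub>F n in sequentially. AE x in lebesgue_on D. \<bar>b' x - S y (Suc n) x\<bar> \<le> e (Suc n)"
    using e(2) by (rule eventually_sequentially_Suc[THEN iffD2])
  with e(2) have "\<forall>\<^sub>F n in sequentially. \<bar>y n\<bar> * c n \<le> e n + e (Suc n)"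
  proof eventually_elim
    case (elim n)
    have ae: "AE x in lebesgue_on D. \<bar>y n\<bar> * \<bar>\<psi> n x\<bar> \<le> e n + e (Suc n)"
      using elim
    proof eventually_elim
      case (elim x)
      have "y n * \<psi> n x = (b' x - S y n x) - (b' x - S y (Suc n) x)" by simp
      then have "\<bar>y n * \<psi> n x\<bar> \<le> \<bar>b' x - S y n x\<bar> + \<bar>b' x - S y (Suc n) x\<bar>" by linarith
      then show ?case using elim by (simp only: abs_mult)
    qed
    show ?case
    proof (cases "y n = 0")
      \<comment> \<open>Division by \<open>y n\<close> is impossible here. That the error bound is
        nonnegative follows from \<open>D\<close> having positive measure.\<close>
      case True
      have "AE x in lebesgue_on D. ereal \<bar>0\<bar> \<le> ereal (e n + e (Suc n))" using ae True by simp
      then have "Linf_norm D (\<lambda>x. 0) \<le> ereal (e n + e (Suc n))" by (intro Linf_norm_le) auto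
      then have "0 \<le> ereal (e n + e (Suc n))" using Linf_norm_nonneg[OF open_D D_nonempty] order_trans by blast
      then show ?thesis using True by simp
    next
      case False
      have "AE x in lebesgue_on D. ereal \<bar>\<psi> n x\<bar> \<le> ereal ((e n + e (Suc n)) / \<bar>y n\<bar>)"
        using ae by eventually_elim (use False in \<open>simp add: pos_le_divide_eq mult.commute\<close>)
      then have "Linf_norm D (\<psi> n) \<le> ereal ((e n + e (Suc n)) / \<bar>y n\<bar>)" by (intro Linf_norm_le) auto
      then show ?thesis using False by (simp add: c_eq pos_le_divide_eq mult.commute)
    qed
  qed
  then have "\<forall>\<^sub>F n in sequentially. norm (\<bar>y n\<bar> * c n) \<le> e n + e (Suc n)" by (simp add: abs_mult)
  moreover have "(\<lambda>n. e n + e (Suc n)) \<longlonglongrightarrow> 0"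
    using tendsto_add[OF e(1) LIMSEQ_Suc[OF e(1)]] by simp
  ultimately show ?thesis unfolding good_def by (rule Lim_null_comparison)
qed

lemma converges_iff_good: "log_coeff_converges D \<psi> y \<longleftrightarrow> good y"
  unfolding log_coeff_converges_def using Linf_sums_b Linf_sums_imp_good by blast

lemma log_coeff_Linf_sums: "good y \<Longrightarrow> Linf_sums D (\<lambda>j x. y j * \<psi> j x) (log_coeff D \<psi> y)"
  unfolding log_coeff_def by (rule someI[of "Linf_sums D (\<lambda>j x. y j * \<psi> j x)"]) (rule Linf_sums_b)

lemma log_coeff_measurable: "good y \<Longrightarrow> log_coeff D \<psi> y \<in> borel_measurable (lebesgue_on D)"
  using log_coeff_Linf_sums[of y] by (simp add: Linf_sums_def Linf_def)

text \<open>The partial sums converge almost everywhere both to the chosen limit in the supremum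
  norm and, being eventually constant, to the pointwise sum \<open>b y\<close>.\<close>

lemma log_coeff_eq_b:
  assumes y: "good y"
  shows "AE x in lebesgue_on D. log_coeff D \<psi> y x = b y x"
proof -
  obtain e where e: "e \<longlonglongrightarrow> (0::real)" "\<forall>\<^sub>F n in sequentially. AE x in lebesgue_on D. \<bar>log_coeff D \<psi> y x - S y n x\<bar> \<le> e n"
    by (rule Linf_sums_remainder[OF log_coeff_Linf_sums[OF y]])
  obtain N where N: "\<And>n. n \<ge> N \<Longrightarrow> AE x in lebesgue_on D. \<bar>log_coeff D \<psi> y x - S y n x\<bar> \<le> e n"
    using e(2) by (auto simp: eventually_sequentially)
  have "AE x in lebesgue_on D. \<forall>n. n \<ge> N \<longrightarrow> \<bar>log_coeff D \<psi> y x - S y n x\<bar> \<le> e n"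
    unfolding AE_all_countable using N by auto
  then show ?thesis using S_tendsto_b[of y]
  proof eventually_elim
    case (elim x)
    have "(\<lambda>n. log_coeff D \<psi> y x - S y n x) \<longlonglongrightarrow> 0"
      by (rule Lim_null_comparison[OF eventually_sequentiallyI[of N] e(1)]) (use elim(1) in auto)
    then have "(\<lambda>n. log_coeff D \<psi> y x - (log_coeff D \<psi> y x - S y n x)) \<longlonglongrightarrow> log_coeff D \<psi> y x - 0"
      by (intro tendsto_intros)
    then show ?case using LIMSEQ_unique[OF _ elim(2)] by simp
  qed
qed

lemma weak_solution_iff:
  assumes y: "good y"
  shows "weak_solution D (diffusion_coeff D \<psi> y) l u \<longleftrightarrow> u \<in> H1_0 D \<and> (\<forall>v\<in>H1_0 D. aform (a y) u v = l v)"
proof -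
  have "(\<integral>x. diffusion_coeff D \<psi> y x * (weak_grad u x \<bullet> weak_grad v x) \<partial>lebesgue_on D) = aform (a y) u v"
    if u: "u \<in> H1_0 D" for v
  proof -
    have [measurable]: "weak_grad w \<in> borel_measurable (lebesgue_on D)" for w :: "'a H1"
      by (rule measurable_restrict_space1, rule measurable_completion) (simp add: measurable_weak_grad)
    note [measurable] = log_coeff_measurable[OF y] bounded_borel_measurable[OF a_bounds(1)[OF y]]
      borel_measurable_lebesgue_on[OF bounded_borel_measurable[OF a_bounds(1)[OF y]]]
    have [measurable]: "D \<in> sets borel" using open_D by auto
    let ?h = "\<lambda>x. a y x * (weak_grad u x \<bullet> weak_grad v x)"
    have "(\<integral>x. diffusion_coeff D \<psi> y x * (weak_grad u x \<bullet> weak_grad v x) \<partial>lebesgue_on D) = (\<integral>x. ?h x \<partial>lebesgue_on D)"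
    proof (rule integral_cong_AE)
      show "AE x in lebesgue_on D. diffusion_coeff D \<psi> y x * (weak_grad u x \<bullet> weak_grad v x) = ?h x"
        using log_coeff_eq_b[OF y] by eventually_elim (simp add: diffusion_coeff_def a_def)
      show "(\<lambda>x. diffusion_coeff D \<psi> y x * (weak_grad u x \<bullet> weak_grad v x)) \<in> borel_measurable (lebesgue_on D)"
        unfolding diffusion_coeff_def by measurable
    qed measurable
    also have "\<dots> = (\<integral>x. indicator D x *\<^sub>R ?h x \<partial>lebesgue)"
      by (subst integral_restrict_space) (auto simp: open_D)
    also have "\<dots> = (\<integral>x. indicator D x *\<^sub>R ?h x \<partial>lborel)"
      by (rule integral_completion) measurable
    also have "\<dots> = aform (a y) u v"
      unfolding aform_def
    proof (rule integral_cong_AE)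
      show "AE x in lborel. indicator D x *\<^sub>R ?h x = ?h x"
        using weak_grad_zero_outside[OF u] by eventually_elim (auto simp: indicator_def)
    qed measurable
    finally show ?thesis .
  qed
  then show ?thesis by (auto simp: weak_solution_def)
qed

lemma weak_solution_iff_T:
  assumes y: "good y"
  shows "weak_solution D (diffusion_coeff D \<psi> y) l u \<longleftrightarrow> u = T mi_zero y"
proof
  assume "weak_solution D (diffusion_coeff D \<psi> y) l u"
  then show "u = T mi_zero y"
    using weak_solution_iff[OF y] T_0_eq[OF y] T_in_H1_0[OF zero_multi_index, of y]
    by (intro variational_unique[OF a_bounds(1)[OF y] _ a_bounds(2)[OF y]]) auto
next
  assume "u = T mi_zero y"
  then show "weak_solution D (diffusion_coeff D \<psi> y) l u"
    using weak_solution_iff[OF y] T_0_eq[OF y] T_in_H1_0[OF zero_multi_index, of y] by auto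
qed

lemma solution_map_eq: "solution_map D \<psi> l = T mi_zero"
proof
  fix y show "solution_map D \<psi> l y = T mi_zero y"
  proof (cases "good y")
    case True
    then have "weak_solution D (diffusion_coeff D \<psi> y) l = (\<lambda>u. u = T mi_zero y)"
      by (simp add: fun_eq_iff weak_solution_iff_T)
    then show ?thesis using True by (simp add: solution_map_def converges_iff_good)
  qed (simp add: solution_map_def converges_iff_good T_def)
qed

end

section \<open>Best \<open>n\<close>-term approximation\<close>

text \<open>Stechkin's argument: the p-th power of a discarded value is at most the mean of the
  \<open>n\<close> retained ones, hence at most \<open>A / n\<close>. The square is split into a
  p-th power, which is summed, and a power 2 - p, which is bounded in this way.\<close>

lemma n_largest_tail_bound:
  fixes x :: "'i \<Rightarrow> real"
  assumes p: "0 < p" "p < 2" and x: "\<And>i. 0 \<le> x i"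
    and A: "\<And>L. finite L \<Longrightarrow> L \<subseteq> I \<Longrightarrow> (\<Sum>i\<in>L. x i powr p) \<le> A"
    and n: "1 \<le> n" and \<Lambda>: "n_largest I x n \<Lambda>" and L: "finite L" "L \<subseteq> I - \<Lambda>"
  shows "(\<Sum>i\<in>L. (x i)\<^sup>2) \<le> A * (A / real n) powr ((2 - p) / p)"
proof -
  have L_fin: "finite \<Lambda>" "\<Lambda> \<subseteq> I" "card \<Lambda> = n" and large: "\<And>i j. i \<in> \<Lambda> \<Longrightarrow> j \<in> I - \<Lambda> \<Longrightarrow> x j \<le> x i"
    using \<Lambda> by (auto simp: n_largest_def)
  have small: "x j powr p \<le> A / real n" if j: "j \<in> I - \<Lambda>" for j
  proof -
    have "real n * x j powr p = (\<Sum>i\<in>\<Lambda>. x j powr p)" by (simp add: L_fin)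
    also have "\<dots> \<le> (\<Sum>i\<in>\<Lambda>. x i powr p)"
      using p x by (intro sum_mono powr_mono2 large[OF _ j]) auto
    also have "\<dots> \<le> A" by (rule A[OF L_fin(1,2)])
    finally show ?thesis using n by (simp add: pos_le_divide_eq mult.commute)
  qed
  have "(\<Sum>i\<in>L. (x i)\<^sup>2) \<le> (\<Sum>i\<in>L. x i powr p * (A / real n) powr ((2 - p) / p))"
  proof (rule sum_mono)
    fix i assume "i \<in> L"
    then have i: "i \<in> I - \<Lambda>" using L by auto
    show "(x i)\<^sup>2 \<le> x i powr p * (A / real n) powr ((2 - p) / p)"
    proof (cases "x i = 0")
      case False
      then have "0 < x i" using x[of i] by simp
      then have "(x i)\<^sup>2 = x i powr p * (x i powr p) powr ((2 - p) / p)"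
        using p by (simp add: powr_powr powr_add[symmetric] flip: powr_numeral)
      also have "\<dots> \<le> x i powr p * (A / real n) powr ((2 - p) / p)"
        using p by (intro mult_left_mono powr_mono2 small[OF i]) auto
      finally show ?thesis .
    qed simp
  qed
  also have "\<dots> = (\<Sum>i\<in>L. x i powr p) * (A / real n) powr ((2 - p) / p)" by (rule sum_distrib_right[symmetric])
  also have "\<dots> \<le> A * (A / real n) powr ((2 - p) / p)"
    using L by (intro mult_right_mono A) auto
  finally show ?thesis .
qed

theorem corollary6p1:
  fixes D :: "'a::euclidean_space set"
    and \<psi> :: "nat \<Rightarrow> 'a \<Rightarrow> real"
    and f :: "'a H1 \<Rightarrow> real"
    and M :: nat
    and p q s :: real
    and u :: "(nat \<Rightarrow> real) \<Rightarrow> 'a H1"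
  assumes D: "bounded_lipschitz_domain D"
    and f: "f \<in> H_minus1 D"
    and \<psi>: "\<And>j. \<psi> j \<in> Linf D"
    and overlap: "\<And>x. x \<in> D \<Longrightarrow> finite {j. \<psi> j x \<noteq> 0} \<and> card {j. \<psi> j x \<noteq> 0} \<le> M"
    and p: "0 < p" "p < 2"
    and q: "q = 2 * p / (2 - p)"
    and s: "s = 1 / p - 1 / 2"
    and \<psi>_lq: "summable (\<lambda>j. real_of_ereal (Linf_norm D (\<psi> j)) powr q)"
    and u: "u = solution_map D \<psi> f"
  shows "(AE y in gaussian_product. log_coeff_converges D \<psi> y \<and>
            (\<exists>!w. weak_solution D (diffusion_coeff D \<psi> y) f w)) \<and>
         u \<in> L2_gaussian D \<and>
         (\<lambda>\<nu>. V_norm (hermite_coeff u \<nu>) powr p) summable_on multi_indices \<and>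
         s = 1 / q \<and>
         (\<exists>C::real. \<forall>n\<ge>1. \<forall>\<Lambda>. n_largest multi_indices (\<lambda>\<nu>. V_norm (hermite_coeff u \<nu>)) n \<Lambda> \<longrightarrow>
            L2_gaussian_norm (\<lambda>y. u y - hermite_partial_sum u \<Lambda> y) \<le> C * real n powr (- s))"
proof -
  define c where "c j = real_of_ereal (Linf_norm D (\<psi> j))" for j
  have open_D: "open D" and D_ne: "D \<noteq> {}" and bounded_D: "bounded D"
    using D by (auto simp: bounded_lipschitz_domain_def)
  note p_bounds = p and q_eq = q
  have q0: "0 < q" using p by (simp add: q)
  have s_q: "s = 1 / q" using p by (simp add: s q field_simps)
  have c_eq: "Linf_norm D (\<psi> j) = ereal (c j)" and c0: "0 \<le> c j" for j
  proof -
    have "0 \<le> Linf_norm D (\<psi> j)" "Linf_norm D (\<psi> j) < \<infinity>"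
      using \<psi>[of j] Linf_norm_nonneg[OF open_D D_ne] by (auto simp: Linf_def)
    then show "Linf_norm D (\<psi> j) = ereal (c j)" "0 \<le> c j"
      unfolding c_def by (cases "Linf_norm D (\<psi> j)"; simp)+
  qed
  have meas_\<psi>: "\<psi> j \<in> borel_measurable (lebesgue_on D)" for j using \<psi>[of j] by (simp add: Linf_def)
  have bound_\<psi>: "AE x in lebesgue_on D. \<bar>\<psi> j x\<bar> \<le> c j" for j
    using AE_le_Linf_norm[of "\<psi> j" D] by (simp add: c_eq)
  obtain \<phi> where rep: "\<And>j. \<phi> j \<in> borel_measurable borel" "\<And>j x. \<bar>\<phi> j x\<bar> \<le> c j"
    "\<And>j x. \<phi> j x \<noteq> 0 \<Longrightarrow> x \<in> D \<and> \<psi> j x \<noteq> 0" "\<And>j. AE x in lebesgue_on D. \<phi> j x = \<psi> j x"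
    by (rule obtain_borel_representative[of D \<psi> c, OF open_D meas_\<psi> bound_\<psi> c0]) blast
  have supp: "finite {j. \<phi> j x \<noteq> 0} \<and> card {j. \<phi> j x \<noteq> 0} \<le> M" for x
  proof (cases "x \<in> D")
    case True
    have "{j. \<phi> j x \<noteq> 0} \<subseteq> {j. \<psi> j x \<noteq> 0}" using rep(3) by blast
    then show ?thesis using overlap[OF True] by (meson card_mono finite_subset order_trans)
  next
    case False
    then have "{j. \<phi> j x \<noteq> 0} = {}" using rep(3) by blast
    then show ?thesis by simp
  qed
  obtain K0 where K0: "\<And>v. v \<in> H1_0 D \<Longrightarrow> \<bar>f v\<bar> \<le> K0 * V_norm v"
    using f unfolding H_minus1_def by blast
  define K where "K = \<bar>K0\<bar>"
  have K: "0 \<le> K" "\<And>v. v \<in> H1_0 D \<Longrightarrow> \<bar>f v\<bar> \<le> K * V_norm v"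
  proof -
    fix v assume v: "v \<in> H1_0 D"
    have "K0 * V_norm v \<le> K * V_norm v" by (intro mult_right_mono) (auto simp: K_def)
    then show "\<bar>f v\<bar> \<le> K * V_norm v" using K0[OF v] by linarith
  qed (simp add: K_def)
  \<comment> \<open>The geometric term keeps \<open>d j\<close> positive when the j-th function
    vanishes, without spoiling q-summability.\<close>
  define d where "d j = c j + (1 / 2) ^ j" for j
  have d_pos: "0 < d j" for j using c0[of j] by (simp add: d_def add_nonneg_pos)
  \<comment> \<open>At each point at most \<open>M\<close> terms are nonzero and each is at most 1 /
    R, so they sum to at most 1/2; the summand 1 covers the case \<open>M = 0\<close>.\<close>
  define R where "R = 2 * (real M + 1)"
  have R: "0 < R" by (simp add: R_def)
  define \<rho> where "\<rho> j = 1 / (R * d j)" for j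
  interpret bounded_open_set D using bounded_D open_D by unfold_locales
  interpret summable_lognormal D \<phi> f K c M q \<rho> "1 / 2"
  proof
    show "bounded_borel (\<phi> j)" for j using rep(1,2) by (rule bounded_borelI)
    show "functional f K" using f K by (auto simp: functional_def H_minus1_def)
    show "summable (\<lambda>j. c j powr q)" using \<psi>_lq by (simp add: c_def)
    show "0 < \<rho> j" for j using R d_pos by (simp add: \<rho>_def)
    show "(\<Sum>j<n. \<bar>\<rho> j * \<phi> j x\<bar>) \<le> 1 / 2" for n x
    proof -
      have "(\<Sum>j<n. \<bar>\<rho> j * \<phi> j x\<bar>) = (\<Sum>j\<in>{..<n} \<inter> {j. \<phi> j x \<noteq> 0}. \<bar>\<rho> j * \<phi> j x\<bar>)"
        by (intro sum.mono_neutral_right) auto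
      also have "\<dots> \<le> (\<Sum>j\<in>{..<n} \<inter> {j. \<phi> j x \<noteq> 0}. 1 / R)"
      proof (rule sum_mono)
        fix j
        have "\<bar>\<phi> j x\<bar> \<le> d j" by (rule order_trans[OF rep(2)]) (simp add: d_def)
        then show "\<bar>\<rho> j * \<phi> j x\<bar> \<le> 1 / R"
          using d_pos[of j] R by (simp add: \<rho>_def abs_mult field_simps)
      qed
      also have "\<dots> = real (card ({..<n} \<inter> {j. \<phi> j x \<noteq> 0})) / R" by simp
      also have "\<dots> \<le> real M / R"
        using supp[of x] R by (intro divide_right_mono) (auto intro: order_trans[OF card_mono])
      also have "\<dots> \<le> 1 / 2" by (simp add: R_def field_simps)
      finally show ?thesis .
    qed
    show "exp (1 / 2 :: real) < 2"
    proof (rule power_less_imp_less_base)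
      have "exp (1 / 2 :: real) ^ 2 = exp 1" by (simp flip: exp_of_nat_mult)
      then show "exp (1 / 2 :: real) ^ 2 < 2 ^ 2" using exp_le by simp
    qed simp
    \<comment> \<open>A sum of two numbers is at most twice their maximum, so its q-th power is at
      most \<open>2 powr q\<close> times the sum of the q-th powers; this is valid for
      \<open>q\<close> below 1 as well.\<close>
    have "summable (\<lambda>j. R powr q * (2 powr q * (c j powr q + ((1 / 2) powr q) ^ j)))"
    proof (intro summable_mult summable_add summable_geometric)
      show "summable (\<lambda>j. c j powr q)" using \<psi>_lq by (simp add: c_def)
      have "(1 / 2 :: real) powr q < 1 powr q" using q0 by (intro powr_less_mono2) auto
      then show "norm ((1 / 2 :: real) powr q) < 1" by simp
    qed
    moreover have "norm (\<rho> j powr - q) \<le> R powr q * (2 powr q * (c j powr q + ((1 / 2) powr q) ^ j))" for j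
    proof -
      have e: "((1 / 2) ^ j) powr q = ((1 / 2 :: real) powr q) ^ j"
        by (simp add: powr_powr mult.commute flip: powr_realpow)
      have "d j powr q \<le> (2 * max (c j) ((1 / 2) ^ j)) powr q"
        using q0 c0[of j] by (intro powr_mono2) (auto simp: d_def)
      also have "\<dots> = 2 powr q * max (c j) ((1 / 2) ^ j) powr q"
        by (rule powr_mult)
      also have "\<dots> \<le> 2 powr q * (c j powr q + ((1 / 2) ^ j) powr q)"
        by (intro mult_left_mono) (auto simp: max_def)
      finally have "R powr q * d j powr q \<le> R powr q * (2 powr q * (c j powr q + ((1 / 2) powr q) ^ j))"
        unfolding e by (intro mult_left_mono) auto
      moreover have "\<rho> j powr - q = R powr q * d j powr q"
        using R d_pos[of j] by (simp add: \<rho>_def powr_divide powr_minus powr_mult)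
      ultimately show ?thesis by simp
    qed
    ultimately show "summable (\<lambda>j. \<rho> j powr - q)"
      by (rule summable_comparison_test'[where N = 0])
  qed (use rep(2) supp q0 K in auto)
  interpret representation D \<phi> f K c M q \<psi>
    by unfold_locales (use D_ne \<psi> c_eq rep(4) in auto)
  have u_T: "u = T mi_zero" unfolding u by (rule solution_map_eq)
  have measurable_u: "u \<in> borel_measurable gaussian_product" unfolding u_T by (rule measurable_T_0)
  have u_H: "u y \<in> H1_0 D" for y unfolding u_T by (rule T_in_H1_0) simp
  have V_\<tau>: "V_norm (u y) = norm (\<tau> mi_zero y)" for y by (simp add: u_T norm_\<tau>)
  note sq_\<tau> = square_integrable_\<tau>[OF zero_multi_index]
  \<comment> \<open>The coefficients in the statement are Bochner integrals in the product space, so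
    integrability is shown in the full norm, by the Poincare inequality; only then can the gradient
    component be taken out of the integral.\<close>
  have sq_u: "square_integrable_on gaussian_product u"
  proof -
    obtain C where C: "0 \<le> C" "\<And>v. v \<in> H1_0 D \<Longrightarrow> norm v \<le> C * V_norm v"
      using Poincare[OF bounded_D] by blast
    show ?thesis
    proof (rule square_integrable_on_bound[OF measurable_u])
      show "integrable gaussian_product (\<lambda>y. C\<^sup>2 * (norm (\<tau> mi_zero y))\<^sup>2)"
        using sq_\<tau> by (simp add: square_integrable_on_def)
      have "(norm (u y))\<^sup>2 \<le> (C * norm (\<tau> mi_zero y))\<^sup>2" for y
        using C(2)[OF u_H, of y] unfolding V_\<tau> by (intro power_mono) auto
      then show "AE y in gaussian_product. (norm (u y))\<^sup>2 \<le> C\<^sup>2 * (norm (\<tau> mi_zero y))\<^sup>2"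
        by (simp add: power_mult_distrib)
    qed
  qed
  have coef_u: "snd (hermite_coeff u \<nu>) = hermite.coef (\<tau> mi_zero) \<nu>" if "\<nu> \<in> multi_indices" for \<nu>
  proof -
    have "snd (hermite_coeff u \<nu>) = (\<integral>y. snd (hermite_multi \<nu> y *\<^sub>R u y) \<partial>gaussian_product)"
      unfolding hermite_coeff_def
      by (rule integral_bounded_linear[symmetric, OF bounded_linear_snd hermite.coef_integrable[OF sq_u that]])
    then show ?thesis by (simp add: hermite.coef_def \<tau>_def u_T)
  qed
  obtain A where A: "\<And>L. finite L \<Longrightarrow> L \<subseteq> multi_indices \<Longrightarrow>
    (\<Sum>\<nu>\<in>L. norm (hermite.coef (\<tau> mi_zero) \<nu>) powr p) \<le> A"
    by (rule coef_p_sum[OF p_bounds q_eq]) blast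
  define x where "x \<nu> = V_norm (hermite_coeff u \<nu>)" for \<nu>
  have x_eq: "x \<nu> = norm (hermite.coef (\<tau> mi_zero) \<nu>)" if "\<nu> \<in> multi_indices" for \<nu>
    by (simp add: x_def V_norm_def coef_u[OF that])
  have x_sum: "(\<Sum>\<nu>\<in>L. x \<nu> powr p) \<le> A" if L: "finite L" "L \<subseteq> multi_indices" for L
  proof -
    have "(\<Sum>\<nu>\<in>L. x \<nu> powr p) = (\<Sum>\<nu>\<in>L. norm (hermite.coef (\<tau> mi_zero) \<nu>) powr p)"
      using L by (intro sum.cong refl) (auto simp: x_eq)
    then show ?thesis using A[OF L] by simp
  qed
  have A0: "0 \<le> A" using x_sum[of "{}"] by simp
  have part1: "AE y in gaussian_product. log_coeff_converges D \<psi> y \<and> (\<exists>!w. weak_solution D (diffusion_coeff D \<psi> y) f w)"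
    using AE_good by eventually_elim (simp add: converges_iff_good weak_solution_iff_T)
  have part2: "u \<in> L2_gaussian D"
    unfolding L2_gaussian_def using measurable_u u_H sq_\<tau>
    by (simp add: V_\<tau> square_integrable_on_def)
  have part3: "(\<lambda>\<nu>. x \<nu> powr p) summable_on multi_indices"
    by (rule nonneg_bdd_above_summable_on) (auto intro!: bdd_aboveI2[where M = A] x_sum)
  have part5: "L2_gaussian_norm (\<lambda>y. u y - hermite_partial_sum u \<Lambda> y) \<le> A powr (1 / p) * real n powr (- s)"
    if n: "1 \<le> n" and \<Lambda>: "n_largest multi_indices x n \<Lambda>" for n \<Lambda>
  proof -
    have fin: "finite \<Lambda>" "\<Lambda> \<subseteq> multi_indices" using \<Lambda> by (auto simp: n_largest_def)
    define e where "e = A * (A / real n) powr ((2 - p) / p)"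
    have "(\<integral>y. (norm (\<tau> mi_zero y - hermite.psum (hermite.coef (\<tau> mi_zero)) \<Lambda> y))\<^sup>2 \<partial>gaussian_product) \<le> e"
    proof (rule hermite_remainder_le[OF _ _ sq_\<tau> fin])
      fix L assume L: "finite L" "L \<subseteq> multi_indices - \<Lambda>"
      have "(\<Sum>\<nu>\<in>L. (norm (hermite.coef (\<tau> mi_zero) \<nu>))\<^sup>2) = (\<Sum>\<nu>\<in>L. (x \<nu>)\<^sup>2)"
        using L by (intro sum.cong refl) (auto simp: x_eq)
      also have "\<dots> \<le> e"
        unfolding e_def by (rule n_largest_tail_bound[OF p_bounds _ x_sum n \<Lambda> L]) (simp_all add: x_def)
      finally show "(\<Sum>\<nu>\<in>L. (norm (hermite.coef (\<tau> mi_zero) \<nu>))\<^sup>2) \<le> e" .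
    qed
    moreover have "V_norm (u y - hermite_partial_sum u \<Lambda> y) =
        norm (\<tau> mi_zero y - hermite.psum (hermite.coef (\<tau> mi_zero)) \<Lambda> y)" for y
    proof -
      have "snd (hermite_partial_sum u \<Lambda> y) = hermite.psum (hermite.coef (\<tau> mi_zero)) \<Lambda> y"
        unfolding hermite_partial_sum_def hermite.psum_def snd_sum using fin
        by (intro sum.cong refl) (auto simp: coef_u)
      then show ?thesis by (simp add: V_norm_def \<tau>_def u_T)
    qed
    ultimately have "L2_gaussian_norm (\<lambda>y. u y - hermite_partial_sum u \<Lambda> y) \<le> sqrt e"
      unfolding L2_gaussian_norm_def by simp
    \<comment> \<open>The exponent of \<open>A\<close> is half of 1 + (2 - p) / p, that is 1 / p;
      the exponent of \<open>n\<close> is minus half of (2 - p) / p, that is - s.\<close>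
    also have "sqrt e = A powr (1 / p) * real n powr (- s)"
    proof (cases "A = 0")
      case False
      then have Apos: "0 < A" using A0 by simp
      have "e = A powr 1 * A powr ((2 - p) / p) * real n powr (- ((2 - p) / p))"
        using Apos n by (simp add: e_def powr_divide powr_minus_divide)
      also have "A powr 1 * A powr ((2 - p) / p) = A powr (2 / p)"
        unfolding powr_add[symmetric] using p_bounds by (simp add: field_simps)
      finally have "sqrt e = (A powr (2 / p)) powr (1 / 2) * (real n powr (- ((2 - p) / p))) powr (1 / 2)"
        by (simp add: powr_half_sqrt[symmetric] powr_mult)
      also have "\<dots> = A powr (1 / p) * real n powr (- s)"
        using p_bounds by (simp add: powr_powr s field_simps)
      finally show ?thesis .
    qed (simp add: e_def)
    finally show ?thesis .
  qed
  show ?thesis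
    using part1 part2 part3 s_q part5 unfolding x_def by blast
qed

end
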